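(* Let $m\ge 2$ be an integer and $\rho>-m$ a real number, and set $\nu=\frac{(m-1)(m+\rho)}{m(m+\rho+1)}\in(0,1)$. Let $X^{(n)}$ be the number of descendants of vertex $n$ in the preferential attachment graph $G_n$ with parameters $m$ and $\rho$. Then, as $n\to\infty$, $$n^{-\nu}X^{(n)}\ \overset{d}{\longrightarrow}\ \frac{\Gamma\left(\frac{(m-1)(m+\rho)}{m(m+\rho+1)}\right)\Gamma\left(\frac{m+\rho}{m(m+\rho+1)}+1\right)}{\Gamma\left(\frac{m+\rho}{m+\rho+1}\right)}\left(\frac{(m+\rho+1)(m-1)}{2m+\rho}\,\xi_1\right)^{1-\nu},$$ where $\xi_1$ has the $\mathrm{Gamma}(m/(m-1),1)$ distribution.
   Context: Preferential attachment graph: fix an integer $m\ge2$ and a real $\rho>-m$. The random directed multigraphs $(G_n)_{n\ge1}$, where $G_n$ has vertex set $[n]=\{1,\dots,n\}$, are generated as follows. $G_1$ is a single vertex 1 with no edges. $G_2$ is obtained by adding vertex 2 and $m$ edges from vertex 2 to vertex 1. For $n\ge3$, given $G_{n-1}$, add vertex $n$ and sequentially add $m$ outgoing edges from $n$ to vertices in $[n-1]$: writing $d_j(n-1)$ for the (total) degree of vertex $j$ in $G_{n-1}$, and $n\overset{\ell}{\to}j$ for the event that the $\ell$-th outgoing edge of $n$ is attached to $j$, given the first $k$ outgoing edges of $n$ ($0\le k\le m-1$), the $(k+1)$-th outgoing edge of $n$ is attached to $j\in[n-1]$ with probability $$\frac{d_j(n-1)+\sum_{\ell=1}^k\mathbf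 1[n\overset{\ell}{\to}j]+\rho}{2m(n-2)+k+(n-1)\rho}.$$ All edges are directed from the vertex with larger label to the vertex with smaller label; multiple edges are allowed. The number of descendants $X^{(n)}$ of $n$ is the number of vertices of $G_n$ that can be reached from vertex $n$ by a directed path, including vertex $n$ itself. $\mathrm{Gamma}(a,b)$ is the distribution with density $\Gamma(a)^{-1}b^{-a}x^{a-1}e^{-x/b}$ on $(0,\infty)$. $\overset{d}{\longrightarrow}$ denotes convergence in distribution. *)

theory Defs
  imports "HOL-Probability.Probability" "Graph_Theory.Digraph"
begin

text \<open>
  An arc \<open>(i, l, j)\<close> is the \<open>l\<close>-th outgoing edge of vertex \<open>i\<close> (with \<open>l = 1, ..., m\<close>) and
  points to \<open>j\<close>; parallel edges are distinguished by \<open>l\<close>.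
\<close>

type_synonym pa_digraph = "(nat, nat \<times> nat \<times> nat) pre_digraph"

definition single_vertex :: pa_digraph where
  "single_vertex = \<lparr>verts = {1}, arcs = {}, tail = fst, head = (\<lambda>(i, l, j). j)\<rparr>"

definition add_vertex :: "nat \<Rightarrow> nat list \<Rightarrow> pa_digraph \<Rightarrow> pa_digraph" where
  "add_vertex n ts G =
     G\<lparr>verts := insert n (verts G), arcs := arcs G \<union> {(n, Suc l, ts ! l) | l. l < length ts}\<rparr>"

definition total_degree :: "('a, 'b) pre_digraph \<Rightarrow> 'a \<Rightarrow> nat" where
  "total_degree G v = in_degree G v + out_degree G v"

text \<open>
  The argument \<open>G\<close> is the graph on \<open>{1..n-1}\<close> before vertex \<open>n\<close> arrives, and \<open>ts\<close> lists the
  targets of the outgoing edges that \<open>n\<close> has already received.  As \<^const>\<open>embed_pmf\<close> is only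
  meaningful for weights that are nonnegative and sum to one, see \<open>pmf_attach_pmf\<close> below.
\<close>

definition attach_weight :: "nat \<Rightarrow> real \<Rightarrow> nat \<Rightarrow> pa_digraph \<Rightarrow> nat list \<Rightarrow> nat \<Rightarrow> real" where
  "attach_weight m \<rho> n G ts j =
     (if j \<in> {1..n - 1}
      then (real (total_degree G j) + real (count_list ts j) + \<rho>) /
           (2 * real m * (real n - 2) + real (length ts) + (real n - 1) * \<rho>)
      else 0)"

definition attach_pmf :: "nat \<Rightarrow> real \<Rightarrow> nat \<Rightarrow> pa_digraph \<Rightarrow> nat list \<Rightarrow> nat pmf" where
  "attach_pmf m \<rho> n G ts = embed_pmf (attach_weight m \<rho> n G ts)"

primrec targets_pmf :: "nat \<Rightarrow> real \<Rightarrow> nat \<Rightarrow> pa_digraph \<Rightarrow> nat \<Rightarrow> nat list pmf" where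
  "targets_pmf m \<rho> n G 0 = return_pmf []"
| "targets_pmf m \<rho> n G (Suc k) =
     bind_pmf (targets_pmf m \<rho> n G k) (\<lambda>ts. map_pmf (\<lambda>j. ts @ [j]) (attach_pmf m \<rho> n G ts))"

text \<open>The law of \<open>G\<^sub>n\<close>; the value at \<open>n = 0\<close> is irrelevant.\<close>

fun pa_graph :: "nat \<Rightarrow> real \<Rightarrow> nat \<Rightarrow> pa_digraph pmf" where
  "pa_graph m \<rho> 0 = return_pmf single_vertex"
| "pa_graph m \<rho> (Suc 0) = return_pmf single_vertex"
| "pa_graph m \<rho> (Suc (Suc 0)) = return_pmf (add_vertex 2 (replicate m 1) single_vertex)"
| "pa_graph m \<rho> (Suc (Suc (Suc n))) =
     bind_pmf (pa_graph m \<rho> (Suc (Suc n)))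
       (\<lambda>G. map_pmf (\<lambda>ts. add_vertex (n + 3) ts G) (targets_pmf m \<rho> (n + 3) G m))"

definition num_descendants :: "('a, 'b) pre_digraph \<Rightarrow> 'a \<Rightarrow> nat" where
  "num_descendants G v = card {w. reachable G v w}"

definition gamma_density :: "real \<Rightarrow> real \<Rightarrow> real \<Rightarrow> real" where
  "gamma_density a b x =
     (if x > 0 then x powr (a - 1) * exp (- x / b) / (Gamma a * b powr a) else 0)"


text \<open>The attachment weights are a probability distribution along the whole process.\<close>

definition pa_invar :: "nat \<Rightarrow> nat \<Rightarrow> pa_digraph \<Rightarrow> bool" where
  "pa_invar m N G \<longleftrightarrow> verts G = {1..N} \<and> tail G = fst \<and> head G = (\<lambda>(i, l, j). j) \<and>
     finite (arcs G) \<and> (\<forall>(i, l, j) \<in> arcs G. i \<in> {1..N} \<and> j \<in> {1..N}) \<and>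
     card (arcs G) = m * (N - 1) \<and> (\<forall>v\<in>{1..N}. m \<le> total_degree G v)"

lemma sum_total_degree:
  assumes "pa_invar m N G"
  shows "(\<Sum>v\<in>{1..N}. total_degree G v) = 2 * m * (N - 1)"
proof -
  have fin: "finite (arcs G)" using assms by (simp add: pa_invar_def)
  have "(\<Sum>v\<in>{1..N}. card {e \<in> arcs G. f e = v}) = card (arcs G)"
    if "f ` arcs G \<subseteq> {1..N}" for f
  proof -
    have "arcs G = (\<Union>v\<in>{1..N}. {e \<in> arcs G. f e = v})" using that by auto
    then have "card (arcs G) = card (\<Union>v\<in>{1..N}. {e \<in> arcs G. f e = v})" by simp
    also have "\<dots> = (\<Sum>v\<in>{1..N}. card {e \<in> arcs G. f e = v})"
      by (rule card_UN_disjoint) (use fin in auto)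
    finally show ?thesis by simp
  qed
  from this[of "tail G"] this[of "head G"]
  have "(\<Sum>v\<in>{1..N}. out_degree G v) = card (arcs G)"
       "(\<Sum>v\<in>{1..N}. in_degree G v) = card (arcs G)"
    using assms by (fastforce simp: out_degree_def out_arcs_def in_degree_def in_arcs_def pa_invar_def)+
  then show ?thesis using assms
    by (simp add: total_degree_def sum.distrib pa_invar_def)
qed

lemma pmf_attach_pmf_invar:
  assumes inv: "pa_invar m N G" and N: "N \<ge> 2" and ts: "set ts \<subseteq> {1..N}"
    and \<rho>: "\<rho> > - real m"
  shows "pmf (attach_pmf m \<rho> (Suc N) G ts) j = attach_weight m \<rho> (Suc N) G ts j"
proof -
  let ?D = "2 * real m * (real N - 1) + real (length ts) + real N * \<rho>"
  have pos: "real (total_degree G v) + real (count_list ts v) + \<rho> > 0" if "v \<in> {1..N}" for v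
  proof -
    have "m \<le> total_degree G v" using inv that by (auto simp: pa_invar_def)
    then show ?thesis using \<rho> by linarith
  qed
  have S: "(\<Sum>v\<in>{1..N}. real (total_degree G v) + real (count_list ts v) + \<rho>) = ?D"
  proof -
    have "(\<Sum>v\<in>{1..N}. count_list ts v) = length ts"
      using ts by (intro sum_count_set) auto
    moreover have "real (2 * m * (N - 1)) = 2 * real m * (real N - 1)"
      using N by (simp add: of_nat_diff)
    ultimately show ?thesis
      using arg_cong[OF sum_total_degree[OF inv], of real]
      by (simp add: sum.distrib flip: of_nat_sum)
  qed
  have "(\<Sum>v\<in>{1..N}. real (total_degree G v) + real (count_list ts v) + \<rho>) > 0"
    by (rule sum_pos) (use N pos in auto)
  then have D: "?D > 0" using S by simp
  have w: "attach_weight m \<rho> (Suc N) G ts v =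
      (if v \<in> {1..N} then (real (total_degree G v) + real (count_list ts v) + \<rho>) / ?D else 0)" for v
    by (simp add: attach_weight_def algebra_simps)
  have nn: "attach_weight m \<rho> (Suc N) G ts v \<ge> 0" for v
    unfolding w using pos[of v] D by auto
  have "(\<integral>\<^sup>+v. ennreal (attach_weight m \<rho> (Suc N) G ts v) \<partial>count_space UNIV) =
        (\<Sum>v\<in>{1..N}. ennreal (attach_weight m \<rho> (Suc N) G ts v))"
    by (rule nn_integral_count_space'[of "{1..N}"]) (auto simp: w)
  also have "\<dots> = ennreal (\<Sum>v\<in>{1..N}. attach_weight m \<rho> (Suc N) G ts v)"
    using nn by simp
  also have "(\<Sum>v\<in>{1..N}. attach_weight m \<rho> (Suc N) G ts v) =
      (\<Sum>v\<in>{1..N}. (real (total_degree G v) + real (count_list ts v) + \<rho>) / ?D)"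
    by (rule sum.cong) (simp_all add: w)
  also have "\<dots> = ?D / ?D"
    by (simp only: S flip: sum_divide_distrib)
  also have "\<dots> = 1" using D by simp
  finally show ?thesis
    unfolding attach_pmf_def using nn by (simp add: pmf_embed_pmf)
qed

lemma set_targets_pmf:
  assumes inv: "pa_invar m N G" and N: "N \<ge> 2" and \<rho>: "\<rho> > - real m"
    and "ts \<in> set_pmf (targets_pmf m \<rho> (Suc N) G k)"
  shows "length ts = k \<and> set ts \<subseteq> {1..N}"
  using assms(4)
proof (induction k arbitrary: ts)
  case (Suc k)
  then obtain us j where us: "us \<in> set_pmf (targets_pmf m \<rho> (Suc N) G k)"
    and j: "j \<in> set_pmf (attach_pmf m \<rho> (Suc N) G us)" and ts: "ts = us @ [j]"
    by auto
  have "pmf (attach_pmf m \<rho> (Suc N) G us) j \<noteq> 0"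
    using j by (simp add: set_pmf_iff)
  then have "j \<in> {1..N}"
    using pmf_attach_pmf_invar[OF inv N _ \<rho>, of us j] Suc.IH[OF us]
    by (auto simp: attach_weight_def split: if_splits)
  then show ?case using Suc.IH[OF us] ts by auto
qed simp

lemma pa_invar_add_vertex:
  assumes inv: "pa_invar m N G" and N: "N \<ge> 1" and ts: "length ts = m" "set ts \<subseteq> {1..N}"
    and deg: "\<And>v. v \<in> {1..N} \<Longrightarrow> m \<le> total_degree (add_vertex (Suc N) ts G) v"
  shows "pa_invar m (Suc N) (add_vertex (Suc N) ts G)"
proof -
  let ?A = "(\<lambda>l. (Suc N, Suc l, ts ! l)) ` {..<m}"
  have A: "{(Suc N, Suc l, ts ! l) | l. l < length ts} = ?A" using ts by auto
  have cA: "card ?A = m" by (subst card_image) (auto simp: inj_on_def)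
  have disj: "arcs G \<inter> ?A = {}" using inv by (fastforce simp: pa_invar_def)
  have arcs: "arcs (add_vertex (Suc N) ts G) = arcs G \<union> ?A"
    by (simp add: add_vertex_def A)
  have hd: "tail (add_vertex (Suc N) ts G) = fst"
    using inv by (simp add: add_vertex_def pa_invar_def)
  have "out_arcs (add_vertex (Suc N) ts G) (Suc N) = ?A"
    unfolding out_arcs_def arcs hd using inv by (fastforce simp: pa_invar_def)
  then have new: "m \<le> total_degree (add_vertex (Suc N) ts G) (Suc N)"
    using cA by (simp add: total_degree_def out_degree_def)
  have cU: "card (arcs G \<union> ?A) = m * (Suc N - 1)"
    using inv N cA disj by (subst card_Un_disjoint) (auto simp: pa_invar_def algebra_simps
        simp flip: mult_Suc_right)
  have tsin: "ts ! l \<in> {1..N}" if "l < m" for l using ts that nth_mem by blast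
  have bd: "\<forall>(i, l, j) \<in> arcs G \<union> ?A. i \<in> {1..Suc N} \<and> j \<in> {1..Suc N}"
    using inv tsin by (fastforce simp: pa_invar_def)
  have dg: "m \<le> total_degree (add_vertex (Suc N) ts G) v" if "v \<in> {1..Suc N}" for v
    using that deg[of v] new by (cases "v = Suc N") auto
  have "verts (add_vertex (Suc N) ts G) = {1..Suc N}"
    "head (add_vertex (Suc N) ts G) = (\<lambda>(i, l, j). j)"
    using inv by (auto simp: add_vertex_def pa_invar_def)
  moreover have "finite (arcs G)" using inv by (simp add: pa_invar_def)
  ultimately show ?thesis
    unfolding pa_invar_def arcs using hd cU bd dg by blast
qed

lemma total_degree_add_vertex_mono:
  assumes "finite (arcs G)"
  shows "total_degree G v \<le> total_degree (add_vertex n ts G) v"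
proof -
  have fin: "finite {(n, Suc l, ts ! l) | l. l < length ts}" by simp
  show ?thesis
    unfolding total_degree_def in_degree_def out_degree_def in_arcs_def out_arcs_def add_vertex_def
    using assms fin by (intro add_mono card_mono) auto
qed

lemma pa_invar_pa_graph:
  assumes \<rho>: "\<rho> > - real m" and "G \<in> set_pmf (pa_graph m \<rho> (Suc (Suc n)))"
  shows "pa_invar m (Suc (Suc n)) G"
  using assms(2)
proof (induction n arbitrary: G)
  case 0
  let ?T = "replicate m (1::nat)"
  have G: "G = add_vertex 2 ?T single_vertex" using 0 by simp
  have A: "arcs G = (\<lambda>l. (2, Suc l, 1)) ` {..<m}"
    by (auto simp: G add_vertex_def single_vertex_def)
  have cA: "card (arcs G) = m" unfolding A by (subst card_image) (auto simp: inj_on_def)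
  have tl: "tail G = fst" "head G = (\<lambda>(i, l, j). j)" "verts G = {1..2}"
    by (auto simp: G add_vertex_def single_vertex_def)
  have "in_arcs G 1 = arcs G" "out_arcs G 2 = arcs G"
    by (auto simp: in_arcs_def out_arcs_def tl A)
  then have "m \<le> total_degree G 1" "m \<le> total_degree G 2"
    using cA by (simp_all add: total_degree_def in_degree_def out_degree_def)
  moreover have "v = 1 \<or> v = 2" if "v \<in> {1..2}" for v :: nat using that by auto
  ultimately have dg: "\<forall>v\<in>{1..2}. m \<le> total_degree G v" by blast
  have "finite (arcs G)" "\<forall>(i, l, j) \<in> arcs G. i \<in> {1..2} \<and> j \<in> {1..2}"
    by (auto simp: A)
  then have "pa_invar m 2 G" unfolding pa_invar_def using tl cA dg by simp
  then show ?case by (simp add: numeral_2_eq_2)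
next
  case (Suc n)
  let ?N = "Suc (Suc n)"
  have n3: "n + 3 = Suc ?N" by simp
  from Suc.prems obtain H ts where H: "H \<in> set_pmf (pa_graph m \<rho> ?N)"
    and ts: "ts \<in> set_pmf (targets_pmf m \<rho> (Suc ?N) H m)" and G: "G = add_vertex (Suc ?N) ts H"
    unfolding pa_graph.simps n3 by auto
  have inv: "pa_invar m ?N H" by (rule Suc.IH[OF H])
  have 1: "length ts = m" "set ts \<subseteq> {1..?N}"
    using set_targets_pmf[OF inv _ \<rho> ts] by simp_all
  show ?case unfolding G
  proof (rule pa_invar_add_vertex[OF inv _ 1])
    fix v assume "v \<in> {1..?N}"
    then have "m \<le> total_degree H v" "finite (arcs H)" using inv by (auto simp: pa_invar_def)
    then show "m \<le> total_degree (add_vertex (Suc ?N) ts H) v"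
      using total_degree_add_vertex_mono le_trans by blast
  qed simp
qed

lemma pmf_attach_pmf:
  assumes "\<rho> > - real m" "n \<ge> 3" "G \<in> set_pmf (pa_graph m \<rho> (n - 1))"
    and "ts \<in> set_pmf (targets_pmf m \<rho> n G k)"
  shows "pmf (attach_pmf m \<rho> n G ts) j = attach_weight m \<rho> n G ts j" and "length ts = k"
proof -
  obtain N where n: "n = Suc (Suc (Suc N))"
    using assms(2) by (metis Suc_le_D numeral_3_eq_3 Suc_le_mono)
  have inv: "pa_invar m (Suc (Suc N)) G"
    using pa_invar_pa_graph assms(1,3) unfolding n by simp
  have ts: "length ts = k \<and> set ts \<subseteq> {1..Suc (Suc N)}"
    using set_targets_pmf[OF inv _ assms(1)] assms(4) unfolding n by simp
  show "pmf (attach_pmf m \<rho> n G ts) j = attach_weight m \<rho> n G ts j"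
    unfolding n by (rule pmf_attach_pmf_invar[OF inv]) (use ts assms(1) in auto)
  show "length ts = k" using ts by simp
qed

end

theory Submission
  imports Defs "HOL-Real_Asymp.Real_Asymp"
begin

text \<open>
  The descendants of \<open>n\<close> are found by looking at the vertices
  \<open>n - 1, n - 2, \<dots>\<close> in decreasing order.  Call an edge active at level \<open>k\<close> if it leaves a descendant
  of \<open>n\<close> with label above \<open>k\<close> and ends in \<open>{1..k}\<close>; let \<open>y\<close> be the number of active edges.  Whether
  these edges hit \<open>k\<close> is decided by a Polya urn in which \<open>k\<close> has weight \<open>\<theta> = m + \<rho>\<close> and the whole
  graph has weight \<open>A k\<close>, about \<open>L k\<close> with \<open>L = 2 m + \<rho>\<close>.  If \<open>z > 0\<close> of them hit \<open>k\<close>, then \<open>k\<close> is a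
  descendant and \<open>y\<close> becomes \<open>m + y - z\<close>.  If none does, then \<open>y\<close> stays the same, and the \<open>m\<close> edges
  sent out by \<open>k\<close> may be forgotten, because the targets of consecutive edges are exchangeable.  So the
  number of active edges is a Markov chain, and up to a bounded error the number of descendants is
  the number of levels at which this chain records a hit (\<open>reached_rec\<close>, \<open>descendants_coupling\<close>).

  As long as \<open>y\<close> is small compared with \<open>k\<close>, hits are rare and mostly single, and
  each active edge produces \<open>m - 1\<close> new ones at rate \<open>\<theta> / (L k)\<close> per level.  This is a Yule process
  in the time \<open>ln (n / k)\<close>, so \<open>y\<close> grows like \<open>(n / k) powr \<alpha>\<close> with \<open>\<alpha> = (m - 1) \<theta> / L\<close>, and its
  normalised size, in units of \<open>m - 1\<close> edges, has a limit with Laplace transform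
  \<open>(1 + \<tau>) powr (- m / (m - 1))\<close>, that of the variable \<open>\<xi>\<^sub>1\<close> (\<open>laplace_limit\<close>).

  At levels of order \<open>n powr \<nu>\<close> the number of active edges is comparable with the
  level, and the urn has to be treated exactly.  With \<open>s = \<theta> + 1\<close>, the ratio \<open>R k y\<close> of the rising
  factorials of \<open>A k + s\<close> and \<open>A k\<close> behaves like an eigenfunction of the urn, and
  \<open>charge k y = norming k * (R k y - 1)\<close> with \<open>norming k\<close> of order \<open>k powr \<gamma>\<close>, \<open>\<gamma> = 1 + \<alpha>\<close>, is
  almost a martingale with small increments.  Hence it hardly changes in this late phase
  (\<open>drift_bound\<close>, \<open>charge_deviation\<close>).  Level \<open>k\<close> is missed with probability close to
  \<open>R k y powr (- q)\<close>, where \<open>q = \<theta> / s\<close> (\<open>miss_approx\<close>).  If \<open>w\<close> is the common value of the charge,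
  normalised so that \<open>norming k\<close> becomes \<open>k powr \<gamma>\<close>, then the number of hits is close to
  \<open>\<Sum>k. 1 - (1 + w * k powr (- \<gamma>)) powr (- q)\<close>.  The corresponding integral over \<open>k\<close> scales as
  \<open>w powr (1 / \<gamma>)\<close> and is evaluated by a Beta integral, which gives the three Gamma factors
  (\<open>nn_integral_hit_profile\<close>, \<open>sum_hit_profile\<close>).

  The two phases are joined at the level \<open>cut n\<close>, a power of \<open>n\<close> with exponent between
  \<open>\<nu>\<close> and \<open>1\<close>.  There \<open>y\<close> is still small compared with the level, so \<open>R k y - 1\<close> is close to
  \<open>s y / A k\<close> and \<open>w\<close> is \<open>n powr \<alpha> * s * (m - 1) / L\<close> times the normalised size of the early phase.
  As \<open>\<alpha> / \<gamma> = \<nu>\<close> and \<open>1 / \<gamma> = 1 - \<nu>\<close>, this shows that \<open>n powr (- \<nu>)\<close> times the number of hits is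
  close in \<open>L\<^sup>1\<close> to a fixed function of the normalised size (\<open>hit_count_limit\<close>).  Finally, convergence
  of Laplace transforms at the integers is convergence of the moments of a variable in \<open>[0, 1]\<close>, and
  this gives weak convergence by Weierstrass approximation (\<open>moments_imp_continuous_means\<close>).
\<close>

section \<open>Adding a vertex: degrees and reachability\<close>

lemma total_degree_add_vertex:
  assumes inv: "pa_invar m N G" and us: "set us \<subseteq> {1..N}"
  shows "total_degree (add_vertex (Suc N) us G) j =
    (if j = Suc N then length us else total_degree G j + count_list us j)"
proof -
  let ?H = "add_vertex (Suc N) us G"
  let ?new = "\<lambda>I. (\<lambda>l. (Suc N, Suc l, us ! l)) ` I"
  have hd: "tail ?H = fst" "head ?H = (\<lambda>(i, l, j). j)" "tail G = fst" "head G = (\<lambda>(i, l, j). j)"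
    using inv by (auto simp: add_vertex_def pa_invar_def)
  have arcs: "arcs ?H = arcs G \<union> ?new {..<length us}"
    by (auto simp: add_vertex_def)
  have fin: "finite (arcs G)" using inv by (simp add: pa_invar_def)
  have old: "i \<in> {1..N} \<and> j \<in> {1..N}" if "(i, l, j) \<in> arcs G" for i l j
    using inv that by (auto simp: pa_invar_def)
  have oldS: "i \<noteq> Suc N" "j \<noteq> Suc N" if "(i, l, j) \<in> arcs G" for i l j
    using old[OF that] by auto
  have usN: "us ! l \<in> {1..N}" if "l < length us" for l
    using us that nth_mem by blast
  have cnew: "card (?new I) = card I" for I
    by (rule card_image) (auto simp: inj_on_def)
  have in_H: "in_arcs ?H j = in_arcs G j \<union> ?new {l. l < length us \<and> us ! l = j}"
    unfolding in_arcs_def arcs hd by auto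
  have "in_arcs G j \<inter> ?new {l. l < length us \<and> us ! l = j} = {}"
    using oldS(1) by (auto simp: in_arcs_def)
  then have "in_degree ?H j = in_degree G j + card {l. l < length us \<and> us ! l = j}"
    unfolding in_degree_def in_H using fin
    by (subst card_Un_disjoint) (simp_all add: cnew in_arcs_def del: mem_Collect_eq)
  then have in_deg: "in_degree ?H j = in_degree G j + count_list us j"
    by (simp add: count_list_eq_length_filter length_filter_conv_card eq_commute)
  have out_H: "out_arcs ?H j = (if j = Suc N then ?new {..<length us} else out_arcs G j)"
    unfolding out_arcs_def arcs hd using oldS(1) by auto
  have "in_arcs G (Suc N) = {}"
    unfolding in_arcs_def hd using oldS(2) by auto
  then have "in_degree G (Suc N) = 0" by (simp add: in_degree_def)
  moreover have "count_list us (Suc N) = 0" using us by (auto simp: count_list_0_iff)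
  ultimately show ?thesis
    unfolding total_degree_def in_deg by (auto simp: out_degree_def out_H cnew)
qed

lemma pa_invar_attach:
  assumes inv: "pa_invar m N G" and "N \<ge> 1" and us: "length us = m" "set us \<subseteq> {1..N}"
  shows "pa_invar m (Suc N) (add_vertex (Suc N) us G)"
proof (rule pa_invar_add_vertex[OF assms])
  fix v assume "v \<in> {1..N}"
  then have "m \<le> total_degree G v" using inv by (auto simp: pa_invar_def)
  also have "\<dots> \<le> total_degree (add_vertex (Suc N) us G) v"
    using inv by (intro total_degree_add_vertex_mono) (simp add: pa_invar_def)
  finally show "m \<le> total_degree (add_vertex (Suc N) us G) v" .
qed

lemma count_list_filter: "count_list (filter P xs) x = (if P x then count_list xs x else 0)"
proof (cases "P x")
  case True then show ?thesis by (induction xs) auto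
next
  case False then have "x \<notin> set (filter P xs)" by simp
  then show ?thesis using False by (simp only: count_list_0_iff if_False not_False_eq_True)
qed

definition reach_from :: "('a, 'b) pre_digraph \<Rightarrow> 'a list \<Rightarrow> 'a set" where
  "reach_from G ts = {w. \<exists>t\<in>set ts. reachable G t w}"

lemma reach_from_subset: "reach_from G ts \<subseteq> verts G"
proof
  fix w assume "w \<in> reach_from G ts"
  then obtain t where "(t, w) \<in> rtrancl_on (verts G) (arcs_ends G)"
    unfolding reach_from_def reachable_def by blast
  then show "w \<in> verts G" by (rule in_rtrancl_on_in_F(2))
qed

text \<open>Edges point to smaller labels, so a new vertex does not help the old ones to reach anything, and
  whatever it reaches beyond itself it reaches through the targets of its edges.\<close>

lemma reachable_add_vertex:
  assumes inv: "pa_invar m N G" and us: "set us \<subseteq> {1..N}"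
  defines "H \<equiv> add_vertex (Suc N) us G"
  shows "t \<in> {1..N} \<Longrightarrow> reachable H t w \<longleftrightarrow> reachable G t w"
    and "reachable H (Suc N) w \<longleftrightarrow> w = Suc N \<or> w \<in> reach_from G us"
proof -
  have hd: "tail H = fst" "head H = (\<lambda>(i, l, j). j)" "tail G = fst" "head G = (\<lambda>(i, l, j). j)"
    and vG: "verts G = {1..N}" and vH: "verts H = insert (Suc N) {1..N}"
    using inv by (auto simp: H_def add_vertex_def pa_invar_def)
  have ends: "arcs_ends H = arcs_ends G \<union> {Suc N} \<times> set us"
  proof -
    have "(Suc N, u) \<in> arcs_ends H" if uin: "u \<in> set us" for u
    proof -
      obtain l where "l < length us" "us ! l = u" using uin[unfolded in_set_conv_nth] by blast
      then have "(Suc N, Suc l, u) \<in> arcs H" by (auto simp: H_def add_vertex_def)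
      then show ?thesis unfolding arcs_ends_def arc_to_ends_def hd
        by (intro image_eqI[where x = "(Suc N, Suc l, u)"]) simp_all
    qed
    moreover have "arcs_ends G \<subseteq> arcs_ends H"
      unfolding arcs_ends_def arc_to_ends_def hd by (auto simp: H_def add_vertex_def)
    moreover have "arcs_ends H \<subseteq> arcs_ends G \<union> {Suc N} \<times> set us"
      unfolding arcs_ends_def arc_to_ends_def hd by (fastforce simp: H_def add_vertex_def)
    ultimately show ?thesis by blast
  qed
  have old: "i \<in> {1..N}" "j \<in> {1..N}" if "(i, j) \<in> arcs_ends G" for i j
    using that inv unfolding arcs_ends_def arc_to_ends_def hd by (fastforce simp: pa_invar_def)+
  have up: "reachable H t w" if "reachable G t w" for t w
    using that unfolding reachable_def
    by (rule rtrancl_on_mono[rotated 2]) (auto simp: ends vG vH)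
  have down: "reachable G t w" if "reachable H t w" "t \<in> {1..N}" for t w
    using that(1) unfolding reachable_def
  proof (induction rule: rtrancl_on_induct)
    case base
    then show ?case using that(2) vG by auto
  next
    case (step y z)
    then have "y \<in> {1..N}" using vG in_rtrancl_on_in_F(2) by metis
    then have "(y, z) \<in> arcs_ends G" using step(2) by (auto simp: ends)
    then show ?case using step(5) old vG by (metis rtrancl_on_into_rtrancl_on)
  qed
  show "reachable H t w \<longleftrightarrow> reachable G t w" if "t \<in> {1..N}"
    using up down that by blast
  show "reachable H (Suc N) w \<longleftrightarrow> w = Suc N \<or> w \<in> reach_from G us"
  proof
    assume "reachable H (Suc N) w"
    then show "w = Suc N \<or> w \<in> reach_from G us"
      unfolding reachable_def
    proof (cases rule: converse_rtrancl_on_cases)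
      case base then show ?thesis by simp
    next
      case (step c)
      then have "c \<in> set us" using old by (fastforce simp: ends)
      moreover have "reachable G c w"
        using down[of c w] step(2) us calculation unfolding reachable_def by blast
      ultimately show ?thesis by (auto simp: reach_from_def)
    qed
  next
    assume "w = Suc N \<or> w \<in> reach_from G us"
    then show "reachable H (Suc N) w"
    proof
      assume "w = Suc N" then show ?thesis by (simp add: reachable_def vH)
    next
      assume "w \<in> reach_from G us"
      then obtain u where u: "u \<in> set us" "reachable G u w" by (auto simp: reach_from_def)
      have "(Suc N, u) \<in> arcs_ends H" using u by (simp add: ends)
      moreover have "reachable H u w" using up u by blast
      ultimately show ?thesis
        unfolding reachable_def by (rule converse_rtrancl_on_into_rtrancl_on) (simp add: vH)
    qed
  qed
qed

lemma reach_from_add_vertex: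
  assumes inv: "pa_invar m N G" and us: "set us \<subseteq> {1..N}" and ts: "set ts \<subseteq> {1..Suc N}"
  shows "reach_from (add_vertex (Suc N) us G) ts =
    (if Suc N \<in> set ts
     then insert (Suc N) (reach_from G (us @ filter (\<lambda>j. j \<noteq> Suc N) ts))
     else reach_from G ts)"
proof -
  note R = reachable_add_vertex[OF inv us]
  have *: "t \<in> {1..N}" if "t \<in> set ts" "t \<noteq> Suc N" for t
    using ts that by fastforce
  show ?thesis
  proof (cases "Suc N \<in> set ts")
    case True
    have "w \<in> reach_from (add_vertex (Suc N) us G) ts \<longleftrightarrow>
       w = Suc N \<or> w \<in> reach_from G us \<or> (\<exists>t\<in>set ts. t \<noteq> Suc N \<and> reachable G t w)" for w
    proof -
      have "w \<in> reach_from (add_vertex (Suc N) us G) ts \<longleftrightarrow>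
         reachable (add_vertex (Suc N) us G) (Suc N) w \<or>
         (\<exists>t\<in>set ts. t \<noteq> Suc N \<and> reachable (add_vertex (Suc N) us G) t w)"
        using True by (auto simp: reach_from_def)
      then show ?thesis using R(1)[OF *] R(2) by auto
    qed
    then show ?thesis using True by (auto simp: reach_from_def)
  next
    case False
    then have "\<And>t. t \<in> set ts \<Longrightarrow> t \<in> {1..N}" using * by metis
    then show ?thesis using R(1) False by (auto simp: reach_from_def)
  qed
qed

lemma num_descendants_add_vertex:
  assumes inv: "pa_invar m N G" and us: "set us \<subseteq> {1..N}"
  shows "num_descendants (add_vertex (Suc N) us G) (Suc N) = Suc (card (reach_from G us))"
proof -
  have "{w. reachable (add_vertex (Suc N) us G) (Suc N) w} = insert (Suc N) (reach_from G us)"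
    using reachable_add_vertex(2)[OF inv us] by auto
  moreover have "reach_from G us \<subseteq> {1..N}"
    using reach_from_subset[of G us] inv by (simp add: pa_invar_def)
  then have "Suc N \<notin> reach_from G us" "finite (reach_from G us)"
    by (auto intro: finite_subset)
  ultimately show ?thesis by (simp add: num_descendants_def)
qed

section \<open>The urn seen from a vertex\<close>

locale pref_attach =
  fixes m :: nat and \<rho> :: real
  assumes m2: "m \<ge> 2" and rho: "\<rho> > - real m"
begin

definition \<theta> :: real where "\<theta> = real m + \<rho>"
definition L :: real where "L = 2 * real m + \<rho>"

text \<open>\<open>A k\<close> is the total weight of the vertices of \<open>G\<^sub>k\<close>, and \<open>b k\<close> that of the vertices other
  than \<open>k\<close>; vertex \<open>k\<close> itself has weight \<open>\<theta>\<close> when it has just been added.\<close>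

definition A :: "nat \<Rightarrow> real" where "A k = L * real k - 2 * real m"
definition b :: "nat \<Rightarrow> real" where "b k = A k - \<theta>"

lemma theta_pos: "\<theta> > 0" using rho by (simp add: \<theta>_def)
lemma L_eq: "L = real m + \<theta>" by (simp add: L_def \<theta>_def)
lemma L_pos: "L > 0" using theta_pos m2 by (simp add: L_eq)
lemma b_Suc: "b (Suc k) = A k + real m" by (simp add: b_def A_def L_eq algebra_simps)
lemma A_Suc: "A (Suc k) = A k + L" by (simp add: A_def algebra_simps)

lemma A_lower:
  assumes "k \<ge> 2" shows "A k \<ge> \<theta> * real k"
proof -
  have "real m * 2 \<le> real m * real k" using assms by (intro mult_left_mono) auto
  then show ?thesis unfolding A_def L_eq by (simp add: algebra_simps)
qed

lemma A_pos:
  assumes "k \<ge> 2" shows "A k > 0"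
proof -
  have "0 < \<theta> * real k" using theta_pos assms by simp
  then show ?thesis using A_lower[OF assms] by linarith
qed

text \<open>The number of \<open>y\<close> successive edges sent into \<open>G\<^sub>k\<close> that hit vertex \<open>k\<close>, a Polya urn.\<close>

primrec hits :: "nat \<Rightarrow> nat \<Rightarrow> nat pmf" where
  "hits k 0 = return_pmf 0"
| "hits k (Suc y) = bind_pmf (hits k y)
     (\<lambda>z. map_pmf (\<lambda>c. if c then Suc z else z) (bernoulli_pmf ((\<theta> + real z) / (A k + real y))))"

lemma hits_le: "z \<in> set_pmf (hits k y) \<Longrightarrow> z \<le> y"
proof (induction y arbitrary: z)
  case (Suc y)
  then show ?case by (fastforce split: if_splits)
qed simp

lemma finite_hits [simp]: "finite (set_pmf (hits k y))"
proof (rule finite_subset)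
  show "set_pmf (hits k y) \<subseteq> {..y}"
  proof
    fix z assume "z \<in> set_pmf (hits k y)"
    then show "z \<in> {..y}" by (simp add: hits_le)
  qed
qed simp

lemma hit_prob_le_1:
  assumes "k \<ge> 3" "z \<le> y"
  shows "0 \<le> (\<theta> + real z) / (A k + real y)" "(\<theta> + real z) / (A k + real y) \<le> 1"
proof -
  obtain j where k: "k = Suc j" "j \<ge> 2" using assms(1) by (cases k) auto
  have "A k \<ge> \<theta>" using A_pos[OF k(2)] L_eq by (simp add: k(1) A_Suc)
  moreover have "A k > 0" using A_pos assms by simp
  ultimately show "0 \<le> (\<theta> + real z) / (A k + real y)" "(\<theta> + real z) / (A k + real y) \<le> 1"
    using theta_pos assms(2) by (auto simp: divide_le_eq)
qed

lemma attach_weight_eq: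
  assumes "N \<ge> 1"
  shows "attach_weight m \<rho> (Suc N) G ts j = (if j \<in> {1..N}
    then (real (total_degree G j) + real (count_list ts j) + \<rho>) / (A N + real (length ts)) else 0)"
proof -
  have "2 * real m * (real (Suc N) - 2) + real (length ts) + (real (Suc N) - 1) * \<rho> = A N + real (length ts)"
    by (simp add: A_def L_def algebra_simps)
  then show ?thesis by (simp only: attach_weight_def diff_Suc_1)
qed

text \<open>One step of the urn.  Let vertex \<open>k = Suc N\<close> have sent out the edges \<open>us\<close>.  A further edge sent into
  \<open>G\<^sub>k\<close> either hits \<open>k\<close>, or, given that it misses \<open>k\<close>, it is distributed like an edge sent into the
  older graph after \<open>us\<close> and those earlier edges that also missed \<open>k\<close>: both see the same degrees.\<close>

lemma attach_pmf_split:
  assumes inv: "pa_invar m N G" and N: "N \<ge> 2" and us: "length us = m" "set us \<subseteq> {1..N}"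
    and ts: "set ts \<subseteq> {1..Suc N}"
  shows "attach_pmf m \<rho> (Suc (Suc N)) (add_vertex (Suc N) us G) ts =
    bind_pmf (bernoulli_pmf ((\<theta> + real (count_list ts (Suc N))) / (A (Suc N) + real (length ts))))
     (\<lambda>c. if c then return_pmf (Suc N)
          else attach_pmf m \<rho> (Suc N) G (us @ filter (\<lambda>j. j \<noteq> Suc N) ts))"
    (is "?L = bind_pmf (bernoulli_pmf ?p) _")
proof (rule pmf_eqI)
  fix i
  let ?H = "add_vertex (Suc N) us G" and ?l = "us @ filter (\<lambda>j. j \<noteq> Suc N) ts"
  have invH: "pa_invar m (Suc N) ?H" using pa_invar_attach[OF inv _ us] N by simp
  have cle: "count_list ts (Suc N) \<le> length ts" by (rule count_le_length)
  have p: "0 \<le> ?p" "?p \<le> 1" using hit_prob_le_1[of "Suc N"] N cle by auto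
  have l: "set ?l \<subseteq> {1..N}" using us ts by fastforce
  have len: "length ?l + count_list ts (Suc N) = m + length ts"
    using sum_length_filter_compl[of "(=) (Suc N)" ts] us
    by (simp add: count_list_eq_length_filter eq_commute[of _ "Suc N"])
  have cnt: "count_list ?l i = count_list us i + (if i = Suc N then 0 else count_list ts i)"
    by (simp add: count_list_filter)
  have AN: "A (Suc N) + real (length ts) > 0" using A_pos[of "Suc N"] N by simp
  have AN': "A N + real (length ?l) > 0" using A_pos[of "N"] N by simp
  have "real (length ?l) = real m + real (length ts) - real (count_list ts (Suc N))"
    using len by linarith
  then have "A (Suc N) + real (length ts) - (\<theta> + real (count_list ts (Suc N))) = A N + real (length ?l)"
    by (simp add: A_Suc L_eq)
  then have p1: "1 - ?p = (A N + real (length ?l)) / (A (Suc N) + real (length ts))"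
    using AN by (simp add: field_simps)
  have L: "pmf ?L i = attach_weight m \<rho> (Suc (Suc N)) ?H ts i"
    by (rule pmf_attach_pmf_invar[OF invH _ ts rho]) (use N in auto)
  have R: "pmf (attach_pmf m \<rho> (Suc N) G ?l) i = attach_weight m \<rho> (Suc N) G ?l i"
    by (rule pmf_attach_pmf_invar[OF inv _ l rho]) (use N in auto)
  have "pmf (bind_pmf (bernoulli_pmf ?p) (\<lambda>c. if c then return_pmf (Suc N)
          else attach_pmf m \<rho> (Suc N) G ?l)) i =
     ?p * (if i = Suc N then 1 else 0) + (1 - ?p) * attach_weight m \<rho> (Suc N) G ?l i"
    unfolding pmf_bind using p R by (simp add: indicator_def)
  also have "\<dots> = attach_weight m \<rho> (Suc (Suc N)) ?H ts i"
  proof (cases "i = Suc N")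
    case True
    then show ?thesis using N us
      by (simp add: attach_weight_eq total_degree_add_vertex[OF inv us(2)] \<theta>_def algebra_simps)
  next
    case False
    define d where "d = A N + real (length ?l)"
    have w: "attach_weight m \<rho> (Suc N) G ?l i = (if i \<in> {1..N}
        then (real (total_degree ?H i) + real (count_list ts i) + \<rho>) / d else 0)"
      using cnt False N
      by (simp add: attach_weight_eq total_degree_add_vertex[OF inv us(2)] d_def add_ac)
    have "d > 0" "i \<in> {1..Suc N} \<longleftrightarrow> i \<in> {1..N}" using AN' False by (auto simp: d_def)
    then show ?thesis unfolding p1[folded d_def] w using N False
      by (simp add: attach_weight_eq flip: d_def)
  qed
  finally show "pmf ?L i = pmf (bind_pmf (bernoulli_pmf ?p) (\<lambda>c. if c then return_pmf (Suc N)
          else attach_pmf m \<rho> (Suc N) G ?l)) i" using L by simp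
qed

text \<open>The urn step applied to \<open>y\<close> edges in a row: the number \<open>z\<close> of hits at \<open>k = Suc N\<close> is drawn first,
  and then the \<open>m\<close> edges of \<open>k\<close> together with the \<open>y - z\<close> missing edges form one sequence of
  consecutive edges sent into the older graph.\<close>

lemma urn_merge:
  assumes inv: "pa_invar m N G" and N: "N \<ge> 2"
  shows "bind_pmf (targets_pmf m \<rho> (Suc N) G m) (\<lambda>us.
      map_pmf (\<lambda>ts. (count_list ts (Suc N), us @ filter (\<lambda>j. j \<noteq> Suc N) ts))
        (targets_pmf m \<rho> (Suc (Suc N)) (add_vertex (Suc N) us G) y)) =
    bind_pmf (hits (Suc N) y) (\<lambda>z. map_pmf (Pair z) (targets_pmf m \<rho> (Suc N) G (m + y - z)))"
    (is "?L y = ?R y")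
proof (induction y)
  case 0
  show ?case by (simp add: bind_return_pmf map_pmf_def)
next
  case (Suc y)
  \<comment> \<open>the transition performed by one further edge on the pair of the hit count and the merged sequence\<close>
  define step where "step = (\<lambda>(z, l). bind_pmf (bernoulli_pmf ((\<theta> + real z) / (A (Suc N) + real y)))
     (\<lambda>c. if c then return_pmf (Suc z, l)
          else map_pmf (\<lambda>j. (z, l @ [j])) (attach_pmf m \<rho> (Suc N) G l)))"
  have S: "map_pmf (\<lambda>j. (count_list (ts @ [j]) (Suc N), us @ filter (\<lambda>j. j \<noteq> Suc N) (ts @ [j])))
        (attach_pmf m \<rho> (Suc (Suc N)) (add_vertex (Suc N) us G) ts) =
      step (count_list ts (Suc N), us @ filter (\<lambda>j. j \<noteq> Suc N) ts)"
    if us: "us \<in> set_pmf (targets_pmf m \<rho> (Suc N) G m)"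
    and ts: "ts \<in> set_pmf (targets_pmf m \<rho> (Suc (Suc N)) (add_vertex (Suc N) us G) y)" for us ts
  proof -
    have us': "length us = m" "set us \<subseteq> {1..N}"
      using set_targets_pmf[OF inv N rho us] by auto
    have "pa_invar m (Suc N) (add_vertex (Suc N) us G)"
      using pa_invar_attach[OF inv _ us'] N by simp
    from set_targets_pmf[OF this _ rho ts] N have ts': "length ts = y" "set ts \<subseteq> {1..Suc N}" by auto
    have notin: "j \<noteq> Suc N" if "j \<in> set_pmf (attach_pmf m \<rho> (Suc N) G (us @ filter (\<lambda>j. j \<noteq> Suc N) ts))" for j
    proof -
      have "set (us @ filter (\<lambda>j. j \<noteq> Suc N) ts) \<subseteq> {1..N}" using us' ts' by fastforce
      from pmf_attach_pmf_invar[OF inv N this rho, of j] that N show ?thesis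
        by (auto simp: set_pmf_iff attach_weight_eq)
    qed
    note split = attach_pmf_split[OF inv N us'(1) us'(2) ts'(2)]
    have snoc: "count_list (ts @ [j]) (Suc N) = (if j = Suc N then Suc (count_list ts (Suc N)) else count_list ts (Suc N))"
      "us @ filter (\<lambda>j. j \<noteq> Suc N) (ts @ [j]) = (if j = Suc N then us @ filter (\<lambda>j. j \<noteq> Suc N) ts
        else (us @ filter (\<lambda>j. j \<noteq> Suc N) ts) @ [j])" for j
      by auto
    have "map_pmf (\<lambda>j. (count_list (ts @ [j]) (Suc N), us @ filter (\<lambda>j. j \<noteq> Suc N) (ts @ [j])))
        (if c then return_pmf (Suc N)
          else attach_pmf m \<rho> (Suc N) G (us @ filter (\<lambda>j. j \<noteq> Suc N) ts)) =
      (if c then return_pmf (Suc (count_list ts (Suc N)), us @ filter (\<lambda>j. j \<noteq> Suc N) ts)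
       else map_pmf (\<lambda>j. (count_list ts (Suc N), (us @ filter (\<lambda>j. j \<noteq> Suc N) ts) @ [j]))
         (attach_pmf m \<rho> (Suc N) G (us @ filter (\<lambda>j. j \<noteq> Suc N) ts)))" for c
    proof (cases c)
      case True
      then show ?thesis by (simp only: if_True map_return_pmf snoc simp_thms)
    next
      case False
      show ?thesis
        by (simp only: False if_False snoc) (rule map_pmf_cong[OF refl], simp only: notin if_False)
    qed
    then show ?thesis
      by (simp only: split step_def prod.case ts'(1) map_bind_pmf)
  qed
  have "?L (Suc y) = bind_pmf (targets_pmf m \<rho> (Suc N) G m) (\<lambda>us.
      bind_pmf (targets_pmf m \<rho> (Suc (Suc N)) (add_vertex (Suc N) us G) y) (\<lambda>ts.
        map_pmf (\<lambda>j. (count_list (ts @ [j]) (Suc N), us @ filter (\<lambda>j. j \<noteq> Suc N) (ts @ [j])))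
        (attach_pmf m \<rho> (Suc (Suc N)) (add_vertex (Suc N) us G) ts)))"
    by (simp add: map_bind_pmf pmf.map_comp o_def)
  also have "\<dots> = bind_pmf (targets_pmf m \<rho> (Suc N) G m) (\<lambda>us.
      bind_pmf (targets_pmf m \<rho> (Suc (Suc N)) (add_vertex (Suc N) us G) y) (\<lambda>ts.
        step (count_list ts (Suc N), us @ filter (\<lambda>j. j \<noteq> Suc N) ts)))"
    using S by (intro bind_pmf_cong refl) auto
  also have "\<dots> = bind_pmf (?L y) step"
    by (simp add: bind_assoc_pmf bind_map_pmf)
  also have "\<dots> = bind_pmf (?R y) step" by (simp only: Suc.IH)
  also have "\<dots> = bind_pmf (hits (Suc N) y) (\<lambda>z.
      bind_pmf (targets_pmf m \<rho> (Suc N) G (m + y - z)) (\<lambda>l.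
      bind_pmf (bernoulli_pmf ((\<theta> + real z) / (A (Suc N) + real y))) (\<lambda>c. if c then return_pmf (Suc z, l)
          else map_pmf (\<lambda>j. (z, l @ [j])) (attach_pmf m \<rho> (Suc N) G l))))"
    by (simp add: bind_assoc_pmf bind_map_pmf step_def)
  also have "\<dots> = bind_pmf (hits (Suc N) y) (\<lambda>z.
      bind_pmf (bernoulli_pmf ((\<theta> + real z) / (A (Suc N) + real y))) (\<lambda>c.
      bind_pmf (targets_pmf m \<rho> (Suc N) G (m + y - z)) (\<lambda>l. if c then return_pmf (Suc z, l)
          else map_pmf (\<lambda>j. (z, l @ [j])) (attach_pmf m \<rho> (Suc N) G l))))"
    by (subst bind_commute_pmf) (rule refl)
  also have "\<dots> = bind_pmf (hits (Suc N) y) (\<lambda>z.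
      bind_pmf (bernoulli_pmf ((\<theta> + real z) / (A (Suc N) + real y))) (\<lambda>c.
      map_pmf (Pair (if c then Suc z else z))
        (targets_pmf m \<rho> (Suc N) G (m + Suc y - (if c then Suc z else z)))))"
  proof (intro bind_pmf_cong refl)
    fix z c assume "z \<in> set_pmf (hits (Suc N) y)"
    then have "m + Suc y - z = Suc (m + y - z)" using hits_le by fastforce
    then show "bind_pmf (targets_pmf m \<rho> (Suc N) G (m + y - z)) (\<lambda>l. if c then return_pmf (Suc z, l)
          else map_pmf (\<lambda>j. (z, l @ [j])) (attach_pmf m \<rho> (Suc N) G l)) =
      map_pmf (Pair (if c then Suc z else z))
        (targets_pmf m \<rho> (Suc N) G (m + Suc y - (if c then Suc z else z)))"
      by (cases c) (simp_all add: map_bind_pmf pmf.map_comp o_def, simp add: map_pmf_def)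
  qed
  also have "\<dots> = ?R (Suc y)"
    by (simp add: bind_assoc_pmf bind_map_pmf)
  finally show ?case .
qed

section \<open>Exchangeability of the targets\<close>

lemma pmf_targets_snoc:
  "pmf (targets_pmf m \<rho> n G (Suc y)) (us @ [j]) = pmf (targets_pmf m \<rho> n G y) us * pmf (attach_pmf m \<rho> n G us) j"
proof -
  have *: "pmf (map_pmf (\<lambda>j. ts @ [j]) (attach_pmf m \<rho> n G ts)) (us @ [j]) =
      (if ts = us then pmf (attach_pmf m \<rho> n G us) j else 0)" for ts
  proof (cases "ts = us")
    case True
    have "pmf (map_pmf (\<lambda>j. us @ [j]) (attach_pmf m \<rho> n G us)) (us @ [j]) = pmf (attach_pmf m \<rho> n G us) j"
      by (rule pmf_map_inj'[where f = "\<lambda>j. us @ [j]"]) (simp add: inj_def)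
    then show ?thesis using True by simp
  next
    case False
    then show ?thesis by (auto simp: pmf_eq_0_set_pmf)
  qed
  have "pmf (targets_pmf m \<rho> n G (Suc y)) (us @ [j]) =
     measure_pmf.expectation (targets_pmf m \<rho> n G y) (\<lambda>ts. if ts = us then pmf (attach_pmf m \<rho> n G us) j else 0)"
    by (simp only: targets_pmf.simps pmf_bind *)
  also have "\<dots> = (\<Sum>ts\<in>{us}. (if ts = us then pmf (attach_pmf m \<rho> n G us) j else 0) * pmf (targets_pmf m \<rho> n G y) ts)"
    by (rule integral_measure_pmf_real) (auto split: if_splits)
  finally show ?thesis by (simp add: mult.commute)
qed

text \<open>The law of a sequence of targets depends only on how often each vertex is hit, so the
  sequence is exchangeable.\<close>

lemma pmf_targets:
  assumes inv: "pa_invar m N G" and N: "N \<ge> 2"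
  shows "pmf (targets_pmf m \<rho> (Suc N) G y) ts = (if length ts = y \<and> set ts \<subseteq> {1..N}
    then (\<Prod>j\<in>{1..N}. pochhammer (real (total_degree G j) + \<rho>) (count_list ts j)) / pochhammer (A N) y
    else 0)"
proof (induction y arbitrary: ts)
  case 0
  show ?case by (auto simp: indicator_def)
next
  case (Suc y)
  let ?w = "\<lambda>j. real (total_degree G j) + \<rho>"
  show ?case
  proof (cases "length ts = Suc y \<and> set ts \<subseteq> {1..N}")
    case False
    then have "ts \<notin> set_pmf (targets_pmf m \<rho> (Suc N) G (Suc y))"
      using set_targets_pmf[OF inv N rho] by blast
    then show ?thesis using False by (simp only: pmf_eq_0_set_pmf if_False not_False_eq_True)
  next
    case True
    then obtain us j where ts: "ts = us @ [j]" by (cases ts rule: rev_cases) auto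
    have us: "length us = y" "set us \<subseteq> {1..N}" and j: "j \<in> {1..N}" using True ts by auto
    have cnt: "count_list (us @ [j]) i = count_list us i + (if i = j then 1 else 0)" for i
      by simp
    have "(\<Prod>i\<in>{1..N}. pochhammer (?w i) (count_list (us @ [j]) i)) =
       (\<Prod>i\<in>{1..N}. pochhammer (?w i) (count_list us i) * (if i = j then ?w j + real (count_list us j) else 1))"
      by (rule prod.cong) (auto simp: cnt pochhammer_Suc)
    also have "\<dots> = (\<Prod>i\<in>{1..N}. pochhammer (?w i) (count_list us i)) * (?w j + real (count_list us j))"
      using j by (simp add: prod.distrib)
    finally have P: "(\<Prod>i\<in>{1..N}. pochhammer (?w i) (count_list (us @ [j]) i)) = \<dots>" .
    have "pmf (attach_pmf m \<rho> (Suc N) G us) j = (?w j + real (count_list us j)) / (A N + real y)"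
      using pmf_attach_pmf_invar[OF inv N us(2) rho, of j] j N us
      by (simp add: attach_weight_eq add_ac)
    then show ?thesis unfolding ts pmf_targets_snoc Suc.IH P using us j
      by (simp add: pochhammer_Suc)
  qed
qed

lemma targets_rev:
  assumes inv: "pa_invar m N G" and N: "N \<ge> 2"
  shows "map_pmf rev (targets_pmf m \<rho> (Suc N) G y) = targets_pmf m \<rho> (Suc N) G y"
proof (rule pmf_eqI)
  fix ts :: "nat list"
  have "pmf (map_pmf rev (targets_pmf m \<rho> (Suc N) G y)) (rev (rev ts)) = pmf (targets_pmf m \<rho> (Suc N) G y) (rev ts)"
    by (rule pmf_map_inj') (simp add: inj_def)
  also have "\<dots> = pmf (targets_pmf m \<rho> (Suc N) G y) ts"
    unfolding pmf_targets[OF inv N] by simp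
  finally show "pmf (map_pmf rev (targets_pmf m \<rho> (Suc N) G y)) ts = pmf (targets_pmf m \<rho> (Suc N) G y) ts"
    by simp
qed

text \<open>The process of sending edges is built up one edge at a time, so later edges do not change the law of
  the earlier ones.\<close>

lemma targets_take:
  assumes inv: "pa_invar m N G" and N: "N \<ge> 2"
  shows "map_pmf (take y) (targets_pmf m \<rho> (Suc N) G (y + d)) = targets_pmf m \<rho> (Suc N) G y"
proof (induction d)
  case 0
  have "map_pmf (take y) (targets_pmf m \<rho> (Suc N) G y) = map_pmf id (targets_pmf m \<rho> (Suc N) G y)"
    using set_targets_pmf[OF inv N rho] by (intro map_pmf_cong) auto
  then show ?case by simp
next
  case (Suc d)
  have "map_pmf (take y) (targets_pmf m \<rho> (Suc N) G (y + Suc d)) =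
    bind_pmf (targets_pmf m \<rho> (Suc N) G (y + d)) (\<lambda>ts. map_pmf (\<lambda>j. take y (ts @ [j])) (attach_pmf m \<rho> (Suc N) G ts))"
    by (simp add: map_bind_pmf pmf.map_comp o_def)
  also have "\<dots> = bind_pmf (targets_pmf m \<rho> (Suc N) G (y + d)) (\<lambda>ts. map_pmf (\<lambda>j. take y ts) (attach_pmf m \<rho> (Suc N) G ts))"
  proof (intro bind_pmf_cong[OF refl] map_pmf_cong[OF refl])
    fix ts j assume "ts \<in> set_pmf (targets_pmf m \<rho> (Suc N) G (y + d))"
    then have "length ts = y + d" using set_targets_pmf[OF inv N rho] by blast
    then show "take y (ts @ [j]) = take y ts" by simp
  qed
  also have "\<dots> = map_pmf (take y) (targets_pmf m \<rho> (Suc N) G (y + d))"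
    by (simp add: map_pmf_const map_pmf_def)
  finally show ?case using Suc.IH by simp
qed

text \<open>By exchangeability the last \<open>y\<close> of \<open>d + y\<close> edges have the law of the first \<open>y\<close>.  For an exploration
  that misses a vertex this removes the edges of that vertex from the picture.  Only the set of
  targets matters later, and this makes reversal of the sequence enough.\<close>

lemma targets_drop:
  assumes inv: "pa_invar m N G" and N: "N \<ge> 2"
  shows "map_pmf (\<lambda>ts. set (drop d ts)) (targets_pmf m \<rho> (Suc N) G (d + y)) =
    map_pmf set (targets_pmf m \<rho> (Suc N) G y)"
proof -
  have "map_pmf (\<lambda>ts. set (drop d ts)) (targets_pmf m \<rho> (Suc N) G (d + y)) =
    map_pmf (\<lambda>ts. set (take y (rev ts))) (targets_pmf m \<rho> (Suc N) G (d + y))"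
  proof (intro map_pmf_cong[OF refl])
    fix ts assume "ts \<in> set_pmf (targets_pmf m \<rho> (Suc N) G (d + y))"
    then have "length ts = d + y" using set_targets_pmf[OF inv N rho] by blast
    then show "set (drop d ts) = set (take y (rev ts))" by (simp add: take_rev)
  qed
  also have "\<dots> = map_pmf (set \<circ> take y) (map_pmf rev (targets_pmf m \<rho> (Suc N) G (d + y)))"
    by (simp add: pmf.map_comp o_def)
  also have "\<dots> = map_pmf set (map_pmf (take y) (targets_pmf m \<rho> (Suc N) G (y + d)))"
    by (simp add: targets_rev[OF inv N] pmf.map_comp add.commute)
  finally show ?thesis by (simp only: targets_take[OF inv N])
qed

section \<open>Descendants as a Markov chain\<close>

text \<open>The size of the set of vertices of \<open>G\<^sub>k\<close> reached through \<open>y\<close> edges that are sent into \<open>G\<^sub>k\<close> one after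
  the other, as if by vertex \<open>k + 1\<close>.\<close>

definition reached :: "nat \<Rightarrow> nat \<Rightarrow> nat pmf" where
  "reached k y = bind_pmf (pa_graph m \<rho> k) (\<lambda>G.
     map_pmf (\<lambda>ts. card (reach_from G ts)) (targets_pmf m \<rho> (Suc k) G y))"

text \<open>The hits at a level use up \<open>z\<close> active edges, and the \<open>m\<close> edges of the vertex that is hit become active.\<close>

definition next_active :: "nat \<Rightarrow> nat \<Rightarrow> nat" where
  "next_active y z = (if z = 0 then y else m + y - z)"

text \<open>Level \<open>k\<close> of the exploration.  If \<open>z > 0\<close> of the \<open>y\<close> edges hit \<open>k\<close>, then \<open>k\<close> is reached, and the
  search continues with its \<open>m\<close> edges and the \<open>y - z\<close> others, a sequence of consecutive edges by
  \<open>urn_merge\<close>.  If none hits \<open>k\<close>, the edges of \<open>k\<close> come first in the merged sequence but are not used;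
  \<open>targets_drop\<close> removes them.\<close>

lemma reached_rec:
  assumes k: "k \<ge> 3"
  shows "reached k y = bind_pmf (hits k y) (\<lambda>z.
    map_pmf (\<lambda>d. (if z = 0 then 0 else 1) + d) (reached (k - 1) (next_active y z)))"
proof -
  obtain n where n: "k = Suc (Suc (Suc n))" using k by (metis Suc_le_D numeral_3_eq_3 Suc_le_mono)
  define N where "N = Suc (Suc n)"
  have kN: "k = Suc N" and N: "N \<ge> 2" using n by (auto simp: N_def)
  have inner: "bind_pmf (targets_pmf m \<rho> (Suc N) G m) (\<lambda>us.
      map_pmf (\<lambda>ts. card (reach_from (add_vertex (Suc N) us G) ts))
        (targets_pmf m \<rho> (Suc (Suc N)) (add_vertex (Suc N) us G) y)) =
    bind_pmf (hits (Suc N) y) (\<lambda>z. map_pmf (\<lambda>ts. (if z = 0 then 0 else 1) + card (reach_from G ts))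
       (targets_pmf m \<rho> (Suc N) G (next_active y z)))" (is "?L = ?R")
    if G: "G \<in> set_pmf (pa_graph m \<rho> N)" for G
  proof -
    have inv: "pa_invar m N G" using pa_invar_pa_graph[OF rho, of G n] G by (simp add: N_def)
    define F :: "nat \<times> nat list \<Rightarrow> nat" where "F = (\<lambda>(z, l). if z = 0 then card (reach_from G (drop m l)) else 1 + card (reach_from G l))"
    have F: "card (reach_from (add_vertex (Suc N) us G) ts) = F (count_list ts (Suc N), us @ filter (\<lambda>j. j \<noteq> Suc N) ts)"
      if us: "us \<in> set_pmf (targets_pmf m \<rho> (Suc N) G m)"
      and ts: "ts \<in> set_pmf (targets_pmf m \<rho> (Suc (Suc N)) (add_vertex (Suc N) us G) y)" for us ts
    proof -
      have us': "length us = m" "set us \<subseteq> {1..N}"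
        using set_targets_pmf[OF inv N rho us] by auto
      have "pa_invar m (Suc N) (add_vertex (Suc N) us G)"
        using pa_invar_attach[OF inv _ us'] N by simp
      from set_targets_pmf[OF this _ rho ts] N have ts': "set ts \<subseteq> {1..Suc N}" by auto
      note R = reach_from_add_vertex[OF inv us'(2) ts']
      show ?thesis
      proof (cases "Suc N \<in> set ts")
        case True
        let ?l = "us @ filter (\<lambda>j. j \<noteq> Suc N) ts"
        have "reach_from G ?l \<subseteq> {1..N}"
          using reach_from_subset[of G ?l] inv by (simp add: pa_invar_def)
        then have "Suc N \<notin> reach_from G ?l" "finite (reach_from G ?l)"
          by (auto intro: finite_subset)
        then have "card (insert (Suc N) (reach_from G ?l)) = Suc (card (reach_from G ?l))"
          by (metis card_insert_disjoint)
        moreover have "count_list ts (Suc N) \<noteq> 0" using True by (simp only: count_list_0_iff not_not simp_thms)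
        ultimately show ?thesis unfolding R F_def prod.case using True
          by (simp only: if_True if_False plus_1_eq_Suc)
      next
        case False
        then have "filter (\<lambda>j. j \<noteq> Suc N) ts = ts" by (metis (mono_tags, lifting) filter_True)
        moreover have "count_list ts (Suc N) = 0" using False by (simp only: count_list_0_iff simp_thms)
        ultimately show ?thesis unfolding R F_def prod.case using False us'
          by simp
      qed
    qed
    have "?L = bind_pmf (targets_pmf m \<rho> (Suc N) G m) (\<lambda>us.
      map_pmf (\<lambda>ts. F (count_list ts (Suc N), us @ filter (\<lambda>j. j \<noteq> Suc N) ts))
        (targets_pmf m \<rho> (Suc (Suc N)) (add_vertex (Suc N) us G) y))"
      by (intro bind_pmf_cong[OF refl] map_pmf_cong[OF refl] F)
    also have "\<dots> = map_pmf F (bind_pmf (targets_pmf m \<rho> (Suc N) G m) (\<lambda>us.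
      map_pmf (\<lambda>ts. (count_list ts (Suc N), us @ filter (\<lambda>j. j \<noteq> Suc N) ts))
        (targets_pmf m \<rho> (Suc (Suc N)) (add_vertex (Suc N) us G) y)))"
      by (simp only: map_bind_pmf pmf.map_comp o_def)
    also have "\<dots> = bind_pmf (hits (Suc N) y) (\<lambda>z. map_pmf (\<lambda>l. F (z, l)) (targets_pmf m \<rho> (Suc N) G (m + y - z)))"
      by (simp only: urn_merge[OF inv N] map_bind_pmf pmf.map_comp o_def)
    also have "\<dots> = ?R"
    proof (intro bind_pmf_cong[OF refl])
      fix z
      show "map_pmf (\<lambda>l. F (z, l)) (targets_pmf m \<rho> (Suc N) G (m + y - z)) =
        map_pmf (\<lambda>ts. (if z = 0 then 0 else 1) + card (reach_from G ts)) (targets_pmf m \<rho> (Suc N) G (next_active y z))"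
      proof (cases "z = 0")
        case True
        define c where "c = (\<lambda>S. card {w. \<exists>t\<in>S. reachable G t w})"
        have c: "card (reach_from G l) = c (set l)" for l by (simp add: c_def reach_from_def)
        have "map_pmf (\<lambda>l. F (0, l)) (targets_pmf m \<rho> (Suc N) G (m + y)) =
          map_pmf c (map_pmf (\<lambda>l. set (drop m l)) (targets_pmf m \<rho> (Suc N) G (m + y)))"
          by (simp add: F_def c pmf.map_comp o_def)
        also have "\<dots> = map_pmf c (map_pmf set (targets_pmf m \<rho> (Suc N) G y))"
          by (simp only: targets_drop[OF inv N])
        finally show ?thesis using True by (simp add: next_active_def c pmf.map_comp o_def)
      next
        case False
        then show ?thesis by (simp add: F_def next_active_def)
      qed
    qed
    finally show ?thesis .
  qed
  have "n + 3 = Suc N" by (simp add: N_def)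
  then have "pa_graph m \<rho> k = bind_pmf (pa_graph m \<rho> N) (\<lambda>G. map_pmf (\<lambda>us. add_vertex (Suc N) us G) (targets_pmf m \<rho> (Suc N) G m))"
    unfolding n pa_graph.simps by (simp only: N_def)
  then have "reached k y = bind_pmf (pa_graph m \<rho> N) (\<lambda>G. bind_pmf (targets_pmf m \<rho> (Suc N) G m) (\<lambda>us.
      map_pmf (\<lambda>ts. card (reach_from (add_vertex (Suc N) us G) ts))
        (targets_pmf m \<rho> (Suc (Suc N)) (add_vertex (Suc N) us G) y)))"
    unfolding reached_def kN by (simp add: bind_assoc_pmf bind_map_pmf)
  also have "\<dots> = bind_pmf (pa_graph m \<rho> N) (\<lambda>G. bind_pmf (hits (Suc N) y) (\<lambda>z. map_pmf (\<lambda>ts. (if z = 0 then 0 else 1) + card (reach_from G ts))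
       (targets_pmf m \<rho> (Suc N) G (next_active y z))))"
    by (intro bind_pmf_cong[OF refl] inner)
  also have "\<dots> = bind_pmf (hits (Suc N) y) (\<lambda>z. bind_pmf (pa_graph m \<rho> N) (\<lambda>G. map_pmf (\<lambda>ts. (if z = 0 then 0 else 1) + card (reach_from G ts))
       (targets_pmf m \<rho> (Suc N) G (next_active y z))))"
    by (rule bind_commute_pmf)
  also have "\<dots> = bind_pmf (hits k y) (\<lambda>z.
    map_pmf (\<lambda>d. (if z = 0 then 0 else 1) + d) (reached (k - 1) (next_active y z)))"
    by (simp only: reached_def kN map_bind_pmf pmf.map_comp o_def diff_Suc_1)
  finally show ?thesis .
qed

lemma num_descendants_reached:
  assumes n: "n \<ge> 3"
  shows "map_pmf (\<lambda>G. num_descendants G n) (pa_graph m \<rho> n) = map_pmf Suc (reached (n - 1) m)"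
proof -
  obtain n' where n': "n = Suc (Suc (Suc n'))" using n by (metis Suc_le_D numeral_3_eq_3 Suc_le_mono)
  define N where "N = Suc (Suc n')"
  have nN: "n = Suc N" and N: "N \<ge> 2" using n' by (auto simp: N_def)
  have "n' + 3 = Suc N" by (simp add: N_def)
  then have "pa_graph m \<rho> n = bind_pmf (pa_graph m \<rho> N) (\<lambda>G. map_pmf (\<lambda>us. add_vertex (Suc N) us G) (targets_pmf m \<rho> (Suc N) G m))"
    unfolding n' pa_graph.simps by (simp only: N_def)
  then have "map_pmf (\<lambda>G. num_descendants G n) (pa_graph m \<rho> n) =
     bind_pmf (pa_graph m \<rho> N) (\<lambda>G. map_pmf (\<lambda>us. num_descendants (add_vertex (Suc N) us G) (Suc N)) (targets_pmf m \<rho> (Suc N) G m))"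
    by (simp only: map_bind_pmf pmf.map_comp o_def nN)
  also have "\<dots> = bind_pmf (pa_graph m \<rho> N) (\<lambda>G. map_pmf (\<lambda>us. Suc (card (reach_from G us))) (targets_pmf m \<rho> (Suc N) G m))"
  proof (intro bind_pmf_cong[OF refl] map_pmf_cong[OF refl])
    fix G us assume G: "G \<in> set_pmf (pa_graph m \<rho> N)" and us: "us \<in> set_pmf (targets_pmf m \<rho> (Suc N) G m)"
    have inv: "pa_invar m N G" using pa_invar_pa_graph[OF rho, of G n'] G by (simp add: N_def)
    show "num_descendants (add_vertex (Suc N) us G) (Suc N) = Suc (card (reach_from G us))"
      using set_targets_pmf[OF inv N rho us] by (intro num_descendants_add_vertex[OF inv]) auto
  qed
  also have "\<dots> = map_pmf Suc (reached (n - 1) m)"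
    by (simp only: reached_def nN map_bind_pmf pmf.map_comp o_def diff_Suc_1)
  finally show ?thesis .
qed

text \<open>The sequence \<open>\<omega>\<close> lists the numbers of hits: \<open>\<omega> t\<close> belongs to level \<open>n - 1 - t\<close>, and \<open>active \<omega> t\<close> is the
  number of active edges when the exploration arrives at this level.  The exploration starts with the \<open>m\<close>
  edges of \<open>n\<close>.  Keeping the whole sequence, and not only the number of active edges, makes the number
  of levels that are hit a function of the state.\<close>

primrec active :: "(nat \<Rightarrow> nat) \<Rightarrow> nat \<Rightarrow> nat" where
  "active \<omega> 0 = m"
| "active \<omega> (Suc t) = next_active (active \<omega> t) (\<omega> t)"

primrec chain :: "nat \<Rightarrow> nat \<Rightarrow> (nat \<Rightarrow> nat) pmf" where
  "chain n 0 = return_pmf (\<lambda>_. 0)"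
| "chain n (Suc t) = bind_pmf (chain n t) (\<lambda>\<omega>.
     map_pmf (\<lambda>z. fun_upd \<omega> t z) (hits (n - 1 - t) (active \<omega> t)))"

definition num_hit :: "(nat \<Rightarrow> nat) \<Rightarrow> nat \<Rightarrow> nat" where
  "num_hit \<omega> t = (\<Sum>i<t. if \<omega> i = 0 then 0 else 1)"

lemma active_cong: "(\<And>i. i < t \<Longrightarrow> \<omega> i = \<omega>' i) \<Longrightarrow> active \<omega> t = active \<omega>' t"
  by (induction t) auto

lemma num_hit_cong: "(\<And>i. i < t \<Longrightarrow> \<omega> i = \<omega>' i) \<Longrightarrow> num_hit \<omega> t = num_hit \<omega>' t"
  by (simp add: num_hit_def)

lemma reached_chain:
  assumes "t + 3 \<le> n"
  shows "reached (n - 1) m = bind_pmf (chain n t) (\<lambda>\<omega>.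
    map_pmf (\<lambda>d. num_hit \<omega> t + d) (reached (n - 1 - t) (active \<omega> t)))"
  using assms
proof (induction t)
  case 0
  show ?case by (simp add: bind_return_pmf num_hit_def)
next
  case (Suc t)
  have k: "n - 1 - t \<ge> 3" and k1: "n - 1 - t - 1 = n - 1 - Suc t" using Suc.prems by auto
  have "reached (n - 1) m = bind_pmf (chain n t) (\<lambda>\<omega>.
    map_pmf (\<lambda>d. num_hit \<omega> t + d) (reached (n - 1 - t) (active \<omega> t)))" using Suc by simp
  also have "\<dots> = bind_pmf (chain n t) (\<lambda>\<omega>. bind_pmf (hits (n - 1 - t) (active \<omega> t)) (\<lambda>z.
     map_pmf (\<lambda>d. num_hit \<omega> t + ((if z = 0 then 0 else 1) + d)) (reached (n - 1 - Suc t) (next_active (active \<omega> t) z))))"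
    unfolding reached_rec[OF k] k1 by (simp only: map_bind_pmf pmf.map_comp o_def)
  also have "\<dots> = bind_pmf (chain n t) (\<lambda>\<omega>. bind_pmf (hits (n - 1 - t) (active \<omega> t)) (\<lambda>z.
     map_pmf (\<lambda>d. num_hit (fun_upd \<omega> t z) (Suc t) + d) (reached (n - 1 - Suc t) (active (fun_upd \<omega> t z) (Suc t)))))"
  proof (intro bind_pmf_cong[OF refl])
    fix \<omega> :: "nat \<Rightarrow> nat" and z
    have "active (fun_upd \<omega> t z) t = active \<omega> t" by (rule active_cong) simp
    moreover have "num_hit (fun_upd \<omega> t z) t = num_hit \<omega> t" by (rule num_hit_cong) simp
    then have "num_hit (fun_upd \<omega> t z) (Suc t) = num_hit \<omega> t + (if z = 0 then 0 else 1)"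
      by (simp add: num_hit_def)
    ultimately show "map_pmf (\<lambda>d. num_hit \<omega> t + ((if z = 0 then 0 else 1) + d)) (reached (n - 1 - Suc t) (next_active (active \<omega> t) z)) =
      map_pmf (\<lambda>d. num_hit (fun_upd \<omega> t z) (Suc t) + d) (reached (n - 1 - Suc t) (active (fun_upd \<omega> t z) (Suc t)))"
      by (simp add: add.assoc)
  qed
  also have "\<dots> = bind_pmf (chain n (Suc t)) (\<lambda>\<omega>.
    map_pmf (\<lambda>d. num_hit \<omega> (Suc t) + d) (reached (n - 1 - Suc t) (active \<omega> (Suc t))))"
    by (simp add: bind_assoc_pmf bind_map_pmf)
  finally show ?case .
qed

text \<open>When level \<open>2\<close> is reached only the vertices \<open>1\<close> and \<open>2\<close> are left, and \<open>n\<close> itself is a descendant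
  as well; hence the difference of at most \<open>3\<close>.\<close>

lemma descendants_coupling:
  assumes n: "n \<ge> 3"
  obtains K :: "((nat \<Rightarrow> nat) \<times> nat) pmf" where
    "map_pmf fst K = chain n (n - 3)"
    "map_pmf snd K = map_pmf (\<lambda>G. num_descendants G n) (pa_graph m \<rho> n)"
    "\<And>\<omega> x. (\<omega>, x) \<in> set_pmf K \<Longrightarrow> num_hit \<omega> (n - 3) \<le> x \<and> x \<le> num_hit \<omega> (n - 3) + 3"
proof
  define K where "K = bind_pmf (chain n (n - 3)) (\<lambda>\<omega>.
    map_pmf (\<lambda>d. (\<omega>, Suc (num_hit \<omega> (n - 3) + d))) (reached (n - 1 - (n - 3)) (active \<omega> (n - 3))))"
  have le: "n - 3 + 3 \<le> n" using n by simp
  have lev: "n - 1 - (n - 3) = Suc (Suc 0)" using n by simp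
  show "map_pmf fst K = chain n (n - 3)"
    by (simp add: K_def map_bind_pmf pmf.map_comp o_def map_pmf_const bind_return_pmf')
  show "map_pmf snd K = map_pmf (\<lambda>G. num_descendants G n) (pa_graph m \<rho> n)"
    unfolding num_descendants_reached[OF n] reached_chain[of "n - 3" n, OF le]
    by (simp add: K_def map_bind_pmf pmf.map_comp o_def)
  have small: "d \<le> 2" if d: "d \<in> set_pmf (reached (Suc (Suc 0)) y)" for d y
  proof -
    obtain G ts where G: "G \<in> set_pmf (pa_graph m \<rho> (Suc (Suc 0)))" and d: "d = card (reach_from G ts)"
      using d unfolding reached_def by auto
    have "pa_invar m (Suc (Suc 0)) G" by (rule pa_invar_pa_graph[OF rho G])
    then have "verts G = {1..2}" by (simp add: pa_invar_def numeral_2_eq_2)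
    then show ?thesis using card_mono[OF _ reach_from_subset[of G ts]] d by simp
  qed
  fix \<omega> x assume "(\<omega>, x) \<in> set_pmf K"
  then obtain d where "d \<in> set_pmf (reached (Suc (Suc 0)) (active \<omega> (n - 3)))" "x = Suc (num_hit \<omega> (n - 3) + d)"
    unfolding K_def lev by auto
  then show "num_hit \<omega> (n - 3) \<le> x \<and> x \<le> num_hit \<omega> (n - 3) + 3" using small by fastforce
qed

end

section \<open>Expectations along the chain\<close>

lemma integrable_finite_pmf [simp, intro]:
  fixes f :: "'a \<Rightarrow> real" shows "finite (set_pmf p) \<Longrightarrow> integrable (measure_pmf p) f"
  by (rule integrable_measure_pmf_finite)

lemma expectation_bind_finite:
  fixes f :: "'b \<Rightarrow> real"
  assumes p: "finite (set_pmf p)" and q: "\<And>x. x \<in> set_pmf p \<Longrightarrow> finite (set_pmf (q x))"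
  shows "measure_pmf.expectation (bind_pmf p q) f =
    measure_pmf.expectation p (\<lambda>x. measure_pmf.expectation (q x) f)"
proof -
  have "measure_pmf.expectation (bind_pmf p q) f =
     (\<Sum>a\<in>set_pmf p. pmf p a *\<^sub>R measure_pmf.expectation (q a) f)"
    by (rule pmf_expectation_bind) (use p q in auto)
  also have "\<dots> = measure_pmf.expectation p (\<lambda>x. measure_pmf.expectation (q x) f)"
    by (rule integral_measure_pmf[symmetric]) (use p in auto)
  finally show ?thesis .
qed

lemma expectation_abs_le_sqrt:
  fixes f :: "'a \<Rightarrow> real"
  assumes "finite (set_pmf p)"
  shows "measure_pmf.expectation p (\<lambda>x. \<bar>f x\<bar>) \<le> sqrt (measure_pmf.expectation p (\<lambda>x. (f x)\<^sup>2))"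
proof -
  have "0 \<le> measure_pmf.variance p (\<lambda>x. \<bar>f x\<bar>)" by (rule measure_pmf.variance_positive)
  also have "\<dots> = measure_pmf.expectation p (\<lambda>x. (f x)\<^sup>2) - (measure_pmf.expectation p (\<lambda>x. \<bar>f x\<bar>))\<^sup>2"
    using assms by (subst measure_pmf.variance_eq) auto
  finally show ?thesis by (intro real_le_rsqrt) simp
qed

lemma expectation_mono_finite:
  fixes f g :: "'a \<Rightarrow> real"
  assumes "finite (set_pmf p)" "\<And>x. x \<in> set_pmf p \<Longrightarrow> f x \<le> g x"
  shows "measure_pmf.expectation p f \<le> measure_pmf.expectation p g"
  using assms by (intro integral_mono_AE) (auto simp: AE_measure_pmf_iff)

lemma expectation_cong:
  fixes f g :: "'a \<Rightarrow> real"
  assumes "\<And>x. x \<in> set_pmf p \<Longrightarrow> f x = g x"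
  shows "measure_pmf.expectation p f = measure_pmf.expectation p g"
  using assms by (intro integral_cong_AE) (auto simp: AE_measure_pmf_iff)

context pref_attach begin

lemma finite_chain [simp]: "finite (set_pmf (chain n t))"
  by (induction t) auto

lemma chain_expectation_Suc:
  fixes f :: "(nat \<Rightarrow> nat) \<Rightarrow> real"
  shows "measure_pmf.expectation (chain n (Suc t)) f = measure_pmf.expectation (chain n t)
    (\<lambda>\<omega>. measure_pmf.expectation (hits (n - 1 - t) (active \<omega> t)) (\<lambda>z. f (fun_upd \<omega> t z)))"
  by (simp add: expectation_bind_finite)

text \<open>The future of the exploration does not influence the law of its past.\<close>

lemma chain_expectation_prefix:
  fixes f :: "(nat \<Rightarrow> nat) \<Rightarrow> real"
  assumes "t \<le> T" and f: "\<And>\<omega> \<omega>'. (\<And>i. i < t \<Longrightarrow> \<omega> i = \<omega>' i) \<Longrightarrow> f \<omega> = f \<omega>'"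
  shows "measure_pmf.expectation (chain n T) f = measure_pmf.expectation (chain n t) f"
  using assms(1)
proof (induction T rule: dec_induct)
  case (step T)
  have "f (fun_upd \<omega> T z) = f \<omega>" for \<omega> z by (rule f) (use step in auto)
  then show ?case using step by (simp only: chain_expectation_Suc) simp
qed simp

text \<open>Mean of a function of the number of active edges when the exploration has reached level \<open>k\<close>.\<close>

definition mean_at :: "nat \<Rightarrow> nat \<Rightarrow> (nat \<Rightarrow> real) \<Rightarrow> real" where
  "mean_at n k f = measure_pmf.expectation (chain n (n - 1 - k)) (\<lambda>\<omega>. f (active \<omega> (n - 1 - k)))"

definition step_mean :: "nat \<Rightarrow> nat \<Rightarrow> (nat \<Rightarrow> real) \<Rightarrow> real" where
  "step_mean k y f = measure_pmf.expectation (hits k y) f"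

lemma mean_at_top: "mean_at n (n - 1) f = f m"
  by (simp add: mean_at_def)

lemma mean_at_step:
  assumes "k \<ge> 1" "k < n"
  shows "mean_at n (k - 1) f = mean_at n k (\<lambda>y. step_mean k y (\<lambda>z. f (next_active y z)))"
proof -
  have t: "n - 1 - (k - 1) = Suc (n - 1 - k)" "n - 1 - (n - 1 - k) = k" using assms by auto
  have "active (fun_upd \<omega> i z) i = active \<omega> i" for \<omega> i z by (rule active_cong) simp
  then show ?thesis
    unfolding mean_at_def t chain_expectation_Suc by (simp add: t step_mean_def)
qed

lemma mean_at_mono: "(\<And>y. f y \<le> g y) \<Longrightarrow> mean_at n k f \<le> mean_at n k g"
  unfolding mean_at_def by (intro expectation_mono_finite) auto

lemma mean_at_add: "mean_at n k (\<lambda>y. f y + g y) = mean_at n k f + mean_at n k g"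
  and mean_at_diff: "mean_at n k (\<lambda>y. f y - g y) = mean_at n k f - mean_at n k g"
  and mean_at_cmult: "mean_at n k (\<lambda>y. c * f y) = c * mean_at n k f"
  and mean_at_const: "mean_at n k (\<lambda>y. c) = c"
  by (simp_all add: mean_at_def)

lemma mean_at_nonneg: "(\<And>y. f y \<ge> 0) \<Longrightarrow> mean_at n k f \<ge> 0"
  unfolding mean_at_def by (rule Bochner_Integration.integral_nonneg) simp

lemma mean_at_abs: "\<bar>mean_at n k f\<bar> \<le> mean_at n k (\<lambda>y. \<bar>f y\<bar>)"
  unfolding mean_at_def by (rule integral_abs_bound)

lemma step_mean_mono: "(\<And>z. z \<le> y \<Longrightarrow> f z \<le> g z) \<Longrightarrow> step_mean k y f \<le> step_mean k y g"
  unfolding step_mean_def by (intro expectation_mono_finite) (auto dest: hits_le)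

lemma step_mean_cong: "(\<And>z. z \<le> y \<Longrightarrow> f z = g z) \<Longrightarrow> step_mean k y f = step_mean k y g"
  unfolding step_mean_def by (intro expectation_cong) (auto dest: hits_le)

lemma step_mean_add: "step_mean k y (\<lambda>z. f z + g z) = step_mean k y f + step_mean k y g"
  and step_mean_diff: "step_mean k y (\<lambda>z. f z - g z) = step_mean k y f - step_mean k y g"
  and step_mean_cmult: "step_mean k y (\<lambda>z. c * f z) = c * step_mean k y f"
  and step_mean_const: "step_mean k y (\<lambda>z. c) = c"
  by (simp_all add: step_mean_def)

lemma step_mean_abs: "\<bar>step_mean k y f\<bar> \<le> step_mean k y (\<lambda>z. \<bar>f z\<bar>)"
  unfolding step_mean_def by (rule integral_abs_bound)

section \<open>Moments of the urn\<close>

lemma step_mean_0: "step_mean k 0 f = f 0"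
  by (simp add: step_mean_def)

text \<open>Conditioning on the first \<open>y\<close> edges: the next one hits with the urn probability.  All moments of the urn
  below are obtained from this recursion.\<close>

lemma step_mean_Suc:
  assumes k: "k \<ge> 3"
  shows "step_mean k (Suc y) f = step_mean k y (\<lambda>z.
    ((\<theta> + real z) * f (Suc z) + (A k - \<theta> + real y - real z) * f z) / (A k + real y))"
proof -
  have Ay: "A k + real y > 0" using A_pos[of k] k by simp
  have "step_mean k (Suc y) f = step_mean k y (\<lambda>z.
     measure_pmf.expectation (bernoulli_pmf ((\<theta> + real z) / (A k + real y))) (\<lambda>c. f (if c then Suc z else z)))"
    unfolding step_mean_def by (simp add: expectation_bind_finite)
  also have "\<dots> = step_mean k y (\<lambda>z.
    ((\<theta> + real z) * f (Suc z) + (A k - \<theta> + real y - real z) * f z) / (A k + real y))"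
  proof (rule step_mean_cong)
    fix z assume "z \<le> y"
    note p = hit_prob_le_1[OF k this]
    have "1 - (\<theta> + real z) / (A k + real y) = (A k - \<theta> + real y - real z) / (A k + real y)"
      using Ay by (simp add: field_simps)
    then show "measure_pmf.expectation (bernoulli_pmf ((\<theta> + real z) / (A k + real y))) (\<lambda>c. f (if c then Suc z else z))
       = ((\<theta> + real z) * f (Suc z) + (A k - \<theta> + real y - real z) * f z) / (A k + real y)"
      using p by (simp add: mult.commute flip: add_divide_distrib)
  qed
  finally show ?thesis .
qed

lemma step_mean_hits:
  assumes k: "k \<ge> 3"
  shows "step_mean k y real = real y * \<theta> / A k"
proof (induction y)
  case 0 show ?case by (simp add: step_mean_0)
next
  case (Suc y)
  have Ay: "A k + real y > 0" and A: "A k > 0" using A_pos[of k] k by simp_all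
  have "step_mean k (Suc y) real = step_mean k y (\<lambda>z. \<theta> / (A k + real y) + (A k + real y + 1) / (A k + real y) * real z)"
    unfolding step_mean_Suc[OF k] by (rule step_mean_cong) (simp add: algebra_simps flip: add_divide_distrib)
  also have "\<dots> = \<theta> / (A k + real y) + (A k + real y + 1) / (A k + real y) * (real y * \<theta> / A k)"
    by (simp only: step_mean_add step_mean_cmult step_mean_const Suc.IH)
  also have "\<dots> = real (Suc y) * \<theta> / A k" using Ay A
    by (simp add: divide_simps) (simp add: algebra_simps)
  finally show ?case .
qed

text \<open>The second factorial moment shows that two hits at one level have probability of order \<open>(y / k)\<^sup>2\<close>.\<close>

lemma step_mean_hits2:
  assumes k: "k \<ge> 3"
  shows "step_mean k y (\<lambda>z. real z * (real z - 1)) =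
    real y * (real y - 1) * (\<theta> * (\<theta> + 1)) / (A k * (A k + 1))"
proof (induction y)
  case 0 show ?case by (simp add: step_mean_0)
next
  case (Suc y)
  have Ay: "A k + real y > 0" and A: "A k > 0" "A k + 1 > 0" using A_pos[of k] k by simp_all
  have "step_mean k (Suc y) (\<lambda>z. real z * (real z - 1)) = step_mean k y (\<lambda>z.
    2 * (\<theta> + 1) / (A k + real y) * real z + (A k + real y + 2) / (A k + real y) * (real z * (real z - 1)))"
    unfolding step_mean_Suc[OF k]
    by (rule step_mean_cong) (use Ay in \<open>simp add: divide_simps\<close>, simp add: algebra_simps)
  also have "\<dots> = 2 * (\<theta> + 1) / (A k + real y) * (real y * \<theta> / A k) + (A k + real y + 2) / (A k + real y) *
     (real y * (real y - 1) * (\<theta> * (\<theta> + 1)) / (A k * (A k + 1)))"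
    by (simp only: step_mean_add step_mean_cmult step_mean_const Suc.IH step_mean_hits[OF k])
  also have "\<dots> = real (Suc y) * (real (Suc y) - 1) * (\<theta> * (\<theta> + 1)) / (A k * (A k + 1))"
    using Ay A by (simp add: divide_simps) (simp add: algebra_simps)
  finally show ?case .
qed

lemma b_pos: assumes "k \<ge> 3" shows "b k > real m"
proof -
  obtain j where k: "k = Suc j" "j \<ge> 2" using assms by (cases k) auto
  then show ?thesis using A_pos[of j] by (simp add: k b_Suc)
qed

lemma A_eq_b: "A k = b k + \<theta>" by (simp add: b_def)

definition miss :: "nat \<Rightarrow> nat \<Rightarrow> real" where
  "miss k y = step_mean k y (\<lambda>z. if z = 0 then 1 else 0)"

lemma miss_eq:
  assumes k: "k \<ge> 3"
  shows "miss k y = pochhammer (b k) y / pochhammer (A k) y"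
proof (induction y)
  case 0 show ?case by (simp add: step_mean_0 miss_def)
next
  case (Suc y)
  have "miss k (Suc y) = step_mean k y (\<lambda>z. (b k + real y) / (A k + real y) * (if z = 0 then 1 else 0))"
    unfolding miss_def step_mean_Suc[OF k] by (rule step_mean_cong) (simp add: b_def)
  also have "\<dots> = (b k + real y) / (A k + real y) * miss k y"
    by (simp only: step_mean_cmult miss_def)
  finally show ?case by (simp add: Suc.IH pochhammer_Suc mult.commute)
qed

text \<open>
  The eigenfunction behind the conserved quantity of the late phase.  When an edge is added, the
  function of the number \<open>y - z\<close> of missing edges either keeps its value, with weight \<open>\<theta> + z\<close>, or gains
  the factor \<open>(b k + s + y - z) / (b k + y - z)\<close>, with weight \<open>b k + y - z\<close>; the sum of the two
  does not involve \<open>z\<close> except through the old value of the function.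
\<close>

lemma step_mean_pochhammer:
  assumes k: "k \<ge> 3"
  shows "step_mean k y (\<lambda>z. pochhammer (b k + s) (y - z) / pochhammer (b k) (y - z)) =
    pochhammer (A k + s) y / pochhammer (A k) y"
proof (induction y)
  case 0 show ?case by (simp add: step_mean_0)
next
  case (Suc y)
  have Ay: "A k + real y > 0" using A_pos[of k] k by simp
  have "step_mean k (Suc y) (\<lambda>z. pochhammer (b k + s) (Suc y - z) / pochhammer (b k) (Suc y - z)) =
    step_mean k y (\<lambda>z. (A k + s + real y) / (A k + real y) *
       (pochhammer (b k + s) (y - z) / pochhammer (b k) (y - z)))"
    unfolding step_mean_Suc[OF k]
  proof (rule step_mean_cong)
    fix z assume z: "z \<le> y"
    define N where "N = y - z"
    have yN: "y = N + z" using z by (simp add: N_def)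
    have bN: "b k + real N > 0" using b_pos[OF k] by simp
    have pb: "pochhammer (b k) N > 0" using b_pos[OF k] by (intro pochhammer_pos) simp
    define T where "T = pochhammer (b k + s) N / pochhammer (b k) N"
    have T: "pochhammer (b k + s) (Suc N) / pochhammer (b k) (Suc N) = T * ((b k + s + real N) / (b k + real N))"
      by (simp add: pochhammer_Suc T_def)
    have w: "A k - \<theta> + real y - real z = b k + real N" by (simp add: b_def yN)
    have sub: "Suc y - z = Suc N" "Suc y - Suc z = N" using z by (auto simp: N_def)
    have alg: "((\<theta> + real z) * T + (b k + real N) * (T * ((b k + s + real N) / (b k + real N)))) / (A k + real y) =
       (A k + s + real y) / (A k + real y) * T"
    proof -
      have "(b k + real N) * (T * ((b k + s + real N) / (b k + real N))) = T * (b k + s + real N)"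
        using bN by simp
      moreover have "(\<theta> + real z) * T + T * (b k + s + real N) = (A k + s + real y) * T"
        by (simp add: A_eq_b yN algebra_simps)
      ultimately show ?thesis by simp
    qed
    show "((\<theta> + real z) * (pochhammer (b k + s) (Suc y - Suc z) / pochhammer (b k) (Suc y - Suc z)) +
          (A k - \<theta> + real y - real z) * (pochhammer (b k + s) (Suc y - z) / pochhammer (b k) (Suc y - z))) / (A k + real y)
       = (A k + s + real y) / (A k + real y) * (pochhammer (b k + s) (y - z) / pochhammer (b k) (y - z))"
      unfolding sub T w N_def[symmetric] T_def[symmetric] by (rule alg)
  qed
  also have "\<dots> = (A k + s + real y) / (A k + real y) * (pochhammer (A k + s) y / pochhammer (A k) y)"
    by (simp only: step_mean_cmult Suc.IH)
  finally show ?case by (simp add: pochhammer_Suc mult.commute)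
qed

section \<open>Square-integrable martingales along the chain\<close>

text \<open>The increments have mean zero given the past, so the cross terms in the square of the sum vanish.\<close>

lemma chain_martingale_L2:
  fixes \<psi> :: "nat \<Rightarrow> nat \<Rightarrow> nat \<Rightarrow> real"
  assumes T: "t1 \<le> T" and t: "t0 \<le> t1"
    and zero: "\<And>i y. t0 \<le> i \<Longrightarrow> i < t1 \<Longrightarrow> step_mean (n - 1 - i) y (\<psi> i y) = 0"
  shows "measure_pmf.expectation (chain n T) (\<lambda>\<omega>. (\<Sum>i\<in>{t0..<t1}. \<psi> i (active \<omega> i) (\<omega> i))\<^sup>2) =
    (\<Sum>i\<in>{t0..<t1}. measure_pmf.expectation (chain n i)
        (\<lambda>\<omega>. step_mean (n - 1 - i) (active \<omega> i) (\<lambda>z. (\<psi> i (active \<omega> i) z)\<^sup>2)))"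
    (is "?E T t1 = ?R t1")
proof -
  have pre: "?E T t = ?E t t" if "t \<le> T" for t T
    by (rule chain_expectation_prefix[OF that])
       (auto intro!: arg_cong2[where f = power] sum.cong arg_cong2[where f = "\<psi> _"] active_cong)
  have "?E t1 t1 = ?R t1" using t zero
  proof (induction t1 rule: dec_induct)
    case base show ?case by simp
  next
    case (step t)
    define S where "S = (\<lambda>\<omega>. \<Sum>i\<in>{t0..<t}. \<psi> i (active \<omega> i) (\<omega> i))"
    have upd: "active (fun_upd \<omega> t z) i = active \<omega> i" if "i \<le> t" for \<omega> z i
      by (rule active_cong) (use that in auto)
    have S: "S (fun_upd \<omega> t z) = S \<omega>" for \<omega> z
      unfolding S_def using upd by (intro sum.cong refl) auto
    have "?E (Suc t) (Suc t) = measure_pmf.expectation (chain n (Suc t)) (\<lambda>\<omega>. (S \<omega> + \<psi> t (active \<omega> t) (\<omega> t))\<^sup>2)"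
      using step by (simp add: S_def)
    also have "\<dots> = measure_pmf.expectation (chain n t) (\<lambda>\<omega>. step_mean (n - 1 - t) (active \<omega> t)
       (\<lambda>z. (S \<omega> + \<psi> t (active \<omega> t) z)\<^sup>2))"
      by (simp only: chain_expectation_Suc S upd order_refl fun_upd_same step_mean_def)
    also have "\<dots> = measure_pmf.expectation (chain n t) (\<lambda>\<omega>. (S \<omega>)\<^sup>2 + step_mean (n - 1 - t) (active \<omega> t)
       (\<lambda>z. (\<psi> t (active \<omega> t) z)\<^sup>2))"
    proof (rule expectation_cong)
      fix \<omega>
      have "step_mean (n - 1 - t) (active \<omega> t) (\<lambda>z. (S \<omega> + \<psi> t (active \<omega> t) z)\<^sup>2) =
        step_mean (n - 1 - t) (active \<omega> t) (\<lambda>z. (S \<omega>)\<^sup>2 + ((2 * S \<omega>) * \<psi> t (active \<omega> t) z + (\<psi> t (active \<omega> t) z)\<^sup>2))"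
        by (rule step_mean_cong) (simp add: power2_sum algebra_simps)
      also have "\<dots> = (S \<omega>)\<^sup>2 + step_mean (n - 1 - t) (active \<omega> t) (\<lambda>z. (\<psi> t (active \<omega> t) z)\<^sup>2)"
        by (simp only: step_mean_add step_mean_cmult step_mean_const) (use step in simp)
      finally show "step_mean (n - 1 - t) (active \<omega> t) (\<lambda>z. (S \<omega> + \<psi> t (active \<omega> t) z)\<^sup>2) =
        (S \<omega>)\<^sup>2 + step_mean (n - 1 - t) (active \<omega> t) (\<lambda>z. (\<psi> t (active \<omega> t) z)\<^sup>2)" .
    qed
    also have "\<dots> = ?E t t + measure_pmf.expectation (chain n t) (\<lambda>\<omega>. step_mean (n - 1 - t) (active \<omega> t)
       (\<lambda>z. (\<psi> t (active \<omega> t) z)\<^sup>2))"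
      by (simp add: S_def)
    finally show ?case using step by simp
  qed
  then show ?thesis using pre[OF T] by simp
qed

end

section \<open>Growth of the normalising products\<close>

text \<open>The quotient of Euler's limit formulas for the Gamma function at the two arguments.\<close>

lemma pochhammer_ratio_asymp:
  fixes u v :: real
  assumes "u > 0" "v > 0"
  shows "(\<lambda>N. pochhammer u N / pochhammer v N / real N powr (u - v)) \<longlonglongrightarrow> Gamma v / Gamma u"
proof -
  have "(\<lambda>N. Gamma_series' v N / Gamma_series' u N) \<longlonglongrightarrow> Gamma v / Gamma u"
    using Gamma_real_pos[OF assms(1)] by (intro tendsto_divide Gamma_series'_LIMSEQ) linarith
  then show ?thesis
  proof (rule Lim_transform_eventually)
    show "eventually (\<lambda>N. Gamma_series' v N / Gamma_series' u N =
        pochhammer u N / pochhammer v N / real N powr (u - v)) sequentially"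
      using eventually_gt_at_top[of 0]
    proof eventually_elim
      case (elim N)
      have "exp (v * ln (real N)) / exp (u * ln (real N)) = 1 / real N powr (u - v)"
        using elim by (simp add: powr_def algebra_simps flip: exp_diff) (simp add: exp_diff exp_minus field_simps)
      then show ?case
        by (simp add: Gamma_series'_def field_simps)
    qed
  qed
qed

lemma tendsto_pos_bounds:
  fixes f :: "nat \<Rightarrow> real"
  assumes lim: "f \<longlonglongrightarrow> c" and c: "c > 0" and pos: "\<And>k. k \<ge> a \<Longrightarrow> f k > 0"
  obtains l u where "l > 0" "u > 0" "\<And>k. k \<ge> a \<Longrightarrow> l \<le> f k \<and> f k \<le> u"
proof -
  obtain u where u: "u > 0" "\<And>k. norm (f k) \<le> u"
    using convergent_imp_Bseq[OF convergentI[OF lim]] by (auto elim: BseqE)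
  have "(\<lambda>k. inverse (f k)) \<longlonglongrightarrow> inverse c" using lim c by (intro tendsto_inverse) auto
  then obtain l where l: "l > 0" "\<And>k. norm (inverse (f k)) \<le> l"
    using convergent_imp_Bseq[OF convergentI, of "\<lambda>k. inverse (f k)"] by (metis BseqE)
  show ?thesis
  proof (rule that[of "inverse l" u])
    fix k assume k: "k \<ge> a"
    have "inverse (f k) \<le> l" using l(2)[of k] pos[OF k] by simp
    then have "inverse l \<le> f k" using pos[OF k] l(1)
      by (metis inverse_inverse_eq le_imp_inverse_le positive_imp_inverse_positive)
    then show "inverse l \<le> f k \<and> f k \<le> u" using u(2)[of k] by simp
  qed (use l u in auto)
qed

context pref_attach begin

definition \<alpha> :: real where "\<alpha> = (real m - 1) * \<theta> / L"
definition s :: real where "s = \<theta> + 1"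
definition \<gamma> :: real where "\<gamma> = real m * s / L"
definition \<nu> :: real where "\<nu> = \<alpha> / \<gamma>"

lemma s_gt_1: "s > 1" using theta_pos by (simp add: s_def)
lemma s_pos: "s > 0" using s_gt_1 by simp
lemma alpha_pos: "\<alpha> > 0" using theta_pos L_pos m2 by (simp add: \<alpha>_def)
lemma gamma_eq: "\<gamma> = 1 + \<alpha>"
  using L_pos by (simp add: \<gamma>_def \<alpha>_def s_def field_simps) (simp add: L_eq)
lemma nu_bounds: "0 < \<nu>" "\<nu> < 1"
  using alpha_pos by (auto simp: \<nu>_def gamma_eq)
lemma nu_gamma: "\<nu> * \<gamma> = \<alpha>" using alpha_pos by (simp add: \<nu>_def gamma_eq)
lemma one_minus_nu: "1 - \<nu> = 1 / \<gamma>" using alpha_pos by (simp add: \<nu>_def gamma_eq field_simps)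
lemma alpha_one_minus_nu: "\<alpha> * (1 - \<nu>) = \<nu>" by (simp only: one_minus_nu) (simp add: \<nu>_def)

text \<open>All normalising sequences are products of this shape, and hence ratios of rising factorials, which are
  of order \<open>k powr (a / L)\<close>.  The product starts at \<open>3\<close>, the lowest level at which the urn is used.\<close>

definition growth :: "real \<Rightarrow> real \<Rightarrow> nat \<Rightarrow> real" where
  "growth a e k = (\<Prod>j\<in>{3..k}. 1 + a / (L * real j + e))"

lemma growth_Suc: "k \<ge> 2 \<Longrightarrow> growth a e (Suc k) = growth a e k * (1 + a / (L * real (Suc k) + e))"
  by (simp add: growth_def atLeastAtMostSuc_conv mult.commute)

lemma growth_pos:
  assumes "a \<ge> 0" "3 * L + e > 0" shows "growth a e k > 0"
  unfolding growth_def
proof (rule prod_pos)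
  fix j assume "j \<in> {3..k}"
  then have "3 * L \<le> L * real j" using L_pos by (simp add: mult.commute)
  then have "L * real j + e > 0" using assms by linarith
  then show "0 < 1 + a / (L * real j + e)" using assms by (simp add: add_pos_nonneg)
qed

lemma growth_asymp:
  assumes a: "a \<ge> 0" and e: "3 * L + e > 0"
  obtains c where "c > 0" "(\<lambda>k. growth a e k / real k powr (a / L)) \<longlonglongrightarrow> c"
proof -
  define v where "v = 3 + e / L"
  define u where "u = v + a / L"
  have v: "v > 0" using e L_pos by (simp add: v_def field_simps)
  have u: "u > 0" using v a L_pos by (simp add: u_def add_pos_nonneg)
  have G: "growth a e (N + 2) = pochhammer u N / pochhammer v N" for N
  proof (induction N)
    case 0 show ?case by (simp add: growth_def)
  next
    case (Suc N)
    have "L * real (Suc (N + 2)) + e = L * (v + real N)" using L_pos by (simp add: v_def field_simps)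
    moreover have "1 + a / (L * (v + real N)) = (u + real N) / (v + real N)"
      using v L_pos by (simp add: u_def divide_simps) (simp add: algebra_simps)
    ultimately show ?case using growth_Suc[of "N + 2" a e] Suc.IH by (simp add: pochhammer_Suc)
  qed
  have "(\<lambda>N. growth a e (N + 2) / real N powr (a / L)) \<longlonglongrightarrow> Gamma v / Gamma u"
    using pochhammer_ratio_asymp[OF u v] by (simp only: G) (simp add: u_def)
  moreover have "(\<lambda>N. real N powr (a / L) / real (N + 2) powr (a / L)) \<longlonglongrightarrow> 1"
    by real_asymp
  ultimately have lim: "(\<lambda>N. growth a e (N + 2) / real N powr (a / L) * (real N powr (a / L) / real (N + 2) powr (a / L)))
      \<longlonglongrightarrow> Gamma v / Gamma u * 1" by (rule tendsto_mult)
  have "(\<lambda>N. growth a e (N + 2) / real (N + 2) powr (a / L)) \<longlonglongrightarrow> Gamma v / Gamma u"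
    using lim[unfolded mult_1_right] by (rule Lim_transform_eventually)
       (rule eventually_mono[OF eventually_gt_at_top[of 0]], simp)
  then have "(\<lambda>k. growth a e k / real k powr (a / L)) \<longlonglongrightarrow> Gamma v / Gamma u"
    by (rule LIMSEQ_offset)
  moreover have "Gamma v / Gamma u > 0" using u v by (simp add: Gamma_real_pos)
  ultimately show ?thesis using that by blast
qed

lemma growth_bounds:
  assumes a: "a \<ge> 0" and e: "3 * L + e > 0"
  obtains l u where "l > 0" "u > 0"
    "\<And>k. k \<ge> 2 \<Longrightarrow> l * real k powr (a / L) \<le> growth a e k \<and> growth a e k \<le> u * real k powr (a / L)"
proof -
  obtain c where c: "c > 0" "(\<lambda>k. growth a e k / real k powr (a / L)) \<longlonglongrightarrow> c"
    using growth_asymp[OF assms] by blast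
  have pos: "growth a e k / real k powr (a / L) > 0" if "k \<ge> 2" for k
    using growth_pos[OF assms] that by simp
  obtain l u where lu: "l > 0" "u > 0"
    "\<And>k. k \<ge> 2 \<Longrightarrow> l \<le> growth a e k / real k powr (a / L) \<and> growth a e k / real k powr (a / L) \<le> u"
    by (rule tendsto_pos_bounds[OF c(2,1) pos]) auto
  show ?thesis
  proof (rule that[OF lu(1,2)])
    fix k :: nat assume k: "k \<ge> 2"
    then have "real k powr (a / L) > 0" by simp
    then show "l * real k powr (a / L) \<le> growth a e k \<and> growth a e k \<le> u * real k powr (a / L)"
      using lu(3)[OF k] by (simp add: field_simps)
  qed
qed

section \<open>Moments of the number of active edges\<close>

text \<open>A rising factorial instead of a power makes the growth of the moments exact at the level of single
  hits, see the identity for \<open>x * \<Delta>\<close> in \<open>step_mean_phi\<close>.\<close>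

definition \<phi> :: "nat \<Rightarrow> nat \<Rightarrow> real" where
  "\<phi> r y = pochhammer (real y / (real m - 1)) r"

lemma pochhammer_mono_real: "0 \<le> (x::real) \<Longrightarrow> x \<le> y \<Longrightarrow> pochhammer x r \<le> pochhammer y r"
  unfolding pochhammer_prod by (intro prod_mono) auto

lemma pochhammer_nonneg_real: "0 \<le> (x::real) \<Longrightarrow> 0 \<le> pochhammer x r"
  unfolding pochhammer_prod by (intro prod_nonneg) auto

lemma power_le_pochhammer: "0 \<le> (x::real) \<Longrightarrow> x ^ r \<le> pochhammer x r"
proof (induction r)
  case (Suc r)
  then show ?case using mult_mono[of "x ^ r" "pochhammer x r" x "x + real r"]
    by (simp add: pochhammer_Suc mult.commute pochhammer_nonneg_real)
qed simp

text \<open>In units of \<open>m - 1\<close> edges, a level that is hit adds at most \<open>1\<close>.  A forward difference of a rising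
  factorial satisfies \<open>x * \<Delta> = r * pochhammer x r\<close>, so the mean increase is at most
  \<open>r (m - 1) \<theta> / A k\<close> times the old value.\<close>

lemma step_mean_phi:
  assumes k: "k \<ge> 3"
  shows "step_mean k y (\<lambda>z. \<phi> r (next_active y z)) \<le> (1 + real r * (real m - 1) * \<theta> / A k) * \<phi> r y"
proof -
  define M where "M = real m - 1"
  have M: "M > 0" using m2 by (simp add: M_def)
  have Ak: "A k > 0" using A_pos k by simp
  define x where "x = real y / M"
  have x: "x \<ge> 0" using M by (simp add: x_def)
  define \<Delta> where "\<Delta> = pochhammer (x + 1) r - pochhammer x r"
  have D: "\<Delta> \<ge> 0" using x by (simp add: \<Delta>_def pochhammer_mono_real)
  have xD: "x * \<Delta> = real r * pochhammer x r"
  proof -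
    have "x * pochhammer (x + 1) r = pochhammer x r * (x + real r)"
      using pochhammer_rec[of x r] pochhammer_Suc[of x r] by simp
    then show ?thesis by (simp add: \<Delta>_def algebra_simps)
  qed
  have "step_mean k y (\<lambda>z. \<phi> r (next_active y z)) \<le> step_mean k y (\<lambda>z. \<phi> r y + \<Delta> * real z)"
  proof (rule step_mean_mono)
    fix z assume z: "z \<le> y"
    show "\<phi> r (next_active y z) \<le> \<phi> r y + \<Delta> * real z"
    proof (cases "z = 0")
      case True then show ?thesis by (simp add: next_active_def)
    next
      case False
      have "real (next_active y z) \<le> real y + M" using False z by (simp add: next_active_def M_def)
      then have "real (next_active y z) / M \<le> x + 1" using M by (simp add: x_def field_simps)
      then have "\<phi> r (next_active y z) \<le> pochhammer (x + 1) r"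
        unfolding \<phi>_def M_def[symmetric] using M by (intro pochhammer_mono_real) auto
      also have "\<dots> = \<phi> r y + \<Delta> * 1" by (simp add: \<Delta>_def \<phi>_def x_def M_def)
      also have "\<dots> \<le> \<phi> r y + \<Delta> * real z" using D False by (intro add_left_mono mult_left_mono) auto
      finally show ?thesis .
    qed
  qed
  also have "\<dots> = \<phi> r y + \<Delta> * (real y * \<theta> / A k)"
    by (simp only: step_mean_add step_mean_cmult step_mean_const step_mean_hits[OF k])
  also have "\<Delta> * (real y * \<theta> / A k) = M * \<theta> / A k * (x * \<Delta>)"
    using M by (simp add: x_def)
  also have "\<dots> = real r * M * \<theta> / A k * \<phi> r y"
    unfolding xD by (simp add: \<phi>_def x_def M_def)
  finally show ?thesis by (simp add: M_def algebra_simps)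
qed

definition moment_growth :: "nat \<Rightarrow> nat \<Rightarrow> real" where
  "moment_growth r = growth (real r * (real m - 1) * \<theta>) (- 2 * real m)"

lemma moment_growth_Suc:
  "k \<ge> 2 \<Longrightarrow> moment_growth r (Suc k) = moment_growth r k * (1 + real r * (real m - 1) * \<theta> / A (Suc k))"
  by (simp add: moment_growth_def growth_Suc A_def)

lemma moment_growth_conds: "3 * L + (- 2 * real m) > 0" "real r * (real m - 1) * \<theta> \<ge> 0"
  using theta_pos m2 L_eq by auto

lemma moment_growth_pos: "moment_growth r k > 0"
  unfolding moment_growth_def by (rule growth_pos[OF moment_growth_conds(2,1)])

lemma growth_exponent: "real r * (real m - 1) * \<theta> / L = real r * \<alpha>"
  by (simp add: \<alpha>_def)

lemma mean_at_phi:
  assumes "2 \<le> k" "k \<le> n - 1"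
  shows "mean_at n k (\<phi> r) \<le> \<phi> r m * (moment_growth r (n - 1) / moment_growth r k)"
  using assms(2)
proof (induction k rule: inc_induct)
  case base
  have "moment_growth r (n - 1) \<noteq> 0" using moment_growth_pos[of r "n - 1"] by simp
  then show ?case by (simp only: mean_at_top divide_self) simp
next
  case (step k)
  have k: "Suc k \<ge> 3" "k \<ge> 2" using step assms(1) by auto
  have A: "A (Suc k) > 0" using A_pos k by simp
  let ?f = "1 + real r * (real m - 1) * \<theta> / A (Suc k)"
  have f: "?f > 0" using A theta_pos m2 by (intro add_pos_nonneg) auto
  have "mean_at n k (\<phi> r) = mean_at n (Suc k) (\<lambda>y. step_mean (Suc k) y (\<lambda>z. \<phi> r (next_active y z)))"
    using mean_at_step[of "Suc k" n] step by simp
  also have "\<dots> \<le> mean_at n (Suc k) (\<lambda>y. ?f * \<phi> r y)"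
    by (intro mean_at_mono step_mean_phi k)
  also have "\<dots> = ?f * mean_at n (Suc k) (\<phi> r)" by (rule mean_at_cmult)
  also have "\<dots> \<le> ?f * (\<phi> r m * (moment_growth r (n - 1) / moment_growth r (Suc k)))"
    using f by (intro mult_left_mono step.IH) simp
  also have "\<dots> = \<phi> r m * (moment_growth r (n - 1) / moment_growth r k)"
    using moment_growth_pos[of r k] f unfolding moment_growth_Suc[OF k(2)] by simp
  finally show ?case .
qed

text \<open>Iterating \<open>step_mean_phi\<close> from level \<open>n - 1\<close> down to \<open>k\<close>: the \<open>r\<close>-th moment of the number of active
  edges is of order \<open>(n / k) powr (r \<alpha>)\<close>, as for a Yule process.\<close>

lemma moment_bound:
  obtains C where "C > 0" "\<And>n k. 2 \<le> k \<Longrightarrow> k < n \<Longrightarrow>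
    mean_at n k (\<lambda>y. real y ^ r) \<le> C * (real n / real k) powr (real r * \<alpha>)"
proof -
  obtain l u where lu: "l > 0" "u > 0" "\<And>k. k \<ge> 2 \<Longrightarrow> l * real k powr (real r * \<alpha>) \<le> moment_growth r k \<and>
      moment_growth r k \<le> u * real k powr (real r * \<alpha>)"
    using growth_bounds[OF moment_growth_conds(2,1), of r] unfolding growth_exponent moment_growth_def by metis
  define M where "M = real m - 1"
  have M: "M > 0" using m2 by (simp add: M_def)
  have ph: "\<phi> r m > 0" unfolding \<phi>_def using m2 by (intro pochhammer_pos) simp
  define C where "C = M ^ r * (\<phi> r m * (u / l))"
  have "mean_at n k (\<lambda>y. real y ^ r) \<le> C * (real n / real k) powr (real r * \<alpha>)"
    if k: "2 \<le> k" "k < n" for n k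
  proof -
    have kr: "real k powr (real r * \<alpha>) > 0" using k by simp
    have "mean_at n k (\<lambda>y. real y ^ r) \<le> mean_at n k (\<lambda>y. M ^ r * \<phi> r y)"
    proof (rule mean_at_mono)
      fix y
      have "real y ^ r = M ^ r * (real y / M) ^ r" using M by (simp add: power_divide)
      also have "\<dots> \<le> M ^ r * \<phi> r y"
        unfolding \<phi>_def M_def[symmetric] using M by (intro mult_left_mono power_le_pochhammer) auto
      finally show "real y ^ r \<le> M ^ r * \<phi> r y" .
    qed
    also have "\<dots> \<le> M ^ r * (\<phi> r m * (moment_growth r (n - 1) / moment_growth r k))"
      unfolding mean_at_cmult using k M by (intro mult_left_mono mean_at_phi) auto
    also have "\<dots> \<le> M ^ r * (\<phi> r m * ((u * real n powr (real r * \<alpha>)) / (l * real k powr (real r * \<alpha>))))"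
    proof (intro mult_left_mono frac_le)
      have "moment_growth r (n - 1) \<le> u * real (n - 1) powr (real r * \<alpha>)" using lu(3)[of "n - 1"] k by simp
      also have "\<dots> \<le> u * real n powr (real r * \<alpha>)"
        using lu alpha_pos by (intro mult_left_mono powr_mono2) auto
      finally show "moment_growth r (n - 1) \<le> u * real n powr (real r * \<alpha>)" .
    qed (use lu k kr ph M in auto)
    also have "\<dots> = C * (real n / real k) powr (real r * \<alpha>)"
      using k by (simp add: C_def powr_divide)
    finally show ?thesis .
  qed
  moreover have "C > 0" using M ph lu by (simp add: C_def)
  ultimately show ?thesis using that by blast
qed

end

section \<open>The early phase: a Yule process\<close>

lemma power_diff_le:
  fixes p :: real
  assumes "0 \<le> p" "p \<le> 1"
  shows "\<bar>p ^ i - p ^ j\<bar> \<le> \<bar>real i - real j\<bar> * (1 - p)"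
proof -
  have *: "\<bar>p ^ i - p ^ (i + d)\<bar> \<le> real d * (1 - p)" for i d
  proof -
    have "p ^ i - p ^ (i + d) = p ^ i * (1 - p ^ d)" by (simp add: power_add algebra_simps)
    moreover have "p ^ d \<le> 1" "p ^ i \<le> 1" "p ^ i \<ge> 0" using assms by (auto intro: power_le_one)
    moreover have "1 - p ^ d \<le> real d * (1 - p)"
      using Bernoulli_inequality[of "p - 1" d] assms by (simp add: algebra_simps)
    ultimately show ?thesis
      by (smt (verit) mult_left_le_one_le mult_nonneg_nonneg)
  qed
  show ?thesis
  proof (cases "i \<le> j")
    case True
    then show ?thesis using *[of i "j - i"] by (simp add: of_nat_diff)
  next
    case False
    then show ?thesis using *[of j "i - j"] by (simp add: of_nat_diff abs_minus_commute)
  qed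
qed

lemma one_minus_power_approx:
  fixes h :: real
  assumes "0 \<le> h" "h \<le> 1"
  shows "\<bar>(1 - h) ^ n - (1 - real n * h)\<bar> \<le> (real n)\<^sup>2 * h\<^sup>2"
proof -
  have "1 - real n * h \<le> (1 - h) ^ n"
    using Bernoulli_inequality[of "- h" n] assms by simp
  moreover have "(1 - h) ^ n \<le> 1 - real n * h + (real n)\<^sup>2 * h\<^sup>2"
  proof (induction n)
    case (Suc n)
    have "(1 - h) ^ Suc n \<le> (1 - real n * h + (real n)\<^sup>2 * h\<^sup>2) * (1 - h)"
      using Suc assms by (simp add: mult.commute mult_left_mono)
    also have "\<dots> = 1 - real (Suc n) * h + real (Suc n) ^ 2 * h\<^sup>2 - ((real n + 1) * h\<^sup>2 + (real n)\<^sup>2 * h ^ 3)"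
      by (simp add: algebra_simps power2_eq_square power3_eq_cube)
    also have "\<dots> \<le> 1 - real (Suc n) * h + real (Suc n) ^ 2 * h\<^sup>2"
    proof -
      have "0 \<le> (real n + 1) * h\<^sup>2 + (real n)\<^sup>2 * h ^ 3" using assms by (intro add_nonneg_nonneg) auto
      then show ?thesis by linarith
    qed
    finally show ?case .
  qed simp
  ultimately show ?thesis by simp
qed

lemma exp_minus_le: "u \<ge> 0 \<Longrightarrow> exp (- u) \<le> 1 - u + (u::real)\<^sup>2"
proof -
  assume u: "u \<ge> 0"
  have "1 \<le> (1 - u + u\<^sup>2) * (1 + u)" using u by (simp add: algebra_simps power2_eq_square)
  also have "\<dots> \<le> (1 - u + u\<^sup>2) * exp u"
  proof (intro mult_left_mono)
    have "0 \<le> (1 - u / 2)\<^sup>2 + 3 / 4 * u\<^sup>2" by simp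
    also have "\<dots> = 1 - u + u\<^sup>2" by (simp add: power2_eq_square algebra_simps)
    finally show "0 \<le> 1 - u + u\<^sup>2" .
  qed simp
  finally show ?thesis by (simp add: exp_minus field_simps)
qed

lemma exp_minus_diff_le:
  fixes u v :: real
  assumes "u \<ge> 0" "v \<ge> 0" shows "\<bar>exp (- u) - exp (- v)\<bar> \<le> \<bar>u - v\<bar>"
proof -
  have *: "exp (- a) - exp (- b) \<le> b - a" if "0 \<le> a" "a \<le> b" for a b :: real
  proof -
    have "exp (- a) - exp (- b) = exp (- a) * (1 - exp (- (b - a)))"
      by (simp add: algebra_simps flip: exp_add)
    also have "\<dots> \<le> 1 * (b - a)"
    proof (intro mult_mono)
      show "1 - exp (- (b - a)) \<le> b - a" using exp_ge_add_one_self[of "- (b - a)"] by linarith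
    qed (use that in auto)
    finally show ?thesis by simp
  qed
  show ?thesis
  proof (cases "u \<le> v")
    case True
    then show ?thesis using *[of u v] assms by simp
  next
    case False
    then show ?thesis using *[of v u] assms by simp
  qed
qed

lemma one_plus_powr_approx:
  fixes h M :: real
  assumes h: "0 \<le> h" and M: "M \<ge> 1" and Mh: "M * h \<le> 1"
  shows "\<bar>(1 - h) - (1 + M * h) powr (- (1 / M))\<bar> \<le> (M + 1) * h\<^sup>2"
proof -
  define v where "v = (1 + M * h) powr (- (1 / M))"
  have Mh0: "M * h \<ge> 0" using h M by simp
  have v: "v = exp (- (ln (1 + M * h) / M))" using Mh0 by (simp add: v_def powr_def)
  have "ln (1 + M * h) / M \<le> h"
    using ln_add_one_self_le_self[OF Mh0] M by (simp add: field_simps)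
  then have "1 - h \<le> v"
    using exp_ge_add_one_self[of "- (ln (1 + M * h) / M)"] unfolding v by simp
  moreover have "v \<le> 1 - h + (M + 1) * h\<^sup>2"
  proof -
    define u where "u = h - M * h\<^sup>2"
    have "M * h * h \<le> 1 * h" using Mh h by (intro mult_right_mono)
    then have u: "0 \<le> u" "u \<le> h" using h M by (auto simp: u_def power2_eq_square)
    have "M * u \<le> ln (1 + M * h)"
      using ln_one_plus_pos_lower_bound[OF Mh0 Mh]
      by (simp add: u_def algebra_simps power2_eq_square)
    then have "u \<le> ln (1 + M * h) / M" using M by (simp add: field_simps)
    then have "v \<le> exp (- u)" unfolding v by simp
    also have "\<dots> \<le> 1 - u + u\<^sup>2" by (rule exp_minus_le[OF u(1)])
    also have "\<dots> \<le> 1 - u + h\<^sup>2" using u by (simp add: power_mono)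
    finally show ?thesis by (simp add: u_def algebra_simps)
  qed
  ultimately show ?thesis unfolding v_def[symmetric] by simp
qed

context pref_attach begin

text \<open>The Laplace transform of the Gamma distribution with shape \<open>1 / (m - 1)\<close>: the limit law of a Yule process
  in which each event adds \<open>m - 1\<close> edges and which starts from one edge.  The \<open>y\<close> active edges behave independently, so
  the transform is raised to the power \<open>y\<close>.\<close>

definition F :: "real \<Rightarrow> real" where
  "F x = (1 + x) powr (- (1 / (real m - 1)))"

lemma F_props:
  assumes x: "x \<ge> 0"
  shows "0 < F x" "F x \<le> 1" "F x ^ (m - 1) = 1 / (1 + x)" "1 - F x \<le> x"
proof -
  show 1: "0 < F x" using x by (simp add: F_def)
  show 2: "F x \<le> 1" using x m2 powr_mono2'[of "- (1 / (real m - 1))" 1 "1 + x"] by (simp add: F_def)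
  have "F x ^ (m - 1) = F x powr real (m - 1)" using 1 by (simp add: powr_realpow)
  also have "\<dots> = (1 + x) powr (- 1)" using m2 by (simp add: F_def powr_powr of_nat_diff)
  finally show 3: "F x ^ (m - 1) = 1 / (1 + x)" using x by (simp add: powr_minus_divide)
  have "F x ^ (m - 1) \<le> F x ^ 1" using 1 2 m2 by (intro power_decreasing) auto
  moreover have "1 - x \<le> 1 / (1 + x)" using x by (simp add: field_simps)
  ultimately show "1 - F x \<le> x" using 3 by simp
qed

lemma hit_prob_bounds: assumes "k \<ge> 2" shows "\<theta> / A k \<le> 1 / real k" "\<theta> / A k > 0"
proof -
  show "\<theta> / A k > 0" using theta_pos A_pos[OF assms] by simp
  show "\<theta> / A k \<le> 1 / real k"
    using A_lower[OF assms] A_pos[OF assms] assms by (simp add: field_simps)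
qed

lemma hit_pairs_bound:
  assumes k: "k \<ge> 3"
  shows "real y * (real y - 1) * (\<theta> * (\<theta> + 1)) / (A k * (A k + 1)) \<le> (\<theta> + 1) / \<theta> * ((real y)\<^sup>2 / (real k)\<^sup>2)"
proof -
  have Ak: "A k > 0" "A k \<ge> \<theta> * real k" using A_pos A_lower k by auto
  have "real y * (real y - 1) * (\<theta> * (\<theta> + 1)) / (A k * (A k + 1)) \<le> (real y)\<^sup>2 * (\<theta> * (\<theta> + 1)) / (\<theta> * real k * (\<theta> * real k))"
  proof (rule frac_le)
    show "0 < \<theta> * real k * (\<theta> * real k)" using theta_pos k by simp
    show "\<theta> * real k * (\<theta> * real k) \<le> A k * (A k + 1)"
      using Ak theta_pos by (intro mult_mono) auto
    show "real y * (real y - 1) * (\<theta> * (\<theta> + 1)) \<le> (real y)\<^sup>2 * (\<theta> * (\<theta> + 1))"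
      using theta_pos by (intro mult_right_mono) (auto simp: power2_eq_square algebra_simps)
  qed (use theta_pos in auto)
  also have "\<dots> = (\<theta> + 1) / \<theta> * ((real y)\<^sup>2 / (real k)\<^sup>2)"
    using theta_pos k by (simp add: field_simps power2_eq_square)
  finally show ?thesis .
qed

definition laplace_const :: real where "laplace_const = 2 * real m * ((\<theta> + 1) / \<theta>) + 1 + real m"

text \<open>One level maps \<open>F x'\<close> to \<open>F x\<close>, where \<open>x\<close> is \<open>x'\<close> times the typical growth of the number of active edges.
  An edge that hits, which happens with probability \<open>\<theta> / A k\<close>, multiplies the power by \<open>F x' ^ (m - 1)\<close>,
  and this is \<open>1 / (1 + x')\<close>.  So in the first order each edge contributes the factor \<open>F x' * (1 - h)\<close> with
  \<open>h = (\<theta> / A k) * (x' / (1 + x'))\<close>, and \<open>1 - h\<close> is close to \<open>(1 + (m - 1) h) powr (- 1 / (m - 1))\<close>,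
  the factor by which \<open>F x\<close> differs from \<open>F x'\<close>.\<close>

lemma laplace_step:
  assumes k: "k \<ge> 3" "k \<ge> m" and x': "x' \<ge> 0"
  defines "x \<equiv> x' * (1 + (real m - 1) * \<theta> / A k)"
  shows "\<bar>step_mean k y (\<lambda>z. F x' ^ next_active y z) - F x ^ y\<bar> \<le> laplace_const * x' * ((real y)\<^sup>2 / (real k)\<^sup>2)"
proof -
  define M where "M = real m - 1"
  have M: "M \<ge> 1" using m2 by (simp add: M_def)
  define p where "p = F x'"
  note p = F_props[OF x', folded p_def]
  define \<beta> where "\<beta> = \<theta> / A k"
  have b: "\<beta> > 0" "\<beta> \<le> 1 / real k" using hit_prob_bounds[of k] k by (auto simp: \<beta>_def)
  define h where "h = \<beta> * (x' / (1 + x'))"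
  have hx: "x' / (1 + x') \<ge> 0" "x' / (1 + x') \<le> 1" "x' / (1 + x') \<le> x'"
    using x' by (auto simp: field_simps)
  have h: "0 \<le> h" "h \<le> \<beta>" "h \<le> \<beta> * x'"
    using b hx mult_left_mono[of "x' / (1 + x')" 1 \<beta>] mult_left_mono[of "x' / (1 + x')" x' \<beta>]
    by (auto simp only: h_def mult_1_right intro: mult_nonneg_nonneg)
  have "1 / real k \<le> 1" using k by simp
  then have h1: "h \<le> 1" using h b by linarith
  have "M * h \<le> M * (1 / real k)" using h b M by (intro mult_left_mono) auto
  also have "\<dots> \<le> 1" using k M by (simp add: M_def field_simps)
  finally have Mh: "M * h \<le> 1" .
  have h2: "h\<^sup>2 \<le> x' * (1 / (real k)\<^sup>2)"
  proof -
    have "h\<^sup>2 \<le> (\<beta> * x') * \<beta>" unfolding power2_eq_square using h x' b by (intro mult_mono) auto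
    also have "\<dots> = x' * \<beta>\<^sup>2" by (simp add: power2_eq_square)
    also have "\<dots> \<le> x' * (1 / real k)\<^sup>2" using b x' by (intro mult_left_mono power_mono) auto
    finally show ?thesis by (simp add: power_divide)
  qed
  define Y where "Y = (real y)\<^sup>2 / (real k)\<^sup>2"
  have Y0: "Y \<ge> 0" by (simp add: Y_def)
  \<comment> \<open>linear in the number of hits: the error comes from levels with at least two hits\<close>
  have a: "\<bar>step_mean k y (\<lambda>z. p ^ next_active y z) - p ^ y * (1 - real y * h)\<bar>
      \<le> 2 * real m * ((\<theta> + 1) / \<theta>) * x' * Y"
  proof -
    define \<delta> where "\<delta> = p ^ (y + (m - 1)) - p ^ y"
    have lin: "step_mean k y (\<lambda>z. p ^ y + \<delta> * real z) = p ^ y * (1 - real y * h)"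
    proof -
      have "1 - p ^ (m - 1) = x' / (1 + x')" using p x' by (simp add: field_simps)
      then have pm: "p ^ (m - 1) = 1 - x' / (1 + x')" by linarith
      have "\<delta> = - (p ^ y * (x' / (1 + x')))"
        by (simp only: \<delta>_def power_add pm) (simp add: algebra_simps)
      then show ?thesis
        by (simp only: step_mean_add step_mean_cmult step_mean_const step_mean_hits[OF k(1)])
           (simp add: h_def \<beta>_def algebra_simps)
    qed
    have pt: "\<bar>p ^ next_active y z - (p ^ y + \<delta> * real z)\<bar> \<le> 2 * real m * (1 - p) * (real z * (real z - 1))"
      if z: "z \<le> y" for z
    proof -
      consider "z = 0" | "z = 1" | "z \<ge> 2" by linarith
      then show ?thesis
      proof cases
        case 1 then show ?thesis by (simp add: next_active_def)
      next
        case 2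
        then have "next_active y z = y + (m - 1)" using m2 z by (simp add: next_active_def)
        then show ?thesis using 2 by (simp add: \<delta>_def)
      next
        case 3
        have na: "real (next_active y z) = real m + real y - real z"
          using 3 z by (simp add: next_active_def of_nat_diff)
        have q: "1 - p \<ge> 0" using p by simp
        have mz: "real m \<le> real m * real z" "real z \<le> real m * real z"
          using 3 m2 by (auto simp: mult_le_cancel_left1 mult_le_cancel_right1)
        have "\<bar>p ^ next_active y z - p ^ y\<bar> \<le> \<bar>real m - real z\<bar> * (1 - p)"
          using power_diff_le[of p "next_active y z" y] p by (simp add: na)
        also have "\<dots> \<le> (real m * real z) * (1 - p)" using q mz by (intro mult_right_mono) auto
        finally have 1: "\<bar>p ^ next_active y z - p ^ y\<bar> \<le> real m * real z * (1 - p)" .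
        have "\<bar>\<delta>\<bar> \<le> (real m - 1) * (1 - p)"
          using power_diff_le[of p "y + (m - 1)" y] p m2 by (simp add: \<delta>_def of_nat_diff)
        also have "\<dots> \<le> real m * (1 - p)" using q by (intro mult_right_mono) auto
        finally have "\<bar>\<delta> * real z\<bar> \<le> real m * (1 - p) * real z" by (simp add: abs_mult mult_right_mono)
        then have "\<bar>p ^ next_active y z - (p ^ y + \<delta> * real z)\<bar> \<le> 2 * real m * (1 - p) * real z"
          using 1 by (simp add: algebra_simps)
        also have "\<dots> \<le> 2 * real m * (1 - p) * (real z * (real z - 1))"
          using 3 q by (intro mult_left_mono) (auto simp: mult_le_cancel_left1)
        finally show ?thesis .
      qed
    qed
    have "\<bar>step_mean k y (\<lambda>z. p ^ next_active y z) - p ^ y * (1 - real y * h)\<bar> =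
      \<bar>step_mean k y (\<lambda>z. p ^ next_active y z - (p ^ y + \<delta> * real z))\<bar>"
      by (simp only: step_mean_diff lin)
    also have "\<dots> \<le> step_mean k y (\<lambda>z. \<bar>p ^ next_active y z - (p ^ y + \<delta> * real z)\<bar>)"
      by (rule step_mean_abs)
    also have "\<dots> \<le> step_mean k y (\<lambda>z. 2 * real m * (1 - p) * (real z * (real z - 1)))"
      by (intro step_mean_mono pt)
    also have "\<dots> = 2 * real m * (1 - p) * (real y * (real y - 1) * (\<theta> * (\<theta> + 1)) / (A k * (A k + 1)))"
      by (simp only: step_mean_cmult step_mean_hits2[OF k(1)])
    also have "\<dots> \<le> 2 * real m * (1 - p) * ((\<theta> + 1) / \<theta> * Y)"
      unfolding Y_def using p by (intro mult_left_mono hit_pairs_bound k) auto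
    also have "\<dots> \<le> 2 * real m * x' * ((\<theta> + 1) / \<theta> * Y)"
      using p Y0 theta_pos by (intro mult_right_mono mult_left_mono) auto
    finally show ?thesis by (simp add: mult_ac)
  qed
  \<comment> \<open>from one linear term to a product over the edges\<close>
  have b: "\<bar>p ^ y * (1 - real y * h) - (p * (1 - h)) ^ y\<bar> \<le> x' * Y"
  proof -
    have "\<bar>p ^ y * (1 - real y * h) - (p * (1 - h)) ^ y\<bar> = p ^ y * \<bar>(1 - h) ^ y - (1 - real y * h)\<bar>"
    proof -
      have "p ^ y * (1 - real y * h) - (p * (1 - h)) ^ y = - (p ^ y * ((1 - h) ^ y - (1 - real y * h)))"
        unfolding power_mult_distrib by (simp add: algebra_simps)
      then show ?thesis using p by (simp add: abs_mult)
    qed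
    also have "\<dots> \<le> 1 * ((real y)\<^sup>2 * h\<^sup>2)"
      using p h h1 by (intro mult_mono one_minus_power_approx power_le_one) auto
    also have "\<dots> \<le> (real y)\<^sup>2 * (x' * (1 / (real k)\<^sup>2))"
      unfolding mult_1 by (intro mult_left_mono h2) auto
    finally show ?thesis by (simp add: Y_def mult_ac)
  qed
  \<comment> \<open>the product is the power of \<open>F x\<close>, as \<open>1 + x = (1 + x') (1 + M h)\<close>\<close>
  have c: "\<bar>(p * (1 - h)) ^ y - F x ^ y\<bar> \<le> real m * x' * Y"
  proof -
    define v where "v = (1 + M * h) powr (- (1 / M))"
    have "1 + x = (1 + x') * (1 + M * h)"
    proof -
      have "(1 + x') * h = \<beta> * x'" using x' by (simp add: h_def)
      then have "(1 + x') * (1 + M * h) = 1 + x' + M * (\<beta> * x')" by (simp add: algebra_simps)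
      then show ?thesis by (simp add: x_def \<beta>_def M_def algebra_simps)
    qed
    moreover have "1 + M * h > 0" using M h by (simp add: add_pos_nonneg)
    ultimately have Fx: "F x = p * v" using x' by (simp add: F_def p_def v_def M_def powr_mult)
    have v: "\<bar>(1 - h) - v\<bar> \<le> real m * h\<^sup>2" "v \<ge> 0"
      using one_plus_powr_approx[OF h(1) M Mh] by (auto simp: v_def M_def)
    have "x \<ge> 0" using x' M theta_pos A_pos[of k] k by (simp add: x_def M_def)
    then have Fx1: "F x \<ge> 0" "F x \<le> 1" using F_props[of x] by auto
    have ph: "0 \<le> p * (1 - h)" "p * (1 - h) \<le> 1" using p h h1 by (auto intro: mult_le_one)
    have "\<bar>(p * (1 - h)) ^ y - F x ^ y\<bar> \<le> real y * \<bar>p * (1 - h) - F x\<bar>"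
      using norm_power_diff[of "p * (1 - h)" "F x" y] ph Fx1 by simp
    also have "\<bar>p * (1 - h) - F x\<bar> = p * \<bar>(1 - h) - v\<bar>"
    proof -
      have "p * (1 - h) - F x = p * ((1 - h) - v)" by (simp add: Fx algebra_simps)
      then show ?thesis using p by (simp add: abs_mult)
    qed
    also have "\<dots> \<le> 1 * (real m * h\<^sup>2)" using p v by (intro mult_mono) auto
    also have "real y * (1 * (real m * h\<^sup>2)) \<le> (real y)\<^sup>2 * (real m * (x' * (1 / (real k)\<^sup>2)))"
      unfolding mult_1
    proof (intro mult_mono[of "real y"] mult_left_mono[of "h\<^sup>2"] h2)
      show "real y \<le> (real y)\<^sup>2" by (cases y) (auto simp: power2_eq_square)
    qed auto
    finally have "\<bar>(p * (1 - h)) ^ y - F x ^ y\<bar> \<le> (real y)\<^sup>2 * (real m * (x' * (1 / (real k)\<^sup>2)))"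
      by (simp add: mult_left_mono)
    then show ?thesis by (simp add: Y_def mult_ac)
  qed
  have "\<bar>step_mean k y (\<lambda>z. p ^ next_active y z) - F x ^ y\<bar> \<le>
     2 * real m * ((\<theta> + 1) / \<theta>) * x' * Y + x' * Y + real m * x' * Y"
    using a b c by linarith
  also have "\<dots> = laplace_const * x' * Y" by (simp add: laplace_const_def algebra_simps)
  finally show ?thesis by (simp add: p_def Y_def)
qed

lemma moment_growth_ratio:
  obtains C where "C > 0" "\<And>n k. 2 \<le> k \<Longrightarrow> k < n \<Longrightarrow>
    moment_growth 1 k / moment_growth 1 (n - 1) \<le> C * (real k / real n) powr \<alpha>"
proof -
  obtain l u where lu: "l > 0" "u > 0" "\<And>k. k \<ge> 2 \<Longrightarrow> l * real k powr \<alpha> \<le> moment_growth 1 k \<and>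
      moment_growth 1 k \<le> u * real k powr \<alpha>"
    using growth_bounds[OF moment_growth_conds(2,1), of 1] unfolding growth_exponent moment_growth_def
    by (metis mult_1 of_nat_1)
  define C where "C = u / l * 2 powr \<alpha>"
  have "moment_growth 1 k / moment_growth 1 (n - 1) \<le> C * (real k / real n) powr \<alpha>"
    if k: "2 \<le> k" "k < n" for n k
  proof -
    have "moment_growth 1 k / moment_growth 1 (n - 1) \<le> (u * real k powr \<alpha>) / (l * (real n / 2) powr \<alpha>)"
    proof (rule frac_le)
      have "l * (real n / 2) powr \<alpha> \<le> l * real (n - 1) powr \<alpha>"
        using k lu alpha_pos by (intro mult_left_mono powr_mono2) (auto simp: of_nat_diff)
      also have "\<dots> \<le> moment_growth 1 (n - 1)" using lu(3)[of "n - 1"] k by simp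
      finally show "l * (real n / 2) powr \<alpha> \<le> moment_growth 1 (n - 1)" .
    qed (use lu k in auto)
    also have "\<dots> = C * (real k / real n) powr \<alpha>"
      using k by (simp add: C_def powr_divide)
    finally show ?thesis .
  qed
  moreover have "C > 0" using lu by (simp add: C_def)
  ultimately show ?thesis using that by blast
qed

text \<open>The argument \<open>X k\<close> is chosen so that one level takes \<open>F (X k)\<close> to \<open>F (X (k + 1))\<close> in \<open>laplace_step\<close>; it
  grows up to \<open>\<tau>\<close> at level \<open>n - 1\<close>, where there are \<open>m\<close> active edges.  The errors of the steps add up.\<close>

lemma laplace_chain:
  assumes k0: "m \<le> k0" "k0 \<le> n - 1" and \<tau>: "\<tau> \<ge> 0"
  defines "X \<equiv> \<lambda>k. \<tau> * (moment_growth 1 k / moment_growth 1 (n - 1))"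
  shows "\<bar>mean_at n k0 (\<lambda>y. F (X k0) ^ y) - F \<tau> ^ m\<bar> \<le>
    (\<Sum>j\<in>{k0..<n - 1}. laplace_const * X j * (mean_at n (Suc j) (\<lambda>y. (real y)\<^sup>2) / (real (Suc j))\<^sup>2))"
  using k0(2)
proof (induction k0 rule: inc_induct)
  case base
  have "X (n - 1) = \<tau>" using moment_growth_pos[of 1 "n - 1"] by (simp add: X_def)
  then show ?case by (simp only: mean_at_top) simp
next
  case (step k)
  have k: "Suc k \<ge> 3" "Suc k \<ge> m" "k \<ge> 2" using step k0(1) m2 by auto
  have Xk: "X k \<ge> 0" using \<tau> moment_growth_pos[of 1 k] moment_growth_pos[of 1 "n - 1"] by (simp add: X_def)
  have XS: "X (Suc k) = X k * (1 + (real m - 1) * \<theta> / A (Suc k))"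
    using moment_growth_Suc[OF k(3), of 1] by (simp add: X_def)
  let ?e = "laplace_const * X k * (mean_at n (Suc k) (\<lambda>y. (real y)\<^sup>2) / (real (Suc k))\<^sup>2)"
  have "mean_at n k (\<lambda>y. F (X k) ^ y) =
     mean_at n (Suc k) (\<lambda>y. step_mean (Suc k) y (\<lambda>z. F (X k) ^ next_active y z))"
    using mean_at_step[of "Suc k" n] step by simp
  then have "\<bar>mean_at n k (\<lambda>y. F (X k) ^ y) - mean_at n (Suc k) (\<lambda>y. F (X (Suc k)) ^ y)\<bar> =
     \<bar>mean_at n (Suc k) (\<lambda>y. step_mean (Suc k) y (\<lambda>z. F (X k) ^ next_active y z) - F (X (Suc k)) ^ y)\<bar>"
    by (simp only: mean_at_diff)
  also have "\<dots> \<le> mean_at n (Suc k) (\<lambda>y. \<bar>step_mean (Suc k) y (\<lambda>z. F (X k) ^ next_active y z) - F (X (Suc k)) ^ y\<bar>)"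
    by (rule mean_at_abs)
  also have "\<dots> \<le> mean_at n (Suc k) (\<lambda>y. (laplace_const * X k * (1 / (real (Suc k))\<^sup>2)) * (real y)\<^sup>2)"
  proof (rule mean_at_mono)
    fix y
    show "\<bar>step_mean (Suc k) y (\<lambda>z. F (X k) ^ next_active y z) - F (X (Suc k)) ^ y\<bar> \<le>
        (laplace_const * X k * (1 / (real (Suc k))\<^sup>2)) * (real y)\<^sup>2"
      using laplace_step[OF k(1,2) Xk, of y] by (simp only: XS) (simp add: mult_ac)
  qed
  also have "\<dots> = ?e" by (simp only: mean_at_cmult) simp
  finally have e: "\<bar>mean_at n k (\<lambda>y. F (X k) ^ y) - mean_at n (Suc k) (\<lambda>y. F (X (Suc k)) ^ y)\<bar> \<le> ?e" .
  have "(\<Sum>j\<in>{k..<n - 1}. laplace_const * X j * (mean_at n (Suc j) (\<lambda>y. (real y)\<^sup>2) / (real (Suc j))\<^sup>2)) =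
     ?e + (\<Sum>j\<in>{Suc k..<n - 1}. laplace_const * X j * (mean_at n (Suc j) (\<lambda>y. (real y)\<^sup>2) / (real (Suc j))\<^sup>2))"
    using step by (subst sum.atLeast_Suc_lessThan) auto
  then show ?case using e step.IH by linarith
qed

lemma sum_inverse_squares:
  assumes "1 \<le> i" "i \<le> r"
  shows "(\<Sum>j\<in>{i..<r}. 1 / (real (Suc j))\<^sup>2) \<le> 1 / real i"
proof -
  have "(\<Sum>j\<in>{i..<r}. 1 / (real (Suc j))\<^sup>2) \<le> 1 / real i - 1 / real r"
    using assms(2)
  proof (induction r rule: dec_induct)
    case (step r)
    have "1 / (real (Suc r))\<^sup>2 \<le> 1 / (real r * real (Suc r))"
      using step assms by (intro divide_left_mono) (auto simp: power2_eq_square)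
    also have "\<dots> = 1 / real r - 1 / real (Suc r)"
      using step assms by (simp add: field_simps)
    finally show ?case using step by simp
  qed simp
  moreover have "1 / real r \<ge> 0" by simp
  ultimately show ?thesis by linarith
qed

lemma ln_one_plus_approx: "x \<ge> 0 \<Longrightarrow> \<bar>ln (1 + x) - x\<bar> \<le> (x::real)\<^sup>2"
proof (cases "x \<le> 1")
  case True
  assume "x \<ge> 0" with True show ?thesis by (intro abs_ln_one_plus_x_minus_x_bound_nonneg)
next
  case False
  assume x: "x \<ge> 0"
  have "ln (1 + x) \<le> x" by (rule ln_add_one_self_le_self[OF x])
  moreover have "ln (1 + x) \<ge> 0" using x by simp
  moreover have "x \<le> x\<^sup>2" using False by (simp add: power2_eq_square)
  ultimately show ?thesis by simp
qed

text \<open>The number of active edges in units of \<open>m - 1\<close>, divided by its typical growth from level \<open>n - 1\<close> to level \<open>k\<close>.\<close>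

definition scaled :: "nat \<Rightarrow> nat \<Rightarrow> nat \<Rightarrow> real" where
  "scaled n k y = moment_growth 1 k / moment_growth 1 (n - 1) * (real y / (real m - 1))"

lemma F_power_approx:
  assumes x: "x \<ge> 0"
  shows "\<bar>F x ^ y - exp (- (x * (real y / (real m - 1))))\<bar> \<le> real y * x\<^sup>2"
proof -
  define w where "w = real y / (real m - 1)"
  have w: "0 \<le> w" "w \<le> real y" using m2 mult_left_mono[of 1 "real m - 1" "real y"] by (auto simp: w_def divide_le_eq)
  have "F x ^ y = F x powr real y" using F_props[OF x] by (simp add: powr_realpow)
  also have "\<dots> = exp (- (w * ln (1 + x)))"
    unfolding F_def powr_powr using x by (simp add: powr_def w_def)
  finally have "\<bar>F x ^ y - exp (- (x * w))\<bar> \<le> \<bar>w * ln (1 + x) - x * w\<bar>"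
    using exp_minus_diff_le[of "w * ln (1 + x)" "x * w"] w x by simp
  also have "\<dots> = w * \<bar>ln (1 + x) - x\<bar>"
  proof -
    have "w * ln (1 + x) - x * w = w * (ln (1 + x) - x)" by (simp add: algebra_simps)
    then show ?thesis using w by (simp add: abs_mult)
  qed
  also have "\<dots> \<le> real y * x\<^sup>2" using w ln_one_plus_approx[OF x] by (intro mult_mono) auto
  finally show ?thesis by (simp add: w_def)
qed

text \<open>The sum of the errors in \<open>laplace_chain\<close> is controlled by the second moment; it is small if \<open>y\<close>, of
  order \<open>(n / k) powr \<alpha>\<close>, is small compared with \<open>k\<close>.  The second error term, for replacing
  \<open>F x\<close> by an exponential, needs \<open>k\<close> small compared with \<open>n\<close>.\<close>

lemma laplace_limit:
  obtains C where "C > 0" "\<And>\<tau> n k. 0 \<le> \<tau> \<Longrightarrow> m \<le> k \<Longrightarrow> k < n \<Longrightarrow>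
    \<bar>mean_at n k (\<lambda>y. exp (- (\<tau> * scaled n k y))) - F \<tau> ^ m\<bar> \<le>
      C * (\<tau> + \<tau>\<^sup>2) * ((real n / real k) powr \<alpha> / real k + (real k / real n) powr \<alpha>)"
proof -
  obtain C0 where C0: "C0 > 0" "\<And>n k. 2 \<le> k \<Longrightarrow> k < n \<Longrightarrow>
    moment_growth 1 k / moment_growth 1 (n - 1) \<le> C0 * (real k / real n) powr \<alpha>"
    using moment_growth_ratio by blast
  obtain C1 where C1: "C1 > 0" "\<And>n k. 2 \<le> k \<Longrightarrow> k < n \<Longrightarrow>
    mean_at n k (\<lambda>y. real y ^ 1) \<le> C1 * (real n / real k) powr (real 1 * \<alpha>)"
    using moment_bound[of 1] by blast
  obtain C2 where C2: "C2 > 0" "\<And>n k. 2 \<le> k \<Longrightarrow> k < n \<Longrightarrow>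
    mean_at n k (\<lambda>y. real y ^ 2) \<le> C2 * (real n / real k) powr (real 2 * \<alpha>)"
    using moment_bound[of 2] by blast
  have laplace_const: "laplace_const > 0" using theta_pos m2 by (simp add: laplace_const_def add_pos_nonneg)
  define C where "C = laplace_const * C0 * C2 + C1 * C0\<^sup>2"
  have C: "C > 0" unfolding C_def using laplace_const C0(1) C1(1) C2(1) by (intro add_pos_pos mult_pos_pos zero_less_power)
  have "\<bar>mean_at n k (\<lambda>y. exp (- (\<tau> * scaled n k y))) - F \<tau> ^ m\<bar> \<le>
      C * (\<tau> + \<tau>\<^sup>2) * ((real n / real k) powr \<alpha> / real k + (real k / real n) powr \<alpha>)"
    if \<tau>: "0 \<le> \<tau>" and k: "m \<le> k" "k < n" for \<tau> n k
  proof -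
    have k2: "k \<ge> 2" using k m2 by simp
    define X where "X = (\<lambda>k. \<tau> * (moment_growth 1 k / moment_growth 1 (n - 1)))"
    have X0: "X j \<ge> 0" for j
      using \<tau> moment_growth_pos[of 1 j] moment_growth_pos[of 1 "n - 1"] by (simp add: X_def)
    have XC: "X j \<le> \<tau> * (C0 * (real j / real n) powr \<alpha>)" if "2 \<le> j" "j < n" for j
      unfolding X_def using C0(2)[OF that] \<tau> by (intro mult_left_mono)
    define P where "P = (real n / real k) powr \<alpha>"
    define Q where "Q = (real k / real n) powr \<alpha>"
    have PQ: "P > 0" "Q > 0" "P * Q = 1" using k k2 by (auto simp: P_def Q_def simp flip: powr_mult)
    have "\<bar>mean_at n k (\<lambda>y. F (X k) ^ y) - F \<tau> ^ m\<bar> \<le>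
      (\<Sum>j\<in>{k..<n - 1}. laplace_const * X j * (mean_at n (Suc j) (\<lambda>y. (real y)\<^sup>2) / (real (Suc j))\<^sup>2))"
      unfolding X_def by (rule laplace_chain) (use k \<tau> in auto)
    also have "\<dots> \<le> (\<Sum>j\<in>{k..<n - 1}. laplace_const * \<tau> * C0 * C2 * P * (1 / (real (Suc j))\<^sup>2))"
    proof (rule sum_mono)
      fix j assume j: "j \<in> {k..<n - 1}"
      define a where "a = (real (Suc j) / real n) powr \<alpha>"
      define b where "b = (real n / real (Suc j)) powr \<alpha>"
      have ab: "a > 0" "b > 0" "a * b = 1" using j k k2 by (auto simp: a_def b_def simp flip: powr_mult)
      have bP: "b \<le> P" unfolding b_def P_def using j k k2 alpha_pos
        by (intro powr_mono2 divide_left_mono) auto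
      have "X j \<le> \<tau> * (C0 * (real j / real n) powr \<alpha>)" using j k k2 by (intro XC) auto
      also have "\<dots> \<le> \<tau> * (C0 * a)" unfolding a_def using C0 \<tau> alpha_pos
        by (intro mult_left_mono powr_mono2 divide_right_mono) auto
      finally have Xa: "X j \<le> \<tau> * (C0 * a)" .
      have "mean_at n (Suc j) (\<lambda>y. (real y)\<^sup>2) \<le> C2 * (real n / real (Suc j)) powr (2 * \<alpha>)"
        using C2(2)[of "Suc j" n] j k2 less_diff_conv[of j n 1] by (simp only: of_nat_numeral) simp
      also have "(real n / real (Suc j)) powr (2 * \<alpha>) = b * b"
        by (simp add: b_def flip: powr_add)
      finally have m2b: "mean_at n (Suc j) (\<lambda>y. (real y)\<^sup>2) \<le> C2 * (b * b)" .
      have "laplace_const * X j * (mean_at n (Suc j) (\<lambda>y. (real y)\<^sup>2) / (real (Suc j))\<^sup>2) \<le>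
        laplace_const * (\<tau> * (C0 * a)) * ((C2 * (b * b)) / (real (Suc j))\<^sup>2)"
        using laplace_const Xa m2b X0 C0 \<tau> ab
        by (intro mult_mono divide_right_mono mult_left_mono) (auto intro!: divide_nonneg_nonneg mean_at_nonneg)
      also have "\<dots> = laplace_const * \<tau> * C0 * C2 * ((a * b) * b) * (1 / (real (Suc j))\<^sup>2)" by (simp add: mult_ac)
      also have "\<dots> \<le> laplace_const * \<tau> * C0 * C2 * P * (1 / (real (Suc j))\<^sup>2)"
        unfolding ab(3) using bP laplace_const C0 C2 \<tau> by (intro mult_right_mono mult_left_mono) auto
      finally show "laplace_const * X j * (mean_at n (Suc j) (\<lambda>y. (real y)\<^sup>2) / (real (Suc j))\<^sup>2) \<le>
        laplace_const * \<tau> * C0 * C2 * P * (1 / (real (Suc j))\<^sup>2)" .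
    qed
    also have "\<dots> = laplace_const * \<tau> * C0 * C2 * P * (\<Sum>j\<in>{k..<n - 1}. 1 / (real (Suc j))\<^sup>2)"
      by (simp only: sum_distrib_left)
    also have "\<dots> \<le> laplace_const * \<tau> * C0 * C2 * P * (1 / real k)"
      using sum_inverse_squares[of k "n - 1"] k k2 laplace_const C0 C2 \<tau> PQ by (intro mult_left_mono) auto
    finally have 1: "\<bar>mean_at n k (\<lambda>y. F (X k) ^ y) - F \<tau> ^ m\<bar> \<le> laplace_const * C0 * C2 * (\<tau> * (P / real k))"
      by (simp add: mult_ac)
    have "\<bar>mean_at n k (\<lambda>y. exp (- (\<tau> * scaled n k y))) - mean_at n k (\<lambda>y. F (X k) ^ y)\<bar> \<le>
       mean_at n k (\<lambda>y. \<bar>exp (- (\<tau> * scaled n k y)) - F (X k) ^ y\<bar>)"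
      unfolding mean_at_diff[symmetric] by (rule mean_at_abs)
    also have "\<dots> \<le> mean_at n k (\<lambda>y. (X k)\<^sup>2 * real y ^ 1)"
    proof (rule mean_at_mono)
      fix y
      show "\<bar>exp (- (\<tau> * scaled n k y)) - F (X k) ^ y\<bar> \<le> (X k)\<^sup>2 * real y ^ 1"
        using F_power_approx[OF X0, of k y] by (simp add: scaled_def X_def abs_minus_commute mult_ac)
    qed
    also have "\<dots> = (X k)\<^sup>2 * mean_at n k (\<lambda>y. real y ^ 1)" by (rule mean_at_cmult)
    also have "\<dots> \<le> (\<tau> * (C0 * Q))\<^sup>2 * (C1 * P)"
      using C1(2)[OF k2 k(2)] XC[OF k2 k(2)] X0[of k]
      by (intro mult_mono power_mono mean_at_nonneg) (auto simp: P_def Q_def)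
    also have "\<dots> = C1 * C0\<^sup>2 * (\<tau>\<^sup>2 * (Q * (P * Q)))" by (simp add: power2_eq_square mult_ac)
    finally have 2: "\<bar>mean_at n k (\<lambda>y. exp (- (\<tau> * scaled n k y))) - mean_at n k (\<lambda>y. F (X k) ^ y)\<bar> \<le>
       C1 * C0\<^sup>2 * (\<tau>\<^sup>2 * Q)" by (simp add: PQ)
    have "laplace_const * C0 * C2 * (\<tau> * (P / real k)) \<le> laplace_const * C0 * C2 * ((\<tau> + \<tau>\<^sup>2) * (P / real k + Q))"
      using laplace_const C0 C2 \<tau> PQ by (intro mult_left_mono mult_mono) auto
    moreover have "C1 * C0\<^sup>2 * (\<tau>\<^sup>2 * Q) \<le> C1 * C0\<^sup>2 * ((\<tau> + \<tau>\<^sup>2) * (P / real k + Q))"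
      using C1 C0 \<tau> PQ by (intro mult_left_mono mult_mono) auto
    ultimately have "\<bar>mean_at n k (\<lambda>y. exp (- (\<tau> * scaled n k y))) - F \<tau> ^ m\<bar> \<le>
      laplace_const * C0 * C2 * ((\<tau> + \<tau>\<^sup>2) * (P / real k + Q)) + C1 * C0\<^sup>2 * ((\<tau> + \<tau>\<^sup>2) * (P / real k + Q))"
      using 1 2 by linarith
    also have "\<dots> = C * (\<tau> + \<tau>\<^sup>2) * (P / real k + Q)" by (simp add: C_def algebra_simps)
    finally show ?thesis by (simp add: P_def Q_def)
  qed
  with C show ?thesis using that by blast
qed

end

section \<open>The late phase: an almost conserved quantity\<close>

lemma pochhammer_ratio_prod:
  fixes x d :: real
  assumes "x > 0"
  shows "pochhammer (x + d) n / pochhammer x n = (\<Prod>i<n. 1 + d / (x + real i))"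
proof (induction n)
  case (Suc n)
  have "(x + d + real n) / (x + real n) = 1 + d / (x + real n)"
    using assms by (simp add: field_simps)
  then show ?case using Suc by (simp add: pochhammer_Suc flip: times_divide_times_eq)
qed simp

lemma prod_one_minus_approx:
  fixes x :: "'a \<Rightarrow> real"
  assumes I: "finite I" and x: "\<And>i. i \<in> I \<Longrightarrow> 0 \<le> x i \<and> x i \<le> 1"
  shows "1 - (\<Sum>i\<in>I. x i) \<le> (\<Prod>i\<in>I. 1 - x i)" "(\<Prod>i\<in>I. 1 - x i) \<le> 1 - (\<Sum>i\<in>I. x i) + (\<Sum>i\<in>I. x i)\<^sup>2"
proof -
  show "1 - (\<Sum>i\<in>I. x i) \<le> (\<Prod>i\<in>I. 1 - x i)"
    using I x
  proof (induction I rule: finite_induct)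
    case (insert j I)
    have p: "(\<Prod>i\<in>I. 1 - x i) \<le> 1" using insert by (intro prod_le_1) auto
    have "x j * (\<Prod>i\<in>I. 1 - x i) \<le> x j * 1" using insert p by (intro mult_left_mono) auto
    moreover have "1 - (\<Sum>i\<in>I. x i) \<le> (\<Prod>i\<in>I. 1 - x i)" using insert by auto
    ultimately show ?case using insert by (simp add: algebra_simps)
  qed simp
  have "(\<Prod>i\<in>I. 1 - x i) \<le> (\<Prod>i\<in>I. exp (- x i))"
  proof (rule prod_mono)
    fix i assume "i \<in> I"
    then show "0 \<le> 1 - x i \<and> 1 - x i \<le> exp (- x i)" using x exp_ge_add_one_self[of "- x i"] by auto
  qed
  also have "\<dots> = exp (- (\<Sum>i\<in>I. x i))" by (simp add: exp_sum[OF I] sum_negf flip: sum_negf)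
  also have "\<dots> \<le> 1 - (\<Sum>i\<in>I. x i) + (\<Sum>i\<in>I. x i)\<^sup>2"
    using x by (intro exp_minus_le sum_nonneg) auto
  finally show "(\<Prod>i\<in>I. 1 - x i) \<le> 1 - (\<Sum>i\<in>I. x i) + (\<Sum>i\<in>I. x i)\<^sup>2" .
qed

lemma sum_inverse_squares_shift:
  fixes c :: real
  assumes "c \<ge> 2"
  shows "(\<Sum>i<n. 1 / (c + real i)\<^sup>2) \<le> 2 / c"
proof -
  have "(\<Sum>i<n. 1 / (c + real i)\<^sup>2) \<le> 1 / (c - 1) - 1 / (c - 1 + real n)"
  proof (induction n)
    case (Suc n)
    have "1 / (c + real n)\<^sup>2 \<le> 1 / ((c - 1 + real n) * (c + real n))"
      using assms by (intro divide_left_mono) (auto simp: power2_eq_square)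
    also have "\<dots> = 1 / (c - 1 + real n) - 1 / (c - 1 + real (Suc n))"
      using assms by (simp add: divide_simps)
    finally show ?case using Suc by simp
  qed simp
  also have "\<dots> \<le> 1 / (c - 1)" using assms by simp
  also have "\<dots> \<le> 2 / c" using assms by (simp add: field_simps)
  finally show ?thesis .
qed

context pref_attach begin

text \<open>\<open>R\<close> and \<open>T\<close> are the two sides of \<open>step_mean_pochhammer\<close>: the average of \<open>T k\<close> over the number of
  edges that miss \<open>k\<close> is \<open>R k y\<close>.\<close>

definition R :: "nat \<Rightarrow> nat \<Rightarrow> real" where
  "R k y = pochhammer (A k + s) y / pochhammer (A k) y"

definition T :: "nat \<Rightarrow> nat \<Rightarrow> real" where
  "T k y = pochhammer (b k + s) y / pochhammer (b k) y"

text \<open>This solves the recursion \<open>norming_Suc\<close>, which is what turns \<open>T k\<close> into \<open>R (k - 1)\<close>; it is of order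
  \<open>k powr \<gamma>\<close>.\<close>

definition norming :: "nat \<Rightarrow> real" where
  "norming k = (\<Prod>i<m. growth s (real i - L - 2 * real m) k)"

text \<open>The quantity that is almost conserved during the late phase.  It vanishes if there is no active edge.\<close>

definition charge :: "nat \<Rightarrow> nat \<Rightarrow> real" where
  "charge k y = norming k * (R k y - 1)"

lemma R_prod: "k \<ge> 2 \<Longrightarrow> R k y = (\<Prod>i<y. 1 + s / (A k + real i))"
  unfolding R_def by (rule pochhammer_ratio_prod) (rule A_pos)

lemma T_prod: "k \<ge> 3 \<Longrightarrow> T k y = (\<Prod>i<y. 1 + s / (b k + real i))"
  unfolding T_def by (rule pochhammer_ratio_prod) (use b_pos[of k] in linarith)

lemma norming_growth_cond: "3 * L + (real i - L - 2 * real m) > 0"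
  using theta_pos L_eq by simp

lemma norming_pos: "norming k > 0"
  unfolding norming_def by (intro prod_pos growth_pos norming_growth_cond) (use s_pos in auto)

lemma norming_Suc: "k \<ge> 2 \<Longrightarrow> norming (Suc k) = norming k * (\<Prod>i<m. 1 + s / (A k + real i))"
proof -
  assume k: "k \<ge> 2"
  have "growth s (real i - L - 2 * real m) (Suc k) = growth s (real i - L - 2 * real m) k * (1 + s / (A k + real i))" for i
  proof -
    have "L * real (Suc k) + (real i - L - 2 * real m) = A k + real i" by (simp add: A_def algebra_simps)
    then show ?thesis by (simp only: growth_Suc[OF k])
  qed
  then show ?thesis by (simp add: norming_def prod.distrib)
qed

lemma norming_asymp:
  obtains \<kappa> where "\<kappa> > 0" "(\<lambda>k. norming k / real k powr \<gamma>) \<longlonglongrightarrow> \<kappa>"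
proof -
  have "\<forall>i. \<exists>c>0. (\<lambda>k. growth s (real i - L - 2 * real m) k / real k powr (s / L)) \<longlonglongrightarrow> c"
    using growth_asymp[OF _ norming_growth_cond, of s] s_pos by (metis less_imp_le)
  then obtain c where c: "\<And>i. c i > 0"
    "\<And>i. (\<lambda>k. growth s (real i - L - 2 * real m) k / real k powr (s / L)) \<longlonglongrightarrow> c i"
    by metis
  have "(\<lambda>k. \<Prod>i<m. growth s (real i - L - 2 * real m) k / real k powr (s / L)) \<longlonglongrightarrow> (\<Prod>i<m. c i)"
    by (intro tendsto_prod c)
  moreover have "(\<Prod>i<m. growth s (real i - L - 2 * real m) k / real k powr (s / L)) = norming k / real k powr \<gamma>" for k
  proof -
    have "(real k powr (s / L)) ^ m = real k powr \<gamma>"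
      by (cases "k = 0") (use m2 in \<open>simp_all add: \<gamma>_def powr_power mult_ac\<close>)
    then show ?thesis by (simp add: prod_dividef norming_def)
  qed
  moreover have "(\<Prod>i<m. c i) > 0" by (intro prod_pos) (use c in auto)
  ultimately show ?thesis using that by simp
qed

lemma weight_bounds:
  assumes k: "k \<ge> 3"
  shows "A (k - 1) \<ge> \<theta> * real k / 2" "b k \<ge> \<theta> * real k / 2" "A k \<ge> \<theta> * real k / 2" "A (k - 1) > 0"
    "b k \<ge> 2" "b k < A k"
proof -
  have k1: "k - 1 \<ge> 2" "Suc (k - 1) = k" using k by auto
  have "\<theta> * real (k - 1) \<le> A (k - 1)" by (rule A_lower[OF k1(1)])
  moreover have "\<theta> * (real k / 2) \<le> \<theta> * real (k - 1)" using theta_pos k by (intro mult_left_mono) auto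
  ultimately show 1: "A (k - 1) \<ge> \<theta> * real k / 2" by simp
  show "A (k - 1) > 0" by (rule A_pos[OF k1(1)])
  show 2: "b k \<ge> \<theta> * real k / 2" using b_Suc[of "k - 1"] 1 k1 by simp
  show "b k < A k" using A_eq_b[of k] theta_pos by simp
  then show "A k \<ge> \<theta> * real k / 2" using 2 by simp
  show "b k \<ge> 2" using b_pos[OF k] m2 by simp
qed

text \<open>The factor that is lost when a level is missed: then the \<open>m\<close> edges of the vertex do not become active.\<close>

definition G :: "nat \<Rightarrow> nat \<Rightarrow> real" where
  "G k y = (\<Prod>i<m. 1 + s / (A (k - 1) + real y + real i))"

text \<open>After a hit, the \<open>m\<close> edges of \<open>k\<close> and the \<open>N\<close> missing ones are active one level below.  The first
  \<open>m\<close> factors of the rising factorials are absorbed by the change of \<open>norming\<close>; the remaining \<open>N\<close> start at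
  \<open>A (k - 1) + m = b k\<close>.\<close>

lemma norming_R_hit:
  assumes k: "k \<ge> 3"
  shows "norming (k - 1) * R (k - 1) (m + N) = norming k * T k N"
proof -
  obtain j where j: "k = Suc j" "j \<ge> 2" using k by (cases k) auto
  have "R j (m + N) = (pochhammer (A j + s) m / pochhammer (A j) m) * (pochhammer (A j + s + real m) N / pochhammer (A j + real m) N)"
    unfolding R_def pochhammer_product' by simp
  also have "pochhammer (A j + s) m / pochhammer (A j) m = (\<Prod>i<m. 1 + s / (A j + real i))"
    by (rule pochhammer_ratio_prod[OF A_pos[OF j(2)]])
  also have "pochhammer (A j + s + real m) N / pochhammer (A j + real m) N = T k N"
    by (simp add: T_def j b_Suc add_ac)
  finally show ?thesis using norming_Suc[OF j(2)] by (simp add: j)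
qed

lemma norming_R_miss:
  assumes k: "k \<ge> 3"
  shows "norming (k - 1) * R (k - 1) y = norming k * T k y / G k y"
proof -
  obtain j where j: "k = Suc j" "j \<ge> 2" using k by (cases k) auto
  have Aj: "A j > 0" by (rule A_pos[OF j(2)])
  have Gp: "G k y > 0" unfolding G_def using s_pos Aj by (intro prod_pos) (auto simp: j intro!: add_pos_nonneg)
  have "R j (y + m) = R j y * (pochhammer (A j + s + real y) m / pochhammer (A j + real y) m)"
    unfolding R_def pochhammer_product' by simp
  also have "pochhammer (A j + s + real y) m / pochhammer (A j + real y) m = G k y"
    using pochhammer_ratio_prod[of "A j + real y" s m] Aj by (simp add: G_def j add_ac)
  finally have "norming j * R j y * G k y = norming k * T k y"
    using norming_R_hit[OF k, of y] by (simp add: j add.commute mult_ac)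
  then show ?thesis using Gp by (simp add: j field_simps)
qed

lemma G_inverse: assumes k: "k \<ge> 3"
  shows "1 / G k y = (\<Prod>i<m. 1 - s / (A (k - 1) + real y + real i + s))"
proof -
  have A: "A (k - 1) > 0" using weight_bounds[OF k] by simp
  have "1 / (1 + s / c) = 1 - s / (c + s)" if "c > 0" for c
    using that s_pos by (simp add: field_simps)
  then have "(\<Prod>i<m. 1 / (1 + s / (A (k - 1) + real y + real i))) = (\<Prod>i<m. 1 - s / (A (k - 1) + real y + real i + s))"
    using A by (intro prod.cong) auto
  then show ?thesis by (simp add: G_def prod_dividef)
qed

lemma G_bounds: assumes k: "k \<ge> 3"
  shows "G k y \<ge> 1" "1 - 1 / G k y \<le> 2 * real m * s / \<theta> / real k"
proof -
  note pb = weight_bounds[OF k]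
  show "G k y \<ge> 1" unfolding G_def using pb s_pos by (intro prod_ge_1) auto
  have "1 - 1 / G k y \<le> (\<Sum>i<m. s / (A (k - 1) + real y + real i + s))"
    unfolding G_inverse[OF k]
    using prod_one_minus_approx(1)[of "{..<m}" "\<lambda>i. s / (A (k - 1) + real y + real i + s)"] pb s_pos
    by (simp add: field_simps)
  also have "\<dots> \<le> (\<Sum>i<m. s / (\<theta> * real k / 2))"
    using pb s_pos theta_pos k by (intro sum_mono divide_left_mono) auto
  also have "\<dots> = 2 * real m * s / \<theta> / real k" by simp
  finally show "1 - 1 / G k y \<le> 2 * real m * s / \<theta> / real k" .
qed

text \<open>The choice \<open>s = \<theta> + 1\<close> is made for this: \<open>b k + s = A k + 1\<close>, so that in the product of the probability
  of a miss with \<open>T k y\<close> all factors but two cancel.\<close>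

lemma miss_T:
  assumes k: "k \<ge> 3"
  shows "miss k y * T k y = (A k + real y) / A k"
proof -
  have b: "pochhammer (b k) y > 0" using weight_bounds[OF k] by (intro pochhammer_pos) simp
  have A: "A k > 0" "pochhammer (A k) y > 0" using A_pos[of k] k by (auto intro: pochhammer_pos)
  have "b k + s = A k + 1" by (simp add: A_eq_b s_def)
  moreover have "A k * pochhammer (A k + 1) y = pochhammer (A k) y * (A k + real y)"
    using pochhammer_rec[of "A k" y] pochhammer_Suc[of "A k" y] by simp
  ultimately show ?thesis using b A by (simp add: miss_eq[OF k] T_def field_simps)
qed

text \<open>The drift of the charge at level \<open>k\<close> is a multiple of \<open>r k y - r k 0\<close>.  Each of its factors depends on
  \<open>y\<close>, but their product is almost the constant \<open>m s\<close>.\<close>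

definition r :: "nat \<Rightarrow> nat \<Rightarrow> real" where
  "r k y = (A k + real y) * (1 - 1 / G k y)"

text \<open>If a miss obeyed the same rule as a hit, the urn eigenfunction would make \<open>norming k * R k y\<close> a
  martingale.  The correction \<open>\<Delta>\<close> for a miss is explicit by \<open>miss_T\<close>, and as \<open>0\<close> is an absorbing state,
  its value at \<open>y = 0\<close> must be the change of \<open>norming\<close>.\<close>

lemma drift_eq:
  assumes k: "k \<ge> 3"
  shows "step_mean k y (\<lambda>z. charge (k - 1) (next_active y z)) - charge k y = - (norming k / A k) * (r k y - r k 0)"
proof -
  have gen: "step_mean k y (\<lambda>z. charge (k - 1) (next_active y z)) - charge k y =
     norming k - norming (k - 1) - norming k / A k * r k y" for y
  proof -
    define \<Delta> where "\<Delta> = norming k * T k y - norming (k - 1) * R (k - 1) y"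
    have "step_mean k y (\<lambda>z. charge (k - 1) (next_active y z)) =
      step_mean k y (\<lambda>z. norming k * T k (y - z) - (\<Delta> * (if z = 0 then 1 else 0) + norming (k - 1)))"
    proof (rule step_mean_cong)
      fix z assume z: "z \<le> y"
      show "charge (k - 1) (next_active y z) = norming k * T k (y - z) - (\<Delta> * (if z = 0 then 1 else 0) + norming (k - 1))"
      proof (cases "z = 0")
        case True then show ?thesis by (simp add: charge_def next_active_def \<Delta>_def algebra_simps)
      next
        case False
        then have "next_active y z = m + (y - z)" using z by (simp add: next_active_def)
        then show ?thesis using norming_R_hit[OF k, of "y - z"] False by (simp add: charge_def algebra_simps)
      qed
    qed
    also have "\<dots> = norming k * R k y - (\<Delta> * miss k y + norming (k - 1))"
      unfolding R_def T_def
      by (simp only: step_mean_diff step_mean_add step_mean_cmult step_mean_const step_mean_pochhammer[OF k] miss_def)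
    also have "\<Delta> * miss k y = norming k / A k * r k y"
    proof -
      have "\<Delta> = norming k * T k y * (1 - 1 / G k y)"
        unfolding \<Delta>_def norming_R_miss[OF k] by (simp add: right_diff_distrib)
      then have "\<Delta> * miss k y = norming k * (miss k y * T k y) * (1 - 1 / G k y)" by simp
      then show ?thesis by (simp add: miss_T[OF k] r_def)
    qed
    finally show ?thesis by (simp add: charge_def algebra_simps)
  qed
  have "step_mean k 0 (\<lambda>z. charge (k - 1) (next_active 0 z)) - charge k 0 = 0"
    by (simp add: step_mean_0 next_active_def charge_def R_def)
  then have "norming k - norming (k - 1) = norming k / A k * r k 0" using gen[of 0] by simp
  then show ?thesis using gen[of y] by (simp add: algebra_simps)
qed

text \<open>The bound is uniform in \<open>y\<close>: with \<open>v = A k + y\<close>, the factor \<open>1 - 1 / G k y\<close> is a sum of \<open>m\<close> terms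
  \<open>s / (v + O(1))\<close> up to its square, and \<open>v\<close> is at least of order \<open>k\<close>.\<close>

lemma r_approx:
  obtains C where "C > 0" "\<And>k y. k \<ge> 3 \<Longrightarrow> \<bar>r k y - real m * s\<bar> \<le> C / real k"
proof -
  define E where "E = 2 * real m * s * (L + real m + s) / \<theta>"
  define E2 where "E2 = 2 * real m * s / \<theta>"
  have E: "E > 0" using m2 s_pos L_pos theta_pos by (simp add: E_def)
  have E2: "E2 > 0" using m2 s_pos theta_pos by (simp add: E2_def)
  define C where "C = E + (real m * s + E) * E2"
  have "\<bar>r k y - real m * s\<bar> \<le> C / real k" if k: "k \<ge> 3" for k y
  proof -
    note pb = weight_bounds[OF k]
    define x where "x = (\<lambda>i. s / (A (k - 1) + real y + real i + s))"
    define S where "S = (\<Sum>i<m. x i)"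
    define v where "v = A k + real y"
    have v: "v > 0" using pb by (simp add: v_def)
    have Ak: "A k = A (k - 1) + L" using A_Suc[of "k - 1"] k by simp
    have x01: "0 \<le> x i \<and> x i \<le> 1" for i using pb s_pos by (auto simp: x_def divide_le_eq)
    have xk: "x i \<le> s / (\<theta> * real k / 2)" for i
      unfolding x_def using pb s_pos theta_pos k by (intro divide_left_mono) auto
    have S0: "S \<ge> 0" unfolding S_def using x01 by (intro sum_nonneg) auto
    have "S \<le> (\<Sum>i<m. s / (\<theta> * real k / 2))" unfolding S_def by (intro sum_mono xk)
    then have Sk: "S \<le> E2 / real k" by (simp add: E2_def mult_ac)
    have vx: "\<bar>v * x i - s\<bar> \<le> (L + real m + s) * (s / (\<theta> * real k / 2))" if "i < m" for i
    proof -
      have d: "A (k - 1) + real y + real i + s > 0" using pb s_pos by simp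
      have "v * x i - s = (L - real i - s) * x i"
        using d by (simp add: x_def v_def Ak field_simps)
      then have "\<bar>v * x i - s\<bar> = \<bar>L - real i - s\<bar> * x i" using x01[of i] by (simp add: abs_mult)
      also have "\<dots> \<le> (L + real m + s) * (s / (\<theta> * real k / 2))"
        using that L_pos s_pos xk x01 by (intro mult_mono) auto
      finally show ?thesis .
    qed
    have "v * S - real m * s = (\<Sum>i<m. v * x i - s)"
      by (simp add: S_def sum_subtractf sum_distrib_left)
    then have "\<bar>v * S - real m * s\<bar> \<le> (\<Sum>i<m. \<bar>v * x i - s\<bar>)" by (simp only: sum_abs)
    also have "\<dots> \<le> (\<Sum>i<m. (L + real m + s) * (s / (\<theta> * real k / 2)))" by (intro sum_mono vx) auto
    also have "\<dots> = E / real k" by (simp add: E_def)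
    finally have vS: "\<bar>v * S - real m * s\<bar> \<le> E / real k" .
    have "E / real k \<le> E" using E k by (simp add: field_simps mult_le_cancel_left1)
    then have vSb: "v * S \<le> real m * s + E" using vS by linarith
    have "v * S\<^sup>2 = (v * S) * S" by (simp add: power2_eq_square)
    also have "\<dots> \<le> (real m * s + E) * (E2 / real k)"
      using vSb Sk S0 v E m2 s_pos by (intro mult_mono) auto
    finally have vS2: "v * S\<^sup>2 \<le> (real m * s + E) * (E2 / real k)" .
    have "1 - S \<le> 1 / G k y" "1 / G k y \<le> 1 - S + S\<^sup>2"
      unfolding G_inverse[OF k] using prod_one_minus_approx[of "{..<m}" x] x01 by (auto simp: x_def S_def)
    then have "v * (S - S\<^sup>2) \<le> r k y" "r k y \<le> v * S"
      unfolding r_def v_def[symmetric] using v by (auto intro!: mult_left_mono)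
    then have "\<bar>r k y - real m * s\<bar> \<le> E / real k + (real m * s + E) * (E2 / real k)"
      unfolding right_diff_distrib using vS vS2 by linarith
    also have "\<dots> = C / real k" by (simp add: C_def add_divide_distrib)
    finally show ?thesis .
  qed
  moreover have "C > 0" using E E2 m2 s_pos by (simp add: C_def add_pos_pos)
  ultimately show ?thesis using that by blast
qed

text \<open>Relative to \<open>norming k\<close> the drift is of order \<open>1 / k\<^sup>2\<close>, which is summable, and this holds for all \<open>y\<close>.\<close>

lemma drift_bound:
  obtains C where "C > 0" "\<And>k y. k \<ge> 3 \<Longrightarrow>
    \<bar>step_mean k y (\<lambda>z. charge (k - 1) (next_active y z)) - charge k y\<bar> \<le> C * norming k / (real k)\<^sup>2"
proof -
  obtain C where C: "C > 0" "\<And>k y. k \<ge> 3 \<Longrightarrow> \<bar>r k y - real m * s\<bar> \<le> C / real k"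
    using r_approx by blast
  have "\<bar>step_mean k y (\<lambda>z. charge (k - 1) (next_active y z)) - charge k y\<bar> \<le> (4 * C / \<theta>) * norming k / (real k)\<^sup>2"
    if k: "k \<ge> 3" for k y
  proof -
    have "\<bar>r k y - r k 0\<bar> \<le> 2 * (C / real k)" using C(2)[OF k, of y] C(2)[OF k, of 0] by linarith
    moreover have "\<bar>norming k / A k\<bar> \<le> norming k / (\<theta> * real k / 2)"
    proof -
      have "norming k / A k \<le> norming k / (\<theta> * real k / 2)"
        using weight_bounds[OF k] theta_pos k norming_pos[of k] by (intro divide_left_mono) auto
      then show ?thesis using weight_bounds[OF k] norming_pos[of k] by simp
    qed
    ultimately have "\<bar>norming k / A k\<bar> * \<bar>r k y - r k 0\<bar> \<le> norming k / (\<theta> * real k / 2) * (2 * (C / real k))"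
      using theta_pos k norming_pos[of k] by (intro mult_mono) auto
    also have "\<dots> = (4 * C / \<theta>) * norming k / (real k)\<^sup>2"
      using theta_pos k by (simp add: field_simps power2_eq_square)
    finally show ?thesis unfolding drift_eq[OF k] by (simp add: abs_mult)
  qed
  moreover have "4 * C / \<theta> > 0" using C theta_pos by simp
  ultimately show ?thesis using that by blast
qed

lemma R_ge_1: "k \<ge> 2 \<Longrightarrow> R k y \<ge> 1"
  unfolding R_prod using s_pos A_pos[of k] by (intro prod_ge_1) auto

lemma R_Suc: "k \<ge> 2 \<Longrightarrow> R k (Suc y) = R k y * (1 + s / (A k + real y))"
  by (simp add: R_prod)

lemma T_R_bounds:
  obtains C where "C > 0" "\<And>k y. k \<ge> 3 \<Longrightarrow> R k y \<le> T k y \<and> T k y \<le> R k y * (1 + C / real k)"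
proof -
  define a where "a = 4 * s"
  define C where "C = a * exp a"
  have a: "a > 0" using s_pos by (simp add: a_def)
  have "R k y \<le> T k y \<and> T k y \<le> R k y * (1 + C / real k)" if k: "k \<ge> 3" for k y
  proof
    note pb = weight_bounds[OF k]
    have k2: "k \<ge> 2" using k by simp
    have A: "A k > 0" using A_pos[OF k2] .
    show "R k y \<le> T k y"
      unfolding R_prod[OF k2] T_prod[OF k] using pb A s_pos
      by (intro prod_mono) (auto intro!: divide_left_mono add_nonneg_nonneg divide_nonneg_pos)
    have fac: "1 + s / (b k + real i) \<le> (1 + s / (A k + real i)) * exp (s * \<theta> * (1 / (b k + real i)\<^sup>2))" for i
    proof -
      define c where "c = b k + real i"
      have c: "c > 0" "c + \<theta> > 0" using pb theta_pos by (auto simp: c_def)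
      have cA: "A k + real i = c + \<theta>" by (simp add: A_eq_b c_def)
      have "s / c = s / (c + \<theta>) + s * \<theta> / (c * (c + \<theta>))" 
      proof -
        have "s / c - s / (c + \<theta>) = (s * (c + \<theta>) - s * c) / (c * (c + \<theta>))" using c by (subst diff_frac_eq) auto
        then show ?thesis by (simp add: algebra_simps)
      qed
      also have "s * \<theta> / (c * (c + \<theta>)) \<le> s * \<theta> / (c * c)"
        using c s_pos theta_pos by (intro divide_left_mono mult_left_mono) auto
      finally have "1 + s / c \<le> 1 + s / (c + \<theta>) + 1 * (s * \<theta> / (c * c))" by simp
      also have "\<dots> \<le> 1 + s / (c + \<theta>) + (1 + s / (c + \<theta>)) * (s * \<theta> / (c * c))"
        using c s_pos theta_pos by (intro add_left_mono mult_right_mono) auto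
      also have "\<dots> = (1 + s / (c + \<theta>)) * (1 + s * \<theta> / (c * c))" by (simp add: algebra_simps)
      also have "\<dots> \<le> (1 + s / (c + \<theta>)) * exp (s * \<theta> / (c * c))"
        using c s_pos by (intro mult_left_mono exp_ge_add_one_self) auto
      finally show ?thesis by (simp add: cA c_def power2_eq_square)
    qed
    have "T k y \<le> (\<Prod>i<y. (1 + s / (A k + real i)) * exp (s * \<theta> * (1 / (b k + real i)\<^sup>2)))"
      unfolding T_prod[OF k] using fac pb s_pos by (intro prod_mono) (auto intro!: add_nonneg_nonneg divide_nonneg_pos)
    also have "\<dots> = R k y * exp (s * \<theta> * (\<Sum>i<y. 1 / (b k + real i)\<^sup>2))"
      unfolding R_prod[OF k2] prod.distrib by (simp add: exp_sum sum_distrib_left)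
    also have "\<dots> \<le> R k y * (1 + C / real k)"
    proof (intro mult_left_mono)
      have "s * \<theta> * (\<Sum>i<y. 1 / (b k + real i)\<^sup>2) \<le> s * \<theta> * (2 / b k)"
        using s_pos theta_pos by (intro mult_left_mono sum_inverse_squares_shift pb) auto
      also have "\<dots> \<le> s * \<theta> * (2 / (\<theta> * real k / 2))"
        using s_pos theta_pos pb k by (intro mult_left_mono divide_left_mono) auto
      also have "\<dots> = a / real k" using theta_pos by (simp add: a_def)
      finally have "exp (s * \<theta> * (\<Sum>i<y. 1 / (b k + real i)\<^sup>2)) \<le> exp (a / real k)" by simp
      also have "\<dots> \<le> 1 + C / real k"
      proof -
        define w where "w = a / real k"
        have w: "0 \<le> w" "w \<le> a" using a k by (auto simp: w_def field_simps mult_le_cancel_left1)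
        have "exp w * (1 - w) \<le> exp w * exp (- w)"
          using exp_ge_add_one_self[of "- w"] by (intro mult_left_mono) auto
        then have "exp w \<le> 1 + w * exp w" by (simp add: exp_minus algebra_simps)
        also have "\<dots> \<le> 1 + w * exp a" using w by (intro add_left_mono mult_left_mono) auto
        finally show ?thesis by (simp add: w_def C_def)
      qed
      finally show "exp (s * \<theta> * (\<Sum>i<y. 1 / (b k + real i)\<^sup>2)) \<le> 1 + C / real k" .
    qed (use R_ge_1[OF k2, of y] in simp)
    finally show "T k y \<le> R k y * (1 + C / real k)" .
  qed
  moreover have "C > 0" using a by (simp add: C_def)
  ultimately show ?thesis using that by blast
qed

lemma R_minus_lower:
  assumes k: "k \<ge> 2" and z: "z \<le> y"
  shows "R k y * (1 - real z * s / A k) \<le> R k (y - z)"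
proof -
  have A: "A k > 0" by (rule A_pos[OF k])
  define u where "u = s / A k"
  have u: "u > 0" using A s_pos by (simp add: u_def)
  have up: "R k (N + z) \<le> R k N * (1 + u) ^ z" for N z
  proof (induction z)
    case (Suc z)
    have "s / (A k + real (N + z)) \<le> u" unfolding u_def using A s_pos by (intro divide_left_mono) auto
    then have "R k (Suc (N + z)) \<le> R k (N + z) * (1 + u)"
      unfolding R_Suc[OF k] using R_ge_1[OF k, of "N + z"] by (intro mult_left_mono) auto
    also have "\<dots> \<le> R k N * (1 + u) ^ z * (1 + u)" using Suc u by (intro mult_right_mono) auto
    finally show ?case by (simp add: mult_ac)
  qed simp
  have "1 - real z * u \<le> (1 - u / (1 + u)) ^ z"
  proof -
    have "1 - real z * u \<le> 1 + real z * (- (u / (1 + u)))"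
      using u by (simp add: field_simps mult_le_cancel_left1)
    also have "\<dots> \<le> (1 + - (u / (1 + u))) ^ z"
      using u by (intro Bernoulli_inequality) (simp add: field_simps)
    finally show ?thesis by simp
  qed
  also have "1 - u / (1 + u) = 1 / (1 + u)" using u by (simp add: field_simps)
  finally have Be: "1 - real z * u \<le> 1 / (1 + u) ^ z" by (simp add: power_one_over)
  have "R k y * (1 - real z * u) \<le> R k y * (1 / (1 + u) ^ z)"
    using R_ge_1[OF k, of y] by (intro mult_left_mono Be) auto
  also have "\<dots> \<le> R k (y - z)" using up[of "y - z" z] z u by (simp add: field_simps)
  finally show ?thesis by (simp add: u_def)
qed

text \<open>The new charge differs from the old one by the passage from \<open>R\<close> to \<open>T\<close>, by the \<open>z\<close> edges that are used up
  at a hit, and by the factor \<open>G\<close> that is lost at a miss; each of these changes \<open>norming k * R k y\<close> by a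
  fraction of order at most \<open>(1 + z) / k\<close>.\<close>

lemma charge_step:
  obtains C where "C > 0" "\<And>k y z. k \<ge> 3 \<Longrightarrow> z \<le> y \<Longrightarrow>
    \<bar>charge (k - 1) (next_active y z) - charge k y\<bar> \<le> C * (norming k * R k y * (1 + real z) / real k)"
proof -
  obtain C1 where C1: "C1 > 0" "\<And>k y. k \<ge> 3 \<Longrightarrow> R k y \<le> T k y \<and> T k y \<le> R k y * (1 + C1 / real k)"
    using T_R_bounds by blast
  define C2 where "C2 = 2 * real m * s / \<theta>"
  define C3 where "C3 = 2 * s / \<theta>"
  have C2: "C2 > 0" and C3: "C3 > 0" using m2 s_pos theta_pos by (auto simp: C2_def C3_def)
  define C where "C = C1 + 2 * C2 + C3"
  have "\<bar>charge (k - 1) (next_active y z) - charge k y\<bar> \<le> C * (norming k * R k y * (1 + real z) / real k)"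
    if k: "k \<ge> 3" and z: "z \<le> y" for k y z
  proof -
    have k2: "k \<ge> 2" using k by simp
    note pb = weight_bounds[OF k]
    have R1: "R k y \<ge> 1" by (rule R_ge_1[OF k2])
    have sc: "norming k > 0" by (rule norming_pos)
    have TG: "T k y \<le> R k y + R k y * (C1 / real k)" using C1(2)[OF k, of y] by (simp add: algebra_simps)
    have T0: "T k y \<ge> R k y" using C1(2)[OF k] by blast
    have kk: "C2 / real k \<ge> 0" "C1 / real k \<ge> 0" "C3 / real k \<ge> 0" using C1 C2 C3 by auto
    have G1: "G k y \<ge> 1" "1 - 1 / G k y \<le> C2 / real k" using G_bounds[OF k] by (auto simp: C2_def)
    have G0: "G k 0 \<ge> 1" "1 - 1 / G k 0 \<le> C2 / real k" using G_bounds[OF k] by (auto simp: C2_def)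
    \<comment> \<open>the change of the charge is \<open>norming k\<close> times \<open>(Q - R k y) + (1 - 1 / G k 0)\<close>\<close>
    have sdiff: "norming (k - 1) = norming k * (1 / G k 0)"
      using norming_R_miss[OF k, of 0] by (simp add: R_def T_def)
    obtain Q where Q: "norming (k - 1) * R (k - 1) (next_active y z) = norming k * Q"
      and Qu: "Q - R k y \<le> R k y * (C1 / real k)"
      and Ql: "- (R k y * (C2 / real k + real z * (C3 / real k))) \<le> Q - R k y"
    proof (cases "z = 0")
      case True
      show ?thesis
      proof (rule that[of "T k y / G k y"])
        show "norming (k - 1) * R (k - 1) (next_active y z) = norming k * (T k y / G k y)"
          unfolding norming_R_miss[OF k, symmetric] times_divide_eq_right using True by (simp add: next_active_def)
        have "T k y / G k y \<le> T k y / 1" using G1 T0 R1 by (intro divide_left_mono) auto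
        then show "T k y / G k y - R k y \<le> R k y * (C1 / real k)" using TG by simp
        have "R k y * (1 - C2 / real k) \<le> R k y * (1 / G k y)" using G1 R1 by (intro mult_left_mono) auto
        also have "\<dots> \<le> T k y * (1 / G k y)" using G1 T0 by (intro mult_right_mono) auto
        finally show "- (R k y * (C2 / real k + real z * (C3 / real k))) \<le> T k y / G k y - R k y"
          using True by (simp add: algebra_simps)
      qed
    next
      case False
      show ?thesis
      proof (rule that[of "T k (y - z)"])
        have "next_active y z = m + (y - z)" using False z by (simp add: next_active_def)
        then show "norming (k - 1) * R (k - 1) (next_active y z) = norming k * T k (y - z)"
          using norming_R_hit[OF k] by simp
        have "T k (y - z) \<le> T k y"
          unfolding T_prod[OF k] using pb s_pos by (intro prod_mono2) (auto intro!: add_nonneg_nonneg divide_nonneg_pos)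
        then show "T k (y - z) - R k y \<le> R k y * (C1 / real k)" using TG by simp
        have "R k y * (1 - real z * s / A k) \<le> R k (y - z)" by (rule R_minus_lower[OF k2 z])
        also have "\<dots> \<le> T k (y - z)" using C1(2)[OF k] by blast
        finally have 1: "R k y * (1 - real z * s / A k) \<le> T k (y - z)" .
        have "real z * (s / A k) \<le> real z * (C3 / real k)"
        proof (intro mult_left_mono)
          have "s / A k \<le> s / (\<theta> * real k / 2)" using pb s_pos theta_pos k by (intro divide_left_mono) auto
          then show "s / A k \<le> C3 / real k" by (simp add: C3_def mult_ac)
        qed simp
        then have "R k y * (real z * (s / A k)) \<le> R k y * (C2 / real k + real z * (C3 / real k))"
          using R1 kk by (intro mult_left_mono) auto
        then show "- (R k y * (C2 / real k + real z * (C3 / real k))) \<le> T k (y - z) - R k y"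
          using 1 by (simp add: right_diff_distrib)
      qed
    qed
    have q1: "\<bar>Q - R k y\<bar> \<le> R k y * (C1 / real k + C2 / real k + real z * (C3 / real k))"
    proof -
      have "C2 / real k + real z * (C3 / real k) \<ge> 0"
        by (rule add_nonneg_nonneg[OF kk(1) mult_nonneg_nonneg[OF of_nat_0_le_iff kk(3)]])
      then have "R k y * (C1 / real k) \<ge> 0" "R k y * (C2 / real k + real z * (C3 / real k)) \<ge> 0"
        using R1 kk(2) by (intro mult_nonneg_nonneg; linarith)+
      then have "\<bar>Q - R k y\<bar> \<le> R k y * (C1 / real k) + R k y * (C2 / real k + real z * (C3 / real k))"
        using Qu Ql by linarith
      then show ?thesis by (simp only: distrib_left add.assoc)
    qed
    have q2: "\<bar>1 - 1 / G k 0\<bar> \<le> R k y * (C2 / real k)"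
    proof -
      have "1 / G k 0 \<le> 1" using G0 by simp
      then have "\<bar>1 - 1 / G k 0\<bar> \<le> 1 * (C2 / real k)" using G0 by simp
      also have "\<dots> \<le> R k y * (C2 / real k)" using R1 kk by (intro mult_right_mono) auto
      finally show ?thesis .
    qed
    have "\<bar>Q - R k y\<bar> + \<bar>1 - 1 / G k 0\<bar> \<le>
        R k y * (C1 / real k + C2 / real k + real z * (C3 / real k)) + R k y * (C2 / real k)"
      by (rule add_mono[OF q1 q2])
    also have "\<dots> = R k y * (C1 / real k + 2 * (C2 / real k) + real z * (C3 / real k))"
      by (simp add: algebra_simps)
    also have "\<dots> \<le> R k y * (C * (1 + real z) / real k)"
    proof (intro mult_left_mono)
      have "C1 + 2 * C2 + real z * C3 \<le> C * (1 + real z)"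
        using C1 C2 C3 by (simp add: C_def algebra_simps)
      then show "C1 / real k + 2 * (C2 / real k) + real z * (C3 / real k) \<le> C * (1 + real z) / real k"
        using k by (simp add: divide_right_mono flip: add_divide_distrib)
    qed (use R1 in simp)
    finally have B: "\<bar>Q - R k y\<bar> + \<bar>1 - 1 / G k 0\<bar> \<le> R k y * (C * (1 + real z) / real k)" .
    have "charge (k - 1) (next_active y z) - charge k y = norming k * ((Q - R k y) + (1 - 1 / G k 0))"
      using Q sdiff by (simp add: charge_def algebra_simps)
    then have "\<bar>charge (k - 1) (next_active y z) - charge k y\<bar> = norming k * \<bar>(Q - R k y) + (1 - 1 / G k 0)\<bar>"
      using sc by (simp add: abs_mult)
    also have "\<dots> \<le> norming k * (R k y * (C * (1 + real z) / real k))"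
      using B sc by (intro mult_left_mono) linarith+
    finally show ?thesis by (simp add: mult_ac)
  qed
  moreover have "C > 0" using C1 C2 C3 by (simp add: C_def)
  ultimately show ?thesis using that by blast
qed

section \<open>Size of the charge and of its increments\<close>

text \<open>An integer that is at least \<open>s\<close>: the rising factorial ratio with \<open>q0\<close> in the place of \<open>s\<close> is a polynomial in \<open>y\<close>, so
  that its means are controlled by moments.\<close>

definition q0 :: nat where "q0 = nat \<lceil>s\<rceil>"

lemma q0: "s \<le> real q0" by (simp add: q0_def) linarith

lemma R_upper:
  assumes k: "k \<ge> 2"
  shows "R k y \<le> (1 + real y / (\<theta> * real k)) ^ q0"
proof -
  have A: "A k > 0" by (rule A_pos[OF k])
  have "R k y \<le> pochhammer (A k + real q0) y / pochhammer (A k) y"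
    unfolding R_def using A q0 s_pos by (intro divide_right_mono pochhammer_mono_real pochhammer_nonneg_real) auto
  also have "\<dots> = pochhammer (A k + real y) q0 / pochhammer (A k) q0"
  proof -
    have "pochhammer (A k) q0 * pochhammer (A k + real q0) y = pochhammer (A k) y * pochhammer (A k + real y) q0"
      using pochhammer_product'[of "A k" q0 y] pochhammer_product'[of "A k" y q0] by (simp add: add.commute)
    moreover have "pochhammer (A k) q0 > 0" "pochhammer (A k) y > 0" using A by (auto intro: pochhammer_pos)
    ultimately show ?thesis by (simp add: field_simps)
  qed
  also have "\<dots> = (\<Prod>i<q0. 1 + real y / (A k + real i))" by (rule pochhammer_ratio_prod[OF A])
  also have "\<dots> \<le> (\<Prod>i<q0. 1 + real y / (\<theta> * real k))"
    using A A_lower[OF k] theta_pos k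
    by (intro prod_mono conjI add_left_mono divide_left_mono mult_pos_pos) (auto intro!: add_nonneg_nonneg divide_nonneg_pos)
  finally show ?thesis by simp
qed

text \<open>The first-order expansion of the charge, used at the end of the early phase, where \<open>y\<close> is small compared
  with \<open>k\<close>.\<close>

lemma R_linear:
  assumes k: "k \<ge> 2"
  shows "\<bar>R k y - 1 - s * (real y / A k)\<bar> \<le> (s * (real y / A k))\<^sup>2 * R k y"
proof -
  have A: "A k > 0" by (rule A_pos[OF k])
  define u where "u = s / A k"
  have u: "u > 0" using A s_pos by (simp add: u_def)
  have fac: "s / (A k + real y) \<le> u" "s / (A k + real y) \<ge> 0" for y
    unfolding u_def using A s_pos by (auto intro!: divide_left_mono divide_nonneg_pos)
  have mono: "R k y \<le> R k (Suc y)" for y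
    using R_ge_1[OF k, of y] fac(2)[of y] by (simp add: R_Suc[OF k] mult_le_cancel_left1)
  have one: "R k y - 1 \<le> real y * u * R k y" for y
  proof (induction y)
    case 0 then show ?case by (simp add: R_def)
  next
    case (Suc y)
    have "R k (Suc y) - 1 \<le> (R k y - 1) + R k y * u"
      unfolding R_Suc[OF k] using mult_left_mono[OF fac(1)[of y], of "R k y"] R_ge_1[OF k, of y]
      by (simp add: algebra_simps)
    also have "\<dots> \<le> real (Suc y) * u * R k y" using Suc by (simp add: algebra_simps)
    also have "\<dots> \<le> real (Suc y) * u * R k (Suc y)" using mono u by (intro mult_left_mono) auto
    finally show ?case .
  qed
  have up: "R k y - 1 - real y * u \<le> (real y * u)\<^sup>2 * R k y" for y
  proof (induction y)
    case 0 then show ?case by (simp add: R_def)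
  next
    case (Suc y)
    have "R k (Suc y) - 1 - real (Suc y) * u \<le> (R k y - 1 - real y * u) + (R k y - 1) * u"
      unfolding R_Suc[OF k] using mult_left_mono[OF fac(1)[of y], of "R k y"] R_ge_1[OF k, of y]
      by (simp add: algebra_simps)
    also have "\<dots> \<le> (real y * u)\<^sup>2 * R k y + (real y * u * R k y) * u"
      using Suc one u by (intro add_mono mult_right_mono) auto
    also have "\<dots> = ((real y)\<^sup>2 + real y) * (u\<^sup>2 * R k y)" by (simp add: power2_eq_square algebra_simps)
    also have "\<dots> \<le> (real (Suc y))\<^sup>2 * (u\<^sup>2 * R k (Suc y))"
    proof (rule mult_mono)
      show "(real y)\<^sup>2 + real y \<le> (real (Suc y))\<^sup>2" by (simp add: power2_eq_square algebra_simps)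
      show "u\<^sup>2 * R k y \<le> u\<^sup>2 * R k (Suc y)" using mono[of y] by (intro mult_left_mono) auto
      show "0 \<le> u\<^sup>2 * R k y" using R_ge_1[OF k, of y] by simp
    qed simp
    finally show ?case by (simp add: power_mult_distrib mult_ac)
  qed
  have low: "- ((real y * u)\<^sup>2) \<le> R k y - 1 - real y * u" for y
  proof (induction y)
    case 0 then show ?case by (simp add: R_def)
  next
    case (Suc y)
    have "u - s / (A k + real y) = real y * u / (A k + real y)"
      using A by (simp add: u_def field_simps)
    also have "\<dots> \<le> real y * u / A k" using A u by (intro divide_left_mono) auto
    also have "\<dots> = real y * u * (1 / A k)" by simp
    also have "\<dots> \<le> real y * u * u"
    proof (intro mult_left_mono)
      show "1 / A k \<le> u" unfolding u_def using A s_gt_1 by (intro divide_right_mono) auto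
    qed (use u in simp)
    finally have 1: "u - real y * u\<^sup>2 \<le> s / (A k + real y)" by (simp add: power2_eq_square)
    have "1 * (s / (A k + real y)) \<le> R k y * (s / (A k + real y))"
      using R_ge_1[OF k, of y] fac(2)[of y] by (intro mult_right_mono) auto
    then have 2: "R k (Suc y) - R k y \<ge> u - real y * u\<^sup>2"
      using 1 unfolding R_Suc[OF k] by (simp only: distrib_left)
    have "(real (Suc y) * u)\<^sup>2 = (real y * u)\<^sup>2 + 2 * (real y * u\<^sup>2) + u\<^sup>2"
      by (simp add: power2_eq_square algebra_simps)
    then have "(real y * u)\<^sup>2 + real y * u\<^sup>2 \<le> (real (Suc y) * u)\<^sup>2" by simp
    moreover have "real (Suc y) * u = real y * u + u" by (simp add: algebra_simps)
    ultimately show ?case using Suc 2 by linarith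
  qed
  have eq: "s * (real y / A k) = real y * u" by (simp add: u_def)
  have "(real y * u)\<^sup>2 * 1 \<le> (real y * u)\<^sup>2 * R k y" using R_ge_1[OF k, of y] by (intro mult_left_mono) auto
  then show ?thesis unfolding eq using up[of y] low[of y] by (simp add: abs_le_iff)
qed

text \<open>
  The exponent that links the miss probability to the charge: both \<open>- ln (miss k y)\<close> and \<open>ln (R k y)\<close> are
  sums of logarithms, with terms close to \<open>\<theta> / (A k + i)\<close> and \<open>s / (A k + i)\<close>.
\<close>

definition q :: real where "q = \<theta> / s"

lemma q_bounds: "0 < q" "q < 1" using theta_pos by (auto simp: q_def s_def)

text \<open>The terms of the two sums of logarithms, one of them multiplied by \<open>q\<close>, differ by \<open>O(1 / (b k + i)\<^sup>2)\<close>, and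
  this sums up to \<open>O(1 / k)\<close> over all \<open>i\<close>, so that the bound does not depend on \<open>y\<close>.\<close>

lemma miss_approx:
  obtains C where "C > 0" "\<And>k y. k \<ge> 3 \<Longrightarrow> \<bar>miss k y - R k y powr (- q)\<bar> \<le> C / real k"
proof -
  define D where "D = 2 * \<theta>\<^sup>2 + q * s\<^sup>2"
  have D: "D > 0" using theta_pos q_bounds s_pos by (simp add: D_def add_pos_pos)
  have "\<bar>miss k y - R k y powr (- q)\<bar> \<le> (4 * D / \<theta>) / real k" if k: "k \<ge> 3" for k y
  proof -
    have k2: "k \<ge> 2" using k by simp
    note pb = weight_bounds[OF k]
    have A: "A k > 0" by (rule A_pos[OF k2])
    have b: "b k > 0" using pb by simp
    define u where "u = (\<Sum>i<y. ln (1 + \<theta> / (b k + real i)))"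
    define v where "v = (\<Sum>i<y. q * ln (1 + s / (A k + real i)))"
    have pos: "1 + \<theta> / (b k + real i) > 0" "1 + s / (A k + real i) > 0" for i
      using A b theta_pos s_pos by (auto intro!: add_pos_nonneg divide_nonneg_pos)
    have u0: "u \<ge> 0" unfolding u_def using b theta_pos by (intro sum_nonneg ln_ge_zero) (auto intro!: divide_nonneg_pos)
    have v0: "v \<ge> 0" unfolding v_def using A s_pos q_bounds
      by (intro sum_nonneg mult_nonneg_nonneg ln_ge_zero) (auto intro!: divide_nonneg_pos)
    have "inverse (miss k y) = (\<Prod>i<y. 1 + \<theta> / (b k + real i))"
      using pochhammer_ratio_prod[OF b, of \<theta> y] by (simp add: miss_eq[OF k] A_eq_b)
    also have "\<dots> = exp u" unfolding u_def using pos by (simp add: exp_sum)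
    finally have "inverse (miss k y) = exp u" .
    then have mu: "miss k y = exp (- u)" by (metis exp_minus inverse_inverse_eq)
    have "ln (R k y) = (\<Sum>i<y. ln (1 + s / (A k + real i)))"
      unfolding R_prod[OF k2]
    proof (rule ln_prod)
      show "1 + s / (A k + real i) \<noteq> 0" for i using pos(2)[of i] by linarith
    qed simp
    then have rv: "R k y powr (- q) = exp (- v)"
      using R_ge_1[OF k2, of y] by (simp add: powr_def v_def sum_distrib_left sum_negf)
    have term_le: "\<bar>ln (1 + \<theta> / (b k + real i)) - q * ln (1 + s / (A k + real i))\<bar> \<le> D * (1 / (b k + real i)\<^sup>2)" for i
    proof -
      define c where "c = b k + real i"
      have c: "c > 0" using b by (simp add: c_def)
      have cA: "A k + real i = c + \<theta>" by (simp add: A_eq_b c_def)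
      have 1: "\<bar>ln (1 + \<theta> / c) - \<theta> / c\<bar> \<le> (\<theta> / c)\<^sup>2" using c theta_pos by (intro ln_one_plus_approx) simp
      have "\<bar>ln (1 + s / (c + \<theta>)) - s / (c + \<theta>)\<bar> \<le> (s / (c + \<theta>))\<^sup>2"
        using c theta_pos s_pos by (intro ln_one_plus_approx) simp
      also have "\<dots> \<le> (s / c)\<^sup>2" using c theta_pos s_pos by (intro power_mono divide_left_mono) auto
      finally have "\<bar>ln (1 + s / (c + \<theta>)) - s / (c + \<theta>)\<bar> \<le> (s / c)\<^sup>2" .
      then have qs: "q * \<bar>ln (1 + s / (c + \<theta>)) - s / (c + \<theta>)\<bar> \<le> q * (s / c)\<^sup>2"
        using q_bounds(1) by (simp only: mult_left_mono less_imp_le)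
      have 2: "\<bar>q * ln (1 + s / (c + \<theta>)) - \<theta> / (c + \<theta>)\<bar> \<le> q * (s / c)\<^sup>2"
      proof -
        have "q * ln (1 + s / (c + \<theta>)) - \<theta> / (c + \<theta>) = q * (ln (1 + s / (c + \<theta>)) - s / (c + \<theta>))"
          using s_pos by (simp add: q_def algebra_simps)
        then show ?thesis using q_bounds qs by (simp add: abs_mult)
      qed
      have "\<theta> / c - \<theta> / (c + \<theta>) = \<theta>\<^sup>2 / (c * (c + \<theta>))"
        using c theta_pos by (subst diff_frac_eq) (auto simp: power2_eq_square algebra_simps)
      also have "\<dots> \<le> \<theta>\<^sup>2 / (c * c)" using c theta_pos by (intro divide_left_mono mult_left_mono) auto
      finally have 3: "\<theta> / c - \<theta> / (c + \<theta>) \<le> (\<theta> / c)\<^sup>2" by (simp add: power2_eq_square)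
      have 4: "\<theta> / c - \<theta> / (c + \<theta>) \<ge> 0" using c theta_pos by (simp add: divide_left_mono)
      have "\<bar>ln (1 + \<theta> / c) - q * ln (1 + s / (c + \<theta>))\<bar> \<le> (\<theta> / c)\<^sup>2 + (\<theta> / c)\<^sup>2 + q * (s / c)\<^sup>2"
        using 1 2 3 4 by linarith
      also have "\<dots> = D * (1 / c\<^sup>2)" by (simp add: D_def power_divide add_divide_distrib)
      finally show ?thesis by (simp add: cA c_def)
    qed
    have "\<bar>u - v\<bar> \<le> (\<Sum>i<y. \<bar>ln (1 + \<theta> / (b k + real i)) - q * ln (1 + s / (A k + real i))\<bar>)"
      unfolding u_def v_def sum_subtractf[symmetric] by (rule sum_abs)
    also have "\<dots> \<le> (\<Sum>i<y. D * (1 / (b k + real i)\<^sup>2))" by (intro sum_mono term_le)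
    also have "\<dots> = D * (\<Sum>i<y. 1 / (b k + real i)\<^sup>2)" by (simp only: sum_distrib_left)
    also have "\<dots> \<le> D * (2 / b k)" using D by (intro mult_left_mono sum_inverse_squares_shift pb) auto
    also have "\<dots> \<le> D * (2 / (\<theta> * real k / 2))"
      using D pb theta_pos k by (intro mult_left_mono divide_left_mono) auto
    also have "\<dots> = (4 * D / \<theta>) / real k" by simp
    finally have "\<bar>u - v\<bar> \<le> (4 * D / \<theta>) / real k" .
    then show ?thesis unfolding mu rv using exp_minus_diff_le[OF u0 v0] by linarith
  qed
  moreover have "4 * D / \<theta> > 0" using D theta_pos by simp
  ultimately show ?thesis using that by blast
qed

lemma charge_step_L2:
  obtains C where "C > 0" "\<And>k y. k \<ge> 3 \<Longrightarrow>
    step_mean k y (\<lambda>z. (charge (k - 1) (next_active y z) - charge k y)\<^sup>2) \<le>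
      C * (norming k / real k)\<^sup>2 * (1 + real y / (\<theta> * real k)) ^ (2 * q0 + 2)"
proof -
  obtain C where C: "C > 0" "\<And>k y z. k \<ge> 3 \<Longrightarrow> z \<le> y \<Longrightarrow>
    \<bar>charge (k - 1) (next_active y z) - charge k y\<bar> \<le> C * (norming k * R k y * (1 + real z) / real k)"
    using charge_step by blast
  define D where "D = 1 + 3 * \<theta> + \<theta> * (\<theta> + 1)"
  have D: "D > 0" using theta_pos by (simp add: D_def add_pos_nonneg)
  have "step_mean k y (\<lambda>z. (charge (k - 1) (next_active y z) - charge k y)\<^sup>2) \<le>
      (C\<^sup>2 * D) * (norming k / real k)\<^sup>2 * (1 + real y / (\<theta> * real k)) ^ (2 * q0 + 2)"
    if k: "k \<ge> 3" for k y
  proof -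
    have k2: "k \<ge> 2" using k by simp
    define w where "w = real y / (\<theta> * real k)"
    have w: "w \<ge> 0" using theta_pos by (simp add: w_def)
    define B where "B = C * (norming k * R k y / real k)"
    have "step_mean k y (\<lambda>z. (charge (k - 1) (next_active y z) - charge k y)\<^sup>2) \<le>
      step_mean k y (\<lambda>z. B\<^sup>2 * (1 + (3 * real z + real z * (real z - 1))))"
    proof (rule step_mean_mono)
      fix z assume z: "z \<le> y"
      have "(charge (k - 1) (next_active y z) - charge k y)\<^sup>2 \<le> (B * (1 + real z))\<^sup>2"
      proof -
        have "\<bar>charge (k - 1) (next_active y z) - charge k y\<bar>\<^sup>2 \<le> (B * (1 + real z))\<^sup>2"
          using C(2)[OF k z] by (intro power_mono) (simp_all add: B_def mult_ac)
        then show ?thesis by simp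
      qed
      also have "\<dots> = B\<^sup>2 * (1 + (3 * real z + real z * (real z - 1)))"
        by (simp add: power_mult_distrib) (simp add: power2_eq_square algebra_simps)
      finally show "(charge (k - 1) (next_active y z) - charge k y)\<^sup>2 \<le> B\<^sup>2 * (1 + (3 * real z + real z * (real z - 1)))" .
    qed
    also have "\<dots> = B\<^sup>2 * (1 + (3 * (real y * \<theta> / A k) + real y * (real y - 1) * (\<theta> * (\<theta> + 1)) / (A k * (A k + 1))))"
      by (simp only: step_mean_cmult step_mean_add step_mean_const step_mean_hits[OF k] step_mean_hits2[OF k])
    also have "\<dots> \<le> B\<^sup>2 * (D * (1 + w)\<^sup>2)"
    proof (intro mult_left_mono)
      have "real y * \<theta> / A k \<le> real y * (1 / real k)"
        using mult_left_mono[OF hit_prob_bounds(1)[OF k2], of "real y"] by simp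
      then have 1: "real y * \<theta> / A k \<le> \<theta> * w" using theta_pos by (simp add: w_def)
      have 2: "real y * (real y - 1) * (\<theta> * (\<theta> + 1)) / (A k * (A k + 1)) \<le> \<theta> * (\<theta> + 1) * w\<^sup>2"
      proof -
        have "(\<theta> + 1) / \<theta> * ((real y)\<^sup>2 / (real k)\<^sup>2) = \<theta> * (\<theta> + 1) * w\<^sup>2"
          using theta_pos by (simp add: w_def power_divide power_mult_distrib) (simp add: power2_eq_square)
        then show ?thesis using hit_pairs_bound[OF k, of y] by simp
      qed
      have "1 + 3 * (\<theta> * w) + \<theta> * (\<theta> + 1) * w\<^sup>2 \<le> 1 * (1 + w)\<^sup>2 + 3 * \<theta> * (1 + w)\<^sup>2 + \<theta> * (\<theta> + 1) * (1 + w)\<^sup>2"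
      proof -
        have "1 \<le> (1 + w)\<^sup>2" "w \<le> (1 + w)\<^sup>2" "w\<^sup>2 \<le> (1 + w)\<^sup>2" using w by (auto simp: power2_eq_square algebra_simps)
        then show ?thesis using theta_pos
          by (intro add_mono) (simp_all add: mult.assoc mult_left_mono)
      qed
      also have "\<dots> = D * (1 + w)\<^sup>2" by (simp add: D_def algebra_simps)
      finally show "1 + (3 * (real y * \<theta> / A k) + real y * (real y - 1) * (\<theta> * (\<theta> + 1)) / (A k * (A k + 1))) \<le> D * (1 + w)\<^sup>2"
        using 1 2 by linarith
    qed simp
    also have "\<dots> \<le> (C * (norming k * (1 + w) ^ q0 / real k))\<^sup>2 * (D * (1 + w)\<^sup>2)"
    proof (intro mult_right_mono power_mono)
      show "B \<le> C * (norming k * (1 + w) ^ q0 / real k)"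
        unfolding B_def w_def using C norming_pos[of k] R_upper[OF k2, of y]
        by (intro mult_left_mono divide_right_mono) auto
      show "0 \<le> B" unfolding B_def using C(1) norming_pos[of k] R_ge_1[OF k2, of y] by simp
    qed (use D in auto)
    also have "\<dots> = (C\<^sup>2 * D) * (norming k / real k)\<^sup>2 * (1 + w) ^ (2 * q0 + 2)"
    proof -
      have W: "((1 + w) ^ q0)\<^sup>2 * (1 + w)\<^sup>2 = (1 + w) ^ (2 * q0 + 2)" by (simp only: power_add power_even_eq)
      have "(C * (norming k * (1 + w) ^ q0 / real k))\<^sup>2 * (D * (1 + w)\<^sup>2) =
         (C\<^sup>2 * D) * (norming k / real k)\<^sup>2 * (((1 + w) ^ q0)\<^sup>2 * (1 + w)\<^sup>2)"
        by (simp only: power_mult_distrib power_divide) (simp only: mult_ac times_divide_eq_right times_divide_eq_left)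
      then show ?thesis by (simp only: W)
    qed
    finally show ?thesis by (simp add: w_def)
  qed
  moreover have "C\<^sup>2 * D > 0" using C D by simp
  ultimately show ?thesis using that by blast
qed

text \<open>
  The typical size of the number of active edges at level \<open>k\<close>, relative to \<open>k\<close>.  The early phase consists
  of the levels where it is small.
\<close>

definition load :: "nat \<Rightarrow> nat \<Rightarrow> real" where
  "load n k = (real n / real k) powr \<alpha> / real k"

lemma one_plus_power_le: "(x::real) \<ge> 0 \<Longrightarrow> (1 + x) ^ p \<le> 2 ^ p * (1 + x ^ p)"
proof -
  assume x: "x \<ge> 0"
  have "(1 + x) ^ p \<le> (2 * max 1 x) ^ p" using x by (intro power_mono) auto
  also have "\<dots> = 2 ^ p * (max 1 x) ^ p" by (simp add: power_mult_distrib)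
  also have "\<dots> \<le> 2 ^ p * (1 + x ^ p)" using x by (intro mult_left_mono) (auto simp: max_def)
  finally show ?thesis .
qed

text \<open>A power of \<open>1 + y / k\<close> is split into a constant and a pure power; then \<open>moment_bound\<close> applies.\<close>

lemma mixed_moment:
  obtains C where "C > 0" "\<And>n k. 2 \<le> k \<Longrightarrow> k < n \<Longrightarrow>
    mean_at n k (\<lambda>y. (real y / real k) ^ i * (1 + real y / (\<theta> * real k)) ^ j) \<le> C * load n k ^ i * (1 + load n k) ^ j"
proof -
  obtain C1 where C1: "C1 > 0" "\<And>n k. 2 \<le> k \<Longrightarrow> k < n \<Longrightarrow>
    mean_at n k (\<lambda>y. real y ^ i) \<le> C1 * (real n / real k) powr (real i * \<alpha>)" using moment_bound by blast
  obtain C2 where C2: "C2 > 0" "\<And>n k. 2 \<le> k \<Longrightarrow> k < n \<Longrightarrow>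
    mean_at n k (\<lambda>y. real y ^ (i + j)) \<le> C2 * (real n / real k) powr (real (i + j) * \<alpha>)" using moment_bound by blast
  define C where "C = 2 ^ j * (C1 + (1 / \<theta>) ^ j * C2)"
  have C: "C > 0" using C1(1) C2(1) theta_pos by (simp add: C_def add_pos_pos)
  have "mean_at n k (\<lambda>y. (real y / real k) ^ i * (1 + real y / (\<theta> * real k)) ^ j) \<le> C * load n k ^ i * (1 + load n k) ^ j"
    if k: "2 \<le> k" "k < n" for n k
  proof -
    have kp: "real k > 0" "real n / real k > 0" using k by auto
    have l0: "load n k \<ge> 0" by (simp add: load_def)
    have pw: "(real n / real k) powr (real p * \<alpha>) / real k ^ p = load n k ^ p" for p
    proof -
      have "((real n / real k) powr \<alpha>) ^ p = (real n / real k) powr (real p * \<alpha>)"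
        using kp(2) by (simp only: powr_realpow[symmetric] powr_gt_zero powr_powr mult.commute)
      then show ?thesis by (simp only: load_def power_divide)
    qed
    have "mean_at n k (\<lambda>y. (real y / real k) ^ i * (1 + real y / (\<theta> * real k)) ^ j) \<le>
       mean_at n k (\<lambda>y. (2 ^ j / real k ^ i) * real y ^ i + (2 ^ j * (1 / \<theta>) ^ j / real k ^ (i + j)) * real y ^ (i + j))"
    proof (rule mean_at_mono)
      fix y
      have "(1 + real y / (\<theta> * real k)) ^ j \<le> 2 ^ j * (1 + (real y / (\<theta> * real k)) ^ j)"
        using theta_pos by (intro one_plus_power_le) auto
      then have "(real y / real k) ^ i * (1 + real y / (\<theta> * real k)) ^ j \<le>
        (real y / real k) ^ i * (2 ^ j * (1 + (real y / (\<theta> * real k)) ^ j))"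
        by (intro mult_left_mono) auto
      also have "\<dots> = (2 ^ j / real k ^ i) * real y ^ i + (2 ^ j * (1 / \<theta>) ^ j / real k ^ (i + j)) * real y ^ (i + j)"
        by (simp add: power_divide power_mult_distrib power_add algebra_simps)
      finally show "(real y / real k) ^ i * (1 + real y / (\<theta> * real k)) ^ j \<le>
         (2 ^ j / real k ^ i) * real y ^ i + (2 ^ j * (1 / \<theta>) ^ j / real k ^ (i + j)) * real y ^ (i + j)" .
    qed
    also have "\<dots> = (2 ^ j / real k ^ i) * mean_at n k (\<lambda>y. real y ^ i) +
       (2 ^ j * (1 / \<theta>) ^ j / real k ^ (i + j)) * mean_at n k (\<lambda>y. real y ^ (i + j))"
      by (simp only: mean_at_add mean_at_cmult)
    also have "\<dots> \<le> (2 ^ j / real k ^ i) * (C1 * (real n / real k) powr (real i * \<alpha>)) +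
       (2 ^ j * (1 / \<theta>) ^ j / real k ^ (i + j)) * (C2 * (real n / real k) powr (real (i + j) * \<alpha>))"
      using C1(2)[OF k] C2(2)[OF k] theta_pos by (intro add_mono mult_left_mono) auto
    also have "\<dots> = 2 ^ j * C1 * load n k ^ i + 2 ^ j * (1 / \<theta>) ^ j * C2 * load n k ^ (i + j)"
      unfolding pw[symmetric] by simp
    also have "\<dots> \<le> 2 ^ j * C1 * (load n k ^ i * (1 + load n k) ^ j) + 2 ^ j * (1 / \<theta>) ^ j * C2 * (load n k ^ i * (1 + load n k) ^ j)"
    proof (intro add_mono mult_left_mono)
      show "load n k ^ i \<le> load n k ^ i * (1 + load n k) ^ j"
        using l0 by (simp add: mult_le_cancel_left1)
      show "load n k ^ (i + j) \<le> load n k ^ i * (1 + load n k) ^ j"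
        unfolding power_add using l0 by (intro mult_left_mono power_mono) auto
    qed (use C1(1) C2(1) theta_pos in auto)
    also have "\<dots> = C * load n k ^ i * (1 + load n k) ^ j" by (simp add: C_def algebra_simps)
    finally show ?thesis .
  qed
  with C show ?thesis using that by blast
qed

end

section \<open>Counting the vertices that are hit\<close>

lemma sum_inverse_le_sqrt: "(\<Sum>j\<in>{i<..k}. 1 / real j) \<le> 2 * sqrt (real k)"
proof -
  have "(\<Sum>j\<in>{0<..k}. 1 / real j) \<le> 2 * sqrt (real k)"
  proof (induction k)
    case (Suc k)
    have "{0<..Suc k} = insert (Suc k) {0<..k}" by auto
    then have "(\<Sum>j\<in>{0<..Suc k}. 1 / real j) = 1 / real (Suc k) + (\<Sum>j\<in>{0<..k}. 1 / real j)" by simp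
    also have "\<dots> \<le> 1 / real (Suc k) + 2 * sqrt (real k)" using Suc by simp
    also have "\<dots> \<le> 2 * sqrt (real (Suc k))"
    proof -
      define a where "a = sqrt (real (Suc k))"
      define c where "c = sqrt (real k)"
      have ac: "c \<le> a" "c \<ge> 0" "a \<ge> 1" by (auto simp: a_def c_def)
      have sq: "a * a = real (Suc k)" "c * c = real k" by (auto simp: a_def c_def)
      have "a \<le> a * a" using ac by (simp add: mult_le_cancel_left1)
      then have "a + c \<le> 2 * (a * a)" using ac(1) by linarith
      then have "a + c \<le> 2 * real (Suc k)" by (simp only: sq)
      then have "1 / real (Suc k) \<le> 2 / (a + c)" using ac by (simp add: field_simps)
      also have "2 / (a + c) = 2 * (a - c)"
      proof -
        have "(a - c) * (a + c) = 1" using sq by (simp add: algebra_simps)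
        then show ?thesis using ac by (simp add: field_simps)
      qed
      finally show ?thesis by (simp add: a_def c_def)
    qed
    finally show ?case .
  qed simp
  moreover have "(\<Sum>j\<in>{i<..k}. 1 / real j) \<le> (\<Sum>j\<in>{0<..k}. 1 / real j)"
    by (rule sum_mono2) auto
  ultimately show ?thesis by linarith
qed

lemma sum_powr_tail:
  fixes a :: real
  assumes a: "a > 0" and k: "k \<ge> 1" and "k \<le> K"
  shows "(\<Sum>j\<in>{k<..K}. real j powr (- (1 + a))) \<le> 1 / a * real k powr (- a)"
proof -
  have "(\<Sum>j\<in>{k<..K}. real j powr (- (1 + a))) \<le> 1 / a * (real k powr (- a) - real K powr (- a))"
    using \<open>k \<le> K\<close>
  proof (induction K rule: dec_induct)
    case (step K)
    define x where "x = real (Suc K)"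
    have x: "x > 1" using step k by (simp add: x_def)
    have "a / x \<le> - a * ln (1 - 1 / x)"
      using ln_le_minus_one[of "1 - 1 / x"] x a mult_left_mono[of "ln (1 - 1 / x)" "- (1 / x)" a] by simp
    also have "\<dots> \<le> exp (- a * ln (1 - 1 / x)) - 1" using exp_ge_add_one_self[of "- a * ln (1 - 1 / x)"] by simp
    also have "exp (- a * ln (1 - 1 / x)) = (1 - 1 / x) powr (- a)" using x by (simp add: powr_def)
    finally have "x powr (- a) * (a / x) \<le> x powr (- a) * ((1 - 1 / x) powr (- a) - 1)"
      by (intro mult_left_mono) auto
    also have "\<dots> = (x * (1 - 1 / x)) powr (- a) - x powr (- a)"
    proof -
      have "(x * (1 - 1 / x)) powr (- a) = x powr (- a) * (1 - 1 / x) powr (- a)"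
        by (rule powr_mult)
      then show ?thesis by (simp only: right_diff_distrib mult_1_right)
    qed
    also have "x * (1 - 1 / x) = real K" using x by (simp add: x_def field_simps)
    finally have fin: "x powr (- a) * (a / x) \<le> real K powr (- a) - x powr (- a)" .
    have "a * x powr (- (1 + a)) \<le> real K powr (- a) - x powr (- a)"
    proof -
      have "- (1 + a) = - a + - 1" by simp
      then have "x powr (- (1 + a)) = x powr (- a) * (1 / x)"
        using x by (simp only: powr_add) (simp add: powr_minus_divide)
      then show ?thesis using fin by (simp add: mult_ac)
    qed
    then have "x powr (- (1 + a)) \<le> 1 / a * (real K powr (- a) - x powr (- a))"
      using a by (simp add: field_simps)
    moreover have "{k<..Suc K} = insert (Suc K) {k<..K}" using step by auto
    ultimately show ?case using step by (simp add: x_def right_diff_distrib)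
  qed simp
  also have "\<dots> \<le> 1 / a * (real k powr (- a) - 0)"
    using a by (intro mult_left_mono) auto
  finally show ?thesis by simp
qed

context pref_attach begin

text \<open>The chain counts steps; \<open>act\<close> and \<open>hit\<close> read it by level.\<close>

definition act :: "nat \<Rightarrow> nat \<Rightarrow> (nat \<Rightarrow> nat) \<Rightarrow> nat" where
  "act n k \<omega> = active \<omega> (n - 1 - k)"

definition hit :: "nat \<Rightarrow> nat \<Rightarrow> (nat \<Rightarrow> nat) \<Rightarrow> nat" where
  "hit n k \<omega> = \<omega> (n - 1 - k)"

text \<open>The chain with \<open>n - 3\<close> steps covers all levels from \<open>n - 1\<close> down to \<open>3\<close>, so that levels can be compared
  in one probability space.\<close>

definition mean :: "nat \<Rightarrow> ((nat \<Rightarrow> nat) \<Rightarrow> real) \<Rightarrow> real" where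
  "mean n f = measure_pmf.expectation (chain n (n - 3)) f"

lemma mean_mono: "(\<And>\<omega>. f \<omega> \<le> g \<omega>) \<Longrightarrow> mean n f \<le> mean n g"
  unfolding mean_def by (intro expectation_mono_finite) auto

lemma mean_add: "mean n (\<lambda>\<omega>. f \<omega> + g \<omega>) = mean n f + mean n g"
  and mean_cmult: "mean n (\<lambda>\<omega>. c * f \<omega>) = c * mean n f"
  and mean_const: "mean n (\<lambda>\<omega>. c) = c"
  and mean_sum: "mean n (\<lambda>\<omega>. \<Sum>j\<in>I. h j \<omega>) = (\<Sum>j\<in>I. mean n (h j))"
  by (simp_all add: mean_def)

lemma mean_act:
  assumes "2 \<le> k" "k < n"
  shows "mean n (\<lambda>\<omega>. f (act n k \<omega>)) = mean_at n k f"
  unfolding mean_def mean_at_def act_def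
proof (rule chain_expectation_prefix)
  show "n - 1 - k \<le> n - 3" using assms by simp
  fix \<omega> \<omega>' :: "nat \<Rightarrow> nat" assume "\<And>i. i < n - 1 - k \<Longrightarrow> \<omega> i = \<omega>' i"
  then have "active \<omega> (n - 1 - k) = active \<omega>' (n - 1 - k)" by (rule active_cong)
  then show "f (active \<omega> (n - 1 - k)) = f (active \<omega>' (n - 1 - k))" by simp
qed

lemma act_pred:
  assumes "1 \<le> k" "k < n" shows "act n (k - 1) \<omega> = next_active (act n k \<omega>) (hit n k \<omega>)"
proof -
  have "n - 1 - (k - 1) = Suc (n - 1 - k)" using assms by simp
  then show ?thesis by (simp only: act_def hit_def active.simps)
qed

lemma mean_act_hit:
  assumes k: "3 \<le> k" "k < n"
  shows "mean n (\<lambda>\<omega>. f (act n k \<omega>) (hit n k \<omega>)) = mean_at n k (\<lambda>y. step_mean k y (f y))"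
proof -
  have idx: "Suc (n - 1 - k) \<le> n - 3" "n - 1 - (n - 1 - k) = k" using k by auto
  have "mean n (\<lambda>\<omega>. f (act n k \<omega>) (hit n k \<omega>)) =
    measure_pmf.expectation (chain n (Suc (n - 1 - k))) (\<lambda>\<omega>. f (act n k \<omega>) (hit n k \<omega>))"
    unfolding mean_def
  proof (rule chain_expectation_prefix[OF idx(1)])
    fix \<omega> \<omega>' :: "nat \<Rightarrow> nat" assume *: "\<And>i. i < Suc (n - 1 - k) \<Longrightarrow> \<omega> i = \<omega>' i"
    then have "active \<omega> (n - 1 - k) = active \<omega>' (n - 1 - k)" by (intro active_cong) simp
    then show "f (act n k \<omega>) (hit n k \<omega>) = f (act n k \<omega>') (hit n k \<omega>')" using * by (simp add: act_def hit_def)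
  qed
  also have "\<dots> = mean_at n k (\<lambda>y. step_mean k y (f y))"
  proof -
    have "active (fun_upd \<omega> i z) i = active \<omega> i" for \<omega> i z by (rule active_cong) simp
    then show ?thesis
      unfolding chain_expectation_Suc mean_at_def act_def hit_def idx(2) step_mean_def by simp
  qed
  finally show ?thesis .
qed

lemma level_reindex:
  fixes n k k0 :: nat
  assumes "k \<le> k0" "k0 < n"
  shows "(\<Sum>i\<in>{n - 1 - k0..<n - 1 - k}. h i) = (\<Sum>j\<in>{k<..k0}. h (n - 1 - j))"
  by (rule sum.reindex_bij_witness[where i = "\<lambda>j. n - 1 - j" and j = "\<lambda>i. n - 1 - i"]) (use assms in auto)

lemma mean_martingale_abs:
  assumes k: "2 \<le> k" "k \<le> k0" "k0 < n"
    and zero: "\<And>j y. k < j \<Longrightarrow> j \<le> k0 \<Longrightarrow> step_mean j y (\<psi> j y) = 0"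
  shows "mean n (\<lambda>\<omega>. \<bar>\<Sum>j\<in>{k<..k0}. \<psi> j (act n j \<omega>) (hit n j \<omega>)\<bar>) \<le>
    sqrt (\<Sum>j\<in>{k<..k0}. mean_at n j (\<lambda>y. step_mean j y (\<lambda>z. (\<psi> j y z)\<^sup>2)))"
proof -
  have S: "(\<Sum>j\<in>{k<..k0}. \<psi> j (act n j \<omega>) (hit n j \<omega>)) =
     (\<Sum>i\<in>{n - 1 - k0..<n - 1 - k}. \<psi> (n - 1 - i) (active \<omega> i) (\<omega> i))" for \<omega>
    unfolding level_reindex[OF k(2,3)] act_def hit_def using k by (intro sum.cong) auto
  have "mean n (\<lambda>\<omega>. \<bar>\<Sum>j\<in>{k<..k0}. \<psi> j (act n j \<omega>) (hit n j \<omega>)\<bar>) \<le>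
    sqrt (mean n (\<lambda>\<omega>. (\<Sum>j\<in>{k<..k0}. \<psi> j (act n j \<omega>) (hit n j \<omega>))\<^sup>2))"
    unfolding mean_def by (rule expectation_abs_le_sqrt) simp
  also have "mean n (\<lambda>\<omega>. (\<Sum>j\<in>{k<..k0}. \<psi> j (act n j \<omega>) (hit n j \<omega>))\<^sup>2) =
    (\<Sum>i\<in>{n - 1 - k0..<n - 1 - k}. measure_pmf.expectation (chain n i)
        (\<lambda>\<omega>. step_mean (n - 1 - i) (active \<omega> i) (\<lambda>z. (\<psi> (n - 1 - i) (active \<omega> i) z)\<^sup>2)))"
    unfolding S mean_def
    by (rule chain_martingale_L2) (use k in \<open>auto intro!: zero\<close>)
  also have "\<dots> = (\<Sum>j\<in>{k<..k0}. mean_at n j (\<lambda>y. step_mean j y (\<lambda>z. (\<psi> j y z)\<^sup>2)))"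
    unfolding level_reindex[OF k(2,3)] mean_at_def using k by (intro sum.cong) auto
  finally show ?thesis .
qed

lemma norming_bounds:
  obtains l u where "l > 0" "u > 0"
    "\<And>k. k \<ge> 1 \<Longrightarrow> l * real k powr \<gamma> \<le> norming k \<and> norming k \<le> u * real k powr \<gamma>"
proof -
  obtain \<kappa> where \<kappa>: "\<kappa> > 0" "(\<lambda>k. norming k / real k powr \<gamma>) \<longlonglongrightarrow> \<kappa>" using norming_asymp by blast
  have pos: "norming k / real k powr \<gamma> > 0" if "k \<ge> 1" for k using norming_pos[of k] that by simp
  obtain l u where lu: "l > 0" "u > 0" "\<And>k. k \<ge> 1 \<Longrightarrow> l \<le> norming k / real k powr \<gamma> \<and> norming k / real k powr \<gamma> \<le> u"
    by (rule tendsto_pos_bounds[OF \<kappa>(2,1) pos]) auto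
  show ?thesis
  proof (rule that[OF lu(1,2)])
    fix k :: nat assume k: "k \<ge> 1"
    then have "real k powr \<gamma> > 0" by simp
    then show "l * real k powr \<gamma> \<le> norming k \<and> norming k \<le> u * real k powr \<gamma>"
      using lu(3)[OF k] by (simp add: field_simps)
  qed
qed

lemma load_antimono:
  assumes "1 \<le> k" "k \<le> j" shows "load n j \<le> load n k"
  unfolding load_def using assms alpha_pos
  by (intro frac_le powr_mono2 divide_left_mono) auto

lemma load_nonneg: "load n k \<ge> 0" by (simp add: load_def)

text \<open>Doob decomposition between the levels \<open>k0\<close> and \<open>k\<close>.  The conditional variances of the martingale part are
  of order \<open>(norming j / j)\<^sup>2\<close>, at most \<open>k0 powr (2 \<alpha>)\<close>, and there are at most \<open>k0\<close> of them; the square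
  root of their sum gives \<open>k0 powr (\<alpha> + 1 / 2)\<close>.  The drift is smaller.\<close>

lemma charge_deviation:
  obtains C where "C > 0" "\<And>n k k0. 2 \<le> k \<Longrightarrow> k \<le> k0 \<Longrightarrow> k0 < n \<Longrightarrow>
    mean n (\<lambda>\<omega>. \<bar>charge k (act n k \<omega>) - charge k0 (act n k0 \<omega>)\<bar>) \<le>
      C * (1 + load n k) ^ (q0 + 1) * real k0 powr (\<alpha> + 1 / 2)"
proof -
  obtain u where u: "u > 0" "\<And>k. k \<ge> 1 \<Longrightarrow> norming k \<le> u * real k powr \<gamma>"
    using norming_bounds by metis
  obtain D where D: "D > 0" "\<And>k y. k \<ge> 3 \<Longrightarrow>
    \<bar>step_mean k y (\<lambda>z. charge (k - 1) (next_active y z)) - charge k y\<bar> \<le> D * norming k / (real k)\<^sup>2"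
    using drift_bound by blast
  obtain V where V: "V > 0" "\<And>k y. k \<ge> 3 \<Longrightarrow>
    step_mean k y (\<lambda>z. (charge (k - 1) (next_active y z) - charge k y)\<^sup>2) \<le>
      V * (norming k / real k)\<^sup>2 * (1 + real y / (\<theta> * real k)) ^ (2 * q0 + 2)"
    using charge_step_L2 by blast
  obtain B where B: "B > 0" "\<And>n k. 2 \<le> k \<Longrightarrow> k < n \<Longrightarrow>
    mean_at n k (\<lambda>y. (real y / real k) ^ 0 * (1 + real y / (\<theta> * real k)) ^ (2 * q0 + 2)) \<le>
      B * load n k ^ 0 * (1 + load n k) ^ (2 * q0 + 2)"
    using mixed_moment by blast
  define C where "C = sqrt (V * B) * u + 2 * D * u"
  have C: "C > 0" using D(1) u(1) V(1) B(1) by (simp add: C_def add_pos_pos)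
  have "mean n (\<lambda>\<omega>. \<bar>charge k (act n k \<omega>) - charge k0 (act n k0 \<omega>)\<bar>) \<le>
      C * (1 + load n k) ^ (q0 + 1) * real k0 powr (\<alpha> + 1 / 2)"
    if k: "2 \<le> k" "k \<le> k0" "k0 < n" for n k k0
  proof -
    define l where "l = load n k"
    have l: "l \<ge> 0" by (simp add: l_def load_nonneg)
    \<comment> \<open>\<open>d\<close> is the predictable part of the increments and \<open>\<psi>\<close> the martingale part\<close>
    define d where "d = (\<lambda>j y. step_mean j y (\<lambda>z. charge (j - 1) (next_active y z)) - charge j y)"
    define \<psi> where "\<psi> = (\<lambda>j y z. (charge (j - 1) (next_active y z) - charge j y) - d j y)"
    have nj: "norming j / real j \<le> u * real k0 powr \<alpha>" if j: "j \<in> {k<..k0}" for j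
    proof -
      have "norming j / real j \<le> u * real j powr \<gamma> / real j"
        using u(2)[of j] j by (intro divide_right_mono) auto
      also have "\<dots> = u * real j powr \<alpha>" using j by (simp add: gamma_eq powr_add)
      also have "\<dots> \<le> u * real k0 powr \<alpha>" using j u alpha_pos by (intro mult_left_mono powr_mono2) auto
      finally show ?thesis .
    qed
    have tele: "charge k (act n k \<omega>) - charge k0 (act n k0 \<omega>) =
       (\<Sum>j\<in>{k<..k0}. \<psi> j (act n j \<omega>) (hit n j \<omega>)) + (\<Sum>j\<in>{k<..k0}. d j (act n j \<omega>))" for \<omega>
    proof -
      have "(\<Sum>j\<in>{k<..k0}. \<psi> j (act n j \<omega>) (hit n j \<omega>)) + (\<Sum>j\<in>{k<..k0}. d j (act n j \<omega>)) =
        (\<Sum>j\<in>{k<..k0}. charge (j - 1) (act n (j - 1) \<omega>) - charge j (act n j \<omega>))"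
        unfolding sum.distrib[symmetric]
      proof (rule sum.cong[OF refl])
        fix j assume "j \<in> {k<..k0}"
        then have "act n (j - 1) \<omega> = next_active (act n j \<omega>) (hit n j \<omega>)" using k by (intro act_pred) auto
        then show "\<psi> j (act n j \<omega>) (hit n j \<omega>) + d j (act n j \<omega>) = charge (j - 1) (act n (j - 1) \<omega>) - charge j (act n j \<omega>)"
          by (simp only: \<psi>_def diff_add_cancel)
      qed
      also have "\<dots> = charge k (act n k \<omega>) - charge k0 (act n k0 \<omega>)"
        using k(2)
      proof (induction k0 rule: dec_induct)
        case (step K)
        have "{k<..Suc K} = insert (Suc K) {k<..K}" using step by auto
        then show ?case using step by simp
      qed simp
      finally show ?thesis by simp
    qed
    have "mean n (\<lambda>\<omega>. \<bar>\<Sum>j\<in>{k<..k0}. \<psi> j (act n j \<omega>) (hit n j \<omega>)\<bar>) \<le>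
      sqrt (\<Sum>j\<in>{k<..k0}. mean_at n j (\<lambda>y. step_mean j y (\<lambda>z. (\<psi> j y z)\<^sup>2)))"
      by (rule mean_martingale_abs[OF k]) (simp only: \<psi>_def step_mean_diff step_mean_const, simp add: d_def)
    also have "\<dots> \<le> sqrt (\<Sum>j\<in>{k<..k0}. V * (u * real k0 powr \<alpha>)\<^sup>2 * (B * (1 + l) ^ (2 * q0 + 2)))"
    proof (intro real_sqrt_le_mono sum_mono)
      fix j assume j: "j \<in> {k<..k0}"
      then have j3: "j \<ge> 3" "j < n" using k by auto
      have "mean_at n j (\<lambda>y. step_mean j y (\<lambda>z. (\<psi> j y z)\<^sup>2)) \<le>
        mean_at n j (\<lambda>y. V * (norming j / real j)\<^sup>2 * ((real y / real j) ^ 0 * (1 + real y / (\<theta> * real j)) ^ (2 * q0 + 2)))"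
      proof (rule mean_at_mono)
        fix y
        define f where "f = (\<lambda>z. charge (j - 1) (next_active y z) - charge j y)"
        have dm: "d j y = step_mean j y f" by (simp only: f_def step_mean_diff step_mean_const) (simp add: d_def)
        have "step_mean j y (\<lambda>z. (\<psi> j y z)\<^sup>2) = step_mean j y (\<lambda>z. (f z)\<^sup>2 - 2 * d j y * f z + (d j y)\<^sup>2)"
          by (rule step_mean_cong) (simp add: \<psi>_def f_def power2_diff mult_ac)
        also have "\<dots> = step_mean j y (\<lambda>z. (f z)\<^sup>2) - (d j y)\<^sup>2"
          by (simp only: step_mean_add step_mean_diff step_mean_cmult step_mean_const) (simp add: dm power2_eq_square)
        also have "\<dots> \<le> step_mean j y (\<lambda>z. (f z)\<^sup>2)" by simp
        also have "\<dots> \<le> V * (norming j / real j)\<^sup>2 * (1 + real y / (\<theta> * real j)) ^ (2 * q0 + 2)"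
          unfolding f_def by (rule V(2)[OF j3(1)])
        finally show "step_mean j y (\<lambda>z. (\<psi> j y z)\<^sup>2) \<le>
          V * (norming j / real j)\<^sup>2 * ((real y / real j) ^ 0 * (1 + real y / (\<theta> * real j)) ^ (2 * q0 + 2))" by simp
      qed
      also have "\<dots> = V * (norming j / real j)\<^sup>2 *
         mean_at n j (\<lambda>y. (real y / real j) ^ 0 * (1 + real y / (\<theta> * real j)) ^ (2 * q0 + 2))"
        by (rule mean_at_cmult)
      also have "\<dots> \<le> V * (u * real k0 powr \<alpha>)\<^sup>2 * (B * (1 + l) ^ (2 * q0 + 2))"
      proof (rule mult_mono)
        show "V * (norming j / real j)\<^sup>2 \<le> V * (u * real k0 powr \<alpha>)\<^sup>2"
          using V(1) nj[OF j] norming_pos[of j] by (intro mult_left_mono power_mono) auto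
        have "mean_at n j (\<lambda>y. (real y / real j) ^ 0 * (1 + real y / (\<theta> * real j)) ^ (2 * q0 + 2)) \<le>
            B * load n j ^ 0 * (1 + load n j) ^ (2 * q0 + 2)" using j3 by (intro B(2)) auto
        also have "\<dots> \<le> B * load n j ^ 0 * (1 + l) ^ (2 * q0 + 2)"
          unfolding l_def using B(1) j k load_antimono[of k j n] load_nonneg[of n j]
          by (intro mult_left_mono power_mono) auto
        finally show "mean_at n j (\<lambda>y. (real y / real j) ^ 0 * (1 + real y / (\<theta> * real j)) ^ (2 * q0 + 2)) \<le>
            B * (1 + l) ^ (2 * q0 + 2)" by simp
        show "0 \<le> mean_at n j (\<lambda>y. (real y / real j) ^ 0 * (1 + real y / (\<theta> * real j)) ^ (2 * q0 + 2))"
          using theta_pos by (intro mean_at_nonneg) auto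
      qed (use V(1) in simp)
      finally show "mean_at n j (\<lambda>y. step_mean j y (\<lambda>z. (\<psi> j y z)\<^sup>2)) \<le>
        V * (u * real k0 powr \<alpha>)\<^sup>2 * (B * (1 + l) ^ (2 * q0 + 2))" .
    qed
    also have "\<dots> \<le> sqrt (real k0 * (V * (u * real k0 powr \<alpha>)\<^sup>2 * (B * (1 + l) ^ (2 * q0 + 2))))"
    proof (rule real_sqrt_le_mono)
      have "real (k0 - k) * (V * (u * real k0 powr \<alpha>)\<^sup>2 * (B * (1 + l) ^ (2 * q0 + 2))) \<le>
         real k0 * (V * (u * real k0 powr \<alpha>)\<^sup>2 * (B * (1 + l) ^ (2 * q0 + 2)))"
        using V(1) B(1) l by (intro mult_right_mono mult_nonneg_nonneg) auto
      then show "(\<Sum>j\<in>{k<..k0}. V * (u * real k0 powr \<alpha>)\<^sup>2 * (B * (1 + l) ^ (2 * q0 + 2))) \<le>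
         real k0 * (V * (u * real k0 powr \<alpha>)\<^sup>2 * (B * (1 + l) ^ (2 * q0 + 2)))" by simp
    qed
    also have "real k0 * (V * (u * real k0 powr \<alpha>)\<^sup>2 * (B * (1 + l) ^ (2 * q0 + 2))) =
       (V * B) * ((sqrt (real k0) * (u * real k0 powr \<alpha>)) * (1 + l) ^ (q0 + 1))\<^sup>2"
    proof -
      have W: "((1 + l) ^ (q0 + 1))\<^sup>2 = (1 + l) ^ (2 * q0 + 2)" 
        using power_even_eq[of "1 + l" "q0 + 1"] by (simp only: distrib_left mult_1_right)
      show ?thesis by (simp only: power_mult_distrib W real_sqrt_pow2 of_nat_0_le_iff) (simp add: mult_ac)
    qed
    also have "sqrt \<dots> = sqrt (V * B) * ((sqrt (real k0) * (u * real k0 powr \<alpha>)) * (1 + l) ^ (q0 + 1))"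
      using u(1) l by (simp only: real_sqrt_mult real_sqrt_abs) simp
    also have "sqrt (real k0) * (u * real k0 powr \<alpha>) = u * real k0 powr (\<alpha> + 1 / 2)"
      by (simp add: powr_half_sqrt powr_add mult_ac)
    finally have 1: "mean n (\<lambda>\<omega>. \<bar>\<Sum>j\<in>{k<..k0}. \<psi> j (act n j \<omega>) (hit n j \<omega>)\<bar>) \<le>
       sqrt (V * B) * (u * real k0 powr (\<alpha> + 1 / 2) * (1 + l) ^ (q0 + 1))" .
    have 2: "\<bar>\<Sum>j\<in>{k<..k0}. d j (act n j \<omega>)\<bar> \<le> 2 * D * u * real k0 powr (\<alpha> + 1 / 2) * (1 + l) ^ (q0 + 1)" for \<omega>
    proof -
      have "\<bar>\<Sum>j\<in>{k<..k0}. d j (act n j \<omega>)\<bar> \<le> (\<Sum>j\<in>{k<..k0}. \<bar>d j (act n j \<omega>)\<bar>)" by (rule sum_abs)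
      also have "\<dots> \<le> (\<Sum>j\<in>{k<..k0}. D * (u * real k0 powr \<alpha>) * (1 / real j))"
      proof (rule sum_mono)
        fix j assume j: "j \<in> {k<..k0}"
        have "\<bar>d j (act n j \<omega>)\<bar> \<le> D * norming j / (real j)\<^sup>2"
          unfolding d_def using j k by (intro D(2)) auto
        also have "\<dots> = D * (norming j / real j) * (1 / real j)" by (simp add: power2_eq_square)
        also have "\<dots> \<le> D * (u * real k0 powr \<alpha>) * (1 / real j)"
          using nj[OF j] D(1) by (intro mult_right_mono mult_left_mono) auto
        finally show "\<bar>d j (act n j \<omega>)\<bar> \<le> D * (u * real k0 powr \<alpha>) * (1 / real j)" .
      qed
      also have "\<dots> = D * (u * real k0 powr \<alpha>) * (\<Sum>j\<in>{k<..k0}. 1 / real j)" by (simp only: sum_distrib_left)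
      also have "\<dots> \<le> D * (u * real k0 powr \<alpha>) * (2 * sqrt (real k0))"
        using D(1) u(1) by (intro mult_left_mono sum_inverse_le_sqrt) auto
      also have "\<dots> = 2 * D * u * real k0 powr (\<alpha> + 1 / 2) * 1"
        by (simp add: powr_half_sqrt powr_add mult_ac)
      also have "\<dots> \<le> 2 * D * u * real k0 powr (\<alpha> + 1 / 2) * (1 + l) ^ (q0 + 1)"
        using D(1) u(1) l by (intro mult_left_mono one_le_power) auto
      finally show ?thesis .
    qed
    have "mean n (\<lambda>\<omega>. \<bar>charge k (act n k \<omega>) - charge k0 (act n k0 \<omega>)\<bar>) \<le>
      mean n (\<lambda>\<omega>. \<bar>\<Sum>j\<in>{k<..k0}. \<psi> j (act n j \<omega>) (hit n j \<omega>)\<bar> + 2 * D * u * real k0 powr (\<alpha> + 1 / 2) * (1 + l) ^ (q0 + 1))"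
    proof (rule mean_mono)
      fix \<omega>
      show "\<bar>charge k (act n k \<omega>) - charge k0 (act n k0 \<omega>)\<bar> \<le>
        \<bar>\<Sum>j\<in>{k<..k0}. \<psi> j (act n j \<omega>) (hit n j \<omega>)\<bar> + 2 * D * u * real k0 powr (\<alpha> + 1 / 2) * (1 + l) ^ (q0 + 1)"
        unfolding tele using 2[of \<omega>] by linarith
    qed
    also have "\<dots> = mean n (\<lambda>\<omega>. \<bar>\<Sum>j\<in>{k<..k0}. \<psi> j (act n j \<omega>) (hit n j \<omega>)\<bar>) +
      2 * D * u * real k0 powr (\<alpha> + 1 / 2) * (1 + l) ^ (q0 + 1)" by (simp only: mean_add mean_const)
    also have "\<dots> \<le> C * (1 + l) ^ (q0 + 1) * real k0 powr (\<alpha> + 1 / 2)"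
      using 1 by (simp add: C_def algebra_simps)
    finally show ?thesis by (simp add: l_def)
  qed
  with C show ?thesis using that by blast
qed

lemma miss_bounds:
  assumes k: "k \<ge> 3"
  shows "0 \<le> 1 - miss k y" "1 - miss k y \<le> real y / real k" "miss k y \<ge> 0"
    "step_mean k y (\<lambda>z. if z = 0 then 0 else 1) = 1 - miss k y"
proof -
  have "step_mean k y (\<lambda>z. 1 - (if z = 0 then 1 else 0)) = 1 - miss k y"
    by (simp only: step_mean_diff step_mean_const miss_def)
  moreover have "step_mean k y (\<lambda>z. 1 - (if z = 0 then 1 else 0)) = step_mean k y (\<lambda>z. if z = 0 then 0 else 1)"
    by (rule step_mean_cong) simp
  ultimately show 1: "step_mean k y (\<lambda>z. if z = 0 then 0 else 1) = 1 - miss k y" by simp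
  have "step_mean k y (\<lambda>z. 0) \<le> step_mean k y (\<lambda>z. if z = 0 then 0 else 1)" by (rule step_mean_mono) simp
  then show "0 \<le> 1 - miss k y" by (simp only: 1 step_mean_const)
  have "step_mean k y (\<lambda>z. if z = 0 then 0 else 1) \<le> step_mean k y real" by (rule step_mean_mono) auto
  also have "\<dots> = real y * (\<theta> / A k)" by (simp add: step_mean_hits[OF k])
  also have "\<dots> \<le> real y * (1 / real k)" using k by (intro mult_left_mono hit_prob_bounds) auto
  finally show "1 - miss k y \<le> real y / real k" by (simp add: 1)
  have "step_mean k y (\<lambda>z. 0) \<le> miss k y" unfolding miss_def by (rule step_mean_mono) simp
  then show "miss k y \<ge> 0" by (simp only: step_mean_const)
qed

lemma num_hit_levels:
  assumes n: "n \<ge> 3"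
  shows "real (num_hit \<omega> (n - 3)) = (\<Sum>j\<in>{2<..n - 1}. if hit n j \<omega> = 0 then 0 else 1)"
proof -
  have "real (num_hit \<omega> (n - 3)) = (\<Sum>i<n - 3. if \<omega> i = 0 then 0 else 1)"
    unfolding num_hit_def of_nat_sum by (intro sum.cong) auto
  also have "{..<n - 3} = {n - 1 - (n - 1)..<n - 1 - 2}" using n by auto
  also have "(\<Sum>i\<in>{n - 1 - (n - 1)..<n - 1 - 2}. if \<omega> i = 0 then 0 else 1) =
    (\<Sum>j\<in>{2<..n - 1}. if hit n j \<omega> = 0 then 0 else (1 :: real))"
    using n unfolding hit_def by (intro level_reindex) auto
  finally show ?thesis .
qed

text \<open>The number of hits is replaced by the sum of the conditional hit probabilities.  Levels up to \<open>k\<close>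
  contribute at most \<open>k\<close>; levels above \<open>k0\<close> contribute the sum of \<open>y / j\<close> in the mean, which is of the
  order of the mean of \<open>y\<close> at \<open>k0\<close>; on the levels between, the difference is a martingale with at most \<open>k0\<close> bounded
  increments.\<close>

lemma num_hit_approx:
  obtains C where "C > 0" "\<And>n k k0. 2 \<le> k \<Longrightarrow> k \<le> k0 \<Longrightarrow> k0 < n \<Longrightarrow>
    mean n (\<lambda>\<omega>. \<bar>real (num_hit \<omega> (n - 3)) - (\<Sum>j\<in>{k<..k0}. 1 - miss j (act n j \<omega>))\<bar>) \<le>
      real k + sqrt (real k0) + C * (real n / real k0) powr \<alpha>"
proof -
  obtain C1 where C1: "C1 > 0" "\<And>n k. 2 \<le> k \<Longrightarrow> k < n \<Longrightarrow>
    mean_at n k (\<lambda>y. real y ^ 1) \<le> C1 * (real n / real k) powr (real 1 * \<alpha>)"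
    using moment_bound[of 1] by blast
  have "mean n (\<lambda>\<omega>. \<bar>real (num_hit \<omega> (n - 3)) - (\<Sum>j\<in>{k<..k0}. 1 - miss j (act n j \<omega>))\<bar>) \<le>
      real k + sqrt (real k0) + (C1 / \<alpha>) * (real n / real k0) powr \<alpha>"
    if k: "2 \<le> k" "k \<le> k0" "k0 < n" for n k k0
  proof -
    define I where "I = (\<lambda>j \<omega>. if hit n j \<omega> = 0 then 0 else (1 :: real))"
    define \<psi> :: "nat \<Rightarrow> nat \<Rightarrow> nat \<Rightarrow> real" where "\<psi> = (\<lambda>j y z. (if z = 0 then 0 else 1) - (1 - miss j y))"
    have split: "{2<..n - 1} = {2<..k} \<union> {k<..k0} \<union> {k0<..n - 1}" using k by auto
    have S: "real (num_hit \<omega> (n - 3)) = (\<Sum>j\<in>{2<..k}. I j \<omega>) + (\<Sum>j\<in>{k<..k0}. I j \<omega>) + (\<Sum>j\<in>{k0<..n - 1}. I j \<omega>)" for \<omega>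
    proof -
      have "real (num_hit \<omega> (n - 3)) = (\<Sum>j\<in>{2<..k} \<union> {k<..k0} \<union> {k0<..n - 1}. I j \<omega>)"
        using num_hit_levels[of n \<omega>] k unfolding split[symmetric] I_def by simp
      also have "\<dots> = (\<Sum>j\<in>{2<..k} \<union> {k<..k0}. I j \<omega>) + (\<Sum>j\<in>{k0<..n - 1}. I j \<omega>)"
        by (rule sum.union_disjoint) (use k in auto)
      also have "(\<Sum>j\<in>{2<..k} \<union> {k<..k0}. I j \<omega>) = (\<Sum>j\<in>{2<..k}. I j \<omega>) + (\<Sum>j\<in>{k<..k0}. I j \<omega>)"
        by (rule sum.union_disjoint) (use k in auto)
      finally show ?thesis .
    qed
    have bot: "0 \<le> (\<Sum>j\<in>{2<..k}. I j \<omega>)" "(\<Sum>j\<in>{2<..k}. I j \<omega>) \<le> real k" for \<omega>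
    proof -
      show "0 \<le> (\<Sum>j\<in>{2<..k}. I j \<omega>)" by (intro sum_nonneg) (simp add: I_def)
      have "(\<Sum>j\<in>{2<..k}. I j \<omega>) \<le> (\<Sum>j\<in>{2<..k}. 1)" by (intro sum_mono) (simp add: I_def)
      also have "\<dots> \<le> real k" by simp
      finally show "(\<Sum>j\<in>{2<..k}. I j \<omega>) \<le> real k" .
    qed
    have top0: "0 \<le> (\<Sum>j\<in>{k0<..n - 1}. I j \<omega>)" for \<omega> by (intro sum_nonneg) (simp add: I_def)
    have top: "mean n (\<lambda>\<omega>. \<Sum>j\<in>{k0<..n - 1}. I j \<omega>) \<le> C1 / \<alpha> * (real n / real k0) powr \<alpha>"
    proof -
      have "mean n (\<lambda>\<omega>. \<Sum>j\<in>{k0<..n - 1}. I j \<omega>) = (\<Sum>j\<in>{k0<..n - 1}. mean n (I j))" by (rule mean_sum)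
      also have "\<dots> \<le> (\<Sum>j\<in>{k0<..n - 1}. C1 * real n powr \<alpha> * real j powr (- (1 + \<alpha>)))"
      proof (rule sum_mono)
        fix j assume "j \<in> {k0<..n - 1}"
        then have j: "3 \<le> j" "j < n" using k by auto
        have "mean n (I j) = mean_at n j (\<lambda>y. 1 - miss j y)"
          using mean_act_hit[OF j, of "\<lambda>y z. if z = 0 then 0 else 1"]
          by (simp only: I_def miss_bounds(4)[OF j(1)])
        also have "\<dots> \<le> mean_at n j (\<lambda>y. (1 / real j) * real y ^ 1)"
          using miss_bounds(2)[OF j(1)] by (intro mean_at_mono) simp
        also have "\<dots> = (1 / real j) * mean_at n j (\<lambda>y. real y ^ 1)" by (rule mean_at_cmult)
        also have "\<dots> \<le> (1 / real j) * (C1 * (real n / real j) powr (real 1 * \<alpha>))"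
          using j by (intro mult_left_mono C1(2)) auto
        also have "\<dots> = C1 * real n powr \<alpha> * real j powr (- (1 + \<alpha>))"
        proof -
          have "real j powr (- (1 + \<alpha>)) = 1 / (real j * real j powr \<alpha>)"
            using j by (simp only: powr_minus powr_add inverse_eq_divide powr_one of_nat_0_le_iff)
          then show ?thesis using j by (simp add: powr_divide)
        qed
        finally show "mean n (I j) \<le> C1 * real n powr \<alpha> * real j powr (- (1 + \<alpha>))" .
      qed
      also have "\<dots> = C1 * real n powr \<alpha> * (\<Sum>j\<in>{k0<..n - 1}. real j powr (- (1 + \<alpha>)))"
        by (simp only: sum_distrib_left)
      also have "\<dots> \<le> C1 * real n powr \<alpha> * (1 / \<alpha> * real k0 powr (- \<alpha>))"
        using k C1(1) alpha_pos by (intro mult_left_mono sum_powr_tail) auto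
      also have "\<dots> = C1 / \<alpha> * (real n / real k0) powr \<alpha>"
        using k by (simp add: powr_divide powr_minus_divide)
      finally show ?thesis .
    qed
    have mid: "mean n (\<lambda>\<omega>. \<bar>\<Sum>j\<in>{k<..k0}. \<psi> j (act n j \<omega>) (hit n j \<omega>)\<bar>) \<le> sqrt (real k0)"
    proof -
      have "mean n (\<lambda>\<omega>. \<bar>\<Sum>j\<in>{k<..k0}. \<psi> j (act n j \<omega>) (hit n j \<omega>)\<bar>) \<le>
        sqrt (\<Sum>j\<in>{k<..k0}. mean_at n j (\<lambda>y. step_mean j y (\<lambda>z. (\<psi> j y z)\<^sup>2)))"
      proof (rule mean_martingale_abs[OF k])
        fix j y assume "k < j"
        then have j: "j \<ge> 3" using k by simp
        show "step_mean j y (\<psi> j y) = 0"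
          unfolding \<psi>_def by (simp only: step_mean_diff step_mean_const miss_bounds(4)[OF j])
      qed
      also have "\<dots> \<le> sqrt (\<Sum>j\<in>{k<..k0}. 1)"
      proof (intro real_sqrt_le_mono sum_mono)
        fix j assume "j \<in> {k<..k0}"
        then have j: "j \<ge> 3" using k by simp
        have "mean_at n j (\<lambda>y. step_mean j y (\<lambda>z. (\<psi> j y z)\<^sup>2)) \<le> mean_at n j (\<lambda>y. step_mean j y (\<lambda>z. 1))"
        proof (intro mean_at_mono step_mean_mono)
          fix y z
          have "\<bar>\<psi> j y z\<bar> \<le> 1" using miss_bounds(1,3)[OF j, of y] by (auto simp: \<psi>_def)
          then have "\<bar>\<psi> j y z\<bar>\<^sup>2 \<le> 1\<^sup>2" by (intro power_mono) auto
          then show "(\<psi> j y z)\<^sup>2 \<le> 1" by simp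
        qed
        then show "mean_at n j (\<lambda>y. step_mean j y (\<lambda>z. (\<psi> j y z)\<^sup>2)) \<le> 1"
          by (simp only: step_mean_const mean_at_const)
      qed
      also have "\<dots> \<le> sqrt (real k0)" by simp
      finally show ?thesis .
    qed
    have "mean n (\<lambda>\<omega>. \<bar>real (num_hit \<omega> (n - 3)) - (\<Sum>j\<in>{k<..k0}. 1 - miss j (act n j \<omega>))\<bar>) \<le>
      mean n (\<lambda>\<omega>. (real k + \<bar>\<Sum>j\<in>{k<..k0}. \<psi> j (act n j \<omega>) (hit n j \<omega>)\<bar>) + (\<Sum>j\<in>{k0<..n - 1}. I j \<omega>))"
    proof (rule mean_mono)
      fix \<omega>
      have "(\<Sum>j\<in>{k<..k0}. \<psi> j (act n j \<omega>) (hit n j \<omega>)) = (\<Sum>j\<in>{k<..k0}. I j \<omega>) - (\<Sum>j\<in>{k<..k0}. 1 - miss j (act n j \<omega>))"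
        unfolding \<psi>_def I_def sum_subtractf[symmetric] by (rule refl)
      then show "\<bar>real (num_hit \<omega> (n - 3)) - (\<Sum>j\<in>{k<..k0}. 1 - miss j (act n j \<omega>))\<bar> \<le>
        (real k + \<bar>\<Sum>j\<in>{k<..k0}. \<psi> j (act n j \<omega>) (hit n j \<omega>)\<bar>) + (\<Sum>j\<in>{k0<..n - 1}. I j \<omega>)"
        unfolding S using bot[of \<omega>] top0[of \<omega>] by linarith
    qed
    also have "\<dots> = (real k + mean n (\<lambda>\<omega>. \<bar>\<Sum>j\<in>{k<..k0}. \<psi> j (act n j \<omega>) (hit n j \<omega>)\<bar>)) +
       mean n (\<lambda>\<omega>. \<Sum>j\<in>{k0<..n - 1}. I j \<omega>)"
      by (simp only: mean_add mean_const)
    also have "\<dots> \<le> real k + sqrt (real k0) + (C1 / \<alpha>) * (real n / real k0) powr \<alpha>"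
      using mid top by linarith
    finally show ?thesis .
  qed
  moreover have "C1 / \<alpha> > 0" using C1(1) alpha_pos by simp
  ultimately show ?thesis using that by blast
qed

end

section \<open>The limiting integral\<close>

lemma nn_integral_powr_diff:
  fixes p q :: real
  assumes "0 < p" "p \<le> 1" "q > 0"
  shows "(\<integral>\<^sup>+x. ennreal (q * x powr (q - 1)) * indicator {p..1} x \<partial>lborel) = ennreal (1 - p powr q)"
proof -
  have "(\<integral>\<^sup>+x. ennreal (q * x powr (q - 1)) * indicator {p..1} x \<partial>lborel) = ennreal (1 powr q - p powr q)"
  proof (rule nn_integral_FTC_Icc)
    fix x assume "x \<in> {p..1}"
    then have "x > 0" using assms by simp
    then show "((\<lambda>x. x powr q) has_real_derivative q * x powr (q - 1)) (at x)"
      by (auto intro!: derivative_eq_intros)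
  qed (use assms in auto)
  then show ?thesis by simp
qed

text \<open>The superlevel sets of the integrand are intervals \<open>(0, t)\<close>, whose lengths are powers of \<open>w * (\<sigma> / (1 - \<sigma>))\<close>.\<close>

lemma hit_profile_level:
  fixes w x \<gamma> \<sigma> :: real
  assumes "w > 0" "x > 0" "\<gamma> > 0" "0 < \<sigma>" "\<sigma> < 1"
  shows "1 / (1 + w * x powr (- \<gamma>)) < \<sigma> \<longleftrightarrow> x < (w * (\<sigma> / (1 - \<sigma>))) powr (1 / \<gamma>)"
proof -
  define u where "u = x powr \<gamma>"
  have u: "u > 0" "x powr (- \<gamma>) = 1 / u" using assms by (auto simp: u_def powr_minus_divide)
  define t where "t = w * (\<sigma> / (1 - \<sigma>))"
  have t: "t > 0" using assms by (simp add: t_def)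
  have "1 / (1 + w * x powr (- \<gamma>)) < \<sigma> \<longleftrightarrow> u < \<sigma> * (u + w)"
  proof -
    have "1 / (1 + w * x powr (- \<gamma>)) = u / (u + w)" unfolding u(2) using u(1) assms by (simp add: field_simps)
    then show ?thesis using u assms by (simp add: divide_less_eq)
  qed
  also have "\<dots> \<longleftrightarrow> u < t" using assms by (simp add: t_def field_simps)
  also have "\<dots> \<longleftrightarrow> x < t powr (1 / \<gamma>)"
  proof -
    have "t = (t powr (1 / \<gamma>)) powr \<gamma>" using t assms by (simp add: powr_powr)
    then have "u < t \<longleftrightarrow> x powr \<gamma> < (t powr (1 / \<gamma>)) powr \<gamma>" by (simp add: u_def)
    also have "\<dots> \<longleftrightarrow> x < t powr (1 / \<gamma>)"
    proof
      assume *: "x powr \<gamma> < (t powr (1 / \<gamma>)) powr \<gamma>"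
      show "x < t powr (1 / \<gamma>)"
      proof (rule ccontr)
        assume "\<not> x < t powr (1 / \<gamma>)"
        then have "(t powr (1 / \<gamma>)) powr \<gamma> \<le> x powr \<gamma>" using assms by (intro powr_mono2) auto
        then show False using * by simp
      qed
    qed (use assms in \<open>auto intro: powr_less_mono2\<close>)
    finally show ?thesis .
  qed
  finally show ?thesis by (simp add: t_def)
qed

text \<open>Writing \<open>1 - p powr q\<close> as an integral over levels and exchanging the integrals turns
  the integral into one over the level \<open>\<sigma>\<close>, with the length given by \<open>hit_profile_level\<close>: a Beta integral.\<close>

lemma nn_integral_hit_profile:
  fixes w \<gamma> q :: real
  assumes w: "w \<ge> 0" and \<gamma>: "\<gamma> > 1" and q: "q > 0"
  shows "(\<integral>\<^sup>+x. ennreal (1 - (1 + w * x powr (- \<gamma>)) powr (- q)) * indicator {0<..} x \<partial>lborel) =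
    ennreal (w powr (1 / \<gamma>) * (Gamma (1 - 1 / \<gamma>) * Gamma (q + 1 / \<gamma>) / Gamma q))"
proof (cases "w = 0")
  case True then show ?thesis by simp
next
  case False
  then have w: "w > 0" using w by simp
  have g0: "\<gamma> > 0" using \<gamma> by simp
  define t where "t = (\<lambda>\<sigma>. (w * (\<sigma> / (1 - \<sigma>))) powr (1 / \<gamma>))"
  define p where "p = (\<lambda>x. 1 / (1 + w * x powr (- \<gamma>)))"
  define h where "h = (\<lambda>x \<sigma>. ennreal (q * \<sigma> powr (q - 1)) * (indicator {0<..<1} \<sigma> * (if 0 < x \<and> x < t \<sigma> then 1 else 0)))"
  have p01: "0 < p x" "p x \<le> 1" for x
    using w by (auto simp: p_def divide_le_eq add_pos_nonneg)
  have pq: "(1 + w * x powr (- \<gamma>)) powr (- q) = p x powr q" for x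
  proof -
    have "1 + w * x powr (- \<gamma>) > 0" using w by (simp add: add_pos_nonneg)
    then show ?thesis by (simp add: p_def powr_minus_divide powr_divide)
  qed
  have meas [measurable]: "case_prod h \<in> borel_measurable (lborel \<Otimes>\<^sub>M lborel)"
    unfolding h_def t_def by measurable
  have in1: "(\<integral>\<^sup>+\<sigma>. h x \<sigma> \<partial>lborel) = ennreal (1 - (1 + w * x powr (- \<gamma>)) powr (- q)) * indicator {0<..} x" for x
  proof (cases "x > 0")
    case False then show ?thesis by (simp add: h_def)
  next
    case x: True
    have "(\<integral>\<^sup>+\<sigma>. h x \<sigma> \<partial>lborel) = (\<integral>\<^sup>+\<sigma>. ennreal (q * \<sigma> powr (q - 1)) * indicator {p x..1} \<sigma> \<partial>lborel)"
    proof (rule nn_integral_cong_AE)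
      have "AE \<sigma> in lborel. \<sigma> \<noteq> p x \<and> \<sigma> \<noteq> 1"
        by (intro AE_conjI AE_lborel_singleton)
      then show "AE \<sigma> in lborel. h x \<sigma> = ennreal (q * \<sigma> powr (q - 1)) * indicator {p x..1} \<sigma>"
      proof eventually_elim
        case (elim \<sigma>)
        have "\<sigma> \<in> {0<..<1} \<and> 0 < x \<and> x < t \<sigma> \<longleftrightarrow> \<sigma> \<in> {p x..1}"
        proof (cases "\<sigma> \<in> {0<..<1}")
          case True
          then have "p x < \<sigma> \<longleftrightarrow> x < t \<sigma>" unfolding p_def t_def using w x g0 by (intro hit_profile_level) auto
          then show ?thesis using True elim x by auto
        next
          case False
          then show ?thesis using elim p01[of x] by auto
        qed
        then show ?case by (auto simp: h_def indicator_def)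
      qed
    qed
    also have "\<dots> = ennreal (1 - p x powr q)" by (rule nn_integral_powr_diff) (use p01 q in auto)
    finally show ?thesis using x by (simp add: pq)
  qed
  have in2: "(\<integral>\<^sup>+x. h x \<sigma> \<partial>lborel) = indicator {0..1} \<sigma> * ennreal (w powr (1 / \<gamma>) * q * (\<sigma> powr (q + 1 / \<gamma> - 1) * (1 - \<sigma>) powr (1 - 1 / \<gamma> - 1)))"
    if \<sigma>: "\<sigma> \<noteq> 0" "\<sigma> \<noteq> 1" for \<sigma>
  proof (cases "\<sigma> \<in> {0<..<1}")
    case False
    then have "\<sigma> \<notin> {0..1}" using \<sigma> by auto
    then show ?thesis using False by (simp add: h_def)
  next
    case s: True
    have "(\<integral>\<^sup>+x. h x \<sigma> \<partial>lborel) = (\<integral>\<^sup>+x. ennreal (q * \<sigma> powr (q - 1)) * indicator {0<..<t \<sigma>} x \<partial>lborel)"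
      using s by (intro nn_integral_cong) (auto simp: h_def indicator_def)
    also have "\<dots> = ennreal (q * \<sigma> powr (q - 1)) * ennreal (t \<sigma>)"
      by (subst nn_integral_cmult_indicator) (auto simp: t_def)
    also have "\<dots> = ennreal (q * \<sigma> powr (q - 1) * t \<sigma>)" using q
      by (intro ennreal_mult[symmetric]) (auto simp: t_def)
    also have "q * \<sigma> powr (q - 1) * t \<sigma> = w powr (1 / \<gamma>) * q * (\<sigma> powr (q + 1 / \<gamma> - 1) * (1 - \<sigma>) powr (1 - 1 / \<gamma> - 1))"
    proof -
      have "t \<sigma> = w powr (1 / \<gamma>) * (\<sigma> powr (1 / \<gamma>) / (1 - \<sigma>) powr (1 / \<gamma>))"
        using s w by (simp add: t_def powr_mult powr_divide)
      moreover have "\<sigma> powr (q + 1 / \<gamma> - 1) = \<sigma> powr (q - 1) * \<sigma> powr (1 / \<gamma>)" by (simp flip: powr_add add: algebra_simps)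
      moreover have "(1 - \<sigma>) powr (1 - 1 / \<gamma> - 1) = 1 / (1 - \<sigma>) powr (1 / \<gamma>)"
        using s by (simp add: powr_minus_divide)
      ultimately show ?thesis by (simp add: mult_ac)
    qed
    finally show ?thesis using s by simp
  qed
  have "(\<integral>\<^sup>+x. ennreal (1 - (1 + w * x powr (- \<gamma>)) powr (- q)) * indicator {0<..} x \<partial>lborel) =
     (\<integral>\<^sup>+x. (\<integral>\<^sup>+\<sigma>. h x \<sigma> \<partial>lborel) \<partial>lborel)" by (simp only: in1)
  also have "\<dots> = (\<integral>\<^sup>+\<sigma>. (\<integral>\<^sup>+x. h x \<sigma> \<partial>lborel) \<partial>lborel)"
    by (rule lborel_pair.Fubini'[symmetric]) (rule meas)
  also have "\<dots> = (\<integral>\<^sup>+\<sigma>. indicator {0..1} \<sigma> * ennreal (w powr (1 / \<gamma>) * q * (\<sigma> powr (q + 1 / \<gamma> - 1) * (1 - \<sigma>) powr (1 - 1 / \<gamma> - 1))) \<partial>lborel)"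
  proof (rule nn_integral_cong_AE)
    have "AE \<sigma> in lborel. \<sigma> \<noteq> 0 \<and> \<sigma> \<noteq> (1 :: real)"
      by (intro AE_conjI AE_lborel_singleton)
    then show "AE \<sigma> in lborel. (\<integral>\<^sup>+x. h x \<sigma> \<partial>lborel) = indicator {0..1} \<sigma> * ennreal (w powr (1 / \<gamma>) * q * (\<sigma> powr (q + 1 / \<gamma> - 1) * (1 - \<sigma>) powr (1 - 1 / \<gamma> - 1)))"
      by eventually_elim (rule in2, auto)
  qed
  also have "\<dots> = ennreal (w powr (1 / \<gamma>) * (q * Beta (q + 1 / \<gamma>) (1 - 1 / \<gamma>)))"
  proof -
    have "((\<lambda>\<sigma>. w powr (1 / \<gamma>) * q * (\<sigma> powr (q + 1 / \<gamma> - 1) * (1 - \<sigma>) powr (1 - 1 / \<gamma> - 1))) has_integral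
       w powr (1 / \<gamma>) * q * Beta (q + 1 / \<gamma>) (1 - 1 / \<gamma>)) {0..1}"
    proof (intro has_integral_mult_right has_integral_Beta_real)
      show "q + 1 / \<gamma> > 0" using \<gamma> q by (intro add_pos_pos) auto
      show "1 - 1 / \<gamma> > 0" using \<gamma> by (simp add: field_simps)
    qed
    from nn_integral_has_integral_lebesgue'[OF _ this] show ?thesis
      using q by (simp add: mult.commute[of "indicator _ _"] mult.assoc)
  qed
  also have "q * Beta (q + 1 / \<gamma>) (1 - 1 / \<gamma>) = Gamma (1 - 1 / \<gamma>) * Gamma (q + 1 / \<gamma>) / Gamma q"
  proof -
    have "q \<notin> \<int>\<^sub>\<le>\<^sub>0" using q by auto
    then have "Gamma (q + 1) = q * Gamma q" by (rule Gamma_plus1)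
    then show ?thesis using q by (simp add: Beta_def mult_ac)
  qed
  finally show ?thesis .
qed

text \<open>The summand decreases in \<open>j\<close>, so the sum is compared with the integral.  The integral over \<open>(0, k + 1]\<close> is
  at most \<open>k + 1\<close>, because the integrand is at most \<open>1\<close>, and beyond \<open>K\<close> the integrand is at most
  \<open>w * x powr (- \<gamma>)\<close>.\<close>

lemma sum_hit_profile:
  fixes w \<gamma> q :: real
  assumes w: "w \<ge> 0" and \<gamma>: "\<gamma> > 1" and q: "0 < q" "q < 1" and k: "1 \<le> k" "k \<le> K"
  shows "\<bar>(\<Sum>j\<in>{k<..K}. 1 - (1 + w * real j powr (- \<gamma>)) powr (- q)) -
    w powr (1 / \<gamma>) * (Gamma (1 - 1 / \<gamma>) * Gamma (q + 1 / \<gamma>) / Gamma q)\<bar> \<le>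
    real k + 1 + w * (real K powr (- (\<gamma> - 1)) / (\<gamma> - 1))"
proof -
  define f where "f = (\<lambda>x::real. 1 - (1 + w * x powr (- \<gamma>)) powr (- q))"
  define I where "I = w powr (1 / \<gamma>) * (Gamma (1 - 1 / \<gamma>) * Gamma (q + 1 / \<gamma>) / Gamma q)"
  have pos: "q + 1 / \<gamma> > 0" "1 - 1 / \<gamma> > 0" using \<gamma> q by (auto intro: add_pos_pos)
  have I0: "I \<ge> 0" unfolding I_def
    using Gamma_real_pos[OF pos(1)] Gamma_real_pos[OF pos(2)] Gamma_real_pos[OF q(1)] by simp
  have I: "(\<integral>\<^sup>+x. ennreal (f x) * indicator {0<..} x \<partial>lborel) = ennreal I"
    unfolding f_def I_def by (rule nn_integral_hit_profile[OF w \<gamma> q(1)])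
  have base: "1 + w * x powr (- \<gamma>) \<ge> 1" for x :: real using w by simp
  have f0: "0 \<le> f x" "f x \<le> 1" for x
    using powr_mono2'[of "- q" 1 "1 + w * x powr (- \<gamma>)"] base[of x] q by (auto simp: f_def)
  have f_tail: "f x \<le> w * x powr (- \<gamma>)" for x
  proof -
    define u where "u = w * x powr (- \<gamma>)"
    have u: "u \<ge> 0" using w by (simp add: u_def)
    have "(1 + u) powr (- 1) \<le> (1 + u) powr (- q)" using u q by (intro powr_mono) auto
    moreover have "1 - u \<le> (1 + u) powr (- 1)" using u by (simp add: powr_minus_divide field_simps)
    ultimately show ?thesis by (simp add: f_def u_def)
  qed
  have mono: "f y \<le> f x" if "0 < x" "x \<le> y" for x y
  proof -
    have "w * y powr (- \<gamma>) \<le> w * x powr (- \<gamma>)" using that w \<gamma> by (intro mult_left_mono powr_mono2') auto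
    then show ?thesis unfolding f_def using base[of y] q by (intro diff_left_mono powr_mono2') auto
  qed
  have [measurable]: "f \<in> borel_measurable borel" unfolding f_def by measurable
  define S where "S = (\<Sum>j\<in>{k<..K}. f (real j))"
  have S0: "S \<ge> 0" unfolding S_def using f0 by (intro sum_nonneg) auto
  \<comment> \<open>the sum as the integral of a step function; \<open>d = - 1\<close> gives the lower and \<open>d = 0\<close> the upper step function\<close>
  have blk: "(\<integral>\<^sup>+x. (\<Sum>j\<in>{k<..K}. ennreal (f (real j)) * indicator {real j + d<..real j + d + 1} x) \<partial>lborel) = ennreal S" for d
  proof -
    have "(\<integral>\<^sup>+x. (\<Sum>j\<in>{k<..K}. ennreal (f (real j)) * indicator {real j + d<..real j + d + 1} x) \<partial>lborel) =
      (\<Sum>j\<in>{k<..K}. \<integral>\<^sup>+x. ennreal (f (real j)) * indicator {real j + d<..real j + d + 1} x \<partial>lborel)"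
      by (rule nn_integral_sum) simp
    also have "\<dots> = (\<Sum>j\<in>{k<..K}. ennreal (f (real j)))"
      by (intro sum.cong refl) (subst nn_integral_cmult_indicator, auto)
    also have "\<dots> = ennreal S" unfolding S_def using f0 by (intro sum_ennreal) auto
    finally show ?thesis .
  qed
  have disj: "(\<Sum>j\<in>{k<..K}. ennreal (f (real j)) * indicator {real j + d<..real j + d + 1} x) =
     (if i \<in> {k<..K} then ennreal (f (real i)) else 0)" if "real i + d < x" "x \<le> real i + d + 1" for i d x
  proof -
    have "(\<Sum>j\<in>{k<..K}. ennreal (f (real j)) * indicator {real j + d<..real j + d + 1} x) =
       (\<Sum>j\<in>{k<..K}. if j = i then ennreal (f (real i)) else 0)"
    proof (intro sum.cong refl)
      fix j
      have "x \<in> {real j + d<..real j + d + 1} \<longleftrightarrow> j = i"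
      proof
        assume "x \<in> {real j + d<..real j + d + 1}"
        then have "real j < real i + 1" "real i < real j + 1" using that by auto
        then show "j = i" by linarith
      qed (use that in auto)
      then show "ennreal (f (real j)) * indicator {real j + d<..real j + d + 1} x = (if j = i then ennreal (f (real i)) else 0)"
        by (auto simp: indicator_def)
    qed
    then show ?thesis by simp
  qed
  have "ennreal S \<le> ennreal I"
    unfolding I[symmetric] blk[of "- 1", symmetric]
  proof (rule nn_integral_mono)
    fix x :: real
    show "(\<Sum>j\<in>{k<..K}. ennreal (f (real j)) * indicator {real j + - 1<..real j + - 1 + 1} x) \<le> ennreal (f x) * indicator {0<..} x"
    proof (cases "x > 0")
      case True
      define i where "i = nat \<lceil>x\<rceil>"
      have i: "real i + - 1 < x" "x \<le> real i + - 1 + 1" using True by (auto simp: i_def) linarith+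
      show ?thesis unfolding disj[OF i] using True i mono[of x "real i"] by (auto intro: ennreal_leI)
    next
      case False
      have "(\<Sum>j\<in>{k<..K}. ennreal (f (real j)) * indicator {real j + - 1<..real j + - 1 + 1} x) = 0"
        using False k by (intro sum.neutral) (auto simp: indicator_def)
      then show ?thesis by simp
    qed
  qed
  then have up: "S \<le> I" using I0 by simp
  define tl where "tl = w * (real K powr (- (\<gamma> - 1)) / (\<gamma> - 1))"
  have tl0: "tl \<ge> 0" using w \<gamma> by (simp add: tl_def)
  have tail: "(\<integral>\<^sup>+x. indicator {real K..} x * ennreal (w * x powr (- \<gamma>)) \<partial>lborel) = ennreal tl"
  proof -
    have "((\<lambda>x. w * x powr (- \<gamma>)) has_integral w * (- (real K powr (- \<gamma> + 1)) / (- \<gamma> + 1))) {real K..}"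
      using \<gamma> k by (intro has_integral_mult_right has_integral_powr_to_inf) auto
    moreover have "- (real K powr (- \<gamma> + 1)) / (- \<gamma> + 1) = real K powr (- (\<gamma> - 1)) / (\<gamma> - 1)"
      using \<gamma> by (simp add: divide_simps) (simp add: algebra_simps)
    ultimately have "((\<lambda>x. w * x powr (- \<gamma>)) has_integral tl) {real K..}" by (simp only: tl_def)
    from nn_integral_has_integral_lebesgue'[OF _ this] show ?thesis
      using w by (simp add: mult.commute[of "indicator _ _"])
  qed
  have "ennreal I \<le> (\<integral>\<^sup>+x. (indicator {0<..real k + 1} x +
       (\<Sum>j\<in>{k<..K}. ennreal (f (real j)) * indicator {real j + 0<..real j + 0 + 1} x)) +
       indicator {real K..} x * ennreal (w * x powr (- \<gamma>)) \<partial>lborel)"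
    unfolding I[symmetric]
  proof (rule nn_integral_mono)
    fix x :: real
    consider "x \<le> 0" | "0 < x" "x \<le> real k + 1" | "real k + 1 < x" "x \<le> real K + 1" | "real K + 1 < x" "0 < x" by linarith
    then show "ennreal (f x) * indicator {0<..} x \<le> (indicator {0<..real k + 1} x +
       (\<Sum>j\<in>{k<..K}. ennreal (f (real j)) * indicator {real j + 0<..real j + 0 + 1} x)) +
       indicator {real K..} x * ennreal (w * x powr (- \<gamma>))"
    proof cases
      case 1 then show ?thesis by simp
    next
      case 2
      have "ennreal (f x) \<le> 1" using f0[of x] by simp
      also have "1 \<le> 1 + ((\<Sum>j\<in>{k<..K}. ennreal (f (real j)) * indicator {real j + 0<..real j + 0 + 1} x) +
         indicator {real K..} x * ennreal (w * x powr (- \<gamma>)))" by simp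
      finally show ?thesis using 2 by (simp add: add.assoc)
    next
      case 3
      define i where "i = nat (\<lceil>x\<rceil> - 1)"
      have "\<lceil>x\<rceil> \<ge> 1" using 3 by linarith
      then have ri: "real i = of_int \<lceil>x\<rceil> - 1" by (simp add: i_def)
      have i: "real i + 0 < x" "x \<le> real i + 0 + 1" unfolding ri by linarith+
      have "real k < real i" "real i < real K + 1" using 3 i by auto
      then have iK: "i \<in> {k<..K}" by auto
      have "f x \<le> f (real i)" using i iK k by (intro mono) auto
      then have "ennreal (f x) \<le> (\<Sum>j\<in>{k<..K}. ennreal (f (real j)) * indicator {real j + 0<..real j + 0 + 1} x)"
        unfolding disj[OF i] using iK by (simp add: ennreal_leI)
      also have "\<dots> \<le> indicator {0<..real k + 1} x + \<dots>" by simp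
      also have "\<dots> \<le> \<dots> + indicator {real K..} x * ennreal (w * x powr (- \<gamma>))" by simp
      finally show ?thesis using 3 by simp
    next
      case 4
      have "ennreal (f x) \<le> indicator {real K..} x * ennreal (w * x powr (- \<gamma>))"
        using 4 f_tail[of x] by (simp add: ennreal_leI)
      also have "\<dots> \<le> (indicator {0<..real k + 1} x +
       (\<Sum>j\<in>{k<..K}. ennreal (f (real j)) * indicator {real j + 0<..real j + 0 + 1} x)) + \<dots>" by simp
      finally show ?thesis using 4 by simp
    qed
  qed
  also have "\<dots> = (\<integral>\<^sup>+x. indicator {0<..real k + 1} x \<partial>lborel) + ennreal S + ennreal tl"
    unfolding tail[symmetric] blk[of 0, symmetric]
  proof -
    have [measurable]: "(\<lambda>x::real. \<Sum>j\<in>{k<..K}. ennreal (f (real j)) * indicator {real j + 0<..real j + 0 + 1} x)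
        \<in> borel_measurable lborel"
      by (intro borel_measurable_sum borel_measurable_times) auto
    show "(\<integral>\<^sup>+x. (indicator {0<..real k + 1} x +
       (\<Sum>j\<in>{k<..K}. ennreal (f (real j)) * indicator {real j + 0<..real j + 0 + 1} x)) +
       indicator {real K..} x * ennreal (w * x powr (- \<gamma>)) \<partial>lborel) =
      (\<integral>\<^sup>+x. indicator {0<..real k + 1} x \<partial>lborel) +
      (\<integral>\<^sup>+x. (\<Sum>j\<in>{k<..K}. ennreal (f (real j)) * indicator {real j + 0<..real j + 0 + 1} x) \<partial>lborel) +
      (\<integral>\<^sup>+x. indicator {real K..} x * ennreal (w * x powr (- \<gamma>)) \<partial>lborel)"
      by (subst nn_integral_add, measurable, subst nn_integral_add, measurable)
  qed
  also have "(\<integral>\<^sup>+x. indicator {0<..real k + 1} x \<partial>lborel) = ennreal (real k + 1)" by simp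
  also have "ennreal (real k + 1) + ennreal S + ennreal tl = ennreal (real k + 1 + S + tl)"
    using S0 tl0 by (simp add: ennreal_plus)
  finally have low: "I \<le> real k + 1 + S + tl" using S0 tl0 by (subst (asm) ennreal_le_iff) auto
  have "\<bar>S - I\<bar> \<le> real k + 1 + tl" using up low tl0 by linarith
  then show ?thesis by (simp only: S_def I_def f_def tl_def)
qed

section \<open>The number of hits in terms of the early phase\<close>

context pref_attach begin

text \<open>The approximate probability of a hit at a level where the charge divided by \<open>norming\<close> has the value \<open>x\<close>.\<close>

definition hit_profile :: "real \<Rightarrow> real" where
  "hit_profile x = 1 - (1 + x) powr (- q)"

lemma hit_profile_Lipschitz:
  assumes "x \<ge> 0" "y \<ge> 0"
  shows "\<bar>hit_profile x - hit_profile y\<bar> \<le> \<bar>x - y\<bar>"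
proof -
  have ln: "\<bar>ln (1 + x) - ln (1 + y)\<bar> \<le> \<bar>x - y\<bar>" if "x \<ge> 0" "y \<ge> 0" for x y :: real
  proof -
    have *: "ln (1 + a) - ln (1 + c) \<le> \<bar>a - c\<bar>" if "a \<ge> 0" "c \<ge> 0" for a c :: real
    proof -
      have "ln (1 + a) - ln (1 + c) \<le> ((1 + a) - (1 + c)) / (1 + c)" by (rule ln_diff_le) (use that in auto)
      also have "\<dots> \<le> \<bar>a - c\<bar> / (1 + c)" using that by (intro divide_right_mono) auto
      also have "\<dots> \<le> \<bar>a - c\<bar> / 1" using that by (intro divide_left_mono) auto
      finally show ?thesis by simp
    qed
    show ?thesis using *[of x y] *[of y x] that by (simp add: abs_le_iff abs_minus_commute)
  qed
  have e: "(1 + x) powr (- q) = exp (- (q * ln (1 + x)))" if "x \<ge> 0" for x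
    using that by (simp add: powr_def)
  have "\<bar>hit_profile x - hit_profile y\<bar> = \<bar>exp (- (q * ln (1 + x))) - exp (- (q * ln (1 + y)))\<bar>"
    using assms by (simp add: hit_profile_def e abs_minus_commute)
  also have "\<dots> \<le> \<bar>q * ln (1 + x) - q * ln (1 + y)\<bar>"
    using assms q_bounds by (intro exp_minus_diff_le mult_nonneg_nonneg) auto
  also have "\<dots> = q * \<bar>ln (1 + x) - ln (1 + y)\<bar>"
    using q_bounds by (simp add: abs_mult flip: right_diff_distrib)
  also have "\<dots> \<le> 1 * \<bar>x - y\<bar>" using q_bounds ln[OF assms] by (intro mult_mono) auto
  finally show ?thesis by simp
qed

text \<open>The value of the normalised charge that is predicted from the number of active edges at the end of the early
  phase: \<open>n powr \<alpha> * s * (m - 1) / L\<close> times \<open>scaled n k y\<close>.\<close>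

definition front :: "nat \<Rightarrow> nat \<Rightarrow> nat \<Rightarrow> real" where
  "front n k y = s / L * (real n powr \<alpha> * (moment_growth 1 k / moment_growth 1 (n - 1))) * real y"

definition beta_const :: real where
  "beta_const = Gamma (1 - 1 / \<gamma>) * Gamma (q + 1 / \<gamma>) / Gamma q"

text \<open>The charge divided by \<open>\<kappa>\<close> and \<open>front\<close> are proportional to \<open>y\<close> in the first order; this is the difference
  of the two factors, divided by \<open>k powr \<alpha>\<close>.  It tends to zero by the asymptotics of \<open>norming\<close>.  Here \<open>\<kappa>\<close> is
  the limit of \<open>norming k / k powr \<gamma>\<close>.\<close>

definition mismatch :: "real \<Rightarrow> nat \<Rightarrow> nat \<Rightarrow> real" where
  "mismatch \<kappa> n k = \<bar>norming k / (\<kappa> * real k powr \<gamma>) * (s * real k / A k) -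
     s / L * ((moment_growth 1 k / real k powr \<alpha>) / (moment_growth 1 (n - 1) / real n powr \<alpha>))\<bar>"

lemma front_nonneg: "front n k y \<ge> 0"
  unfolding front_def using s_pos L_pos moment_growth_pos[of 1 k] moment_growth_pos[of 1 "n - 1"] by simp

lemma charge_nonneg: "k \<ge> 2 \<Longrightarrow> charge k y \<ge> 0"
  unfolding charge_def using R_ge_1[of k y] norming_pos[of k] by simp

lemma mean_front:
  obtains C where "C > 0" "\<And>n k. 2 \<le> k \<Longrightarrow> k < n \<Longrightarrow> mean_at n k (front n k) \<le> C * real n powr \<alpha>"
proof -
  obtain C0 where C0: "C0 > 0" "\<And>n k. 2 \<le> k \<Longrightarrow> k < n \<Longrightarrow>
    moment_growth 1 k / moment_growth 1 (n - 1) \<le> C0 * (real k / real n) powr \<alpha>"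
    using moment_growth_ratio by blast
  obtain C1 where C1: "C1 > 0" "\<And>n k. 2 \<le> k \<Longrightarrow> k < n \<Longrightarrow>
    mean_at n k (\<lambda>y. real y ^ 1) \<le> C1 * (real n / real k) powr (real 1 * \<alpha>)"
    using moment_bound[of 1] by blast
  have "mean_at n k (front n k) \<le> (s / L * C0 * C1) * real n powr \<alpha>" if k: "2 \<le> k" "k < n" for n k
  proof -
    define P where "P = (real n / real k) powr \<alpha>"
    define Q where "Q = (real k / real n) powr \<alpha>"
    have PQ: "P > 0" "Q > 0" "Q * P = 1" using k by (auto simp: P_def Q_def simp flip: powr_mult)
    have r0: "moment_growth 1 k / moment_growth 1 (n - 1) \<ge> 0"
      using moment_growth_pos[of 1 k] moment_growth_pos[of 1 "n - 1"] by simp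
    have "mean_at n k (front n k) = s / L * (real n powr \<alpha> * (moment_growth 1 k / moment_growth 1 (n - 1))) * mean_at n k (\<lambda>y. real y ^ 1)"
      unfolding front_def by (simp only: mean_at_cmult power_one_right)
    also have "\<dots> \<le> s / L * (real n powr \<alpha> * (C0 * Q)) * (C1 * P)"
    proof (rule mult_mono)
      have "moment_growth 1 k / moment_growth 1 (n - 1) \<le> C0 * Q" using C0(2)[OF k] by (simp add: Q_def)
      then show "s / L * (real n powr \<alpha> * (moment_growth 1 k / moment_growth 1 (n - 1))) \<le> s / L * (real n powr \<alpha> * (C0 * Q))"
        using s_pos L_pos by (intro mult_left_mono) auto
      show "mean_at n k (\<lambda>y. real y ^ 1) \<le> C1 * P" using C1(2)[OF k] by (simp add: P_def)
      show "0 \<le> s / L * (real n powr \<alpha> * (C0 * Q))" using s_pos L_pos C0(1) PQ by simp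
    qed (rule mean_at_nonneg, simp)
    also have "\<dots> = (s / L * C0 * C1) * real n powr \<alpha> * (Q * P)" by (simp add: mult_ac)
    finally show ?thesis by (simp add: PQ)
  qed
  moreover have "s / L * C0 * C1 > 0" using s_pos L_pos C0(1) C1(1) by simp
  ultimately show ?thesis using that by blast
qed

lemma norming_load:
  obtains C where "C > 0" "\<And>n k. 1 \<le> k \<Longrightarrow> k < n \<Longrightarrow> norming k * load n k \<le> C * real n powr \<alpha>"
proof -
  obtain u where u: "u > 0" "\<And>k. k \<ge> 1 \<Longrightarrow> norming k \<le> u * real k powr \<gamma>" using norming_bounds by metis
  have "norming k * load n k \<le> u * real n powr \<alpha>" if k: "1 \<le> k" "k < n" for n k
  proof -
    have "norming k * load n k \<le> u * real k powr \<gamma> * load n k"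
      using u(2)[OF k(1)] load_nonneg by (intro mult_right_mono) auto
    also have "real k powr \<gamma> * load n k = real n powr \<alpha>"
      using k by (simp add: load_def gamma_eq powr_add powr_divide)
    then have "u * real k powr \<gamma> * load n k = u * real n powr \<alpha>" by simp
    finally show ?thesis .
  qed
  then show ?thesis using that u by blast
qed

lemma charge_linear:
  obtains C where "C > 0" "\<And>n k. 2 \<le> k \<Longrightarrow> k < n \<Longrightarrow> load n k \<le> 1 \<Longrightarrow>
    mean_at n k (\<lambda>y. \<bar>charge k y - norming k * (s * (real y / A k))\<bar>) \<le> C * real n powr \<alpha> * load n k"
proof -
  obtain B where B: "B > 0" "\<And>n k. 2 \<le> k \<Longrightarrow> k < n \<Longrightarrow>
    mean_at n k (\<lambda>y. (real y / real k) ^ 2 * (1 + real y / (\<theta> * real k)) ^ q0) \<le> B * load n k ^ 2 * (1 + load n k) ^ q0"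
    using mixed_moment by blast
  obtain N where N: "N > 0" "\<And>n k. 1 \<le> k \<Longrightarrow> k < n \<Longrightarrow> norming k * load n k \<le> N * real n powr \<alpha>"
    using norming_load by blast
  define c where "c = (s / \<theta>)\<^sup>2"
  have c: "c > 0" using s_pos theta_pos by (simp add: c_def)
  have "mean_at n k (\<lambda>y. \<bar>charge k y - norming k * (s * (real y / A k))\<bar>) \<le> (c * B * 2 ^ q0 * N) * real n powr \<alpha> * load n k"
    if k: "2 \<le> k" "k < n" and l: "load n k \<le> 1" for n k
  proof -
    have nk: "norming k > 0" by (rule norming_pos)
    have "mean_at n k (\<lambda>y. \<bar>charge k y - norming k * (s * (real y / A k))\<bar>) \<le>
      mean_at n k (\<lambda>y. (norming k * c) * ((real y / real k) ^ 2 * (1 + real y / (\<theta> * real k)) ^ q0))"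
    proof (rule mean_at_mono)
      fix y
      have "charge k y - norming k * (s * (real y / A k)) = norming k * (R k y - 1 - s * (real y / A k))"
        by (simp add: charge_def algebra_simps)
      then have "\<bar>charge k y - norming k * (s * (real y / A k))\<bar> = norming k * \<bar>R k y - 1 - s * (real y / A k)\<bar>"
        using nk by (simp add: abs_mult)
      also have "\<dots> \<le> norming k * ((s * (real y / A k))\<^sup>2 * R k y)"
        using nk by (intro mult_left_mono R_linear k) auto
      also have "\<dots> \<le> norming k * ((s * (real y / (\<theta> * real k)))\<^sup>2 * (1 + real y / (\<theta> * real k)) ^ q0)"
        using nk s_pos theta_pos k A_lower[OF k(1)] A_pos[OF k(1)] R_ge_1[OF k(1), of y] R_upper[OF k(1), of y]
        by (intro mult_left_mono mult_mono power_mono divide_left_mono) auto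
      also have "\<dots> = (norming k * c) * ((real y / real k) ^ 2 * (1 + real y / (\<theta> * real k)) ^ q0)"
        by (simp add: c_def power_mult_distrib power_divide)
      finally show "\<bar>charge k y - norming k * (s * (real y / A k))\<bar> \<le>
        (norming k * c) * ((real y / real k) ^ 2 * (1 + real y / (\<theta> * real k)) ^ q0)" .
    qed
    also have "\<dots> = (norming k * c) * mean_at n k (\<lambda>y. (real y / real k) ^ 2 * (1 + real y / (\<theta> * real k)) ^ q0)"
      by (rule mean_at_cmult)
    also have "\<dots> \<le> (norming k * c) * (B * load n k ^ 2 * (1 + load n k) ^ q0)"
      using nk c by (intro mult_left_mono B k) auto
    also have "\<dots> \<le> (norming k * c) * (B * load n k ^ 2 * 2 ^ q0)"
      using nk c B(1) l load_nonneg[of n k] by (intro mult_left_mono power_mono) auto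
    also have "\<dots> = (c * B * 2 ^ q0) * ((norming k * load n k) * load n k)" by (simp add: power2_eq_square mult_ac)
    also have "\<dots> \<le> (c * B * 2 ^ q0) * ((N * real n powr \<alpha>) * load n k)"
      using c B(1) load_nonneg k by (intro mult_left_mono mult_right_mono N(2)) auto
    finally show ?thesis by (simp add: mult_ac)
  qed
  moreover have "c * B * 2 ^ q0 * N > 0" using c B(1) N(1) by simp
  ultimately show ?thesis using that by blast
qed

lemma mean_active: obtains C where "C > 0" "\<And>n k. 2 \<le> k \<Longrightarrow> k < n \<Longrightarrow>
    mean_at n k real \<le> C * (real n / real k) powr \<alpha>"
proof -
  obtain C1 where C1: "C1 > 0" "\<And>n k. 2 \<le> k \<Longrightarrow> k < n \<Longrightarrow>
    mean_at n k (\<lambda>y. real y ^ 1) \<le> C1 * (real n / real k) powr (real 1 * \<alpha>)"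
    using moment_bound[of 1] by blast
  show ?thesis by (rule that[OF C1(1)]) (use C1(2) in simp)
qed

lemma mean_charge:
  obtains C where "C > 0" "\<And>n k. 2 \<le> k \<Longrightarrow> k < n \<Longrightarrow> load n k \<le> 1 \<Longrightarrow> mean_at n k (charge k) \<le> C * real n powr \<alpha>"
proof -
  obtain D where D: "D > 0" "\<And>n k. 2 \<le> k \<Longrightarrow> k < n \<Longrightarrow> load n k \<le> 1 \<Longrightarrow>
    mean_at n k (\<lambda>y. \<bar>charge k y - norming k * (s * (real y / A k))\<bar>) \<le> D * real n powr \<alpha> * load n k"
    using charge_linear by blast
  obtain C1 where C1: "C1 > 0" "\<And>n k. 2 \<le> k \<Longrightarrow> k < n \<Longrightarrow> mean_at n k real \<le> C1 * (real n / real k) powr \<alpha>"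
    using mean_active by blast
  obtain N where N: "N > 0" "\<And>n k. 1 \<le> k \<Longrightarrow> k < n \<Longrightarrow> norming k * load n k \<le> N * real n powr \<alpha>"
    using norming_load by blast
  have "mean_at n k (charge k) \<le> (D + s / \<theta> * C1 * N) * real n powr \<alpha>" if k: "2 \<le> k" "k < n" and l: "load n k \<le> 1" for n k
  proof -
    have nk: "norming k > 0" by (rule norming_pos)
    have "mean_at n k (charge k) \<le> mean_at n k (\<lambda>y. \<bar>charge k y - norming k * (s * (real y / A k))\<bar> + (norming k * (s / A k)) * real y)"
      by (rule mean_at_mono) (simp add: abs_le_iff)
    also have "\<dots> = mean_at n k (\<lambda>y. \<bar>charge k y - norming k * (s * (real y / A k))\<bar>) + (norming k * (s / A k)) * mean_at n k real"
      by (simp only: mean_at_add mean_at_cmult)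
    also have "\<dots> \<le> D * real n powr \<alpha> * 1 + (norming k * (s / (\<theta> * real k))) * (C1 * (real n / real k) powr \<alpha>)"
    proof (intro add_mono mult_mono)
      show "mean_at n k (\<lambda>y. \<bar>charge k y - norming k * (s * (real y / A k))\<bar>) \<le> D * real n powr \<alpha> * 1"
        by (rule order_trans[OF D(2)[OF k l]]) (use D(1) l in \<open>intro mult_left_mono, auto\<close>)
      show "s / A k \<le> s / (\<theta> * real k)"
        using s_pos theta_pos k A_lower[OF k(1)] A_pos[OF k(1)] by (intro divide_left_mono) auto
      show "0 \<le> mean_at n k real" by (rule mean_at_nonneg) simp
    qed (use nk C1 k s_pos theta_pos A_pos[OF k(1)] in auto)
    also have "\<dots> = D * real n powr \<alpha> + s / \<theta> * C1 * (norming k * load n k)" by (simp add: load_def)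
    also have "\<dots> \<le> D * real n powr \<alpha> + s / \<theta> * C1 * (N * real n powr \<alpha>)"
      using s_pos theta_pos C1(1) k by (intro add_left_mono mult_left_mono N(2)) auto
    finally show ?thesis by (simp add: algebra_simps)
  qed
  moreover have "D + s / \<theta> * C1 * N > 0" using D(1) C1(1) N(1) s_pos theta_pos by (simp add: add_pos_pos)
  ultimately show ?thesis using that by blast
qed

text \<open>The linear approximation \<open>norming k * s * y / A k\<close> of the charge is compared with the charge and with
  \<open>front\<close>.\<close>

lemma charge_front:
  assumes \<kappa>: "\<kappa> > 0"
  obtains C where "C > 0" "\<And>n k. 2 \<le> k \<Longrightarrow> k < n \<Longrightarrow> load n k \<le> 1 \<Longrightarrow>
    mean_at n k (\<lambda>y. \<bar>charge k y / \<kappa> - front n k y\<bar>) \<le> C * real n powr \<alpha> * (load n k + mismatch \<kappa> n k)"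
proof -
  obtain D where D: "D > 0" "\<And>n k. 2 \<le> k \<Longrightarrow> k < n \<Longrightarrow> load n k \<le> 1 \<Longrightarrow>
    mean_at n k (\<lambda>y. \<bar>charge k y - norming k * (s * (real y / A k))\<bar>) \<le> D * real n powr \<alpha> * load n k"
    using charge_linear by blast
  obtain C1 where C1: "C1 > 0" "\<And>n k. 2 \<le> k \<Longrightarrow> k < n \<Longrightarrow> mean_at n k real \<le> C1 * (real n / real k) powr \<alpha>"
    using mean_active by blast
  define C where "C = D / \<kappa> + C1"
  have "mean_at n k (\<lambda>y. \<bar>charge k y / \<kappa> - front n k y\<bar>) \<le> C * real n powr \<alpha> * (load n k + mismatch \<kappa> n k)"
    if k: "2 \<le> k" "k < n" and l: "load n k \<le> 1" for n k
  proof -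
    define Z where "Z = mismatch \<kappa> n k"
    have Z: "Z \<ge> 0" by (simp add: Z_def mismatch_def)
    have "mean_at n k (\<lambda>y. \<bar>charge k y / \<kappa> - front n k y\<bar>) \<le>
      mean_at n k (\<lambda>y. (1 / \<kappa>) * \<bar>charge k y - norming k * (s * (real y / A k))\<bar> + (real k powr \<alpha> * Z) * real y)"
    proof (rule mean_at_mono)
      fix y
      have "norming k * (s * (real y / A k)) / \<kappa> - front n k y =
        real k powr \<alpha> * (norming k / (\<kappa> * real k powr \<gamma>) * (s * real k / A k) -
     s / L * ((moment_growth 1 k / real k powr \<alpha>) / (moment_growth 1 (n - 1) / real n powr \<alpha>))) * real y"
      proof -
        have "real k powr \<gamma> = real k * real k powr \<alpha>" using k by (simp add: gamma_eq powr_add)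
        moreover have "real k powr \<alpha> > 0" using k by simp
        ultimately have p1: "real k powr \<alpha> * (norming k / (\<kappa> * real k powr \<gamma>) * (s * real k / A k)) = norming k * s / (\<kappa> * A k)"
          using k \<kappa> by simp
        have p2: "real k powr \<alpha> * ((moment_growth 1 k / real k powr \<alpha>) / (moment_growth 1 (n - 1) / real n powr \<alpha>)) =
          real n powr \<alpha> * (moment_growth 1 k / moment_growth 1 (n - 1))" using k by simp
        have "x * (a - c * d) * e = (x * a - c * (x * d)) * e" for x a c d e :: real by (simp add: algebra_simps)
        then show ?thesis unfolding front_def by (simp only: p1 p2) (simp add: algebra_simps)
      qed
      then have "\<bar>norming k * (s * (real y / A k)) / \<kappa> - front n k y\<bar> = real k powr \<alpha> * Z * real y"
        by (simp only: abs_mult Z_def mismatch_def) simp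
      moreover have "charge k y / \<kappa> - front n k y = (1 / \<kappa>) * (charge k y - norming k * (s * (real y / A k))) +
          (norming k * (s * (real y / A k)) / \<kappa> - front n k y)" by (simp add: algebra_simps diff_divide_distrib)
      moreover have "\<bar>(1 / \<kappa>) * (charge k y - norming k * (s * (real y / A k)))\<bar> = (1 / \<kappa>) * \<bar>charge k y - norming k * (s * (real y / A k))\<bar>"
        using \<kappa> by (simp only: abs_mult) simp
      ultimately show "\<bar>charge k y / \<kappa> - front n k y\<bar> \<le> (1 / \<kappa>) * \<bar>charge k y - norming k * (s * (real y / A k))\<bar> + (real k powr \<alpha> * Z) * real y"
        by linarith
    qed
    also have "\<dots> = (1 / \<kappa>) * mean_at n k (\<lambda>y. \<bar>charge k y - norming k * (s * (real y / A k))\<bar>) + (real k powr \<alpha> * Z) * mean_at n k real"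
      by (simp only: mean_at_add mean_at_cmult)
    also have "\<dots> \<le> (1 / \<kappa>) * (D * real n powr \<alpha> * load n k) + (real k powr \<alpha> * Z) * (C1 * (real n / real k) powr \<alpha>)"
      using \<kappa> Z by (intro add_mono mult_left_mono D(2) C1(2) k l) auto
    also have "\<dots> = D / \<kappa> * (real n powr \<alpha> * load n k) + C1 * (real n powr \<alpha> * Z)"
      using k by (simp add: powr_divide)
    also have "\<dots> \<le> (D / \<kappa> + C1) * (real n powr \<alpha> * load n k) + (D / \<kappa> + C1) * (real n powr \<alpha> * Z)"
      using D(1) C1(1) \<kappa> Z load_nonneg[of n k] by (intro add_mono mult_right_mono) auto
    finally show ?thesis by (simp add: C_def Z_def algebra_simps)
  qed
  moreover have "C > 0" using D(1) C1(1) \<kappa> by (simp add: C_def add_pos_pos)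
  ultimately show ?thesis using that by blast
qed

text \<open>The hits are counted in five steps, each with its error: conditional hit probabilities for hits; the
  profile of the charge for these (\<open>miss_approx\<close>); the charge at level \<open>k0\<close> for the charge at
  level \<open>j\<close> (\<open>charge_deviation\<close>); the prediction \<open>w * j powr (- \<gamma>)\<close> for the charge at level \<open>k0\<close> divided by
  \<open>norming j\<close> (\<open>charge_front\<close> and the hypothesis on \<open>\<eta>\<close>); and the integral for the sum
  (\<open>sum_hit_profile\<close>).\<close>

lemma hit_count_bound:
  assumes \<kappa>: "\<kappa> > 0"
  obtains C where "C > 0" "\<And>n k k0 \<eta>. 2 \<le> k \<Longrightarrow> k \<le> k0 \<Longrightarrow> k0 < n \<Longrightarrow> load n k0 \<le> 1 \<Longrightarrow>
    (\<And>j. j > k \<Longrightarrow> \<bar>real j powr \<gamma> / norming j - 1 / \<kappa>\<bar> \<le> \<eta>) \<Longrightarrow>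
    mean n (\<lambda>\<omega>. \<bar>real (num_hit \<omega> (n - 3)) - front n k0 (act n k0 \<omega>) powr (1 / \<gamma>) * beta_const\<bar>) \<le>
      C * (real k + sqrt (real k0) + (real n / real k0) powr \<alpha> +
        (1 + load n k) ^ (q0 + 1) * real k0 powr (\<alpha> + 1 / 2) * real k powr (- \<alpha>) +
        real k powr (- \<alpha>) * (real n powr \<alpha> * (load n k0 + mismatch \<kappa> n k0 + \<eta>)))"
proof -
  obtain Ch where Ch: "Ch > 0" "\<And>n k k0. 2 \<le> k \<Longrightarrow> k \<le> k0 \<Longrightarrow> k0 < n \<Longrightarrow>
    mean n (\<lambda>\<omega>. \<bar>real (num_hit \<omega> (n - 3)) - (\<Sum>j\<in>{k<..k0}. 1 - miss j (act n j \<omega>))\<bar>) \<le>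
      real k + sqrt (real k0) + Ch * (real n / real k0) powr \<alpha>" using num_hit_approx by blast
  obtain Cm where Cm: "Cm > 0" "\<And>k y. k \<ge> 3 \<Longrightarrow> \<bar>miss k y - R k y powr (- q)\<bar> \<le> Cm / real k"
    using miss_approx by blast
  obtain Cd where Cd: "Cd > 0" "\<And>n k k0. 2 \<le> k \<Longrightarrow> k \<le> k0 \<Longrightarrow> k0 < n \<Longrightarrow>
    mean n (\<lambda>\<omega>. \<bar>charge k (act n k \<omega>) - charge k0 (act n k0 \<omega>)\<bar>) \<le>
      Cd * (1 + load n k) ^ (q0 + 1) * real k0 powr (\<alpha> + 1 / 2)" using charge_deviation by blast
  obtain l where l: "l > 0" "\<And>k. k \<ge> 1 \<Longrightarrow> l * real k powr \<gamma> \<le> norming k" using norming_bounds by metis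
  obtain Cw where Cw: "Cw > 0" "\<And>n k. 2 \<le> k \<Longrightarrow> k < n \<Longrightarrow> mean_at n k (front n k) \<le> Cw * real n powr \<alpha>"
    using mean_front by blast
  obtain CM where CM: "CM > 0" "\<And>n k. 2 \<le> k \<Longrightarrow> k < n \<Longrightarrow> load n k \<le> 1 \<Longrightarrow> mean_at n k (charge k) \<le> CM * real n powr \<alpha>"
    using mean_charge by blast
  obtain Cf where Cf: "Cf > 0" "\<And>n k. 2 \<le> k \<Longrightarrow> k < n \<Longrightarrow> load n k \<le> 1 \<Longrightarrow>
    mean_at n k (\<lambda>y. \<bar>charge k y / \<kappa> - front n k y\<bar>) \<le> Cf * real n powr \<alpha> * (load n k + mismatch \<kappa> n k)"
    using charge_front[OF \<kappa>] by blast
  define C where "C = 3 + 2 * Cm + Ch + Cw / \<alpha> + Cd / (l * \<alpha>) + (Cf + CM) / \<alpha>"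
  have C: "C > 0" unfolding C_def using Cm(1) Ch(1) Cw(1) Cd(1) Cf(1) CM(1) l(1) alpha_pos
    by (intro add_pos_pos divide_pos_pos mult_pos_pos) auto
  have "mean n (\<lambda>\<omega>. \<bar>real (num_hit \<omega> (n - 3)) - front n k0 (act n k0 \<omega>) powr (1 / \<gamma>) * beta_const\<bar>) \<le>
      C * (real k + sqrt (real k0) + (real n / real k0) powr \<alpha> +
        (1 + load n k) ^ (q0 + 1) * real k0 powr (\<alpha> + 1 / 2) * real k powr (- \<alpha>) +
        real k powr (- \<alpha>) * (real n powr \<alpha> * (load n k0 + mismatch \<kappa> n k0 + \<eta>)))"
    if k: "2 \<le> k" "k \<le> k0" "k0 < n" and ld: "load n k0 \<le> 1"
      and \<eta>: "\<And>j. j > k \<Longrightarrow> \<bar>real j powr \<gamma> / norming j - 1 / \<kappa>\<bar> \<le> \<eta>" for n k k0 \<eta>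
  proof -
    have k0: "2 \<le> k0" using k by simp
    have \<eta>0: "\<eta> \<ge> 0" using \<eta>[of "Suc k"] by simp
    define w where "w = (\<lambda>\<omega>. front n k0 (act n k0 \<omega>))"
    define M where "M = (\<lambda>\<omega>. charge k0 (act n k0 \<omega>))"
    have w0: "w \<omega> \<ge> 0" and M0: "M \<omega> \<ge> 0" for \<omega>
      using front_nonneg charge_nonneg[OF k0] by (auto simp: w_def M_def)
    define Sg where "Sg = (\<Sum>j\<in>{k<..k0}. real j powr (- \<gamma>))"
    have Sg: "Sg \<le> 1 / \<alpha> * real k powr (- \<alpha>)" "Sg \<ge> 0"
      unfolding Sg_def gamma_eq using sum_powr_tail[OF alpha_pos, of k k0] k by (auto intro: sum_nonneg)
    define D1 where "D1 = (\<lambda>\<omega>. \<bar>real (num_hit \<omega> (n - 3)) - (\<Sum>j\<in>{k<..k0}. 1 - miss j (act n j \<omega>))\<bar>)"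
    define D3 where "D3 = (\<lambda>\<omega>. \<Sum>j\<in>{k<..k0}. (1 / norming j) * \<bar>charge j (act n j \<omega>) - M \<omega>\<bar>)"
    define D4 where "D4 = (\<lambda>\<omega>. \<bar>M \<omega> / \<kappa> - w \<omega>\<bar> + \<eta> * M \<omega>)"
    have pt: "\<bar>real (num_hit \<omega> (n - 3)) - w \<omega> powr (1 / \<gamma>) * beta_const\<bar> \<le>
       (((D1 \<omega> + 2 * Cm * sqrt (real k0)) + D3 \<omega>) + Sg * D4 \<omega>) + ((real k + 1) + real k0 powr (- \<alpha>) / \<alpha> * w \<omega>)" for \<omega>
    proof -
      define a where "a = (\<lambda>j. 1 - miss j (act n j \<omega>))"
      define b1 where "b1 = (\<lambda>j. hit_profile (charge j (act n j \<omega>) / norming j))"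
      define b2 where "b2 = (\<lambda>j. hit_profile (M \<omega> / norming j))"
      define b3 where "b3 = (\<lambda>j. hit_profile (w \<omega> * real j powr (- \<gamma>)))"
      have "\<bar>(\<Sum>j\<in>{k<..k0}. a j) - (\<Sum>j\<in>{k<..k0}. b1 j)\<bar> \<le> (\<Sum>j\<in>{k<..k0}. \<bar>a j - b1 j\<bar>)"
        unfolding sum_subtractf[symmetric] by (rule sum_abs)
      also have "\<dots> \<le> (\<Sum>j\<in>{k<..k0}. Cm * (1 / real j))"
      proof (rule sum_mono)
        fix j assume "j \<in> {k<..k0}"
        then have j: "j \<ge> 3" using k by simp
        have "1 + charge j (act n j \<omega>) / norming j = R j (act n j \<omega>)"
          using norming_pos[of j] by (simp add: charge_def)
        then have "a j - b1 j = - (miss j (act n j \<omega>) - R j (act n j \<omega>) powr (- q))"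
          by (simp add: a_def b1_def hit_profile_def)
        then show "\<bar>a j - b1 j\<bar> \<le> Cm * (1 / real j)" using Cm(2)[OF j, of "act n j \<omega>"] by simp
      qed
      also have "\<dots> = Cm * (\<Sum>j\<in>{k<..k0}. 1 / real j)" by (simp only: sum_distrib_left)
      also have "\<dots> \<le> Cm * (2 * sqrt (real k0))" using Cm(1) by (intro mult_left_mono sum_inverse_le_sqrt) auto
      finally have 2: "\<bar>(\<Sum>j\<in>{k<..k0}. a j) - (\<Sum>j\<in>{k<..k0}. b1 j)\<bar> \<le> 2 * Cm * sqrt (real k0)" by simp
      have "\<bar>(\<Sum>j\<in>{k<..k0}. b1 j) - (\<Sum>j\<in>{k<..k0}. b2 j)\<bar> \<le> (\<Sum>j\<in>{k<..k0}. \<bar>b1 j - b2 j\<bar>)"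
        unfolding sum_subtractf[symmetric] by (rule sum_abs)
      also have "\<dots> \<le> D3 \<omega>"
        unfolding D3_def
      proof (rule sum_mono)
        fix j assume "j \<in> {k<..k0}"
        then have j: "j \<ge> 2" using k by simp
        have nj: "norming j > 0" by (rule norming_pos)
        have "\<bar>b1 j - b2 j\<bar> \<le> \<bar>charge j (act n j \<omega>) / norming j - M \<omega> / norming j\<bar>"
          unfolding b1_def b2_def using nj charge_nonneg[OF j] M0 by (intro hit_profile_Lipschitz) auto
        also have "\<dots> = (1 / norming j) * \<bar>charge j (act n j \<omega>) - M \<omega>\<bar>"
          using nj by (simp add: abs_divide flip: diff_divide_distrib)
        finally show "\<bar>b1 j - b2 j\<bar> \<le> (1 / norming j) * \<bar>charge j (act n j \<omega>) - M \<omega>\<bar>" .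
      qed
      finally have 3: "\<bar>(\<Sum>j\<in>{k<..k0}. b1 j) - (\<Sum>j\<in>{k<..k0}. b2 j)\<bar> \<le> D3 \<omega>" .
      have "\<bar>(\<Sum>j\<in>{k<..k0}. b2 j) - (\<Sum>j\<in>{k<..k0}. b3 j)\<bar> \<le> (\<Sum>j\<in>{k<..k0}. \<bar>b2 j - b3 j\<bar>)"
        unfolding sum_subtractf[symmetric] by (rule sum_abs)
      also have "\<dots> \<le> (\<Sum>j\<in>{k<..k0}. real j powr (- \<gamma>) * D4 \<omega>)"
      proof (rule sum_mono)
        fix j assume jk: "j \<in> {k<..k0}"
        then have j: "j \<ge> 2" using k by simp
        have nj: "norming j > 0" by (rule norming_pos)
        have jp: "real j powr (- \<gamma>) * real j powr \<gamma> = 1" using j by (simp flip: powr_add)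
        have "\<bar>b2 j - b3 j\<bar> \<le> \<bar>M \<omega> / norming j - w \<omega> * real j powr (- \<gamma>)\<bar>"
          unfolding b2_def b3_def using nj M0 w0 by (intro hit_profile_Lipschitz) auto
        also have "M \<omega> / norming j - w \<omega> * real j powr (- \<gamma>) =
           real j powr (- \<gamma>) * ((M \<omega> / \<kappa> - w \<omega>) + M \<omega> * (real j powr \<gamma> / norming j - 1 / \<kappa>))"
        proof -
          have "real j powr (- \<gamma>) * ((M \<omega> / \<kappa> - w \<omega>) + M \<omega> * (real j powr \<gamma> / norming j - 1 / \<kappa>)) =
            (real j powr (- \<gamma>) * real j powr \<gamma>) * (M \<omega> / norming j) - w \<omega> * real j powr (- \<gamma>)"
            by (simp add: algebra_simps)
          then show ?thesis by (simp add: jp)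
        qed
        also have "\<bar>\<dots>\<bar> = real j powr (- \<gamma>) * \<bar>(M \<omega> / \<kappa> - w \<omega>) + M \<omega> * (real j powr \<gamma> / norming j - 1 / \<kappa>)\<bar>"
          by (simp only: abs_mult) simp
        also have "\<dots> \<le> real j powr (- \<gamma>) * D4 \<omega>"
        proof (intro mult_left_mono)
          have "\<bar>M \<omega> * (real j powr \<gamma> / norming j - 1 / \<kappa>)\<bar> \<le> M \<omega> * \<eta>"
            unfolding abs_mult using M0[of \<omega>] \<eta>[of j] jk by (intro mult_mono) auto
          then show "\<bar>(M \<omega> / \<kappa> - w \<omega>) + M \<omega> * (real j powr \<gamma> / norming j - 1 / \<kappa>)\<bar> \<le> D4 \<omega>"
            unfolding D4_def mult.commute[of \<eta>] by linarith
        qed simp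
        finally show "\<bar>b2 j - b3 j\<bar> \<le> real j powr (- \<gamma>) * D4 \<omega>" .
      qed
      also have "\<dots> = Sg * D4 \<omega>" by (simp only: Sg_def sum_distrib_right)
      finally have 4: "\<bar>(\<Sum>j\<in>{k<..k0}. b2 j) - (\<Sum>j\<in>{k<..k0}. b3 j)\<bar> \<le> Sg * D4 \<omega>" .
      have "\<bar>(\<Sum>j\<in>{k<..k0}. b3 j) - w \<omega> powr (1 / \<gamma>) * beta_const\<bar> \<le> real k + 1 + w \<omega> * (real k0 powr (- (\<gamma> - 1)) / (\<gamma> - 1))"
        unfolding b3_def hit_profile_def beta_const_def
        by (rule sum_hit_profile) (use w0 k alpha_pos q_bounds gamma_eq in auto)
      then have 5: "\<bar>(\<Sum>j\<in>{k<..k0}. b3 j) - w \<omega> powr (1 / \<gamma>) * beta_const\<bar> \<le> (real k + 1) + real k0 powr (- \<alpha>) / \<alpha> * w \<omega>"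
        by (simp add: gamma_eq mult.commute)
      have 1: "\<bar>real (num_hit \<omega> (n - 3)) - (\<Sum>j\<in>{k<..k0}. a j)\<bar> = D1 \<omega>" by (simp add: D1_def a_def)
      show ?thesis using 1 2 3 4 5 by linarith
    qed
    have "mean n (\<lambda>\<omega>. \<bar>real (num_hit \<omega> (n - 3)) - w \<omega> powr (1 / \<gamma>) * beta_const\<bar>) \<le>
      mean n (\<lambda>\<omega>. (((D1 \<omega> + 2 * Cm * sqrt (real k0)) + D3 \<omega>) + Sg * D4 \<omega>) + ((real k + 1) + real k0 powr (- \<alpha>) / \<alpha> * w \<omega>))"
      by (intro mean_mono pt)
    also have "\<dots> = (((mean n D1 + 2 * Cm * sqrt (real k0)) + mean n D3) + Sg * mean n D4) + ((real k + 1) + real k0 powr (- \<alpha>) / \<alpha> * mean n w)"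
      by (simp only: mean_add mean_cmult mean_const)
    finally have tot: "mean n (\<lambda>\<omega>. \<bar>real (num_hit \<omega> (n - 3)) - w \<omega> powr (1 / \<gamma>) * beta_const\<bar>) \<le> \<dots>" .
    define P where "P = (real n / real k0) powr \<alpha>"
    define X where "X = (1 + load n k) ^ (q0 + 1) * real k0 powr (\<alpha> + 1 / 2) * real k powr (- \<alpha>)"
    define Y where "Y = real k powr (- \<alpha>) * (real n powr \<alpha> * (load n k0 + mismatch \<kappa> n k0 + \<eta>))"
    have mm: "mismatch \<kappa> n k0 \<ge> 0" by (simp add: mismatch_def)
    have P0: "P \<ge> 0" and X0: "X \<ge> 0" and Y0: "Y \<ge> 0"
      using load_nonneg[of n k] load_nonneg[of n k0] \<eta>0 mm by (auto simp: P_def X_def Y_def)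
    have 1: "mean n D1 \<le> real k + sqrt (real k0) + Ch * P" unfolding D1_def P_def by (rule Ch(2)[OF k])
    have 3: "mean n D3 \<le> Cd / (l * \<alpha>) * X"
    proof -
      have "mean n D3 = (\<Sum>j\<in>{k<..k0}. (1 / norming j) * mean n (\<lambda>\<omega>. \<bar>charge j (act n j \<omega>) - M \<omega>\<bar>))"
        unfolding D3_def by (simp only: mean_sum mean_cmult)
      also have "\<dots> \<le> (\<Sum>j\<in>{k<..k0}. (1 / l * real j powr (- \<gamma>)) * (Cd * (1 + load n k) ^ (q0 + 1) * real k0 powr (\<alpha> + 1 / 2)))"
      proof (intro sum_mono mult_mono)
        fix j assume j: "j \<in> {k<..k0}"
        have "1 / norming j \<le> 1 / (l * real j powr \<gamma>)"
          using l j norming_pos[of j] by (intro divide_left_mono) auto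
        then show "1 / norming j \<le> 1 / l * real j powr (- \<gamma>)" using j by (simp add: powr_minus_divide)
        have "mean n (\<lambda>\<omega>. \<bar>charge j (act n j \<omega>) - M \<omega>\<bar>) \<le> Cd * (1 + load n j) ^ (q0 + 1) * real k0 powr (\<alpha> + 1 / 2)"
          unfolding M_def using j k by (intro Cd(2)) auto
        also have "\<dots> \<le> Cd * (1 + load n k) ^ (q0 + 1) * real k0 powr (\<alpha> + 1 / 2)"
          using Cd(1) load_nonneg[of n j] load_antimono[of k j n] j k
          by (intro mult_right_mono mult_left_mono power_mono) auto
        finally show "mean n (\<lambda>\<omega>. \<bar>charge j (act n j \<omega>) - M \<omega>\<bar>) \<le> Cd * (1 + load n k) ^ (q0 + 1) * real k0 powr (\<alpha> + 1 / 2)" .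
        have "mean n (\<lambda>\<omega>. 0) \<le> mean n (\<lambda>\<omega>. \<bar>charge j (act n j \<omega>) - M \<omega>\<bar>)" by (rule mean_mono) simp
        then show "0 \<le> mean n (\<lambda>\<omega>. \<bar>charge j (act n j \<omega>) - M \<omega>\<bar>)" by (simp only: mean_const)
      qed (use l in auto)
      also have "\<dots> = Cd / l * ((1 + load n k) ^ (q0 + 1) * real k0 powr (\<alpha> + 1 / 2)) * Sg"
        unfolding Sg_def sum_distrib_left by (intro sum.cong refl) (simp add: mult_ac)
      also have "\<dots> \<le> Cd / l * ((1 + load n k) ^ (q0 + 1) * real k0 powr (\<alpha> + 1 / 2)) * (1 / \<alpha> * real k powr (- \<alpha>))"
        using Cd(1) l(1) load_nonneg[of n k] Sg by (intro mult_left_mono) auto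
      also have "\<dots> = Cd / (l * \<alpha>) * X" by (simp add: X_def mult_ac)
      finally show ?thesis .
    qed
    have 4: "Sg * mean n D4 \<le> (Cf + CM) / \<alpha> * Y"
    proof -
      have e1: "mean n (\<lambda>\<omega>. \<bar>M \<omega> / \<kappa> - w \<omega>\<bar>) = mean_at n k0 (\<lambda>y. \<bar>charge k0 y / \<kappa> - front n k0 y\<bar>)"
        unfolding M_def w_def by (rule mean_act[OF k0 k(3)])
      have e2: "mean n M = mean_at n k0 (charge k0)"
        unfolding M_def by (rule mean_act[OF k0 k(3)])
      have "mean n D4 = mean n (\<lambda>\<omega>. \<bar>M \<omega> / \<kappa> - w \<omega>\<bar>) + \<eta> * mean n M"
        unfolding D4_def by (simp only: mean_add mean_cmult)
      also have "\<dots> \<le> Cf * real n powr \<alpha> * (load n k0 + mismatch \<kappa> n k0) + \<eta> * (CM * real n powr \<alpha>)"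
        unfolding e1 e2 using \<eta>0 by (intro add_mono mult_left_mono Cf(2) CM(2) k0 k ld) auto
      also have "\<dots> \<le> (Cf + CM) * (real n powr \<alpha> * (load n k0 + mismatch \<kappa> n k0)) + (Cf + CM) * (real n powr \<alpha> * \<eta>)"
      proof (intro add_mono)
        have "0 \<le> real n powr \<alpha> * (load n k0 + mismatch \<kappa> n k0)" using mm load_nonneg[of n k0] by simp
        then have "Cf * (real n powr \<alpha> * (load n k0 + mismatch \<kappa> n k0)) \<le> (Cf + CM) * (real n powr \<alpha> * (load n k0 + mismatch \<kappa> n k0))"
          using CM(1) by (intro mult_right_mono) auto
        then show "Cf * real n powr \<alpha> * (load n k0 + mismatch \<kappa> n k0) \<le> (Cf + CM) * (real n powr \<alpha> * (load n k0 + mismatch \<kappa> n k0))"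
          by (simp only: mult.assoc)
        have "CM * (real n powr \<alpha> * \<eta>) \<le> (Cf + CM) * (real n powr \<alpha> * \<eta>)"
          using Cf(1) \<eta>0 by (intro mult_right_mono) auto
        then show "\<eta> * (CM * real n powr \<alpha>) \<le> (Cf + CM) * (real n powr \<alpha> * \<eta>)" by (simp only: mult_ac)
      qed
      finally have d4: "mean n D4 \<le> (Cf + CM) * (real n powr \<alpha> * (load n k0 + mismatch \<kappa> n k0 + \<eta>))"
        by (simp add: algebra_simps)
      have "mean n (\<lambda>\<omega>. 0) \<le> mean n D4" unfolding D4_def using \<eta>0 M0 by (intro mean_mono) auto
      then have d40: "0 \<le> mean n D4" by (simp only: mean_const)
      have "Sg * mean n D4 \<le> (1 / \<alpha> * real k powr (- \<alpha>)) * ((Cf + CM) * (real n powr \<alpha> * (load n k0 + mismatch \<kappa> n k0 + \<eta>)))"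
        using Sg d4 d40 alpha_pos by (intro mult_mono) auto
      also have "\<dots> = (Cf + CM) / \<alpha> * Y" by (simp add: Y_def mult_ac)
      finally show ?thesis .
    qed
    have 5: "real k0 powr (- \<alpha>) / \<alpha> * mean n w \<le> Cw / \<alpha> * P"
    proof -
      have "mean n w = mean_at n k0 (front n k0)" unfolding w_def by (rule mean_act[OF k0 k(3)])
      also have "\<dots> \<le> Cw * real n powr \<alpha>" by (rule Cw(2)[OF k0 k(3)])
      finally have "real k0 powr (- \<alpha>) / \<alpha> * mean n w \<le> real k0 powr (- \<alpha>) / \<alpha> * (Cw * real n powr \<alpha>)"
        using alpha_pos by (intro mult_left_mono) auto
      also have "\<dots> = Cw / \<alpha> * P" using k0 by (simp add: P_def powr_divide powr_minus_divide)
      finally show ?thesis .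
    qed
    have k1: "1 \<le> real k" using k by simp
    have sk: "sqrt (real k0) \<ge> 0" by simp
    have "mean n (\<lambda>\<omega>. \<bar>real (num_hit \<omega> (n - 3)) - w \<omega> powr (1 / \<gamma>) * beta_const\<bar>) \<le>
       3 * real k + (1 + 2 * Cm) * sqrt (real k0) + (Ch + Cw / \<alpha>) * P + Cd / (l * \<alpha>) * X + (Cf + CM) / \<alpha> * Y"
      using tot 1 3 4 5 k1 by (simp add: algebra_simps)
    also have "\<dots> \<le> C * real k + C * sqrt (real k0) + C * P + C * X + C * Y"
    proof -
      have pos: "2 * Cm \<ge> 0" "Ch \<ge> 0" "Cw / \<alpha> \<ge> 0" "Cd / (l * \<alpha>) \<ge> 0" "(Cf + CM) / \<alpha> \<ge> 0"
        using Cm(1) Ch(1) Cw(1) Cd(1) Cf(1) CM(1) l(1) alpha_pos by auto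
      have c: "3 \<le> C" "1 + 2 * Cm \<le> C" "Ch + Cw / \<alpha> \<le> C" "Cd / (l * \<alpha>) \<le> C" "(Cf + CM) / \<alpha> \<le> C"
        unfolding C_def using pos by linarith+
      show ?thesis
        by (intro add_mono mult_right_mono c of_nat_0_le_iff sk P0 X0 Y0)
    qed
    also have "\<dots> = C * (real k + sqrt (real k0) + P + X + Y)" by (simp add: distrib_left)
    finally show ?thesis by (simp only: w_def P_def X_def Y_def)
  qed
  with C show ?thesis using that by blast
qed

end

section \<open>Joining the two phases\<close>

lemma tendsto_neg_powr_real: "c < 0 \<Longrightarrow> (\<lambda>n. real n powr c) \<longlonglongrightarrow> 0"
  by real_asymp

context pref_attach begin

text \<open>
  The level \<open>n powr cut_exponent\<close> separates the two phases.  The exponent has to exceed \<open>\<nu>\<close> for the active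
  edges to be few compared with the level, and to stay below \<open>\<alpha> / (\<alpha> + 1 / 2)\<close> for the fluctuations of the
  charge below the cut, of order \<open>cut powr (\<alpha> + 1 / 2)\<close>, to be small against its size \<open>n powr \<alpha>\<close>.
  Any number in between works.
\<close>

definition cut_exponent :: real where
  "cut_exponent = (\<nu> + \<alpha> / (\<alpha> + 1 / 2)) / 2"

definition cut :: "nat \<Rightarrow> nat" where
  "cut n = nat \<lceil>real n powr cut_exponent\<rceil>"

lemma cut_exponent_bounds:
  "\<nu> < cut_exponent" "cut_exponent * (\<alpha> + 1 / 2) < \<alpha>" "cut_exponent < 1" "cut_exponent < 2 * \<nu>" "cut_exponent > 0"
proof -
  define t where "t = \<alpha> / (\<alpha> + 1 / 2)"
  have nu: "\<nu> = \<alpha> / (1 + \<alpha>)" by (simp add: \<nu>_def gamma_eq)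
  have "\<nu> < t" unfolding nu t_def using alpha_pos by (intro divide_strict_left_mono) auto
  moreover have "cut_exponent = (\<nu> + t) / 2" by (simp add: cut_exponent_def t_def)
  ultimately have b: "\<nu> < cut_exponent" "cut_exponent < t" by auto
  show "\<nu> < cut_exponent" by (rule b)
  have "cut_exponent * (\<alpha> + 1 / 2) < t * (\<alpha> + 1 / 2)" using b alpha_pos by (intro mult_strict_right_mono) auto
  then show "cut_exponent * (\<alpha> + 1 / 2) < \<alpha>" using alpha_pos by (simp add: t_def)
  have "t < 1" using alpha_pos by (simp add: t_def)
  then show "cut_exponent < 1" using b by simp
  have "t \<le> 2 * \<nu>"
  proof -
    have "t = 2 * (\<alpha> / (1 + 2 * \<alpha>))" using alpha_pos by (simp add: t_def field_simps)
    also have "\<dots> \<le> 2 * (\<alpha> / (1 + \<alpha>))" using alpha_pos by (intro mult_left_mono divide_left_mono) auto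
    finally show ?thesis by (simp add: nu)
  qed
  then show "cut_exponent < 2 * \<nu>" using b by simp
  show "cut_exponent > 0" using b nu_bounds by simp
qed

lemma cut_bounds:
  assumes "n \<ge> 1"
  shows "real n powr cut_exponent \<le> real (cut n)" "real (cut n) \<le> 2 * real n powr cut_exponent"
proof -
  define x where "x = real n powr cut_exponent"
  have x: "x \<ge> 1" unfolding x_def using assms cut_exponent_bounds by (intro ge_one_powr_ge_zero) auto
  then have "real (cut n) = of_int \<lceil>x\<rceil>" by (simp add: cut_def x_def)
  then show "x \<le> real (cut n)" "real (cut n) \<le> 2 * x" using x by linarith+
qed

lemma filterlim_cut: "filterlim cut at_top sequentially"
proof -
  have "filterlim (\<lambda>n. real n powr cut_exponent) at_top sequentially"
    using cut_exponent_bounds(5)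
    by real_asymp
  then have "filterlim (\<lambda>n. real (cut n)) at_top sequentially"
    by (rule filterlim_at_top_mono) (use cut_bounds(1) in \<open>auto intro: eventually_sequentiallyI[of 1]\<close>)
  then show ?thesis by (simp add: filterlim_sequentially_iff_filterlim_real)
qed

lemma cut_lt: "eventually (\<lambda>n. cut n < n) sequentially"
proof -
  have "(\<lambda>n. real n powr (cut_exponent - 1)) \<longlonglongrightarrow> 0"
    using cut_exponent_bounds by (intro tendsto_neg_powr_real) auto
  then have "eventually (\<lambda>n. real n powr (cut_exponent - 1) < 1 / 2) sequentially"
    by (rule order_tendstoD) simp
  then show ?thesis using eventually_gt_at_top[of 0]
  proof eventually_elim
    case (elim n)
    have "real (cut n) \<le> 2 * real n powr cut_exponent" using cut_bounds(2)[of n] elim by simp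
    also have "\<dots> = 2 * real n powr (cut_exponent - 1) * real n"
      using elim by (simp add: powr_diff)
    also have "\<dots> < 1 * real n" using elim by (intro mult_strict_right_mono) auto
    finally show ?case by simp
  qed
qed

lemma cut_ratio:
  assumes "n \<ge> 1"
  shows "(real n / real (cut n)) powr \<alpha> \<le> real n powr (\<alpha> * (1 - cut_exponent))"
proof -
  have "real n / real (cut n) \<le> real n / real n powr cut_exponent"
  proof (rule divide_left_mono)
    have p: "real n powr cut_exponent > 0" using assms by simp
    with cut_bounds(1)[OF assms] have "real (cut n) > 0" by linarith
    with p show "0 < real (cut n) * real n powr cut_exponent" by (intro mult_pos_pos)
  qed (use cut_bounds(1)[OF assms] in simp_all)
  also have "\<dots> = real n powr (1 - cut_exponent)" using assms by (simp add: powr_diff)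
  finally have "(real n / real (cut n)) powr \<alpha> \<le> (real n powr (1 - cut_exponent)) powr \<alpha>"
    using alpha_pos by (intro powr_mono2) auto
  then show ?thesis by (simp add: powr_powr mult.commute)
qed

lemma load_cut: "(\<lambda>n. load n (cut n)) \<longlonglongrightarrow> 0"
proof (rule tendsto_sandwich)
  show "eventually (\<lambda>n. 0 \<le> load n (cut n)) sequentially" by (simp add: load_nonneg)
  show "(\<lambda>n. real n powr (\<alpha> - cut_exponent * \<gamma>)) \<longlonglongrightarrow> 0"
  proof (rule tendsto_neg_powr_real)
    have "\<nu> * \<gamma> < cut_exponent * \<gamma>" using cut_exponent_bounds(1) gamma_eq alpha_pos by (intro mult_strict_right_mono) auto
    then show "\<alpha> - cut_exponent * \<gamma> < 0" by (simp add: nu_gamma)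
  qed
  show "eventually (\<lambda>n. load n (cut n) \<le> real n powr (\<alpha> - cut_exponent * \<gamma>)) sequentially"
    using eventually_ge_at_top[of 1]
  proof eventually_elim
    case (elim n)
    have p: "real n powr cut_exponent > 0" using elim by simp
    have "load n (cut n) \<le> real n powr (\<alpha> * (1 - cut_exponent)) / real n powr cut_exponent"
      unfolding load_def using cut_ratio[OF elim] cut_bounds(1)[OF elim] p by (intro frac_le) auto
    also have "\<dots> = real n powr (\<alpha> * (1 - cut_exponent) - cut_exponent)" by (simp add: powr_diff)
    also have "\<alpha> * (1 - cut_exponent) - cut_exponent = \<alpha> - cut_exponent * \<gamma>" by (simp add: gamma_eq algebra_simps)
    finally show ?case .
  qed
qed simp

lemma mismatch_cut:
  assumes \<kappa>: "\<kappa> > 0" and lim: "(\<lambda>k. norming k / real k powr \<gamma>) \<longlonglongrightarrow> \<kappa>"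
  shows "(\<lambda>n. mismatch \<kappa> n (cut n)) \<longlonglongrightarrow> 0"
proof -
  obtain d where d: "d > 0" "(\<lambda>k. moment_growth 1 k / real k powr \<alpha>) \<longlonglongrightarrow> d"
    using growth_asymp[OF moment_growth_conds(2,1), of 1] unfolding moment_growth_def growth_exponent by auto
  have 1: "(\<lambda>n. norming (cut n) / (\<kappa> * real (cut n) powr \<gamma>)) \<longlonglongrightarrow> 1"
  proof -
    have "(\<lambda>k. norming k / real k powr \<gamma> / \<kappa>) \<longlonglongrightarrow> \<kappa> / \<kappa>" using lim \<kappa> by (intro tendsto_divide) auto
    then have "(\<lambda>k. norming k / (\<kappa> * real k powr \<gamma>)) \<longlonglongrightarrow> 1" using \<kappa> by (simp add: mult.commute)
    then show ?thesis by (rule filterlim_compose[OF _ filterlim_cut])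
  qed
  have 2: "(\<lambda>n. s * real (cut n) / A (cut n)) \<longlonglongrightarrow> s / L"
  proof -
    have "(\<lambda>k. s * real k / (L * real k - 2 * real m)) \<longlonglongrightarrow> s / L" 
    proof -
      have "(\<lambda>k. s * real k / (L * real k - 2 * real m)) \<longlonglongrightarrow> s * inverse L" using L_pos by real_asymp
      then show ?thesis by (simp only: divide_inverse)
    qed
    then have "(\<lambda>k. s * real k / A k) \<longlonglongrightarrow> s / L" by (simp only: A_def)
    then show ?thesis by (rule filterlim_compose[OF _ filterlim_cut])
  qed
  have 3: "(\<lambda>n. moment_growth 1 (cut n) / real (cut n) powr \<alpha>) \<longlonglongrightarrow> d"
    by (rule filterlim_compose[OF d(2) filterlim_cut])
  have 4: "(\<lambda>n. moment_growth 1 (n - 1) / real n powr \<alpha>) \<longlonglongrightarrow> d"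
  proof -
    have "(\<lambda>n. moment_growth 1 n / real n powr \<alpha> * (real n powr \<alpha> / real (n + 1) powr \<alpha>)) \<longlonglongrightarrow> d * 1"
      by (intro tendsto_mult d) real_asymp
    then have "(\<lambda>n. moment_growth 1 (n + 1 - 1) / real (n + 1) powr \<alpha>) \<longlonglongrightarrow> d * 1"
      by (rule Lim_transform_eventually) (rule eventually_sequentiallyI[of 1], simp)
    then show ?thesis by (simp only: mult_1_right) (rule LIMSEQ_offset[of _ 1])
  qed
  have "(\<lambda>n. mismatch \<kappa> n (cut n)) \<longlonglongrightarrow> \<bar>1 * (s / L) - s / L * (d / d)\<bar>"
    unfolding mismatch_def by (intro tendsto_intros 1 2 3 4) (use d in auto)
  then show ?thesis using d by simp
qed

text \<open>The limit of the number of hits as a function of the limit of \<open>scaled\<close>.\<close>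

definition limit_map :: "real \<Rightarrow> real" where
  "limit_map u = beta_const * (s * (real m - 1) / L * u) powr (1 / \<gamma>)"

lemma scaled_nonneg: "scaled n k y \<ge> 0"
  unfolding scaled_def
  by (intro mult_nonneg_nonneg divide_nonneg_nonneg less_imp_le[OF moment_growth_pos]) (use m2 in auto)

text \<open>Here the exponents of the theorem appear: \<open>\<alpha> / \<gamma> = \<nu>\<close> and \<open>1 / \<gamma> = 1 - \<nu>\<close>.\<close>

lemma front_scaled:
  assumes "n \<ge> 1"
  shows "front n k y powr (1 / \<gamma>) * beta_const = real n powr \<nu> * limit_map (scaled n k y)"
proof -
  define u where "u = s * (real m - 1) / L * scaled n k y"
  have u: "u \<ge> 0" using s_pos m2 L_pos scaled_nonneg[of n k y] by (simp add: u_def)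
  have "front n k y = real n powr \<alpha> * u" using m2 by (simp add: front_def u_def scaled_def)
  then have "front n k y powr (1 / \<gamma>) = (real n powr \<alpha>) powr (1 / \<gamma>) * u powr (1 / \<gamma>)"
    using u by (simp add: powr_mult)
  also have "(real n powr \<alpha>) powr (1 / \<gamma>) = real n powr \<nu>" by (simp add: powr_powr \<nu>_def)
  finally show ?thesis by (simp add: limit_map_def u_def)
qed

text \<open>In \<open>hit_count_bound\<close> the upper level \<open>k0\<close> is \<open>cut n\<close>, and the lower level is \<open>\<delta> * n powr \<nu>\<close>.  The levels
  below it contribute at most about \<open>\<delta> * n powr \<nu>\<close> hits; above it the charge is controlled with constants
  that depend on \<open>\<delta>\<close>, and all errors from there are small for large \<open>n\<close>.\<close>

lemma hit_count_limit:
  "(\<lambda>n. mean n (\<lambda>\<omega>. \<bar>real n powr (- \<nu>) * real (num_hit \<omega> (n - 3)) - limit_map (scaled n (cut n) (act n (cut n) \<omega>))\<bar>)) \<longlonglongrightarrow> 0"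
proof -
  obtain \<kappa> where \<kappa>: "\<kappa> > 0" "(\<lambda>k. norming k / real k powr \<gamma>) \<longlonglongrightarrow> \<kappa>" using norming_asymp by blast
  obtain C where C: "C > 0" "\<And>n k k0 \<eta>. 2 \<le> k \<Longrightarrow> k \<le> k0 \<Longrightarrow> k0 < n \<Longrightarrow> load n k0 \<le> 1 \<Longrightarrow>
    (\<And>j. j > k \<Longrightarrow> \<bar>real j powr \<gamma> / norming j - 1 / \<kappa>\<bar> \<le> \<eta>) \<Longrightarrow>
    mean n (\<lambda>\<omega>. \<bar>real (num_hit \<omega> (n - 3)) - front n k0 (act n k0 \<omega>) powr (1 / \<gamma>) * beta_const\<bar>) \<le>
      C * (real k + sqrt (real k0) + (real n / real k0) powr \<alpha> +
        (1 + load n k) ^ (q0 + 1) * real k0 powr (\<alpha> + 1 / 2) * real k powr (- \<alpha>) +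
        real k powr (- \<alpha>) * (real n powr \<alpha> * (load n k0 + mismatch \<kappa> n k0 + \<eta>)))"
    using hit_count_bound[OF \<kappa>(1)] by blast
  define E where "E = (\<lambda>n. mean n (\<lambda>\<omega>. \<bar>real n powr (- \<nu>) * real (num_hit \<omega> (n - 3)) - limit_map (scaled n (cut n) (act n (cut n) \<omega>))\<bar>))"
  have E0: "E n \<ge> 0" for n
  proof -
    have "mean n (\<lambda>\<omega>. 0) \<le> E n" unfolding E_def by (intro mean_mono) simp
    then show ?thesis by (simp only: mean_const)
  qed
  have small: "eventually (\<lambda>n. E n < \<epsilon>) sequentially" if \<epsilon>: "\<epsilon> > 0" for \<epsilon>
  proof -
    define \<delta> where "\<delta> = min (1 / 2) (\<epsilon> / (4 * C))"
    have \<delta>: "\<delta> > 0" "\<delta> < 1" "C * \<delta> \<le> \<epsilon> / 4" using \<epsilon> C(1) by (auto simp: \<delta>_def min_def field_simps)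
    define \<eta> where "\<eta> = \<epsilon> / (4 * C * \<delta> powr (- \<alpha>))"
    have \<eta>: "\<eta> > 0" "C * (\<delta> powr (- \<alpha>) * \<eta>) = \<epsilon> / 4" using \<epsilon> C(1) \<delta> by (auto simp: \<eta>_def)
    have "(\<lambda>j. inverse (norming j / real j powr \<gamma>)) \<longlonglongrightarrow> inverse \<kappa>" using \<kappa> by (intro tendsto_inverse) auto
    then have "(\<lambda>j. real j powr \<gamma> / norming j) \<longlonglongrightarrow> 1 / \<kappa>" by (simp add: inverse_eq_divide)
    then have "eventually (\<lambda>j. dist (real j powr \<gamma> / norming j) (1 / \<kappa>) < \<eta>) sequentially"
      using \<eta>(1) by (rule tendstoD)
    then obtain j0 where j0: "\<And>j. j \<ge> j0 \<Longrightarrow> \<bar>real j powr \<gamma> / norming j - 1 / \<kappa>\<bar> \<le> \<eta>"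
      unfolding eventually_sequentially dist_real_def by (meson less_imp_le)
    define k where "k = (\<lambda>n. nat \<lceil>\<delta> * real n powr \<nu>\<rceil>)"
    have kb: "\<delta> * real n powr \<nu> \<le> real (k n)" "real (k n) \<le> \<delta> * real n powr \<nu> + 1" for n
    proof -
      have "\<delta> * real n powr \<nu> \<ge> 0" using \<delta> by simp
      then have "real (k n) = of_int \<lceil>\<delta> * real n powr \<nu>\<rceil>" by (simp add: k_def)
      then show "\<delta> * real n powr \<nu> \<le> real (k n)" "real (k n) \<le> \<delta> * real n powr \<nu> + 1" by linarith+
    qed
    have "filterlim (\<lambda>n. real n powr \<nu>) at_top sequentially"
      using nu_bounds(1) by real_asymp
    then have "filterlim (\<lambda>n. \<delta> * real n powr \<nu>) at_top sequentially"
      using \<delta> by (intro filterlim_tendsto_pos_mult_at_top[OF tendsto_const]) auto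
    then have "eventually (\<lambda>n. \<delta> * real n powr \<nu> \<ge> real (max 2 j0)) sequentially"
      by (simp only: filterlim_at_top)
    then have ev_k: "eventually (\<lambda>n. max 2 j0 \<le> k n) sequentially"
    proof eventually_elim
      case (elim n)
      then have "real (max 2 j0) \<le> real (k n)" using kb(1)[of n] by linarith
      then show ?case by (simp only: of_nat_le_iff)
    qed
    have "(\<lambda>n. \<delta> * real n powr (\<nu> - cut_exponent) + real n powr (- cut_exponent)) \<longlonglongrightarrow> \<delta> * 0 + 0"
      using cut_exponent_bounds by (intro tendsto_intros tendsto_neg_powr_real) auto
    then have "eventually (\<lambda>n. \<delta> * real n powr (\<nu> - cut_exponent) + real n powr (- cut_exponent) < 1) sequentially"
      by (rule order_tendstoD) simp
    then have ev_kc: "eventually (\<lambda>n. k n \<le> cut n) sequentially"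
      using eventually_ge_at_top[of 1]
    proof eventually_elim
      case (elim n)
      have p: "real n powr cut_exponent > 0" using elim by simp
      have "real (k n) \<le> (\<delta> * real n powr (\<nu> - cut_exponent) + real n powr (- cut_exponent)) * real n powr cut_exponent"
      proof -
        have "real n powr (\<nu> - cut_exponent) * real n powr cut_exponent = real n powr \<nu>"
          "real n powr (- cut_exponent) * real n powr cut_exponent = 1"
          using elim by (simp_all flip: powr_add)
        then show ?thesis using kb(2)[of n] by (simp add: distrib_right mult.assoc)
      qed
      also have "\<dots> \<le> 1 * real n powr cut_exponent" using elim by (intro mult_right_mono) auto
      also have "\<dots> \<le> real (cut n)" using cut_bounds(1)[of n] elim by simp
      finally show ?case by simp
    qed
    have ev_l: "eventually (\<lambda>n. load n (cut n) < 1) sequentially"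
      using load_cut by (rule order_tendstoD) simp
    \<comment> \<open>\<open>B n\<close> is the bound of \<open>hit_count_bound\<close> divided by \<open>n powr \<nu>\<close>; its limit is \<open>C * \<delta> + \<epsilon> / 4\<close>\<close>
    define W where "W = (1 + \<delta> powr (- \<gamma>)) ^ (q0 + 1) * 2 powr (\<alpha> + 1 / 2) * \<delta> powr (- \<alpha>)"
    define B where "B = (\<lambda>n. C * ((\<delta> + real n powr (- \<nu>)) + sqrt 2 * real n powr (cut_exponent / 2 - \<nu>) +
       real n powr (\<alpha> * (1 - cut_exponent) - \<nu>) + W * real n powr (cut_exponent * (\<alpha> + 1 / 2) - \<alpha>) +
       \<delta> powr (- \<alpha>) * (load n (cut n) + mismatch \<kappa> n (cut n) + \<eta>)))"
    have "B \<longlonglongrightarrow> C * ((\<delta> + 0) + sqrt 2 * 0 + 0 + W * 0 + \<delta> powr (- \<alpha>) * (0 + 0 + \<eta>))"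
      unfolding B_def
    proof (intro tendsto_mult tendsto_add tendsto_const tendsto_neg_powr_real load_cut mismatch_cut \<kappa>)
      show "- \<nu> < 0" "cut_exponent / 2 - \<nu> < 0" "cut_exponent * (\<alpha> + 1 / 2) - \<alpha> < 0"
        using nu_bounds cut_exponent_bounds by auto
      have "\<alpha> * (1 - cut_exponent) < \<alpha> * (1 - \<nu>)" using alpha_pos cut_exponent_bounds by (intro mult_strict_left_mono) auto
      then show "\<alpha> * (1 - cut_exponent) - \<nu> < 0" by (simp add: alpha_one_minus_nu)
    qed
    moreover have "C * ((\<delta> + 0) + sqrt 2 * 0 + 0 + W * 0 + \<delta> powr (- \<alpha>) * (0 + 0 + \<eta>)) < \<epsilon>"
      using \<delta>(3) \<eta>(2) \<epsilon> by (simp add: distrib_left)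
    ultimately have ev_B: "eventually (\<lambda>n. B n < \<epsilon>) sequentially" by (rule order_tendstoD)
    show ?thesis
      using ev_k ev_kc ev_l ev_B cut_lt eventually_ge_at_top[of 1]
    proof eventually_elim
      case (elim n)
      define N where "N = real n"
      have N: "N \<ge> 1" using elim by (simp add: N_def)
      then have Np: "N powr c > 0" for c by simp
      have k2: "2 \<le> k n" and kj: "j0 \<le> k n" using elim by auto
      have kp: "real (k n) > 0" using k2 by simp
      have cutp: "real (cut n) \<ge> 0" "real (cut n) \<le> 2 * N powr cut_exponent" using cut_bounds(2)[of n] elim by (auto simp: N_def)
      have dn: "\<delta> * N powr \<nu> > 0" using \<delta> Np by simp
      have ka: "real (k n) powr (- \<alpha>) \<le> \<delta> powr (- \<alpha>) * N powr (\<nu> - \<alpha>)"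
      proof -
        have "real (k n) powr (- \<alpha>) \<le> (\<delta> * N powr \<nu>) powr (- \<alpha>)"
          using kb(1)[of n] dn alpha_pos by (intro powr_mono2') (auto simp: N_def)
        also have "\<dots> = \<delta> powr (- \<alpha>) * N powr (- (\<nu> * \<alpha>))" using \<delta> by (simp add: powr_mult powr_powr)
        also have "- (\<nu> * \<alpha>) = \<nu> - \<alpha>" using nu_gamma by (simp add: gamma_eq algebra_simps)
        finally show ?thesis .
      qed
      have lk: "load n (k n) \<le> \<delta> powr (- \<gamma>)"
      proof -
        have "load n (k n) = N powr \<alpha> * real (k n) powr (- \<gamma>)"
        proof -
          have "real (k n) powr (- \<gamma>) = 1 / (real (k n) * real (k n) powr \<alpha>)"
            using kp by (simp only: powr_minus_divide gamma_eq powr_add powr_one less_imp_le)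
          then show ?thesis by (simp add: load_def powr_divide N_def)
        qed
        also have "\<dots> \<le> N powr \<alpha> * (\<delta> * N powr \<nu>) powr (- \<gamma>)"
          using kb(1)[of n] dn alpha_pos gamma_eq by (intro mult_left_mono powr_mono2') (auto simp: N_def)
        also have "\<dots> = N powr \<alpha> * (\<delta> powr (- \<gamma>) * N powr (- \<alpha>))"
          using \<delta> by (simp add: powr_mult powr_powr nu_gamma)
        also have "\<dots> = \<delta> powr (- \<gamma>)" using N by (simp add: powr_minus)
        finally show ?thesis .
      qed
      have mm: "mismatch \<kappa> n (cut n) \<ge> 0" by (simp add: mismatch_def)
      have "mean n (\<lambda>\<omega>. \<bar>real (num_hit \<omega> (n - 3)) - front n (cut n) (act n (cut n) \<omega>) powr (1 / \<gamma>) * beta_const\<bar>) \<le>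
        C * (real (k n) + sqrt (real (cut n)) + (real n / real (cut n)) powr \<alpha> +
        (1 + load n (k n)) ^ (q0 + 1) * real (cut n) powr (\<alpha> + 1 / 2) * real (k n) powr (- \<alpha>) +
        real (k n) powr (- \<alpha>) * (real n powr \<alpha> * (load n (cut n) + mismatch \<kappa> n (cut n) + \<eta>)))"
        by (rule C(2)) (use elim k2 kj j0 in auto)
      also have "\<dots> \<le> C * (N powr \<nu> * (\<delta> + N powr (- \<nu>)) + N powr \<nu> * (sqrt 2 * N powr (cut_exponent / 2 - \<nu>)) +
         N powr \<nu> * N powr (\<alpha> * (1 - cut_exponent) - \<nu>) + N powr \<nu> * (W * N powr (cut_exponent * (\<alpha> + 1 / 2) - \<alpha>)) +
         N powr \<nu> * (\<delta> powr (- \<alpha>) * (load n (cut n) + mismatch \<kappa> n (cut n) + \<eta>)))"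
      proof (intro mult_left_mono add_mono)
        show "real (k n) \<le> N powr \<nu> * (\<delta> + N powr (- \<nu>))"
        proof -
          have "N powr \<nu> * N powr (- \<nu>) = 1" using N by (simp add: powr_minus)
          then show ?thesis using kb(2)[of n] by (simp add: N_def distrib_left mult.commute)
        qed
        show "sqrt (real (cut n)) \<le> N powr \<nu> * (sqrt 2 * N powr (cut_exponent / 2 - \<nu>))"
        proof -
          have "sqrt (real (cut n)) \<le> sqrt (2 * N powr cut_exponent)" using cutp by simp
          also have "\<dots> = sqrt 2 * N powr (cut_exponent / 2)"
            using N by (simp add: real_sqrt_mult powr_half_sqrt_powr)
          also have "N powr (cut_exponent / 2) = N powr \<nu> * N powr (cut_exponent / 2 - \<nu>)" by (simp flip: powr_add)
          finally show ?thesis by (simp add: mult_ac)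
        qed
        show "(real n / real (cut n)) powr \<alpha> \<le> N powr \<nu> * N powr (\<alpha> * (1 - cut_exponent) - \<nu>)"
          using cut_ratio[of n] elim by (simp add: N_def flip: powr_add)
        show "(1 + load n (k n)) ^ (q0 + 1) * real (cut n) powr (\<alpha> + 1 / 2) * real (k n) powr (- \<alpha>) \<le>
          N powr \<nu> * (W * N powr (cut_exponent * (\<alpha> + 1 / 2) - \<alpha>))"
        proof -
          have c2: "real (cut n) powr (\<alpha> + 1 / 2) \<le> 2 powr (\<alpha> + 1 / 2) * N powr (cut_exponent * (\<alpha> + 1 / 2))"
          proof -
            have "real (cut n) powr (\<alpha> + 1 / 2) \<le> (2 * N powr cut_exponent) powr (\<alpha> + 1 / 2)"
              using cutp alpha_pos by (intro powr_mono2) auto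
            then show ?thesis by (simp add: powr_mult powr_powr)
          qed
          have "(1 + load n (k n)) ^ (q0 + 1) * real (cut n) powr (\<alpha> + 1 / 2) * real (k n) powr (- \<alpha>) \<le>
            (1 + \<delta> powr (- \<gamma>)) ^ (q0 + 1) * (2 powr (\<alpha> + 1 / 2) * N powr (cut_exponent * (\<alpha> + 1 / 2))) *
            (\<delta> powr (- \<alpha>) * N powr (\<nu> - \<alpha>))"
            using lk c2 ka load_nonneg[of n "k n"] by (intro mult_mono power_mono) auto
          also have "\<dots> = W * (N powr (cut_exponent * (\<alpha> + 1 / 2)) * N powr (\<nu> - \<alpha>))" by (simp add: W_def mult_ac)
          also have "N powr (cut_exponent * (\<alpha> + 1 / 2)) * N powr (\<nu> - \<alpha>) = N powr \<nu> * N powr (cut_exponent * (\<alpha> + 1 / 2) - \<alpha>)"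
            unfolding powr_add[symmetric] by (rule arg_cong[where f = "\<lambda>c. N powr c"]) simp
          finally show ?thesis by (simp add: mult_ac)
        qed
        show "real (k n) powr (- \<alpha>) * (real n powr \<alpha> * (load n (cut n) + mismatch \<kappa> n (cut n) + \<eta>)) \<le>
          N powr \<nu> * (\<delta> powr (- \<alpha>) * (load n (cut n) + mismatch \<kappa> n (cut n) + \<eta>))"
        proof -
          have "real (k n) powr (- \<alpha>) * (real n powr \<alpha> * (load n (cut n) + mismatch \<kappa> n (cut n) + \<eta>)) \<le>
             (\<delta> powr (- \<alpha>) * N powr (\<nu> - \<alpha>)) * (N powr \<alpha> * (load n (cut n) + mismatch \<kappa> n (cut n) + \<eta>))"
            unfolding N_def[symmetric] using ka mm \<eta>(1) load_nonneg[of n "cut n"] by (intro mult_right_mono) auto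
          also have "\<dots> = (N powr (\<nu> - \<alpha>) * N powr \<alpha>) * (\<delta> powr (- \<alpha>) * (load n (cut n) + mismatch \<kappa> n (cut n) + \<eta>))"
            by (simp only: mult_ac)
          also have "N powr (\<nu> - \<alpha>) * N powr \<alpha> = N powr \<nu>" by (simp flip: powr_add)
          finally show ?thesis .
        qed
      qed (use C(1) in auto)
      also have "\<dots> = N powr \<nu> * B n" by (simp add: B_def N_def distrib_left mult_ac)
      finally have 1: "mean n (\<lambda>\<omega>. \<bar>real (num_hit \<omega> (n - 3)) - front n (cut n) (act n (cut n) \<omega>) powr (1 / \<gamma>) * beta_const\<bar>) \<le> N powr \<nu> * B n" .
      have "E n = N powr (- \<nu>) * mean n (\<lambda>\<omega>. \<bar>real (num_hit \<omega> (n - 3)) - front n (cut n) (act n (cut n) \<omega>) powr (1 / \<gamma>) * beta_const\<bar>)"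
        unfolding E_def mean_cmult[symmetric]
      proof (rule arg_cong[where f = "mean n"], rule ext)
        fix \<omega>
        have "N powr (- \<nu>) * N powr \<nu> = 1" using N by (simp add: powr_minus)
        then have "real n powr (- \<nu>) * real (num_hit \<omega> (n - 3)) - limit_map (scaled n (cut n) (act n (cut n) \<omega>)) =
          N powr (- \<nu>) * (real (num_hit \<omega> (n - 3)) - N powr \<nu> * limit_map (scaled n (cut n) (act n (cut n) \<omega>)))"
          by (simp add: N_def right_diff_distrib flip: mult.assoc)
        then show "\<bar>real n powr (- \<nu>) * real (num_hit \<omega> (n - 3)) - limit_map (scaled n (cut n) (act n (cut n) \<omega>))\<bar> =
          N powr (- \<nu>) * \<bar>real (num_hit \<omega> (n - 3)) - front n (cut n) (act n (cut n) \<omega>) powr (1 / \<gamma>) * beta_const\<bar>"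
          using front_scaled[of n "cut n" "act n (cut n) \<omega>"] elim by (simp add: abs_mult N_def)
      qed
      also have "\<dots> \<le> N powr (- \<nu>) * (N powr \<nu> * B n)" by (intro mult_left_mono 1) simp
      also have "\<dots> = B n" using N by (simp add: powr_minus)
      finally show ?case using elim by linarith
    qed
  qed
  have "E \<longlonglongrightarrow> 0"
  proof (rule order_tendstoI)
    fix a :: real assume "a < 0"
    then show "eventually (\<lambda>n. a < E n) sequentially" using E0 by (intro always_eventually) (auto intro: less_le_trans)
  qed (rule small)
  then show ?thesis by (simp only: E_def)
qed

text \<open>The initial \<open>m\<close> active edges give the power \<open>m\<close> of \<open>F\<close>, and \<open>1 / (m - 1)\<close> becomes \<open>m / (m - 1)\<close>.\<close>

lemma scaled_laplace_limit:
  "(\<lambda>n. mean_at n (cut n) (\<lambda>y. exp (- (real j * scaled n (cut n) y)))) \<longlonglongrightarrow> (1 + real j) powr (- (real m / (real m - 1)))"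
proof -
  obtain C where C: "C > 0" "\<And>\<tau> n k. 0 \<le> \<tau> \<Longrightarrow> m \<le> k \<Longrightarrow> k < n \<Longrightarrow>
    \<bar>mean_at n k (\<lambda>y. exp (- (\<tau> * scaled n k y))) - F \<tau> ^ m\<bar> \<le>
      C * (\<tau> + \<tau>\<^sup>2) * ((real n / real k) powr \<alpha> / real k + (real k / real n) powr \<alpha>)"
    using laplace_limit by blast
  define D where "D = C * (real j + (real j)\<^sup>2)"
  have Fm: "F (real j) ^ m = (1 + real j) powr (- (real m / (real m - 1)))"
    by (simp add: F_def powr_power)
  have lim: "(\<lambda>n. D * (load n (cut n) + 2 powr \<alpha> * real n powr (\<alpha> * (cut_exponent - 1)))) \<longlonglongrightarrow> D * (0 + 2 powr \<alpha> * 0)"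
    using alpha_pos cut_exponent_bounds by (intro tendsto_intros load_cut tendsto_neg_powr_real mult_pos_neg) auto
  have ev: "eventually (\<lambda>n. norm (mean_at n (cut n) (\<lambda>y. exp (- (real j * scaled n (cut n) y))) - F (real j) ^ m) \<le>
     D * (load n (cut n) + 2 powr \<alpha> * real n powr (\<alpha> * (cut_exponent - 1)))) sequentially"
  proof -
    have "eventually (\<lambda>n. m \<le> cut n) sequentially" using filterlim_cut by (simp add: filterlim_at_top)
    then show ?thesis using cut_lt eventually_ge_at_top[of 1]
    proof eventually_elim
      case (elim n)
      have "norm (mean_at n (cut n) (\<lambda>y. exp (- (real j * scaled n (cut n) y))) - F (real j) ^ m) \<le>
        D * ((real n / real (cut n)) powr \<alpha> / real (cut n) + (real (cut n) / real n) powr \<alpha>)"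
        unfolding D_def real_norm_def by (rule C(2)) (use elim in auto)
      also have "\<dots> \<le> D * (load n (cut n) + 2 powr \<alpha> * real n powr (\<alpha> * (cut_exponent - 1)))"
      proof (intro mult_left_mono add_mono)
        have "real (cut n) / real n \<le> 2 * real n powr cut_exponent / real n"
          using cut_bounds(2)[of n] elim by (intro divide_right_mono) auto
        also have "\<dots> = 2 * real n powr (cut_exponent - 1)" using elim by (simp add: powr_diff)
        finally have "(real (cut n) / real n) powr \<alpha> \<le> (2 * real n powr (cut_exponent - 1)) powr \<alpha>"
          using alpha_pos by (intro powr_mono2) auto
        then show "(real (cut n) / real n) powr \<alpha> \<le> 2 powr \<alpha> * real n powr (\<alpha> * (cut_exponent - 1))"
          by (simp add: powr_mult powr_powr mult.commute)
      qed (use C(1) in \<open>auto simp: D_def load_def\<close>)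
      finally show ?case .
    qed
  qed
  have "(\<lambda>n. mean_at n (cut n) (\<lambda>y. exp (- (real j * scaled n (cut n) y))) - F (real j) ^ m) \<longlonglongrightarrow> 0"
    by (rule Lim_null_comparison[OF ev]) (use lim in simp)
  then show ?thesis unfolding Fm by (simp add: LIM_zero_iff)
qed

end

section \<open>From Laplace transforms to weak convergence\<close>

lemma integrable_continuous_unit:
  fixes f :: "real \<Rightarrow> real" and Z :: "'a \<Rightarrow> real"
  assumes P: "prob_space P" and Z: "Z \<in> borel_measurable P" "AE x in P. Z x \<in> {0..1}"
    and f: "f \<in> borel_measurable borel" "continuous_on {0..1} f"
  shows "integrable P (\<lambda>x. f (Z x))"
proof -
  interpret prob_space P by (rule P)
  have "bounded (f ` {0..1})" using f(2) by (intro compact_imp_bounded compact_continuous_image) auto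
  then obtain B where B: "\<And>x. x \<in> {0..1} \<Longrightarrow> norm (f x) \<le> B" unfolding bounded_iff by blast
  show ?thesis
  proof (rule integrable_const_bound)
    show "AE x in P. norm (f (Z x)) \<le> B" using Z(2) by eventually_elim (rule B)
    show "(\<lambda>x. f (Z x)) \<in> borel_measurable P" using Z(1) f(1) by measurable
  qed
qed

lemma mean_diff_le_unit:
  fixes f g :: "real \<Rightarrow> real" and Z :: "'a \<Rightarrow> real"
  assumes P: "prob_space P" and Z: "Z \<in> borel_measurable P" "AE x in P. Z x \<in> {0..1}"
    and f: "f \<in> borel_measurable borel" "continuous_on {0..1} f"
    and g: "g \<in> borel_measurable borel" "continuous_on {0..1} g"
    and e: "\<And>x. x \<in> {0..1} \<Longrightarrow> \<bar>g x - f x\<bar> \<le> e"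
  shows "\<bar>(\<integral>x. g (Z x) \<partial>P) - (\<integral>x. f (Z x) \<partial>P)\<bar> \<le> e"
proof -
  interpret prob_space P by (rule P)
  note ig = integrable_continuous_unit[OF P Z g] and ip = integrable_continuous_unit[OF P Z f]
  have "\<bar>(\<integral>x. g (Z x) \<partial>P) - (\<integral>x. f (Z x) \<partial>P)\<bar> = \<bar>\<integral>x. g (Z x) - f (Z x) \<partial>P\<bar>" using ig ip by simp
  also have "\<dots> \<le> (\<integral>x. \<bar>g (Z x) - f (Z x)\<bar> \<partial>P)" by (rule integral_abs_bound)
  also have "\<dots> \<le> (\<integral>x. e \<partial>P)"
  proof (rule integral_mono_AE)
    show "AE x in P. \<bar>g (Z x) - f (Z x)\<bar> \<le> e" using Z(2) by eventually_elim (rule e)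
  qed (use ig ip in auto)
  also have "\<dots> = e" by (simp add: prob_space)
  finally show ?thesis .
qed

text \<open>Convergence of all moments of \<open>[0, 1]\<close>-valued variables gives convergence of the means of all
  continuous functions, by the Weierstrass approximation theorem.\<close>

lemma moments_imp_continuous_means:
  fixes N :: "nat \<Rightarrow> 'a measure" and X :: "nat \<Rightarrow> 'a \<Rightarrow> real" and M :: "'b measure" and Y :: "'b \<Rightarrow> real"
    and g :: "real \<Rightarrow> real"
  assumes N: "\<And>n. prob_space (N n)" and M: "prob_space M"
    and X [measurable]: "\<And>n. X n \<in> borel_measurable (N n)" and Y [measurable]: "Y \<in> borel_measurable M"
    and X01: "\<And>n. AE x in N n. X n x \<in> {0..1}" and Y01: "AE x in M. Y x \<in> {0..1}"
    and mom: "\<And>j::nat. (\<lambda>n. \<integral>x. X n x ^ j \<partial>N n) \<longlonglongrightarrow> (\<integral>x. Y x ^ j \<partial>M)"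
    and g [measurable]: "g \<in> borel_measurable borel" and cont: "continuous_on {0..1} g"
  shows "(\<lambda>n. \<integral>x. g (X n x) \<partial>N n) \<longlonglongrightarrow> (\<integral>x. g (Y x) \<partial>M)"
proof -
  define A where "A = (\<lambda>f :: real \<Rightarrow> real. f \<in> borel_measurable borel \<and> continuous_on {0..1} f \<and>
    (\<lambda>n. \<integral>x. f (X n x) \<partial>N n) \<longlonglongrightarrow> (\<integral>x. f (Y x) \<partial>M))"
  have A_add: "A (\<lambda>x. f x + h x)" and A_diff: "A (\<lambda>x. f x - h x)" if "A f" "A h" for f h
  proof -
    have f: "f \<in> borel_measurable borel" "continuous_on {0..1} f" "(\<lambda>n. \<integral>x. f (X n x) \<partial>N n) \<longlonglongrightarrow> (\<integral>x. f (Y x) \<partial>M)"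
      and h: "h \<in> borel_measurable borel" "continuous_on {0..1} h" "(\<lambda>n. \<integral>x. h (X n x) \<partial>N n) \<longlonglongrightarrow> (\<integral>x. h (Y x) \<partial>M)"
      using that by (auto simp: A_def)
    note iX = integrable_continuous_unit[OF N X X01] and iY = integrable_continuous_unit[OF M Y Y01]
    have "(\<lambda>n. (\<integral>x. f (X n x) \<partial>N n) + (\<integral>x. h (X n x) \<partial>N n)) \<longlonglongrightarrow> (\<integral>x. f (Y x) \<partial>M) + (\<integral>x. h (Y x) \<partial>M)"
      by (intro tendsto_add f h)
    then show "A (\<lambda>x. f x + h x)" using f h
      by (auto simp: A_def iX iY intro!: continuous_intros)
    have "(\<lambda>n. (\<integral>x. f (X n x) \<partial>N n) - (\<integral>x. h (X n x) \<partial>N n)) \<longlonglongrightarrow> (\<integral>x. f (Y x) \<partial>M) - (\<integral>x. h (Y x) \<partial>M)"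
      by (intro tendsto_diff f h)
    then show "A (\<lambda>x. f x - h x)" using f h
      by (auto simp: A_def iX iY intro!: continuous_intros)
  qed
  have A_cmult: "A (\<lambda>x. c * f x)" if "A f" for f c
    using that by (auto simp: A_def intro!: continuous_intros tendsto_intros)
  have A_pow: "A (\<lambda>x. x ^ k * (1 - x) ^ l)" for k l
  proof (induction l arbitrary: k)
    case 0 show ?case using mom[of k] by (auto simp: A_def intro!: continuous_intros)
  next
    case (Suc l)
    have "A (\<lambda>x. x ^ k * (1 - x) ^ l - x ^ Suc k * (1 - x) ^ l)" by (intro A_diff Suc)
    also have "(\<lambda>x::real. x ^ k * (1 - x) ^ l - x ^ Suc k * (1 - x) ^ l) = (\<lambda>x. x ^ k * (1 - x) ^ Suc l)"
      by (rule ext) (simp add: algebra_simps)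
    finally show ?case .
  qed
  have A_bern: "A (\<lambda>x. \<Sum>k\<in>I. c k * Bernstein K k x)" if "finite I" for I c K
    using that
  proof (induction I rule: finite_induct)
    case empty show ?case by (simp add: A_def)
  next
    case (insert i I)
    have "A (\<lambda>x. (c i * real (K choose i)) * (x ^ i * (1 - x) ^ (K - i)) + (\<Sum>k\<in>I. c k * Bernstein K k x))"
      by (intro A_add A_cmult A_pow insert)
    then show ?case using insert by (simp add: Bernstein_def mult.assoc)
  qed
  show ?thesis
  proof (rule tendstoI)
    fix e :: real assume e: "e > 0"
    obtain K where K: "\<And>x. x \<in> {0..1} \<Longrightarrow> \<bar>g x - (\<Sum>k\<le>K. g (real k / real K) * Bernstein K k x)\<bar> < e / 3"
      using Bernstein_Weierstrass[OF cont, of "e / 3"] e by auto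
    define p where "p = (\<lambda>x. \<Sum>k\<le>K. g (real k / real K) * Bernstein K k x)"
    have Ap: "A p" unfolding p_def by (rule A_bern) simp
    then have p: "p \<in> borel_measurable borel" "continuous_on {0..1} p"
      "(\<lambda>n. \<integral>x. p (X n x) \<partial>N n) \<longlonglongrightarrow> (\<integral>x. p (Y x) \<partial>M)" by (auto simp: A_def)
    have pK: "\<bar>g x - p x\<bar> \<le> e / 3" if "x \<in> {0..1}" for x using K[OF that] by (simp add: p_def)
    note closeX = mean_diff_le_unit[OF N X X01 p(1,2) g cont pK]
      and closeY = mean_diff_le_unit[OF M Y Y01 p(1,2) g cont pK]
    have "eventually (\<lambda>n. dist (\<integral>x. p (X n x) \<partial>N n) (\<integral>x. p (Y x) \<partial>M) < e / 3) sequentially"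
      using p(3) by (rule tendstoD) (use e in simp)
    then show "eventually (\<lambda>n. dist (\<integral>x. g (X n x) \<partial>N n) (\<integral>x. g (Y x) \<partial>M) < e) sequentially"
    proof eventually_elim
      case (elim n)
      then show ?case
        using closeX[of n] closeY unfolding dist_real_def by linarith
    qed
  qed
qed

text \<open>The substitution \<open>c * x\<close> with \<open>c = 1 + j\<close> maps the tilted density to a multiple of the density.\<close>

lemma gamma_laplace:
  fixes a :: real
  assumes M: "prob_space M" and X: "distributed M lborel X (gamma_density a 1)" and a: "a > 0"
  shows "(\<integral>\<omega>. exp (- X \<omega>) ^ j \<partial>M) = (1 + real j) powr (- a)" and "AE \<omega> in M. X \<omega> > 0"
proof -
  interpret prob_space M by (rule M)
  have Ga: "Gamma a > 0" using a by (rule Gamma_real_pos)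
  have nn: "gamma_density a 1 x \<ge> 0" for x using Ga by (simp add: gamma_density_def)
  have one: "(\<integral>x. gamma_density a 1 x \<partial>lborel) = 1"
    using distributed_integral[OF X, of "\<lambda>_. 1"] nn by (simp add: prob_space)
  define c where "c = 1 + real j"
  have c: "c > 0" by (simp add: c_def)
  have "(\<integral>\<omega>. exp (- X \<omega>) ^ j \<partial>M) = (\<integral>x. gamma_density a 1 x * exp (- x) ^ j \<partial>lborel)"
    using distributed_integral[OF X, of "\<lambda>x. exp (- x) ^ j"] nn by simp
  also have "\<dots> = (\<integral>x. c powr (1 - a) * gamma_density a 1 (0 + c * x) \<partial>lborel)"
  proof (intro Bochner_Integration.integral_cong refl)
    fix x :: real
    show "gamma_density a 1 x * exp (- x) ^ j = c powr (1 - a) * gamma_density a 1 (0 + c * x)"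
    proof (cases "x > 0")
      case True
      have "exp (- x) * exp (- x) ^ j = exp (- (c * x))"
        by (simp add: c_def algebra_simps exp_add exp_of_nat_mult[symmetric] flip: exp_add)
      moreover have "c powr (1 - a) * (c * x) powr (a - 1) = x powr (a - 1)"
        using c True by (simp add: powr_mult flip: powr_add mult.assoc)
      ultimately show ?thesis using True c by (simp add: gamma_density_def field_simps)
    next
      case False
      then show ?thesis using c by (simp add: gamma_density_def zero_less_mult_iff)
    qed
  qed
  also have "\<dots> = c powr (1 - a) * (1 / c * (\<bar>c\<bar> *\<^sub>R (\<integral>x. gamma_density a 1 (0 + c * x) \<partial>lborel)))"
    using c by simp
  also have "\<bar>c\<bar> *\<^sub>R (\<integral>x. gamma_density a 1 (0 + c * x) \<partial>lborel) = 1"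
    using lborel_integral_real_affine[of c "gamma_density a 1" 0] one c by simp
  also have "c powr (1 - a) * (1 / c * 1) = c powr (- a)"
    using c by (simp add: powr_diff powr_minus_divide)
  finally show "(\<integral>\<omega>. exp (- X \<omega>) ^ j \<partial>M) = (1 + real j) powr (- a)" by (simp add: c_def)
  show "AE \<omega> in M. X \<omega> > 0"
    using X by (subst distributed_AE2[OF X]) (auto simp: gamma_density_def)
qed

section \<open>The limit theorem\<close>

lemma cts_step_Lipschitz:
  assumes "x < y"
  shows "\<bar>cts_step x y a - cts_step x y c\<bar> \<le> \<bar>a - c\<bar> / (y - x)"
proof -
  have clip: "cts_step x y v = max 0 (min 1 ((y - v) / (y - x)))" for v
    using assms by (auto simp: cts_step_def divide_simps max_def min_def)
  have "(y - a) / (y - x) - (y - c) / (y - x) = (c - a) / (y - x)" by (simp flip: diff_divide_distrib)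
  then have "\<bar>(y - a) / (y - x) - (y - c) / (y - x)\<bar> = \<bar>a - c\<bar> / (y - x)"
    using assms by (simp add: abs_minus_commute)
  then show ?thesis unfolding clip by linarith
qed

context pref_attach begin

lemma beta_const_pos: "beta_const > 0"
proof -
  have "1 - 1 / \<gamma> > 0" "q + 1 / \<gamma> > 0"
    using gamma_eq alpha_pos q_bounds by (auto intro: add_pos_pos)
  then show ?thesis unfolding beta_const_def using q_bounds by (intro divide_pos_pos mult_pos_pos Gamma_real_pos) auto
qed

lemma limit_map_continuous: "continuous_on {0..} limit_map"
  unfolding limit_map_def
  by (intro continuous_intros continuous_on_powr') (use s_pos m2 L_pos gamma_eq alpha_pos in auto)

lemma limit_map_measurable [measurable]: "limit_map \<in> borel_measurable borel"
  unfolding limit_map_def by measurable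

lemma limit_map_unbounded: "\<exists>v>0. \<forall>u\<ge>v. limit_map u \<ge> B"
proof -
  define c where "c = s * (real m - 1) / L"
  have c: "c > 0" using s_pos m2 L_pos by (simp add: c_def)
  have g: "\<gamma> > 0" using gamma_eq alpha_pos by simp
  define B' where "B' = max B 1"
  have B': "B' > 0" "B \<le> B'" by (auto simp: B'_def)
  define v where "v = (B' / beta_const) powr \<gamma> / c"
  have v: "v > 0" using B' beta_const_pos c by (simp add: v_def)
  have "limit_map u \<ge> B" if u: "u \<ge> v" for u
  proof -
    have "c * v \<le> c * u" using u c by (intro mult_left_mono) auto
    then have "(B' / beta_const) powr \<gamma> \<le> c * u" using c by (simp add: v_def)
    then have "((B' / beta_const) powr \<gamma>) powr (1 / \<gamma>) \<le> (c * u) powr (1 / \<gamma>)" using g by (intro powr_mono2) auto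
    then have "B' / beta_const \<le> (c * u) powr (1 / \<gamma>)" using B' beta_const_pos g by (simp add: powr_powr)
    then have "B' \<le> beta_const * (c * u) powr (1 / \<gamma>)" using beta_const_pos by (simp add: field_simps)
    then show ?thesis using B' by (simp add: limit_map_def c_def)
  qed
  then show ?thesis using v by blast
qed

text \<open>Expressed through \<open>v = exp (- u)\<close>, a test function of the limit extends continuously to \<open>v = 0\<close>, because
  \<open>cts_step x y\<close> vanishes beyond \<open>y\<close> and \<open>limit_map\<close> is unbounded.\<close>

lemma test_function:
  assumes xy: "x < y"
  defines "g \<equiv> \<lambda>v. if v \<le> 0 then 0 else cts_step x y (limit_map (- ln v))"
  shows "g \<in> borel_measurable borel" and "continuous_on {0..1} g"
proof -
  have cc: "continuous_on UNIV (cts_step x y)"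
    by (rule uniformly_continuous_imp_continuous[OF cts_step_uniformly_continuous[OF xy]])
  have [measurable]: "cts_step x y \<in> borel_measurable borel" by (rule borel_measurable_continuous_onI[OF cc])
  show "g \<in> borel_measurable borel" unfolding g_def by measurable
  obtain v where v: "v > 0" "\<And>u. u \<ge> v \<Longrightarrow> limit_map u \<ge> y" using limit_map_unbounded[of y] by blast
  have e: "0 < exp (- v)" "exp (- v) \<le> 1" using v by auto
  have g0: "g u = 0" if "u \<in> {0..exp (- v)}" for u
  proof (cases "u \<le> 0")
    case True then show ?thesis by (simp add: g_def)
  next
    case False
    then have "ln u \<le> ln (exp (- v))" using that by (subst ln_le_cancel_iff) auto
    then have "limit_map (- ln u) \<ge> y" by (intro v(2)) simp
    then show ?thesis using False xy by (simp add: g_def cts_step_def)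
  qed
  have "continuous_on {0..exp (- v)} g"
    using continuous_on_cong[OF refl, of "{0..exp (- v)}" g "\<lambda>_. 0"] g0 by simp
  moreover have "continuous_on {exp (- v)..1} g"
  proof -
    have "continuous_on {exp (- v)..1} (\<lambda>u. cts_step x y (limit_map (- ln u)))"
    proof (rule continuous_on_compose2[OF cc])
      show "continuous_on {exp (- v)..1} (\<lambda>u. limit_map (- ln u))"
      proof (rule continuous_on_compose2[OF limit_map_continuous])
        show "continuous_on {exp (- v)..1} (\<lambda>u. - ln u)" using e by (intro continuous_intros) auto
        show "(\<lambda>u. - ln u) ` {exp (- v)..1} \<subseteq> {0..}" using e
          by (auto simp: ln_le_zero_iff order.strict_trans2[of 0 "exp (- v)"])
      qed
    qed auto
    moreover have "g u = cts_step x y (limit_map (- ln u))" if "u \<in> {exp (- v)..1}" for u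
    proof -
      have "u > 0" using that by (auto intro: order.strict_trans2[OF e(1)])
      then show ?thesis by (simp add: g_def)
    qed
    ultimately show ?thesis using continuous_on_cong[OF refl, of "{exp (- v)..1}" g] by simp
  qed
  ultimately have "continuous_on ({0..exp (- v)} \<union> {exp (- v)..1}) g"
    by (intro continuous_on_closed_Un) auto
  also have "{0..exp (- v)} \<union> {exp (- v)..1} = {0..1}"
    using e by (intro ivl_disj_un_two_touch) auto
  finally show "continuous_on {0..1} g" .
qed

text \<open>The moments of \<open>exp (- scaled n k y)\<close> are the values of the Laplace transform at the integers.\<close>

lemma mean_test_limit:
  fixes M :: "'a measure" and \<xi> :: "'a \<Rightarrow> real"
  assumes M: "prob_space M" and \<xi>: "distributed M lborel \<xi> (gamma_density (real m / (real m - 1)) 1)" and xy: "x < y"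
  shows "(\<lambda>n. mean n (\<lambda>\<omega>. cts_step x y (limit_map (scaled n (cut n) (act n (cut n) \<omega>))))) \<longlonglongrightarrow>
    (\<integral>\<omega>. cts_step x y (limit_map (\<xi> \<omega>)) \<partial>M)"
proof -
  define g where "g = (\<lambda>v. if v \<le> 0 then 0 else cts_step x y (limit_map (- ln v)))"
  define X where "X = (\<lambda>n \<omega>. exp (- scaled n (cut n) (act n (cut n) \<omega>)))"
  note g = test_function[OF xy, folded g_def]
  have a: "real m / (real m - 1) > 0" using m2 by simp
  have meas: "\<xi> \<in> borel_measurable M" using distributed_measurable[OF \<xi>] by simp
  have "(\<lambda>n. \<integral>\<omega>. g (X n \<omega>) \<partial>measure_pmf (chain n (n - 3))) \<longlonglongrightarrow> (\<integral>\<omega>. g (exp (- \<xi> \<omega>)) \<partial>M)"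
  proof (rule moments_imp_continuous_means[OF _ M _ _ _ _ _ g])
    show "prob_space (measure_pmf (chain n (n - 3)))" for n by (rule measure_pmf.prob_space_axioms)
    show "(\<lambda>\<omega>. exp (- \<xi> \<omega>)) \<in> borel_measurable M" using meas by measurable
    show "AE \<omega> in measure_pmf (chain n (n - 3)). X n \<omega> \<in> {0..1}" for n
      using scaled_nonneg by (intro AE_I2) (auto simp: X_def)
    show "AE \<omega> in M. exp (- \<xi> \<omega>) \<in> {0..1}"
      using gamma_laplace(2)[OF M \<xi> a] by eventually_elim auto
    fix j :: nat
    have "eventually (\<lambda>n. 2 \<le> cut n) sequentially" using filterlim_cut by (simp add: filterlim_at_top)
    then have "eventually (\<lambda>n. mean_at n (cut n) (\<lambda>y. exp (- (real j * scaled n (cut n) y))) =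
        (\<integral>\<omega>. X n \<omega> ^ j \<partial>measure_pmf (chain n (n - 3)))) sequentially"
      using cut_lt
    proof eventually_elim
      case (elim n)
      have "X n \<omega> ^ j = exp (- (real j * scaled n (cut n) (act n (cut n) \<omega>)))" for \<omega>
        by (simp add: X_def flip: exp_of_nat_mult)
      then show ?case using mean_act[OF elim, of "\<lambda>y. exp (- (real j * scaled n (cut n) y))"]
        by (simp add: mean_def)
    qed
    then have "(\<lambda>n. \<integral>\<omega>. X n \<omega> ^ j \<partial>measure_pmf (chain n (n - 3))) \<longlonglongrightarrow> (1 + real j) powr (- (real m / (real m - 1)))"
      by (rule Lim_transform_eventually[OF scaled_laplace_limit])
    then show "(\<lambda>n. \<integral>\<omega>. X n \<omega> ^ j \<partial>measure_pmf (chain n (n - 3))) \<longlonglongrightarrow> (\<integral>\<omega>. exp (- \<xi> \<omega>) ^ j \<partial>M)"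
      by (simp only: gamma_laplace(1)[OF M \<xi> a])
  qed simp
  then show ?thesis by (simp add: g_def X_def mean_def)
qed

text \<open>The coupling changes the number of descendants by at most \<open>3\<close>, and \<open>cts_step x y\<close> is Lipschitz with
  constant \<open>1 / (y - x)\<close>.\<close>

lemma coupling_error:
  assumes n: "n \<ge> 3" and xy: "x < y"
  shows "\<bar>(\<integral>G. cts_step x y (real n powr (- \<nu>) * real (num_descendants G n)) \<partial>measure_pmf (pa_graph m \<rho> n)) -
      mean n (\<lambda>\<omega>. cts_step x y (h \<omega>))\<bar> \<le>
    (3 * real n powr (- \<nu>) + mean n (\<lambda>\<omega>. \<bar>real n powr (- \<nu>) * real (num_hit \<omega> (n - 3)) - h \<omega>\<bar>)) / (y - x)"
proof -
  obtain K :: "((nat \<Rightarrow> nat) \<times> nat) pmf" where K: "map_pmf fst K = chain n (n - 3)"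
    "map_pmf snd K = map_pmf (\<lambda>G. num_descendants G n) (pa_graph m \<rho> n)"
    "\<And>\<omega> k. (\<omega>, k) \<in> set_pmf K \<Longrightarrow> num_hit \<omega> (n - 3) \<le> k \<and> k \<le> num_hit \<omega> (n - 3) + 3"
    using descendants_coupling[OF n] by metis
  define p where "p = real n powr (- \<nu>)"
  have p: "p \<ge> 0" by (simp add: p_def)
  have fin: "finite (set_pmf K)"
  proof (rule finite_subset)
    show "set_pmf K \<subseteq> Sigma (set_pmf (chain n (n - 3))) (\<lambda>\<omega>. {..num_hit \<omega> (n - 3) + 3})"
    proof
      fix z assume z: "z \<in> set_pmf K"
      then have "fst z \<in> set_pmf (chain n (n - 3))" by (simp flip: K(1))
      then show "z \<in> Sigma (set_pmf (chain n (n - 3))) (\<lambda>\<omega>. {..num_hit \<omega> (n - 3) + 3})"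
        using K(3)[of "fst z" "snd z"] z by (cases z) auto
    qed
  qed (auto intro: finite_SigmaI)
  have fst: "mean n f = (\<integral>z. f (fst z) \<partial>measure_pmf K)" for f :: "(nat \<Rightarrow> nat) \<Rightarrow> real"
    unfolding mean_def K(1)[symmetric] by simp
  have snd: "(\<integral>G. cts_step x y (p * real (num_descendants G n)) \<partial>measure_pmf (pa_graph m \<rho> n)) =
    (\<integral>z. cts_step x y (p * real (snd z)) \<partial>measure_pmf K)"
  proof -
    have "(\<integral>G. cts_step x y (p * real (num_descendants G n)) \<partial>measure_pmf (pa_graph m \<rho> n)) =
      (\<integral>k. cts_step x y (p * real k) \<partial>measure_pmf (map_pmf (\<lambda>G. num_descendants G n) (pa_graph m \<rho> n)))" by simp
    then show ?thesis by (simp flip: K(2))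
  qed
  have "\<bar>(\<integral>z. cts_step x y (p * real (snd z)) \<partial>measure_pmf K) - (\<integral>z. cts_step x y (h (fst z)) \<partial>measure_pmf K)\<bar> =
    \<bar>\<integral>z. cts_step x y (p * real (snd z)) - cts_step x y (h (fst z)) \<partial>measure_pmf K\<bar>"
    using fin by (subst Bochner_Integration.integral_diff) auto
  also have "\<dots> \<le> (\<integral>z. \<bar>cts_step x y (p * real (snd z)) - cts_step x y (h (fst z))\<bar> \<partial>measure_pmf K)"
    by (rule integral_abs_bound)
  also have "\<dots> \<le> (\<integral>z. (3 * p + \<bar>p * real (num_hit (fst z) (n - 3)) - h (fst z)\<bar>) / (y - x) \<partial>measure_pmf K)"
  proof (rule expectation_mono_finite[OF fin])
    fix z assume z: "z \<in> set_pmf K"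
    define a where "a = real (snd z)"
    define c where "c = real (num_hit (fst z) (n - 3))"
    have "c \<le> a" "a \<le> c + 3" using K(3)[of "fst z" "snd z"] z by (auto simp: a_def c_def)
    then have "p * c \<le> p * a" "p * a \<le> p * c + 3 * p"
      using p mult_left_mono[of c a p] mult_left_mono[of a "c + 3" p] by (auto simp: algebra_simps)
    then have "\<bar>p * a - h (fst z)\<bar> \<le> 3 * p + \<bar>p * c - h (fst z)\<bar>" using p by linarith
    then have "\<bar>p * a - h (fst z)\<bar> / (y - x) \<le> (3 * p + \<bar>p * c - h (fst z)\<bar>) / (y - x)"
      using xy by (intro divide_right_mono) auto
    then show "\<bar>cts_step x y (p * real (snd z)) - cts_step x y (h (fst z))\<bar> \<le> (3 * p + \<bar>p * real (num_hit (fst z) (n - 3)) - h (fst z)\<bar>) / (y - x)"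
      using cts_step_Lipschitz[OF xy, of "p * a" "h (fst z)"] unfolding a_def c_def by linarith
  qed
  also have "\<dots> = mean n (\<lambda>\<omega>. (1 / (y - x)) * (3 * p + \<bar>p * real (num_hit \<omega> (n - 3)) - h \<omega>\<bar>))"
    unfolding fst by simp
  also have "\<dots> = (3 * p + mean n (\<lambda>\<omega>. \<bar>p * real (num_hit \<omega> (n - 3)) - h \<omega>\<bar>)) / (y - x)"
    by (simp only: mean_cmult mean_add mean_const) simp
  finally show ?thesis unfolding fst[of "\<lambda>\<omega>. cts_step x y (h \<omega>)"] snd[unfolded p_def] p_def .
qed

lemma descendants_weak_limit:
  fixes M :: "'a measure" and \<xi> :: "'a \<Rightarrow> real"
  assumes M: "prob_space M" and \<xi>: "distributed M lborel \<xi> (gamma_density (real m / (real m - 1)) 1)"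
  shows "weak_conv_m (\<lambda>n. distr (measure_pmf (pa_graph m \<rho> n)) borel (\<lambda>G. real n powr (- \<nu>) * real (num_descendants G n)))
    (distr M borel (\<lambda>\<omega>. limit_map (\<xi> \<omega>)))"
proof (rule integral_cts_step_conv_imp_weak_conv)
  have meas [measurable]: "\<xi> \<in> borel_measurable M" using distributed_measurable[OF \<xi>] by simp
  show "real_distribution (distr (measure_pmf (pa_graph m \<rho> n)) borel (\<lambda>G. real n powr (- \<nu>) * real (num_descendants G n)))" for n
    by (rule prob_space.real_distribution_distr[OF measure_pmf.prob_space_axioms]) simp
  show "real_distribution (distr M borel (\<lambda>\<omega>. limit_map (\<xi> \<omega>)))"
    by (rule prob_space.real_distribution_distr[OF M]) measurable
  fix x y :: real assume xy: "x < y"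
  have cc: "continuous_on UNIV (cts_step x y)"
    by (rule uniformly_continuous_imp_continuous[OF cts_step_uniformly_continuous[OF xy]])
  have [measurable]: "cts_step x y \<in> borel_measurable borel" by (rule borel_measurable_continuous_onI[OF cc])
  define h where "h = (\<lambda>n \<omega>. limit_map (scaled n (cut n) (act n (cut n) \<omega>)))"
  define I where "I = (\<lambda>n. \<integral>G. cts_step x y (real n powr (- \<nu>) * real (num_descendants G n)) \<partial>measure_pmf (pa_graph m \<rho> n))"
  have lim: "(\<lambda>n. (3 * real n powr (- \<nu>) + mean n (\<lambda>\<omega>. \<bar>real n powr (- \<nu>) * real (num_hit \<omega> (n - 3)) - h n \<omega>\<bar>)) / (y - x)) \<longlonglongrightarrow> (3 * 0 + 0) / (y - x)"
    unfolding h_def using nu_bounds xy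
    by (intro tendsto_divide tendsto_add tendsto_mult tendsto_const tendsto_neg_powr_real hit_count_limit) auto
  have "(\<lambda>n. I n - mean n (\<lambda>\<omega>. cts_step x y (h n \<omega>))) \<longlonglongrightarrow> 0"
  proof (rule Lim_null_comparison)
    show "eventually (\<lambda>n. norm (I n - mean n (\<lambda>\<omega>. cts_step x y (h n \<omega>))) \<le>
      (3 * real n powr (- \<nu>) + mean n (\<lambda>\<omega>. \<bar>real n powr (- \<nu>) * real (num_hit \<omega> (n - 3)) - h n \<omega>\<bar>)) / (y - x)) sequentially"
      using eventually_ge_at_top[of 3]
      by eventually_elim (simp only: I_def real_norm_def coupling_error[OF _ xy])
  qed (use lim in simp)
  moreover have "(\<lambda>n. mean n (\<lambda>\<omega>. cts_step x y (h n \<omega>))) \<longlonglongrightarrow> (\<integral>\<omega>. cts_step x y (limit_map (\<xi> \<omega>)) \<partial>M)"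
    unfolding h_def by (rule mean_test_limit[OF M \<xi> xy])
  ultimately have "(\<lambda>n. (I n - mean n (\<lambda>\<omega>. cts_step x y (h n \<omega>))) + mean n (\<lambda>\<omega>. cts_step x y (h n \<omega>))) \<longlonglongrightarrow>
      0 + (\<integral>\<omega>. cts_step x y (limit_map (\<xi> \<omega>)) \<partial>M)" by (rule tendsto_add)
  then have "I \<longlonglongrightarrow> (\<integral>\<omega>. cts_step x y (limit_map (\<xi> \<omega>)) \<partial>M)" by simp
  then show "(\<lambda>n. integral\<^sup>L (distr (measure_pmf (pa_graph m \<rho> n)) borel (\<lambda>G. real n powr (- \<nu>) * real (num_descendants G n))) (cts_step x y))
    \<longlonglongrightarrow> integral\<^sup>L (distr M borel (\<lambda>\<omega>. limit_map (\<xi> \<omega>))) (cts_step x y)"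
    by (simp add: integral_distr I_def)
qed

end

theorem theorem1p2:
  fixes m :: nat and \<rho> \<nu> :: real and M :: "'a measure" and \<xi>\<^sub>1 :: "'a \<Rightarrow> real"
  assumes m: "m \<ge> 2"
    and \<rho>: "\<rho> > - real m"
    and \<nu>: "\<nu> = (real m - 1) * (real m + \<rho>) / (real m * (real m + \<rho> + 1))"
    and M: "prob_space M"
    and \<xi>\<^sub>1: "distributed M lborel \<xi>\<^sub>1 (gamma_density (real m / (real m - 1)) 1)"
  shows "0 < \<nu> \<and> \<nu> < 1 \<and>
    weak_conv_m
      (\<lambda>n. distr (measure_pmf (pa_graph m \<rho> n)) borel
             (\<lambda>G. real n powr (- \<nu>) * real (num_descendants G n)))
      (distr M borel
        (\<lambda>\<omega>. Gamma ((real m - 1) * (real m + \<rho>) / (real m * (real m + \<rho> + 1)))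
              * Gamma ((real m + \<rho>) / (real m * (real m + \<rho> + 1)) + 1)
              / Gamma ((real m + \<rho>) / (real m + \<rho> + 1))
              * ((real m + \<rho> + 1) * (real m - 1) / (2 * real m + \<rho>) * \<xi>\<^sub>1 \<omega>) powr (1 - \<nu>)))"
proof -
  interpret P: pref_attach m \<rho> by unfold_locales (use m \<rho> in auto)
  have \<theta>: "P.\<theta> = real m + \<rho>" by (simp add: P.\<theta>_def)
  have \<nu>_eq: "P.\<nu> = \<nu>"
    using P.L_pos P.theta_pos m
    by (simp add: P.\<nu>_def P.\<alpha>_def P.\<gamma>_def P.s_def \<nu> \<theta>)
  have 1: "1 - 1 / P.\<gamma> = \<nu>" using P.one_minus_nu \<nu>_eq by simp
  have 2: "P.q + 1 / P.\<gamma> = (real m + \<rho>) / (real m * (real m + \<rho> + 1)) + 1"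
  proof -
    have "P.q + 1 / P.\<gamma> = P.q + 1 - \<nu>" using P.one_minus_nu \<nu>_eq by simp
    also have "P.q - \<nu> = (real m + \<rho>) / (real m * (real m + \<rho> + 1))"
      using P.theta_pos m unfolding P.q_def P.s_def \<nu> \<theta> by (simp add: divide_simps) (simp add: algebra_simps)
    then have "P.q + 1 - \<nu> = (real m + \<rho>) / (real m * (real m + \<rho> + 1)) + 1" by linarith
    finally show ?thesis .
  qed
  have lm: "P.limit_map u = Gamma ((real m - 1) * (real m + \<rho>) / (real m * (real m + \<rho> + 1)))
      * Gamma ((real m + \<rho>) / (real m * (real m + \<rho> + 1)) + 1)
      / Gamma ((real m + \<rho>) / (real m + \<rho> + 1))
      * ((real m + \<rho> + 1) * (real m - 1) / (2 * real m + \<rho>) * u) powr (1 - \<nu>)" for u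
  proof -
    have "1 / P.\<gamma> = 1 - \<nu>" using 1 by simp
    moreover have "P.q = (real m + \<rho>) / (real m + \<rho> + 1)" by (simp add: P.q_def P.s_def \<theta>)
    moreover have "P.s = real m + \<rho> + 1" "P.L = 2 * real m + \<rho>" by (simp_all add: P.s_def \<theta> P.L_def)
    ultimately show ?thesis unfolding P.limit_map_def P.beta_const_def 1 2 by (simp only: \<nu>[symmetric])
  qed
  show ?thesis
    using P.nu_bounds P.descendants_weak_limit[OF M \<xi>\<^sub>1] by (simp only: \<nu>_eq lm simp_thms)
qed

end
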